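(* Let $\Lambda$ be a basic finite dimensional algebra over an algebraically closed field $K$ whose Jacobson radical $J$ satisfies $J^2=0$. For a dimension vector $\mathbf d$ and a semisimple left $\Lambda$-module $T$, the following statements are equivalent: (a) $T$ is a generic top of $\mathbf{Rep}_{\mathbf d}(\Lambda)$, i.e., $\overline{\mathbf{Rep}^T_{\mathbf d}}$ is an irreducible component of $\mathbf{Rep}_{\mathbf d}(\Lambda)$. (b) There exists a $\Lambda$-module $M$ with top $T$ and dimension vector $\mathbf d$ having the following property: whenever a simple $\Lambda$-module $S$ is a direct summand of $M$, say $M=M'\oplus S$, and $P'$ is a projective cover of $M'$, the semisimple module $JM\oplus S$ fails to embed into $JP'$.
   Context: Write $\Lambda=KQ/I$ with $Q$ a finite quiver with vertices $e_1,\dots,e_n$ (identified with primitive idempotents of $\Lambda$) and arrow set $Q_1$, and $I$ an admissible ideal; since $J^2=0$, $I$ is generated by all paths of length $2$. Modules are finite dimensional left modules; dimension vectors are in $(\mathbb N_0)^n$; $\operatorname{top}M=M/JM$. Isomorphic semisimple modules are identified. For $\mathbf d=(d_1,\dots,d_n)$, $\mathbf{Rep}_{\mathbf d}(\Lambda)$ is the affine variety of tuples $(x_\alpha)_{\alpha\in Q_1}\in\prod_\alpha \operatorname{Hom}_K(K^{d_{\mathrm{start}(\alpha)}},K^{d_{\mathrm{end}(\alpha)}})$ satisfying all relations in $I$; its points correspond to $\Lambda$-modules with dimension vector $\mathbf d$. For a semisimple module $T$, $\mathbf{Rep}^T_{\mathbf d}$ is the locally closed subvariety of points whose modules have top $T$;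 the closure $\overline{\mathbf{Rep}^T_{\mathbf d}}$ is taken in $\mathbf{Rep}_{\mathbf d}(\Lambda)$. *)

theory Defs
  imports
    "HOL-Algebra.Ideal_Product"
    "HOL-Algebra.QuotRing"
    "HOL-Algebra.Generated_Groups"
    "HOL-Analysis.Abstract_Topology"
    "Graph_Theory.Arc_Walk"
    "Jordan_Normal_Form.VS_Connect"
begin

section \<open>Left modules over a not necessarily commutative ring\<close>

text \<open>The locale \<open>module\<close> of HOL-Algebra assumes a commutative ring of scalars. We keep its
  record type and its notion of submodule, and the notions \<open>module_hom\<close> and \<open>direct_sum\<close> of the
  vector space library, none of which refers to commutativity.\<close>

locale left_module = R?: ring R + M?: abelian_group M
  for R :: "('a, 'r) ring_scheme" (structure)
    and M :: "('a, 'm, 'e) module_scheme" (structure) +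
  assumes smult_closed:
      "\<lbrakk>a \<in> carrier R; x \<in> carrier M\<rbrakk> \<Longrightarrow> a \<odot>\<^bsub>M\<^esub> x \<in> carrier M"
    and smult_l_distr:
      "\<lbrakk>a \<in> carrier R; b \<in> carrier R; x \<in> carrier M\<rbrakk> \<Longrightarrow>
        (a \<oplus>\<^bsub>R\<^esub> b) \<odot>\<^bsub>M\<^esub> x = a \<odot>\<^bsub>M\<^esub> x \<oplus>\<^bsub>M\<^esub> b \<odot>\<^bsub>M\<^esub> x"
    and smult_r_distr:
      "\<lbrakk>a \<in> carrier R; x \<in> carrier M; y \<in> carrier M\<rbrakk> \<Longrightarrow>
        a \<odot>\<^bsub>M\<^esub> (x \<oplus>\<^bsub>M\<^esub> y) = a \<odot>\<^bsub>M\<^esub> x \<oplus>\<^bsub>M\<^esub> a \<odot>\<^bsub>M\<^esub> y"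
    and smult_assoc:
      "\<lbrakk>a \<in> carrier R; b \<in> carrier R; x \<in> carrier M\<rbrakk> \<Longrightarrow>
        (a \<otimes>\<^bsub>R\<^esub> b) \<odot>\<^bsub>M\<^esub> x = a \<odot>\<^bsub>M\<^esub> (b \<odot>\<^bsub>M\<^esub> x)"
    and smult_one:
      "x \<in> carrier M \<Longrightarrow> \<one>\<^bsub>R\<^esub> \<odot>\<^bsub>M\<^esub> x = x"

abbreviation submod :: "('a, 'm) module \<Rightarrow> 'm set \<Rightarrow> ('a, 'm) module"
  where "submod M N \<equiv> M\<lparr>carrier := N\<rparr>"

definition module_iso ::
    "('a, 'e) ring_scheme \<Rightarrow> ('a, 'm) module \<Rightarrow> ('a, 'n) module \<Rightarrow> bool"
  where "module_iso R M N \<longleftrightarrow>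
    (\<exists>h \<in> LinearCombinations.module_hom R M N. bij_betw h (carrier M) (carrier N))"

definition module_embeds ::
    "('a, 'e) ring_scheme \<Rightarrow> ('a, 'm) module \<Rightarrow> ('a, 'n) module \<Rightarrow> bool"
  where "module_embeds R M N \<longleftrightarrow>
    (\<exists>h \<in> LinearCombinations.module_hom R M N. inj_on h (carrier M))"

definition simple_module :: "('a, 'e) ring_scheme \<Rightarrow> ('a, 'm) module \<Rightarrow> bool"
  where "simple_module R S \<longleftrightarrow> left_module R S \<and> carrier S \<noteq> {\<zero>\<^bsub>S\<^esub>} \<and>
    (\<forall>N. Module.submodule N R S \<longrightarrow> N = {\<zero>\<^bsub>S\<^esub>} \<or> N = carrier S)"

definition semisimple_module :: "('a, 'e) ring_scheme \<Rightarrow> ('a, 'm) module \<Rightarrow> bool"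
  where "semisimple_module R M \<longleftrightarrow> left_module R M \<and>
    generate (add_monoid M)
      (\<Union>{N. Module.submodule N R M \<and> simple_module R (submod M N)}) = carrier M"

definition is_internal_direct_sum ::
    "('a, 'e) ring_scheme \<Rightarrow> ('a, 'm) module \<Rightarrow> 'm set \<Rightarrow> 'm set \<Rightarrow> bool"
  where "is_internal_direct_sum R M A B \<longleftrightarrow>
    Module.submodule A R M \<and> Module.submodule B R M \<and>
    A \<inter> B = {\<zero>\<^bsub>M\<^esub>} \<and> A <+>\<^bsub>M\<^esub> B = carrier M"

text \<open>The fields \<open>mult\<close> and \<open>one\<close> that the record of modules inherits from rings carry no
  information.\<close>

definition quotient_module :: "('a, 'm) module \<Rightarrow> 'm set \<Rightarrow> ('a, 'm set) module"
  where "quotient_module M N =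
    \<lparr>carrier = a_rcosets\<^bsub>M\<^esub> N, mult = undefined, one = undefined, zero = N, add = set_add M,
     smult = (\<lambda>a X. \<Union>x\<in>X. N +>\<^bsub>M\<^esub> (a \<odot>\<^bsub>M\<^esub> x))\<rparr>"

definition left_ideal :: "'a set \<Rightarrow> ('a, 'e) ring_scheme \<Rightarrow> bool"
  where "left_ideal L R \<longleftrightarrow> additive_subgroup L R \<and>
    (\<forall>a \<in> carrier R. \<forall>x \<in> L. a \<otimes>\<^bsub>R\<^esub> x \<in> L)"

definition maximal_left_ideal :: "'a set \<Rightarrow> ('a, 'e) ring_scheme \<Rightarrow> bool"
  where "maximal_left_ideal L R \<longleftrightarrow> left_ideal L R \<and> L \<noteq> carrier R \<and>
    (\<forall>L'. left_ideal L' R \<and> L \<subseteq> L' \<longrightarrow> L' = L \<or> L' = carrier R)"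

definition jacobson_radical :: "('a, 'e) ring_scheme \<Rightarrow> 'a set"
  where "jacobson_radical R = carrier R \<inter> \<Inter>{L. maximal_left_ideal L R}"

definition rad :: "('a, 'e) ring_scheme \<Rightarrow> ('a, 'm) module \<Rightarrow> 'm set"  \<comment> \<open>\<open>JM\<close>\<close>
  where "rad R M =
    generate (add_monoid M) {a \<odot>\<^bsub>M\<^esub> x |a x. a \<in> jacobson_radical R \<and> x \<in> carrier M}"

definition module_top :: "('a, 'e) ring_scheme \<Rightarrow> ('a, 'm) module \<Rightarrow> ('a, 'm set) module"
  where "module_top R M = quotient_module M (rad R M)"


section \<open>Path algebras and admissible ideals\<close>

text \<open>A path is a pair \<open>(u, as)\<close> of its starting vertex and the list of its arrows in the order
  in which they are traversed; \<open>(u, [])\<close> is the trivial path at \<open>u\<close>.\<close>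

type_synonym ('v, 'a) path = "'v \<times> 'a list"

definition is_path :: "('v, 'a) pre_digraph \<Rightarrow> ('v, 'a) path \<Rightarrow> bool"
  where "is_path Q p \<longleftrightarrow> (\<exists>v. pre_digraph.awalk Q (fst p) (snd p) v)"

text \<open>As we use left modules, the product \<open>pq\<close> of paths is \<open>q\<close> followed by \<open>p\<close>. Hence the
  coefficient of \<open>fg\<close> at a path is the sum, over all ways of cutting it in two, of the
  coefficient of \<open>g\<close> at the initial piece times the coefficient of \<open>f\<close> at the final piece.\<close>

definition path_algebra :: "('v, 'a) pre_digraph \<Rightarrow> (('v, 'a) path \<Rightarrow> 'k::field) ring"
  where "path_algebra Q =
    \<lparr>carrier = {f. finite {p. f p \<noteq> 0} \<and> (\<forall>p. f p \<noteq> 0 \<longrightarrow> is_path Q p)},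
     mult = (\<lambda>f g (u, as). \<Sum>k\<le>length as.
       f (pre_digraph.awlast Q u (take k as), drop k as) * g (u, take k as)),
     one = (\<lambda>(u, as). if u \<in> verts Q \<and> as = [] then 1 else 0),
     zero = (\<lambda>_. 0),
     add = (\<lambda>f g p. f p + g p)\<rparr>"

definition of_path :: "('v, 'a) path \<Rightarrow> ('v, 'a) path \<Rightarrow> 'k::field"
  where "of_path p = (\<lambda>q. if q = p then 1 else 0)"

definition arrow_ideal :: "('v, 'a) pre_digraph \<Rightarrow> (('v, 'a) path \<Rightarrow> 'k::field) set"
  where "arrow_ideal Q =
    Idl\<^bsub>path_algebra Q\<^esub> ((\<lambda>\<alpha>. of_path (tail Q \<alpha>, [\<alpha>])) ` arcs Q)"

primrec ideal_power :: "('a, 'e) ring_scheme \<Rightarrow> 'a set \<Rightarrow> nat \<Rightarrow> 'a set"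
  where
    "ideal_power R A 0 = carrier R"
  | "ideal_power R A (Suc m) = ideal_prod R A (ideal_power R A m)"

definition admissible_ideal ::
    "('v, 'a) pre_digraph \<Rightarrow> (('v, 'a) path \<Rightarrow> 'k::field) set \<Rightarrow> bool"
  where "admissible_ideal Q I \<longleftrightarrow> ideal I (path_algebra Q) \<and>
    I \<subseteq> ideal_power (path_algebra Q) (arrow_ideal Q) 2 \<and>
    (\<exists>m\<ge>2. ideal_power (path_algebra Q) (arrow_ideal Q) m \<subseteq> I)"

abbreviation quiver_algebra ::
    "('v, 'a) pre_digraph \<Rightarrow> (('v, 'a) path \<Rightarrow> 'k::field) set \<Rightarrow> (('v, 'a) path \<Rightarrow> 'k) set ring"
  where "quiver_algebra Q I \<equiv> path_algebra Q Quot I"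

text \<open>The \<open>K\<close>-algebra structure \<open>K \<rightarrow> KQ/I\<close> and the primitive idempotents \<open>e\<^sub>i\<close>.\<close>

definition scalar ::
    "('v, 'a) pre_digraph \<Rightarrow> (('v, 'a) path \<Rightarrow> 'k::field) set \<Rightarrow> 'k \<Rightarrow> (('v, 'a) path \<Rightarrow> 'k) set"
  where "scalar Q I c = I +>\<^bsub>path_algebra Q\<^esub> (\<lambda>p. c * \<one>\<^bsub>path_algebra Q\<^esub> p)"

definition vertex_idem ::
    "('v, 'a) pre_digraph \<Rightarrow> (('v, 'a) path \<Rightarrow> 'k::field) set \<Rightarrow> 'v \<Rightarrow> (('v, 'a) path \<Rightarrow> 'k) set"
  where "vertex_idem Q I i = I +>\<^bsub>path_algebra Q\<^esub> of_path (i, [])"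


section \<open>Finite dimensional modules over \<open>KQ/I\<close>\<close>

type_synonym ('v, 'a, 'k, 'm) quiver_module = "((('v, 'a) path \<Rightarrow> 'k) set, 'm) module"

definition K_space ::
    "('v, 'a) pre_digraph \<Rightarrow> (('v, 'a) path \<Rightarrow> 'k::field) set \<Rightarrow>
     ('v, 'a, 'k, 'm) quiver_module \<Rightarrow> ('k, 'm) module"
  where "K_space Q I M =
    \<lparr>carrier = carrier M, mult = mult M, one = one M, zero = zero M, add = add M,
     smult = (\<lambda>c x. scalar Q I c \<odot>\<^bsub>M\<^esub> x)\<rparr>"

definition fd_module ::
    "('v, 'a) pre_digraph \<Rightarrow> (('v, 'a) path \<Rightarrow> 'k::field) set \<Rightarrow>
     ('v, 'a, 'k, 'm) quiver_module \<Rightarrow> bool"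
  where "fd_module Q I M \<longleftrightarrow> left_module (quiver_algebra Q I) M \<and>
    vectorspace.fin_dim class_ring (K_space Q I M)"

definition dimension_vector ::
    "('v, 'a) pre_digraph \<Rightarrow> (('v, 'a) path \<Rightarrow> 'k::field) set \<Rightarrow>
     ('v, 'a, 'k, 'm) quiver_module \<Rightarrow> 'v \<Rightarrow> nat"
  where "dimension_vector Q I M i = vectorspace.dim class_ring
    (submod (K_space Q I M) ((\<lambda>x. vertex_idem Q I i \<odot>\<^bsub>M\<^esub> x) ` carrier M))"

text \<open>The test modules \<open>N\<close> and \<open>N'\<close> range over the finite dimensional modules whose elements
  have the same type as those of \<open>P\<close>. This is no restriction for a type such as
  \<^typ>\<open>'v \<Rightarrow> 'k vec\<close>, on which every finite dimensional module has an isomorphic copy.\<close>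

definition projective_module ::
    "('v, 'a) pre_digraph \<Rightarrow> (('v, 'a) path \<Rightarrow> 'k::field) set \<Rightarrow>
     ('v, 'a, 'k, 'm) quiver_module \<Rightarrow> bool"
  where "projective_module Q I P \<longleftrightarrow> fd_module Q I P \<and>
    (\<forall>(N :: ('v, 'a, 'k, 'm) quiver_module) (N' :: ('v, 'a, 'k, 'm) quiver_module).
      fd_module Q I N \<and> fd_module Q I N' \<longrightarrow>
      (\<forall>g \<in> LinearCombinations.module_hom (quiver_algebra Q I) N N'.
       \<forall>f \<in> LinearCombinations.module_hom (quiver_algebra Q I) P N'.
         g ` carrier N = carrier N' \<longrightarrow>
         (\<exists>h \<in> LinearCombinations.module_hom (quiver_algebra Q I) P N.
           \<forall>x \<in> carrier P. g (h x) = f x)))"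

definition projective_cover ::
    "('v, 'a) pre_digraph \<Rightarrow> (('v, 'a) path \<Rightarrow> 'k::field) set \<Rightarrow>
     ('v, 'a, 'k, 'm) quiver_module \<Rightarrow> ('m \<Rightarrow> 'n) \<Rightarrow> ('v, 'a, 'k, 'n) quiver_module \<Rightarrow> bool"
  where "projective_cover Q I P \<phi> M \<longleftrightarrow> projective_module Q I P \<and>
    \<phi> \<in> LinearCombinations.module_hom (quiver_algebra Q I) P M \<and>
    \<phi> ` carrier P = carrier M \<and>
    (\<forall>N. Module.submodule N (quiver_algebra Q I) P \<and>
         N <+>\<^bsub>P\<^esub> {x \<in> carrier P. \<phi> x = \<zero>\<^bsub>M\<^esub>} = carrier P \<longrightarrow> N = carrier P)"


section \<open>Varieties of representations\<close>

definition rep_ambient ::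
    "('v, 'a) pre_digraph \<Rightarrow> ('v \<Rightarrow> nat) \<Rightarrow> ('a \<Rightarrow> 'k::field mat) set"
  where "rep_ambient Q d = (\<Pi>\<^sub>E \<alpha>\<in>arcs Q. carrier_mat (d (head Q \<alpha>)) (d (tail Q \<alpha>)))"

primrec path_map ::
    "('v, 'a) pre_digraph \<Rightarrow> ('v \<Rightarrow> nat) \<Rightarrow> ('a \<Rightarrow> 'k::field mat) \<Rightarrow> 'v \<Rightarrow> 'a list \<Rightarrow> 'k mat"
  where
    "path_map Q d x u [] = 1\<^sub>m (d u)"
  | "path_map Q d x u (\<alpha> # as) = path_map Q d x (head Q \<alpha>) as * x \<alpha>"

definition rep_space :: "('v, 'a) pre_digraph \<Rightarrow> ('v \<Rightarrow> nat) \<Rightarrow> ('v \<Rightarrow> 'k::field vec) set"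
  where "rep_space Q d = (\<Pi>\<^sub>E i\<in>verts Q. carrier_vec (d i))"

text \<open>The action of \<open>f \<in> KQ\<close> on \<open>\<Oplus>\<^sub>i K\<^bsup>d\<^sub>i\<^esup>\<close> determined by the point \<open>x\<close>.\<close>

definition rep_act ::
    "('v, 'a) pre_digraph \<Rightarrow> ('v \<Rightarrow> nat) \<Rightarrow> ('a \<Rightarrow> 'k::field mat) \<Rightarrow>
     (('v, 'a) path \<Rightarrow> 'k) \<Rightarrow> ('v \<Rightarrow> 'k vec) \<Rightarrow> 'v \<Rightarrow> 'k vec"
  where "rep_act Q d x f m = (\<lambda>j\<in>verts Q. vec (d j) (\<lambda>r.
    \<Sum>p | f p \<noteq> 0 \<and> pre_digraph.awalk Q (fst p) (snd p) j.
      f p * ((path_map Q d x (fst p) (snd p) *\<^sub>v m (fst p)) $ r)))"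

definition rep_variety ::
    "('v, 'a) pre_digraph \<Rightarrow> (('v, 'a) path \<Rightarrow> 'k::field) set \<Rightarrow> ('v \<Rightarrow> nat) \<Rightarrow>
     ('a \<Rightarrow> 'k mat) set"
  where "rep_variety Q I d = {x \<in> rep_ambient Q d.
    \<forall>f \<in> I. \<forall>m \<in> rep_space Q d. rep_act Q d x f m = (\<lambda>i\<in>verts Q. 0\<^sub>v (d i))}"

text \<open>The \<open>KQ/I\<close>-module of a point \<open>x\<close> of \<^const>\<open>rep_variety\<close>. All representatives \<open>f\<close> of a
  coset \<open>X\<close> act in the same way, as \<open>x\<close> satisfies the relations in \<open>I\<close>.\<close>

definition rep_module ::
    "('v, 'a) pre_digraph \<Rightarrow> ('v \<Rightarrow> nat) \<Rightarrow> ('a \<Rightarrow> 'k::field mat) \<Rightarrow>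
     ('v, 'a, 'k, 'v \<Rightarrow> 'k vec) quiver_module"
  where "rep_module Q d x =
    \<lparr>carrier = rep_space Q d, mult = undefined, one = undefined,
     zero = (\<lambda>i\<in>verts Q. 0\<^sub>v (d i)),
     add = (\<lambda>m n. \<lambda>i\<in>verts Q. m i + n i),
     smult = (\<lambda>X m. the_elem ((\<lambda>f. rep_act Q d x f m) ` X))\<rparr>"

definition rep_top ::
    "('v, 'a) pre_digraph \<Rightarrow> (('v, 'a) path \<Rightarrow> 'k::field) set \<Rightarrow> ('v \<Rightarrow> nat) \<Rightarrow>
     ('v, 'a, 'k, 't) quiver_module \<Rightarrow> ('a \<Rightarrow> 'k mat) set"
  where "rep_top Q I d T = {x \<in> rep_variety Q I d.
    module_iso (quiver_algebra Q I) (module_top (quiver_algebra Q I) (rep_module Q d x)) T}"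

inductive_set rep_polynomials ::
    "('v, 'a) pre_digraph \<Rightarrow> ('v \<Rightarrow> nat) \<Rightarrow> (('a \<Rightarrow> 'k::field mat) \<Rightarrow> 'k) set"
  for Q :: "('v, 'a) pre_digraph" and d :: "'v \<Rightarrow> nat"
  where
    const: "(\<lambda>_. c) \<in> rep_polynomials Q d"
  | coord: "\<lbrakk>\<alpha> \<in> arcs Q; r < d (head Q \<alpha>); s < d (tail Q \<alpha>)\<rbrakk> \<Longrightarrow>
      (\<lambda>x. x \<alpha> $$ (r, s)) \<in> rep_polynomials Q d"
  | add: "\<lbrakk>f \<in> rep_polynomials Q d; g \<in> rep_polynomials Q d\<rbrakk> \<Longrightarrow>
      (\<lambda>x. f x + g x) \<in> rep_polynomials Q d"
  | mult: "\<lbrakk>f \<in> rep_polynomials Q d; g \<in> rep_polynomials Q d\<rbrakk> \<Longrightarrow>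
      (\<lambda>x. f x * g x) \<in> rep_polynomials Q d"

definition zariski_open ::
    "('v, 'a) pre_digraph \<Rightarrow> (('v, 'a) path \<Rightarrow> 'k::field) set \<Rightarrow> ('v \<Rightarrow> nat) \<Rightarrow>
     ('a \<Rightarrow> 'k mat) set \<Rightarrow> bool"
  where "zariski_open Q I d U \<longleftrightarrow>
    (\<exists>F \<subseteq> rep_polynomials Q d. U = {x \<in> rep_variety Q I d. \<exists>f \<in> F. f x \<noteq> 0})"

definition rep_zariski ::
    "('v, 'a) pre_digraph \<Rightarrow> (('v, 'a) path \<Rightarrow> 'k::field) set \<Rightarrow> ('v \<Rightarrow> nat) \<Rightarrow>
     ('a \<Rightarrow> 'k mat) topology"
  where "rep_zariski Q I d = topology (zariski_open Q I d)"

lemma zariski_open_Int: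
  assumes "zariski_open Q I d U" "zariski_open Q I d V"
  shows "zariski_open Q I d (U \<inter> V)"
proof -
  obtain F G where F: "F \<subseteq> rep_polynomials Q d" "U = {x \<in> rep_variety Q I d. \<exists>f\<in>F. f x \<noteq> 0}"
    and G: "G \<subseteq> rep_polynomials Q d" "V = {x \<in> rep_variety Q I d. \<exists>f\<in>G. f x \<noteq> 0}"
    using assms unfolding zariski_open_def by (elim exE conjE) (rule that)
  let ?H = "(\<lambda>(f, g) x. f x * g x) ` (F \<times> G)"
  have "?H \<subseteq> rep_polynomials Q d"
    using F(1) G(1) by (auto intro!: rep_polynomials.mult)
  moreover have "U \<inter> V = {x \<in> rep_variety Q I d. \<exists>f\<in>?H. f x \<noteq> 0}"
    unfolding F(2) G(2) by auto
  ultimately show ?thesis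
    unfolding zariski_open_def by (intro exI[of _ ?H] conjI)
qed

lemma zariski_open_Union:
  assumes "\<And>U. U \<in> \<U> \<Longrightarrow> zariski_open Q I d U"
  shows "zariski_open Q I d (\<Union>\<U>)"
proof -
  have "\<forall>U\<in>\<U>. \<exists>F. F \<subseteq> rep_polynomials Q d \<and> U = {x \<in> rep_variety Q I d. \<exists>f\<in>F. f x \<noteq> 0}"
    using assms unfolding zariski_open_def by simp
  from bchoice[OF this] obtain F where
    F: "\<forall>U\<in>\<U>. F U \<subseteq> rep_polynomials Q d \<and> U = {x \<in> rep_variety Q I d. \<exists>f\<in>F U. f x \<noteq> 0}" ..
  let ?H = "\<Union>U\<in>\<U>. F U"
  have "?H \<subseteq> rep_polynomials Q d"
    using F by (intro UN_least) simp
  moreover have "\<Union>\<U> = {x \<in> rep_variety Q I d. \<exists>f\<in>?H. f x \<noteq> 0}"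
  proof -
    have "(\<lambda>U. {x \<in> rep_variety Q I d. \<exists>f\<in>F U. f x \<noteq> 0}) ` \<U> = (\<lambda>U. U) ` \<U>"
      by (rule image_cong[OF refl], rule sym) (rule conjunct2[OF bspec[OF F]])
    then have "\<Union>\<U> = (\<Union>U\<in>\<U>. {x \<in> rep_variety Q I d. \<exists>f\<in>F U. f x \<noteq> 0})"
      by (simp only: image_ident)
    also have "\<dots> = {x \<in> rep_variety Q I d. \<exists>f\<in>?H. f x \<noteq> 0}"
      by auto
    finally show ?thesis .
  qed
  ultimately show ?thesis
    unfolding zariski_open_def by (intro exI[of _ ?H] conjI)
qed

lemma openin_rep_zariski: "openin (rep_zariski Q I d) U \<longleftrightarrow> zariski_open Q I d U"
proof -
  have "istopology (zariski_open Q I d)"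
    unfolding istopology_def using zariski_open_Int zariski_open_Union by metis
  then show ?thesis
    unfolding rep_zariski_def by (simp add: topology_inverse')
qed

definition irreducible_in :: "'p topology \<Rightarrow> 'p set \<Rightarrow> bool"
  where "irreducible_in X Z \<longleftrightarrow> Z \<subseteq> topspace X \<and> Z \<noteq> {} \<and>
    (\<forall>A B. closedin X A \<and> closedin X B \<and> Z \<subseteq> A \<union> B \<longrightarrow> Z \<subseteq> A \<or> Z \<subseteq> B)"

definition irreducible_component :: "'p topology \<Rightarrow> 'p set \<Rightarrow> bool"
  where "irreducible_component X Z \<longleftrightarrow> irreducible_in X Z \<and>
    (\<forall>Z'. irreducible_in X Z' \<and> Z \<subseteq> Z' \<longrightarrow> Z' = Z)"

definition generic_top ::
    "('v, 'a) pre_digraph \<Rightarrow> (('v, 'a) path \<Rightarrow> 'k::field) set \<Rightarrow> ('v \<Rightarrow> nat) \<Rightarrow>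
     ('v, 'a, 'k, 't) quiver_module \<Rightarrow> bool"
  where "generic_top Q I d T \<longleftrightarrow>
    irreducible_component (rep_zariski Q I d)
      (Abstract_Topology.closure_of (rep_zariski Q I d) (rep_top Q I d T))"

end

theory Submission
  imports Defs "Jordan_Normal_Form.DL_Rank"
begin

text \<open>For a point \<open>x\<close> let \<open>r\<close> be the dimension vector of the radical of its module. The points with
  a fixed \<open>r\<close> form the stratum of a fixed top. It is irreducible: any two of its points lie on a
  polynomial curve in it, obtained by interpolating adapted bases and block matrices. Since \<open>r\<close> is
  lower semicontinuous, a stratum has a component as its closure if and only if some point \<open>x\<close> of it
  lies in the closure of no other stratum. If \<open>x\<close> lies in the closure of the stratum of \<open>r' \<noteq> r\<close>, then
  \<open>r' \<ge> r\<close> and the common kernel of the arrows at some vertex exceeds their image there, which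
  splits off a simple summand \<open>S\<close>; as \<open>J P'\<close> depends only on the top of \<open>M'\<close>, the stratum of
  \<open>r + dim S\<close> is nonempty exactly if \<open>J M \<oplus> S\<close> embeds in \<open>J P'\<close>. Conversely, enlarging the image
  by the line \<open>S\<close> and running the same curves from \<open>x\<close> shows that such an embedding puts \<open>x\<close> into
  the closure of that stratum.\<close>

section \<open>Subspaces and coordinates\<close>

text \<open>The obstacle to joining two points of a stratum is the quadratic condition
  \<open>x \<beta> * x \<alpha> = 0\<close>: linear interpolation leaves the variety. The remedy is
  to move to the leading coordinates, at every vertex, a subspace U of the prescribed dimension r
  that contains the images of the incoming arrows and lies in the kernels of the outgoing ones;
  there the vanishing of certain blocks, a linear condition, implies the relation. The base change
  is undone by an adjugate instead of an inverse, so the curve is polynomial and defined even where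
  the interpolated bases degenerate. Along it the radical has dimension at most r, with equality on
  a nonempty open set of parameters because equality holds at the end point. At the starting point U
  may be strictly larger than the images; this freedom yields the closure criterion.

  The module side is numerical: a module annihilated by J is determined by its dimension vector, and
  the radical of the projective module with top t has at j one basis element for every arrow into j
  and generator at its tail. So the embedding in (b) becomes an inequality of dimension
  vectors.\<close>

context vectorspace
begin

lemma subspaceI:
  assumes "W \<subseteq> carrier V" "\<zero>\<^bsub>V\<^esub> \<in> W" "\<And>v w. v \<in> W \<Longrightarrow> w \<in> W \<Longrightarrow> v \<oplus>\<^bsub>V\<^esub> w \<in> W"
    "\<And>c v. c \<in> carrier K \<Longrightarrow> v \<in> W \<Longrightarrow> c \<odot>\<^bsub>V\<^esub> v \<in> W"
  shows "VectorSpace.subspace K W V"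
  using assms by (auto simp: VectorSpace.subspace_def LinearCombinations.submodule_def
      vectorspace_axioms module_axioms)

lemma subspaceD:
  assumes "VectorSpace.subspace K W V"
  shows "W \<subseteq> carrier V" "\<zero>\<^bsub>V\<^esub> \<in> W" "\<And>v w. v \<in> W \<Longrightarrow> w \<in> W \<Longrightarrow> v \<oplus>\<^bsub>V\<^esub> w \<in> W"
    "\<And>c v. c \<in> carrier K \<Longrightarrow> v \<in> W \<Longrightarrow> c \<odot>\<^bsub>V\<^esub> v \<in> W" "vectorspace K (vs W)"
  using assms subspace_is_vs
  by (auto simp: VectorSpace.subspace_def LinearCombinations.submodule_def)

lemma span_subspace: "VectorSpace.subspace K W V \<Longrightarrow> span W = W"
  by (intro subset_antisym span_is_subset in_own_span subspaceD(1)) (simp_all add: VectorSpace.subspace_def)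

text \<open>The bound by \<open>dim\<close> yields a maximal independent subset even of an infinite
  family. That it lies in F, and not merely in the span, matters in \<open>open_rank\<close>, where
  the chosen vectors have to vary with a parameter.\<close>

lemma independent_spanning_subset:
  assumes fd: fin_dim and F: "F \<subseteq> carrier V"
  obtains A where "finite A" "A \<subseteq> F" "lin_indpt A" "span A = span F"
proof -
  have "\<exists>A. finite A \<and> maximal A (\<lambda>A. A \<subseteq> F \<and> lin_indpt A)"
    using li_le_dim[OF fd] F
    by (intro maximal_exists[of _ dim "{}"]) (auto simp: lin_dep_def)
  then obtain A where A: "finite A" "A \<subseteq> F" "lin_indpt A"
    and mx: "\<And>B. A \<subseteq> B \<Longrightarrow> B \<subseteq> F \<Longrightarrow> lin_indpt B \<Longrightarrow> B = A"
    by (auto simp: maximal_def)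
  have Ac: "A \<subseteq> carrier V" using A F by auto
  have "F \<subseteq> span A"
  proof
    fix v assume v: "v \<in> F"
    show "v \<in> span A"
    proof (rule ccontr)
      assume n: "v \<notin> span A"
      then have "v \<notin> A" using in_own_span[OF Ac] by auto
      then have "lin_indpt (A \<union> {v})" using lin_dep_iff_in_span[OF Ac A(3), of v] v F n by auto
      then show False using mx[of "A \<union> {v}"] v A \<open>v \<notin> A\<close> by auto
    qed
  qed
  then have "span F \<subseteq> span A"
    using Ac span_is_subset span_is_submodule by metis
  moreover have "span A \<subseteq> span F" using A(2) span_is_monotone by simp
  ultimately show thesis using that A by auto
qed

lemma basis_span_vs:
  assumes "A \<subseteq> carrier V" "lin_indpt A"
  shows "vectorspace.basis K (span_vs A) A"
proof -
  have vs: "vectorspace K (span_vs A)" using span_is_subspace[OF assms(1)] subspace_is_vs by blast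
  show ?thesis
    using span_li_not_depend[OF in_own_span[OF assms(1)] span_is_submodule[OF assms(1)]] assms
      in_own_span[OF assms(1)]
    by (simp add: vectorspace.basis_def[OF vs])
qed

lemma dim_span_indpt:
  assumes "finite A" "A \<subseteq> carrier V" "lin_indpt A"
  shows "vectorspace.dim K (span_vs A) = card A"
  using vectorspace.dim_basis basis_span_vs[OF assms(2,3)] assms(1)
    span_is_subspace[OF assms(2)] subspace_is_vs by blast

lemma fin_dim_subspace:
  assumes fin_dim "VectorSpace.subspace K W V"
  shows "vectorspace.fin_dim K (vs W)"
proof -
  obtain A where A: "finite A" "A \<subseteq> W" "lin_indpt A" "span A = W"
    using independent_spanning_subset[OF assms(1) subspaceD(1)[OF assms(2)]] span_subspace[OF assms(2)] by metis
  have "vectorspace.basis K (span_vs A) A"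
    using A subspaceD(1)[OF assms(2)] by (intro basis_span_vs) auto
  then show ?thesis
    using A subspaceD(5)[OF assms(2)] by (auto simp: vectorspace.basis_def vectorspace.fin_dim_def)
qed

lemma dim_subspace_mono:
  assumes fin_dim "VectorSpace.subspace K W V" "VectorSpace.subspace K W' V" "W \<subseteq> W'"
  shows "vectorspace.dim K (vs W) \<le> vectorspace.dim K (vs W')"
  using vectorspace.subspace_dim[OF subspaceD(5)[OF assms(3)], of W]
    fin_dim_subspace[OF assms(1)] assms nested_subspaces[OF assms(3,2,4)] by simp

lemma extend_to_basis:
  assumes fd: fin_dim and A: "A \<subseteq> carrier V" "lin_indpt A"
  obtains B where "finite B" "A \<inter> B = {}" "basis (A \<union> B)"
proof -
  have "\<exists>B. finite B \<and> maximal B (\<lambda>B. A \<subseteq> B \<and> B \<subseteq> carrier V \<and> lin_indpt B)"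
    using li_le_dim[OF fd] A by (intro maximal_exists[of _ dim A]) auto
  then obtain B where B: "finite B" "A \<subseteq> B" "maximal B (\<lambda>B. B \<subseteq> carrier V \<and> lin_indpt B)"
    unfolding maximal_def by (metis (no_types, lifting) order_trans)
  have "basis B" by (rule max_li_is_basis[OF B(3)])
  moreover have "A \<union> (B - A) = B" using B by auto
  ultimately show thesis using that[of "B - A"] B by auto
qed

lemma subspace_dim_eq:
  assumes fd: fin_dim and W: "VectorSpace.subspace K W V" and d: "vectorspace.dim K (vs W) = dim"
  shows "W = carrier V"
proof -
  obtain A where A: "finite A" "A \<subseteq> W" "lin_indpt A" "span A = W"
    using independent_spanning_subset[OF fd subspaceD(1)[OF W]] span_subspace[OF W] by metis
  have Ac: "A \<subseteq> carrier V" using A subspaceD(1)[OF W] by auto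
  have "card A = dim" using dim_span_indpt[OF A(1) Ac A(3)] d A(4) by simp
  then have "basis A" using dim_li_is_basis[OF fd A(1) Ac A(3)] by simp
  then show ?thesis using A(4) by (simp add: basis_def)
qed

end

lemma (in vec_space) module_hom_mat:
  assumes "A \<in> carrier_mat m n"
  shows "(\<lambda>v. A *\<^sub>v v) \<in> LinearCombinations.module_hom class_ring (module_vec TYPE('a) n) (module_vec TYPE('a) m)"
  using assms by (auto simp: module_hom_def module_vec_simps mult_add_distrib_mat_vec mult_mat_vec)

lemma linear_mapI:
  assumes "vectorspace K V" "vectorspace K W" "T \<in> module_hom K V W"
  shows "linear_map K V W T"
  using assms by (auto simp: linear_map_def mod_hom_def mod_hom_axioms_def vectorspace_def)

text \<open>Image and kernel are written as carrier updates because this is the form in which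
  dimension vectors of submodules appear.\<close>

lemma rank_nullity_hom:
  assumes "vectorspace K V" "vectorspace K W" "T \<in> module_hom K V W" "vectorspace.fin_dim K V"
  shows "vectorspace.dim K (W\<lparr>carrier := T ` carrier V\<rparr>) +
    vectorspace.dim K (V\<lparr>carrier := {v \<in> carrier V. T v = \<zero>\<^bsub>W\<^esub>}\<rparr>) = vectorspace.dim K V"
proof -
  interpret linear_map K V W T by (rule linear_mapI[OF assms(1-3)])
  show ?thesis using rank_nullity[OF assms(4)] by (simp add: im_def ker_def)
qed

lemma dim_inj_hom:
  assumes "vectorspace K V" "vectorspace K W" "T \<in> module_hom K V W" "vectorspace.fin_dim K V"
    "inj_on T (carrier V)"
  shows "vectorspace.dim K (W\<lparr>carrier := T ` carrier V\<rparr>) = vectorspace.dim K V"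
proof -
  interpret linear_map K V W T by (rule linear_mapI[OF assms(1-3)])
  show ?thesis using rank_nullity[OF assms(4)] inj_imp_dim_ker0[OF assms(5)] by (simp add: im_def)
qed

lemma (in vec_space) mat_of_cols_append_mult:
  assumes us: "set us \<subseteq> carrier_vec n" and ws: "set ws \<subseteq> carrier_vec n" and v: "v \<in> carrier_vec (length us)"
  shows "mat_of_cols n (us @ ws) *\<^sub>v (v @\<^sub>v 0\<^sub>v (length ws)) = mat_of_cols n us *\<^sub>v v"
proof (rule eq_vecI)
  fix i assume i: "i < dim_vec (mat_of_cols n us *\<^sub>v v)"
  let ?f = "\<lambda>k. (us @ ws) ! k $ i * (v @\<^sub>v 0\<^sub>v (length ws)) $ k"
  have "(mat_of_cols n (us @ ws) *\<^sub>v (v @\<^sub>v 0\<^sub>v (length ws))) $ i = (\<Sum>k\<in>{0..<length us + length ws}. ?f k)"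
    using i v by (auto simp: scalar_prod_def mat_of_cols_index intro!: sum.cong)
  also have "\<dots> = (\<Sum>k\<in>{0..<length us}. ?f k)"
    using v by (intro sum.mono_neutral_right) (auto simp: append_vec_def Let_def)
  also have "\<dots> = (mat_of_cols n us *\<^sub>v v) $ i"
    using i v by (auto simp: scalar_prod_def mat_of_cols_index append_vec_def Let_def nth_append intro!: sum.cong)
  finally show "(mat_of_cols n (us @ ws) *\<^sub>v (v @\<^sub>v 0\<^sub>v (length ws))) $ i = (mat_of_cols n us *\<^sub>v v) $ i" .
qed auto

lemma (in vec_space) span_mat_of_cols:
  assumes "set us \<subseteq> carrier_vec n"
  shows "span (set us) = (\<lambda>v. mat_of_cols n us *\<^sub>v v) ` carrier_vec (length us)"
proof -
  have d: "\<forall>w\<in>set us. dim_vec w = n" using assms by auto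
  have "span (set us) = {lincomb_list c us | c. True}"
    using span_list_as_span[OF assms] by (auto simp: span_list_def)
  also have "\<dots> = {mat_of_cols n us *\<^sub>v vec (length us) c | c. True}"
    using lincomb_list_as_mat_mult[OF d] by simp
  also have "\<dots> = (\<lambda>v. mat_of_cols n us *\<^sub>v v) ` carrier_vec (length us)"
    by (auto simp: image_def) (metis carrier_vecD dim_vec eq_vecI index_vec)
  finally show ?thesis .
qed

text \<open>A maximal independent part of F is completed to a basis, whose members become the
  columns of an invertible matrix. One nonzero determinant thus certifies the rank of F, which is
  how rank conditions turn into polynomial ones.\<close>

lemma (in vec_space) adapted_columns:
  assumes F: "F \<subseteq> carrier_vec n"
  obtains us ws where "set us \<subseteq> F" "set ws \<subseteq> carrier_vec n" "length us + length ws = n"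
    "det (mat_of_cols n (us @ ws)) \<noteq> 0" "span (set us) = span F"
    "vectorspace.dim class_ring (span_vs F) = length us"
proof -
  obtain A where A: "finite A" "A \<subseteq> F" "lin_indpt A" "span A = span F"
    using independent_spanning_subset[OF fin_dim, of F] F by auto
  have Ac: "A \<subseteq> carrier_vec n" using A F by auto
  obtain B where B: "finite B" "A \<inter> B = {}" "basis (A \<union> B)"
    using extend_to_basis[OF fin_dim, of A] A Ac by auto
  have Bc: "B \<subseteq> carrier_vec n" using B(3) by (auto simp: basis_def)
  obtain us where us: "set us = A" "distinct us" using finite_distinct_list[OF A(1)] by auto
  obtain ws where ws: "set ws = B" "distinct ws" using finite_distinct_list[OF B(1)] by auto
  have card: "length us + length ws = n"
    using dim_basis[OF _ B(3)] A B us ws dim_is_n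
    by (simp add: card_Un_disjoint distinct_card[symmetric])
  let ?g = "mat_of_cols n (us @ ws)"
  have g: "?g \<in> carrier_mat n n" using card by (auto simp: mat_of_cols_def)
  have cols: "cols ?g = us @ ws" using Ac Bc us ws by (intro cols_mat_of_cols) auto
  have "det ?g \<noteq> 0"
  proof
    assume "det ?g = 0"
    \<comment> \<open>A kernel vector would be a linear dependence between the columns, which form a
      basis.\<close>
    then obtain v where "v \<in> carrier_vec n" "v \<noteq> 0\<^sub>v n" "?g *\<^sub>v v = 0\<^sub>v n"
      using det_0_iff_vec_prod_zero_field[OF g] by auto
    then have "lin_dep (set (cols ?g))"
      using lin_depI[OF g, of v] cols us ws B by auto
    then show False using B(3) cols us ws by (auto simp: basis_def)
  qed
  moreover have "vectorspace.dim class_ring (span_vs F) = length us"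
    using dim_span_indpt[of A] A Ac us by (simp add: distinct_card[symmetric])
  ultimately show thesis using that[of us ws] us ws A Bc card by auto
qed

text \<open>Normal forms of subspaces: \<open>leading\<close> is the chosen subspace at a vertex in
  adapted coordinates, while \<open>trailing\<close> is the radical of a module whose generators are
  listed before its radical basis.\<close>

definition leading :: "nat \<Rightarrow> nat \<Rightarrow> 'a::zero vec set" where
  "leading n r = {v \<in> carrier_vec n. \<forall>k<n. r \<le> k \<longrightarrow> v $ k = 0}"

definition trailing :: "nat \<Rightarrow> nat \<Rightarrow> 'a::zero vec set" where
  "trailing n r = {v \<in> carrier_vec n. \<forall>k<n. k < r \<longrightarrow> v $ k = 0}"

lemma leading_eq_append:
  assumes "r \<le> n"
  shows "leading n r = (\<lambda>v. v @\<^sub>v 0\<^sub>v (n - r)) ` carrier_vec r"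
proof (intro equalityI subsetI)
  fix v :: "'a vec" assume v: "v \<in> leading n r"
  have "v = vec r (\<lambda>k. v $ k) @\<^sub>v 0\<^sub>v (n - r)"
  proof (rule eq_vecI)
    fix i assume "i < dim_vec (vec r (\<lambda>k. v $ k) @\<^sub>v (0\<^sub>v (n - r) :: 'a vec))"
    then have "i < n" using assms by simp
    then show "v $ i = (vec r (\<lambda>k. v $ k) @\<^sub>v 0\<^sub>v (n - r)) $ i"
      using v assms by (cases "i < r") (simp_all add: leading_def)
  qed (use v assms in \<open>simp add: leading_def\<close>)
  then show "v \<in> (\<lambda>v. v @\<^sub>v 0\<^sub>v (n - r)) ` carrier_vec r" by (rule image_eqI) simp
next
  fix w :: "'a vec" assume "w \<in> (\<lambda>v. v @\<^sub>v 0\<^sub>v (n - r)) ` carrier_vec r"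
  then obtain v where "v \<in> carrier_vec r" "w = v @\<^sub>v 0\<^sub>v (n - r)" by blast
  then have "dim_vec w = n" "\<forall>k<n. r \<le> k \<longrightarrow> w $ k = 0" using assms by auto
  then show "w \<in> leading n r" by (auto simp: leading_def intro: carrier_vecI)
qed

lemma (in vec_space) span_eq_leading:
  assumes "set us \<subseteq> carrier_vec n" "set ws \<subseteq> carrier_vec n" "length us + length ws = n"
  shows "span (set us) = (\<lambda>v. mat_of_cols n (us @ ws) *\<^sub>v v) ` leading n (length us)"
proof -
  have "n - length us = length ws" using assms by simp
  then have "leading n (length us) = (\<lambda>v. v @\<^sub>v 0\<^sub>v (length ws) :: 'a vec) ` carrier_vec (length us)"
    using leading_eq_append[of "length us" n] assms(3) by (metis le_add1)
  then have "(\<lambda>v. mat_of_cols n (us @ ws) *\<^sub>v v) ` leading n (length us) =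
      (\<lambda>v. mat_of_cols n (us @ ws) *\<^sub>v (v @\<^sub>v 0\<^sub>v (length ws))) ` carrier_vec (length us)"
    by (metis image_image)
  also have "\<dots> = (\<lambda>v. mat_of_cols n us *\<^sub>v v) ` carrier_vec (length us)"
    by (rule image_cong[OF refl mat_of_cols_append_mult[OF assms(1,2)]])
  finally show ?thesis using span_mat_of_cols[OF assms(1)] by metis
qed

lemma (in vec_space) adapted_matrix:
  assumes W: "VectorSpace.subspace class_ring W V"
  obtains g where "g \<in> carrier_mat n n" "det g \<noteq> 0"
    "W = (\<lambda>v. g *\<^sub>v v) ` leading n (vectorspace.dim class_ring (vs W))"
    "vectorspace.dim class_ring (vs W) \<le> n"
proof -
  obtain us ws where *: "set us \<subseteq> W" "set ws \<subseteq> carrier_vec n" "length us + length ws = n"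
    "det (mat_of_cols n (us @ ws)) \<noteq> 0" "span (set us) = W"
    "vectorspace.dim class_ring (vs W) = length us"
    using adapted_columns[of W] subspaceD(1)[OF W] span_subspace[OF W] by auto
  then have "W = (\<lambda>v. mat_of_cols n (us @ ws) *\<^sub>v v) ` leading n (length us)"
    using span_eq_leading[of us ws] subspaceD(1)[OF W] by auto
  then show thesis using that[of "mat_of_cols n (us @ ws)"] * by (auto simp: mat_of_cols_def)
qed

lemma vector_space_coordinates:
  fixes V :: "('k::field, 'm, 'e) module_scheme"
  assumes "vectorspace class_ring V" "vectorspace.fin_dim class_ring V"
  obtains \<theta> where "\<theta> \<in> LinearCombinations.module_hom class_ring
      (module_vec TYPE('k) (vectorspace.dim class_ring V)) V"
    "bij_betw \<theta> (carrier_vec (vectorspace.dim class_ring V)) (carrier V)"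
proof -
  interpret vectorspace class_ring V by fact
  obtain B where B: "finite B" "basis B" using finite_basis_exists assms(2) by auto
  obtain bs where bs: "set bs = B" "distinct bs" using finite_distinct_list[OF B(1)] by auto
  have n: "dim = length bs" using dim_basis[OF B] bs by (simp add: distinct_card[symmetric])
  have Bc: "B \<subseteq> carrier V" using B by (auto simp: basis_def)
  define ix where "ix = the_inv_into {0..<length bs} (nth bs)"
  have ij: "inj_on (nth bs) {0..<length bs}" using bs by (auto intro!: inj_on_nth)
  have ix: "ix (bs ! k) = k" if "k < length bs" for k
    unfolding ix_def using that ij by (intro the_inv_into_f_f) auto
  have ixB: "ix b < length bs \<and> bs ! ix b = b" if "b \<in> B" for b
    using that bs ix by (metis in_set_conv_nth)
  define \<theta> where "\<theta> v = lincomb (\<lambda>b. v $ ix b) B" for v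
  have ex1: "\<exists>! a. a \<in> B \<rightarrow>\<^sub>E carrier class_ring \<and> lincomb a B = v" if "v \<in> carrier V" for v
    using basis_criterion[OF B(1) Bc] B(2) that by blast
  \<comment> \<open>Coefficients are unique only among functions that are extensional on
    \<open>B\<close>, so they have to be restricted before uniqueness applies.\<close>
  have lc_restrict: "lincomb (restrict a B) B = lincomb a B" for a
    by (rule lincomb_cong[OF refl Bc]) auto
  have cl: "\<theta> v \<in> carrier V" for v
    unfolding \<theta>_def using Bc by auto
  have hom: "\<theta> \<in> LinearCombinations.module_hom class_ring (module_vec TYPE('k) dim) V"
    unfolding module_hom_def
  proof (safe)
    fix v w :: "'k vec" assume vw: "v \<in> carrier (module_vec TYPE('k) dim)" "w \<in> carrier (module_vec TYPE('k) dim)"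
    then have "\<theta> (v + w) = lincomb (\<lambda>b. v $ ix b + w $ ix b) B"
      unfolding \<theta>_def using ixB n by (intro lincomb_cong[OF refl Bc]) (auto simp: module_vec_simps)
    also have "\<dots> = \<theta> v \<oplus>\<^bsub>V\<^esub> \<theta> w"
      unfolding \<theta>_def lincomb_def using Bc
      by (subst M.finsum_addf[symmetric]) (auto simp: smult_l_distr[symmetric] intro!: M.finsum_cong')
    finally show "\<theta> (v \<oplus>\<^bsub>module_vec TYPE('k) dim\<^esub> w) = \<theta> v \<oplus>\<^bsub>V\<^esub> \<theta> w"
      by (simp add: module_vec_simps)
  next
    fix c :: 'k and v :: "'k vec" assume v: "v \<in> carrier (module_vec TYPE('k) dim)"
    have "\<theta> (c \<cdot>\<^sub>v v) = lincomb (\<lambda>b. c \<otimes>\<^bsub>class_ring\<^esub> v $ ix b) B"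
      unfolding \<theta>_def using ixB n v by (intro lincomb_cong[OF refl Bc]) (auto simp: module_vec_simps)
    also have "\<dots> = c \<odot>\<^bsub>V\<^esub> \<theta> v"
      unfolding \<theta>_def using Bc by (intro lincomb_smult) auto
    finally show "\<theta> (c \<odot>\<^bsub>module_vec TYPE('k) dim\<^esub> v) = c \<odot>\<^bsub>V\<^esub> \<theta> v"
      by (simp add: module_vec_simps)
  qed (use cl in auto)
  have "inj_on \<theta> (carrier_vec dim)"
  proof (rule inj_onI)
    fix v w :: "'k vec" assume v: "v \<in> carrier_vec dim" and w: "w \<in> carrier_vec dim" and e: "\<theta> v = \<theta> w"
    have "restrict (\<lambda>b. v $ ix b) B = restrict (\<lambda>b. w $ ix b) B"
      using ex1[OF cl[of v]] e lc_restrict unfolding \<theta>_def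
      by (smt (verit) PiE_iff extensional_restrict restrict_extensional partial_object.select_convs(1) UNIV_I)
    then have "v $ ix (bs ! k) = w $ ix (bs ! k)" if "k < length bs" for k
      using that bs by (metis nth_mem restrict_apply')
    then show "v = w" using v w n ix by (intro eq_vecI) auto
  qed
  moreover have "\<theta> ` carrier_vec dim = carrier V"
  proof (intro equalityI subsetI)
    fix x assume "x \<in> carrier V"
    then obtain a where a: "lincomb a B = x" using ex1 by blast
    have "\<theta> (vec dim (\<lambda>k. a (bs ! k))) = x"
      unfolding \<theta>_def a[symmetric] using ixB n by (intro lincomb_cong[OF refl Bc]) auto
    then show "x \<in> \<theta> ` carrier_vec dim" by (metis image_eqI vec_carrier)
  qed (use cl in auto)
  ultimately show thesis using that[OF hom] by (auto simp: bij_betw_def)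
qed

lemma linear_eq_mat_mult:
  fixes f :: "'k::field vec \<Rightarrow> 'k vec"
  assumes "f \<in> LinearCombinations.module_hom class_ring (module_vec TYPE('k) n) (module_vec TYPE('k) m)"
  obtains A where "A \<in> carrier_mat m n" "\<And>v. v \<in> carrier_vec n \<Longrightarrow> f v = A *\<^sub>v v"
proof -
  define A where "A = mat m n (\<lambda>(i,j). f (unit_vec n j) $ i)"
  have A: "A \<in> carrier_mat m n" "\<And>i j. i < m \<Longrightarrow> j < n \<Longrightarrow> A $$ (i,j) = f (unit_vec n j) $ i"
    by (simp_all add: A_def)
  have fc: "f v \<in> carrier_vec m" if "v \<in> carrier_vec n" for v
    using assms that by (auto simp: module_hom_def module_vec_simps)
  have fadd: "f (v + w) = f v + f w" if "v \<in> carrier_vec n" "w \<in> carrier_vec n" for v w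
    using assms that by (auto simp: module_hom_def module_vec_simps)
  have fsm: "f (c \<cdot>\<^sub>v v) = c \<cdot>\<^sub>v f v" if "v \<in> carrier_vec n" for c v
    using assms that by (auto simp: module_hom_def module_vec_simps)
  have f0: "f (0\<^sub>v n) = 0\<^sub>v m"
  proof -
    have "(0 :: 'k) \<cdot>\<^sub>v 0\<^sub>v n = 0\<^sub>v n" by (rule eq_vecI) simp_all
    then have "f (0\<^sub>v n) = 0 \<cdot>\<^sub>v f (0\<^sub>v n)" using fsm[of "0\<^sub>v n" 0] by (metis zero_carrier_vec)
    also have "\<dots> = 0\<^sub>v m" using fc[of "0\<^sub>v n"] by (intro eq_vecI) simp_all
    finally show ?thesis .
  qed
  have fA: "f v = A *\<^sub>v v" if v: "v \<in> carrier_vec n" for v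
  proof -
    \<comment> \<open>Induction on the number of coordinates of v that are kept; it replaces a sum
      of scaled unit vectors.\<close>
    have "f (vec n (\<lambda>k. if k < l then v $ k else 0)) = vec m (\<lambda>i. \<Sum>k<l. A $$ (i,k) * v $ k)" if "l \<le> n" for l
      using that
    proof (induction l)
      case 0
      have "vec n (\<lambda>k. 0) = (0\<^sub>v n :: 'k vec)" "vec m (\<lambda>k. 0) = (0\<^sub>v m :: 'k vec)" by auto
      then show ?case using f0 by simp
    next
      case (Suc l)
      have "vec n (\<lambda>k. if k < Suc l then v $ k else 0) =
        vec n (\<lambda>k. if k < l then v $ k else 0) + v $ l \<cdot>\<^sub>v unit_vec n l"
        using Suc.prems by (intro eq_vecI) (auto simp: less_Suc_eq)
      then have "f (vec n (\<lambda>k. if k < Suc l then v $ k else 0)) =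
          f (vec n (\<lambda>k. if k < l then v $ k else 0)) + v $ l \<cdot>\<^sub>v f (unit_vec n l)"
        by (simp add: fadd fsm)
      also have "f (vec n (\<lambda>k. if k < l then v $ k else 0)) = vec m (\<lambda>i. \<Sum>k<l. A $$ (i,k) * v $ k)"
        using Suc by simp
      also have "\<dots> + v $ l \<cdot>\<^sub>v f (unit_vec n l) = vec m (\<lambda>i. \<Sum>k<Suc l. A $$ (i,k) * v $ k)"
        using fc[of "unit_vec n l"] Suc.prems by (intro eq_vecI) (simp_all add: mult.commute A)
      finally show ?case .
    qed
    from this[of n] have "f (vec n (\<lambda>k. if k < n then v $ k else 0)) = vec m (\<lambda>i. \<Sum>k<n. A $$ (i,k) * v $ k)"
      by simp
    moreover have "vec n (\<lambda>k. if k < n then v $ k else 0) = v" using v by (intro eq_vecI) auto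
    moreover have "vec m (\<lambda>i. \<Sum>k<n. A $$ (i,k) * v $ k) = A *\<^sub>v v"
      using v A(1) by (intro eq_vecI) (auto simp: scalar_prod_def atLeast0LessThan)
    ultimately show ?thesis by metis
  qed
  show thesis by (rule that[of A, OF A(1) fA])
qed

section \<open>The structure of a quiver algebra with vanishing square radical\<close>

text \<open>If N were not contained in M, then M + N would be the whole ring and 1 = l + b with l in
  M and b nilpotent. All powers of b are congruent to 1 modulo M, so the power that vanishes would
  put 1 into M.\<close>

lemma (in ring) nil_ideal_subset_maximal:
  assumes N: "ideal N R" and nil: "\<And>b. b \<in> N \<Longrightarrow> \<exists>k::nat. b [^] k = \<zero>"
    and M: "maximal_left_ideal M R"
  shows "N \<subseteq> M"
proof (rule ccontr)
  assume n: "\<not> N \<subseteq> M"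
  interpret N: ideal N R by (rule N)
  have M': "additive_subgroup M R" "\<And>a x. a \<in> carrier R \<Longrightarrow> x \<in> M \<Longrightarrow> a \<otimes> x \<in> M" "M \<noteq> carrier R"
    using M by (auto simp: maximal_left_ideal_def left_ideal_def)
  interpret M: additive_subgroup M R by (rule M'(1))
  have Mc: "x \<in> carrier R" if "x \<in> M" for x using M.a_subset that by auto
  have S: "set_add R M N = {l \<oplus> b | l b. l \<in> M \<and> b \<in> N}" by (auto simp: set_add_defs)
  have "left_ideal (set_add R M N) R"
    unfolding left_ideal_def
  proof (intro conjI ballI)
    show "additive_subgroup (set_add R M N) R"
      by (rule add_additive_subgroups[OF M'(1) N.additive_subgroup_axioms])
    fix a x assume a: "a \<in> carrier R" and "x \<in> set_add R M N"
    then obtain l b where x: "x = l \<oplus> b" "l \<in> M" "b \<in> N" unfolding S by auto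
    then have "a \<otimes> x = (a \<otimes> l) \<oplus> (a \<otimes> b)"
      using a Mc N.Icarr by (simp add: r_distr)
    then show "a \<otimes> x \<in> set_add R M N" unfolding S using M'(2)[OF a x(2)] N.I_l_closed[OF x(3) a] by blast
  qed
  moreover have "x \<in> set_add R M N" if "x \<in> M" for x
  proof -
    have "x = x \<oplus> \<zero>" using Mc[OF that] by simp
    then show ?thesis unfolding S using that N.zero_closed by blast
  qed
  moreover have "x \<in> set_add R M N" if "x \<in> N" for x
  proof -
    have "x = \<zero> \<oplus> x" using N.Icarr[OF that] by simp
    then show ?thesis unfolding S using that M.zero_closed by blast
  qed
  ultimately have "set_add R M N = carrier R" using M n unfolding maximal_left_ideal_def by (metis subsetI)
  then obtain l b where lb: "l \<in> M" "b \<in> N" "\<one> = l \<oplus> b"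
    using one_closed unfolding S by blast
  have c: "l \<in> carrier R" "b \<in> carrier R" using lb Mc N.Icarr by auto
  have l: "l = \<one> \<ominus> b" using lb(3) c by (simp add: a_minus_def a_assoc r_neg)
  have pow: "\<one> \<ominus> b [^] k \<in> M" for k :: nat
  proof (induction k)
    case 0
    then show ?case using M.zero_closed by (simp add: a_minus_def r_neg)
  next
    case (Suc k)
    have "\<one> \<ominus> b [^] Suc k = l \<oplus> b \<otimes> (\<one> \<ominus> b [^] k)"
      unfolding l nat_pow_Suc2[OF c(2)] using c(2)
      by (simp add: a_minus_def r_distr r_minus) (simp add: a_assoc[symmetric] a_assoc l_neg)
    then show ?case using M'(2)[OF c(2) Suc] lb(1) M.a_closed by simp
  qed
  obtain k :: nat where "b [^] k = \<zero>" using nil lb(2) by blast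
  then have "\<one> \<in> M" using pow[of k] by (simp add: a_minus_def)
  then have "x \<in> M" if "x \<in> carrier R" for x using M'(2)[OF that, of \<one>] that by simp
  then show False using M'(3) Mc by blast
qed

text \<open>The coefficient is built in because such elements generate the path algebra additively;
  inductions over it then need no separate step for scalars.\<close>

definition path_term :: "'k::field \<Rightarrow> ('v,'a) path \<Rightarrow> ('v,'a) path \<Rightarrow> 'k" where
  "path_term c p = (\<lambda>q. if q = p then c else 0)"

lemma path_term_scaled: "(\<lambda>q. c * path_term 1 p q) = path_term c p"
  by (auto simp: path_term_def)

lemma of_path_eq: "of_path p = path_term 1 p"
  by (simp add: of_path_def path_term_def)

locale rad_square_zero =
  fixes Q :: "('v,'a) pre_digraph" and I :: "(('v,'a) path \<Rightarrow> 'k::field) set"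
  assumes fin_digraph: "fin_digraph Q" and admissible: "admissible_ideal Q I"
    and rad_square: "ideal_prod (quiver_algebra Q I) (jacobson_radical (quiver_algebra Q I))
      (jacobson_radical (quiver_algebra Q I)) = {\<zero>\<^bsub>quiver_algebra Q I\<^esub>}"
begin

interpretation D: fin_digraph Q by (rule fin_digraph)

abbreviation A where "A \<equiv> (path_algebra Q :: (('v,'a) path \<Rightarrow> 'k) ring)"
abbreviation Arr where "Arr \<equiv> (arrow_ideal Q :: (('v,'a) path \<Rightarrow> 'k) set)"
abbreviation L where "L \<equiv> quiver_algebra Q I"

lemma ideal_I: "ideal I A" using admissible by (simp add: admissible_ideal_def)

sublocale A: ring A using ideal_I by (simp add: ideal_def)
interpretation I: ideal I A by (rule ideal_I)
sublocale L: ring L by (rule I.quotient_is_ring)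

lemma A_simps:
  "carrier A = {f. finite {p. f p \<noteq> 0} \<and> (\<forall>p. f p \<noteq> 0 \<longrightarrow> is_path Q p)}"
  "\<zero>\<^bsub>A\<^esub> = (\<lambda>_. 0)" "f \<oplus>\<^bsub>A\<^esub> g = (\<lambda>p. f p + g p)"
  "\<one>\<^bsub>A\<^esub> = (\<lambda>(u, as). if u \<in> verts Q \<and> as = [] then 1 else 0)"
  by (simp_all add: path_algebra_def)

lemma carrier_is_path: "f \<in> carrier A \<Longrightarrow> f p \<noteq> 0 \<Longrightarrow> is_path Q p"
  by (cases p) (simp add: A_simps)

lemma A_mult: "(f \<otimes>\<^bsub>A\<^esub> g) (u, as) = (\<Sum>k\<le>length as.
    f (pre_digraph.awlast Q u (take k as), drop k as) * g (u, take k as))"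
  by (simp add: path_algebra_def)

lemma A_mult_0: "(f \<otimes>\<^bsub>A\<^esub> g) (u, []) = f (u, []) * g (u, [])"
  by (simp add: A_mult)

lemma is_path_Nil: "is_path Q (u, []) \<longleftrightarrow> u \<in> verts Q"
  by (auto simp: is_path_def D.awalk_def)

lemma is_path_Cons: "is_path Q (u, \<alpha> # as) \<longleftrightarrow> \<alpha> \<in> arcs Q \<and> u = tail Q \<alpha> \<and> is_path Q (head Q \<alpha>, as)"
  by (auto simp: is_path_def D.awalk_def)

lemma is_path_awlast: "is_path Q (u, as) \<Longrightarrow> D.awlast u as \<in> verts Q"
  by (induction as arbitrary: u) (auto simp: is_path_Nil is_path_Cons)

lemma path_term_closed: "is_path Q p \<Longrightarrow> path_term c p \<in> carrier A"
  by (auto simp: A_simps path_term_def)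

lemma path_term_mult:
  "path_term c (w, bs) \<otimes>\<^bsub>A\<^esub> path_term d (u, as) =
    (if D.awlast u as = w then path_term (c * d) (u, as @ bs) else (\<lambda>_. 0))"
proof (rule ext, clarify)
  fix u' cs
  \<comment> \<open>Of all the cuts of a path, only the one after \<open>length as\<close> arrows
    can contribute, and at most once.\<close>
  have "(path_term c (w, bs) \<otimes>\<^bsub>A\<^esub> path_term d (u, as)) (u', cs) =
    (\<Sum>k\<le>length cs. if k = length as then
      (if u' = u \<and> cs = as @ bs \<and> D.awlast u as = w then c * d else 0) else 0)"
    unfolding A_mult
  proof (rule sum.cong[OF refl])
    fix k assume k: "k \<in> {..length cs}"
    show "path_term c (w, bs) (D.awlast u' (take k cs), drop k cs) * path_term d (u, as) (u', take k cs) =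
      (if k = length as then
      (if u' = u \<and> cs = as @ bs \<and> D.awlast u as = w then c * d else 0) else 0)"
    proof (cases "take k cs = as")
      case True
      then have "k = length as" using k by auto
      moreover have "cs = as @ drop k cs" using True append_take_drop_id by metis
      ultimately show ?thesis using True by (auto simp: path_term_def)
    next
      case False
      then have "k = length as \<Longrightarrow> cs \<noteq> as @ bs" by auto
      then show ?thesis using False by (auto simp: path_term_def)
    qed
  qed
  also have "\<dots> = (if D.awlast u as = w then path_term (c * d) (u, as @ bs) else (\<lambda>_. 0)) (u', cs)"
    by (auto simp: path_term_def)
  finally show "(path_term c (w, bs) \<otimes>\<^bsub>A\<^esub> path_term d (u, as)) (u', cs) =
    (if D.awlast u as = w then path_term (c * d) (u, as @ bs) else (\<lambda>_. 0)) (u', cs)" .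
qed

lemma scale_one_closed: "(\<lambda>p. c * \<one>\<^bsub>A\<^esub> p) \<in> carrier A"
proof -
  have "\<one>\<^bsub>A\<^esub> \<in> carrier A" by simp
  then show ?thesis unfolding A_simps(1)
    by (auto elim!: rev_finite_subset)
qed

lemma scale_closed: "f \<in> carrier A \<Longrightarrow> (\<lambda>p. c * f p) \<in> carrier A"
  unfolding A_simps(1) by (auto elim!: rev_finite_subset)

lemma mult_scale_one:
  assumes "f \<in> carrier A"
  shows "f \<otimes>\<^bsub>A\<^esub> (\<lambda>p. c * \<one>\<^bsub>A\<^esub> p) = (\<lambda>p. c * f p)"
proof (rule ext, clarify)
  fix u as
  have "(f \<otimes>\<^bsub>A\<^esub> (\<lambda>p. c * \<one>\<^bsub>A\<^esub> p)) (u, as) = (\<Sum>k\<le>length as. if k = 0 then c * f (u, as) else 0)"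
    unfolding A_mult
  proof (rule sum.cong[OF refl])
    fix k assume "k \<in> {..length as}"
    then have "take k as = [] \<longleftrightarrow> k = 0" by auto
    moreover have "f (u, as) \<noteq> 0 \<Longrightarrow> u \<in> verts Q"
      using carrier_is_path[OF assms, of "(u, as)"] by (cases as) (auto simp: is_path_Nil is_path_Cons)
    ultimately show "f (D.awlast u (take k as), drop k as) * (c * \<one>\<^bsub>A\<^esub> (u, take k as)) =
      (if k = 0 then c * f (u, as) else 0)"
      by (auto simp: A_simps(4))
  qed
  then show "(f \<otimes>\<^bsub>A\<^esub> (\<lambda>p. c * \<one>\<^bsub>A\<^esub> p)) (u, as) = c * f (u, as)" by simp
qed

lemma scale_one_mult:
  assumes "f \<in> carrier A"
  shows "(\<lambda>p. c * \<one>\<^bsub>A\<^esub> p) \<otimes>\<^bsub>A\<^esub> f = (\<lambda>p. c * f p)"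
proof (rule ext, clarify)
  fix u as
  have "((\<lambda>p. c * \<one>\<^bsub>A\<^esub> p) \<otimes>\<^bsub>A\<^esub> f) (u, as) = (\<Sum>k\<le>length as. if k = length as then c * f (u, as) else 0)"
    unfolding A_mult
  proof (rule sum.cong[OF refl])
    fix k assume "k \<in> {..length as}"
    then have "drop k as = [] \<longleftrightarrow> k = length as" by auto
    moreover have "f (u, as) \<noteq> 0 \<Longrightarrow> D.awlast u as \<in> verts Q"
      using carrier_is_path[OF assms, of "(u, as)"] by (auto intro!: is_path_awlast)
    ultimately show "(c * \<one>\<^bsub>A\<^esub> (D.awlast u (take k as), drop k as)) * f (u, take k as) =
      (if k = length as then c * f (u, as) else 0)"
      by (auto simp: A_simps(4))
  qed
  then show "((\<lambda>p. c * \<one>\<^bsub>A\<^esub> p) \<otimes>\<^bsub>A\<^esub> f) (u, as) = c * f (u, as)" by simp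
qed

text \<open>Supports are finite, so f is assembled one path at a time. Only paths in the support of
  f have to be treated, which lets the induction stay inside the ideals \<open>Z m\<close>.\<close>

lemma path_algebra_induct:
  assumes f: "f \<in> carrier A" and 0: "(\<lambda>_. 0) \<in> H"
    and 1: "\<And>p c. is_path Q p \<Longrightarrow> f p \<noteq> 0 \<Longrightarrow> path_term c p \<in> H"
    and 2: "\<And>g h. g \<in> H \<Longrightarrow> h \<in> H \<Longrightarrow> g \<in> carrier A \<Longrightarrow> h \<in> carrier A \<Longrightarrow> (\<lambda>p. g p + h p) \<in> H"
  shows "f \<in> H"
proof -
  have "(\<lambda>p. if p \<in> S then f p else 0) \<in> H \<and> (\<lambda>p. if p \<in> S then f p else 0) \<in> carrier A"
    if "finite S" "S \<subseteq> {p. f p \<noteq> 0}" for S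
    using that
  proof (induction S rule: finite_induct)
    case empty
    then show ?case using 0 by (simp add: A_simps)
  next
    case (insert p S)
    have p: "is_path Q p" "f p \<noteq> 0" using insert.prems carrier_is_path[OF f] by auto
    have e: "(\<lambda>q. if q \<in> insert p S then f q else 0) =
        (\<lambda>q. path_term (f p) p q + (if q \<in> S then f q else 0))"
      using insert.hyps by (auto simp: path_term_def)
    have "(\<lambda>q. path_term (f p) p q + (if q \<in> S then f q else 0)) \<in> H"
      using insert by (intro 2 1 p path_term_closed) auto
    moreover have "(\<lambda>q. path_term (f p) p q + (if q \<in> S then f q else 0)) \<in> carrier A"
      using A.a_closed[OF path_term_closed[OF p(1)]] insert by (simp add: A_simps(3))
    ultimately show ?case unfolding e by blast
  qed
  from this[of "{p. f p \<noteq> 0}"] have "(\<lambda>p. if p \<in> {p. f p \<noteq> 0} then f p else 0) \<in> H"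
    using f by (simp add: A_simps)
  moreover have "(\<lambda>p. if p \<in> {p. f p \<noteq> 0} then f p else 0) = f" by auto
  ultimately show ?thesis by simp
qed

text \<open>The filtration by path length. \<open>Z 1\<close> turns out to be the arrow ideal and
  \<open>Z 2\<close> the ideal of relations, so both get a description by supports.\<close>

definition Z :: "nat \<Rightarrow> (('v,'a) path \<Rightarrow> 'k) set" where
  "Z m = {f \<in> carrier A. \<forall>p. length (snd p) < m \<longrightarrow> f p = 0}"

lemma Z_nonzero: "f \<in> Z m \<Longrightarrow> f p \<noteq> 0 \<Longrightarrow> m \<le> length (snd p)"
  unfolding Z_def using not_less by blast

text \<open>However a path of length below a + b is cut in two, the initial piece is shorter than b
  or the final piece is shorter than a.\<close>

lemma Z_mult:
  assumes "f \<in> Z a" "g \<in> Z b"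
  shows "f \<otimes>\<^bsub>A\<^esub> g \<in> Z (a + b)"
proof -
  have "(f \<otimes>\<^bsub>A\<^esub> g) (u, as) = 0" if "length as < a + b" for u as
    unfolding A_mult
  proof (rule sum.neutral, rule ballI)
    fix k assume "k \<in> {..length as}"
    then show "f (D.awlast u (take k as), drop k as) * g (u, take k as) = 0"
      using assms that by (cases "k < b") (auto simp: Z_def)
  qed
  then show ?thesis using assms by (auto simp: Z_def)
qed

lemma ideal_Z: "ideal (Z m) A"
proof (rule idealI[OF A.ring_axioms])
  have "\<ominus>\<^bsub>A\<^esub> f = (\<lambda>p. - f p)" if "f \<in> carrier A" for f
  proof -
    have "(\<lambda>p. (-1) * f p) \<in> carrier A" using scale_closed[OF that] .
    then show ?thesis using that by (intro A.minus_equality) (auto simp: A_simps)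
  qed
  moreover have "(\<lambda>p. - f p) \<in> carrier A" if "f \<in> carrier A" for f
    using scale_closed[OF that, of "-1"] by simp
  ultimately show "subgroup (Z m) (add_monoid A)"
    by (intro A.add.subgroupI) (auto simp: Z_def A_simps(2,3) a_inv_def[symmetric] intro: A.a_closed[unfolded A_simps(3)])
next
  \<comment> \<open>Multiplication by arbitrary elements, on either side, is the case of
    \<open>Z_mult\<close> in which one factor lies in \<open>Z 0\<close>.\<close>
  have "carrier A = Z 0" by (auto simp: Z_def)
  then show "x \<otimes>\<^bsub>A\<^esub> a \<in> Z m" "a \<otimes>\<^bsub>A\<^esub> x \<in> Z m" if "a \<in> Z m" "x \<in> carrier A" for a x
    using Z_mult[of x 0 a m] Z_mult[of a m x 0] that by auto
qed

lemma Z_subset: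
  assumes H: "additive_subgroup H A"
    and path: "\<And>p c. is_path Q p \<Longrightarrow> m \<le> length (snd p) \<Longrightarrow> path_term c p \<in> H"
  shows "Z m \<subseteq> H"
proof
  fix f assume f: "f \<in> Z m"
  show "f \<in> H"
  proof (rule path_algebra_induct)
    show "f \<in> carrier A" using f by (simp add: Z_def)
    show "(\<lambda>_. 0) \<in> H" using additive_subgroup.zero_closed[OF H] by (simp add: A_simps)
    fix p c assume "is_path Q p" "f p \<noteq> 0"
    then show "path_term c p \<in> H" using path Z_nonzero[OF f] by blast
  next
    fix g h assume "g \<in> H" "h \<in> H"
    then show "(\<lambda>p. g p + h p) \<in> H"
      using additive_subgroup.a_closed[OF H, of g h] by (simp add: A_simps)
  qed
qed

lemma arrow_paths: "(\<lambda>\<alpha>. of_path (tail Q \<alpha>, [\<alpha>])) ` arcs Q \<subseteq> carrier A"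
  by (auto simp: of_path_eq is_path_Nil is_path_Cons intro!: path_term_closed)

lemma ideal_arrow: "ideal (Arr) A"
  unfolding arrow_ideal_def by (rule A.genideal_ideal[OF arrow_paths])

text \<open>A path with at least one arrow is the product of its remaining part with its first
  arrow, so it lies in every ideal that contains the arrows.\<close>

lemma arrow_ideal_eq: "Arr = Z 1"
proof
  have "(\<lambda>\<alpha>. of_path (tail Q \<alpha>, [\<alpha>])) ` arcs Q \<subseteq> Z 1"
    using arrow_paths by (auto simp: Z_def of_path_def)
  then show "Arr \<subseteq> Z 1"
    unfolding arrow_ideal_def by (rule A.genideal_minimal[OF ideal_Z])
  interpret J: ideal "Arr" A by (rule ideal_arrow)
  show "Z 1 \<subseteq> Arr"
  proof (rule Z_subset[OF J.additive_subgroup_axioms])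
    fix p :: "('v,'a) path" and c :: 'k assume p: "is_path Q p" "1 \<le> length (snd p)"
    obtain u \<alpha> as where e: "p = (u, \<alpha> # as)" using p(2) by (cases p; cases "snd p") auto
    have al: "\<alpha> \<in> arcs Q" "u = tail Q \<alpha>" "is_path Q (head Q \<alpha>, as)"
      using p(1) by (auto simp: e is_path_Cons)
    have "path_term c p = path_term c (head Q \<alpha>, as) \<otimes>\<^bsub>A\<^esub> of_path (tail Q \<alpha>, [\<alpha>])"
      by (simp add: of_path_eq path_term_mult e al)
    moreover have "of_path (tail Q \<alpha>, [\<alpha>]) \<in> Arr"
      unfolding arrow_ideal_def using A.genideal_self[OF arrow_paths] al by blast
    ultimately show "path_term c p \<in> Arr"
      using J.I_l_closed path_term_closed[OF al(3)] by simp
  qed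
qed

lemma Z_carrier: "Z m \<subseteq> carrier A"
  by (auto simp: Z_def)

lemma ideal_prod_Z: "H \<subseteq> Z m \<Longrightarrow> ideal_prod A (Arr) H \<subseteq> Z (Suc m)"
proof
  fix f assume H: "H \<subseteq> Z m" and f: "f \<in> ideal_prod A (Arr) H"
  interpret Z: ideal "Z (Suc m)" A by (rule ideal_Z)
  show "f \<in> Z (Suc m)" using f
  proof induction
    case (prod i j)
    then show ?case using Z_mult[of i 1 j m] H by (auto simp: arrow_ideal_eq)
  qed auto
qed

lemma I_subset: "I \<subseteq> Z 2"
proof -
  have "carrier A \<subseteq> Z 0" by (auto simp: Z_def)
  then have "ideal_power A (Arr) 2 \<subseteq> Z (Suc (Suc 0))"
    unfolding numeral_2_eq_2 by (auto dest!: ideal_prod_Z)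
  then show ?thesis using admissible by (auto simp: admissible_ideal_def numeral_2_eq_2)
qed

abbreviation cls :: "(('v,'a) path \<Rightarrow> 'k) \<Rightarrow> (('v,'a) path \<Rightarrow> 'k) set" where
  "cls f \<equiv> I +>\<^bsub>A\<^esub> f"

lemma cls_hom: "ring_hom_ring A L cls"
  by (rule I.rcos_ring_hom_ring)

lemma L_carrier: "carrier L = cls ` carrier A"
  by (auto simp: FactRing_def A_RCOSETS_def')

lemma L_zero: "\<zero>\<^bsub>L\<^esub> = I"
  by (simp add: FactRing_def)

lemma cls_simps:
  "f \<in> carrier A \<Longrightarrow> cls f \<in> carrier L"
  "\<lbrakk>f \<in> carrier A; g \<in> carrier A\<rbrakk> \<Longrightarrow> cls f \<otimes>\<^bsub>L\<^esub> cls g = cls (f \<otimes>\<^bsub>A\<^esub> g)"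
  "\<lbrakk>f \<in> carrier A; g \<in> carrier A\<rbrakk> \<Longrightarrow> cls f \<oplus>\<^bsub>L\<^esub> cls g = cls (f \<oplus>\<^bsub>A\<^esub> g)"
  "cls \<one>\<^bsub>A\<^esub> = \<one>\<^bsub>L\<^esub>"
  using ring_hom_closed[OF ring_hom_ring.homh[OF cls_hom], of f]
    ring_hom_mult[OF ring_hom_ring.homh[OF cls_hom], of f g]
    ring_hom_add[OF ring_hom_ring.homh[OF cls_hom], of f g]
    ring_hom_one[OF ring_hom_ring.homh[OF cls_hom]]
  by metis+

lemma cls_zero_iff: "f \<in> carrier A \<Longrightarrow> cls f = \<zero>\<^bsub>L\<^esub> \<longleftrightarrow> f \<in> I"
  using I.a_rcos_const I.a_rcos_self by (auto simp: L_zero)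

lemma cls_eq_iff:
  "f \<in> carrier A \<Longrightarrow> g \<in> carrier A \<Longrightarrow> cls f = cls g \<longleftrightarrow> f \<ominus>\<^bsub>A\<^esub> g \<in> I"
  using A.quotient_eq_iff_same_a_r_cos[OF ideal_I] by blast

lemma A_minus: "f \<in> carrier A \<Longrightarrow> g \<in> carrier A \<Longrightarrow> f \<ominus>\<^bsub>A\<^esub> g = (\<lambda>p. f p - g p)"
proof -
  assume f: "f \<in> carrier A" and g: "g \<in> carrier A"
  have c: "(\<lambda>p. - g p) \<in> carrier A" using scale_closed[OF g, of "-1"] by simp
  have "\<ominus>\<^bsub>A\<^esub> g = (\<lambda>p. - g p)" using g c by (intro A.minus_equality) (auto simp: A_simps(2,3))
  then show ?thesis by (simp add: a_minus_def A_simps(3))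
qed

lemma ideal_cls_Arr: "ideal (cls ` Arr) L"
proof (rule idealI[OF L.ring_axioms])
  interpret h: ring_hom_ring A L cls by (rule cls_hom)
  interpret J: ideal Arr A by (rule ideal_arrow)
  have "group_hom (add_monoid A) (add_monoid L) cls" by (rule h.a_group_hom)
  from group_hom.subgroup_img_is_subgroup[OF this J.a_subgroup]
  show "subgroup (cls ` Arr) (add_monoid L)" .
  fix a x assume "a \<in> cls ` Arr" "x \<in> carrier L"
  then obtain b f where b: "b \<in> Arr" "a = cls b" "b \<in> carrier A" and f: "f \<in> carrier A" "x = cls f"
    using J.Icarr by (auto simp: L_carrier)
  have "x \<otimes>\<^bsub>L\<^esub> a = cls (f \<otimes>\<^bsub>A\<^esub> b)" "a \<otimes>\<^bsub>L\<^esub> x = cls (b \<otimes>\<^bsub>A\<^esub> f)"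
    unfolding b(2) f(2) by (rule cls_simps(2)[OF f(1) b(3)], rule cls_simps(2)[OF b(3) f(1)])
  then show "x \<otimes>\<^bsub>L\<^esub> a \<in> cls ` Arr" "a \<otimes>\<^bsub>L\<^esub> x \<in> cls ` Arr"
    using J.I_l_closed[OF b(1) f(1)] J.I_r_closed[OF b(1) f(1)] by (metis imageI)+
qed

text \<open>Admissibility places some power of the arrow ideal inside I, and this power annihilates
  the class of every element of the arrow ideal.\<close>

lemma Arr_nil:
  assumes "X \<in> cls ` Arr"
  shows "\<exists>k::nat. X [^]\<^bsub>L\<^esub> k = \<zero>\<^bsub>L\<^esub>"
proof -
  interpret J: ideal Arr A by (rule ideal_arrow)
  obtain b where b: "b \<in> Arr" "X = cls b" "b \<in> carrier A" using assms J.Icarr by auto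
  have pw: "b [^]\<^bsub>A\<^esub> k \<in> ideal_power A Arr k" for k :: nat
  proof (induction k)
    case (Suc k)
    then show ?case using b(1) A.nat_pow_Suc2[OF b(3), of k] by (simp add: ideal_prod.prod)
  qed simp
  have hp: "X [^]\<^bsub>L\<^esub> k = cls (b [^]\<^bsub>A\<^esub> k)" for k :: nat
    by (induction k) (auto simp: b cls_simps)
  obtain m where "ideal_power A Arr m \<subseteq> I" using admissible by (auto simp: admissible_ideal_def)
  then have "X [^]\<^bsub>L\<^esub> m = \<zero>\<^bsub>L\<^esub>"
    unfolding hp using pw[of m] b(3) by (auto simp: cls_zero_iff)
  then show ?thesis by blast
qed

text \<open>The coefficient at the trivial path of i is multiplicative and vanishes on I, which has
  no paths shorter than 2; the set is the kernel of this map to K. A larger left ideal contains an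
  element that can be scaled to differ from 1 by an element of the kernel.\<close>

lemma maximal_vertex:
  assumes "i \<in> verts Q"
  shows "maximal_left_ideal {cls f | f. f \<in> carrier A \<and> f (i, []) = 0} L" (is "maximal_left_ideal ?M L")
proof -
  interpret h: ring_hom_ring A L cls by (rule cls_hom)
  \<comment> \<open>The coefficient does not depend on the representative of the class.\<close>
  have key: "f (i, []) = 0" if f: "f \<in> carrier A" and m: "cls f \<in> ?M" for f
  proof -
    obtain g where g: "g \<in> carrier A" "g (i, []) = 0" "cls f = cls g" using m by auto
    then have "f \<ominus>\<^bsub>A\<^esub> g \<in> Z 2" using cls_eq_iff[OF f g(1)] I_subset by auto
    then show ?thesis using g by (auto simp: A_minus[OF f g(1)] Z_def)
  qed
  have li: "left_ideal ?M L"
    unfolding left_ideal_def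
  proof (intro conjI ballI)
    have "additive_subgroup {f \<in> carrier A. f (i, []) = 0} A"
    proof (intro additive_subgroup.intro A.add.subgroupI)
      show "{f \<in> carrier A. f (i, []) = 0} \<noteq> {}" using A.zero_closed by (auto simp: A_simps(2))
      fix f assume "f \<in> {f \<in> carrier A. f (i, []) = 0}"
      then have "\<ominus>\<^bsub>A\<^esub> f \<in> carrier A" "f \<in> carrier A" "f (i, []) = 0" by simp_all
      moreover from this(2,3) have "(\<zero>\<^bsub>A\<^esub> \<ominus>\<^bsub>A\<^esub> f) (i, []) = 0"
        using A_minus[OF A.zero_closed, of f] by (simp only: A_simps(2)) simp
      ultimately have "\<ominus>\<^bsub>A\<^esub> f \<in> carrier A" "(\<zero>\<^bsub>A\<^esub> \<ominus>\<^bsub>A\<^esub> f) (i, []) = 0" by blast+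
      then show "\<ominus>\<^bsub>A\<^esub> f \<in> {f \<in> carrier A. f (i, []) = 0}"
        by (simp add: a_minus_def)
    qed (auto simp: A_simps(3) intro: A.a_closed[unfolded A_simps(3)])
    then have "subgroup (cls ` {f \<in> carrier A. f (i, []) = 0}) (add_monoid L)"
      by (rule group_hom.subgroup_img_is_subgroup[OF h.a_group_hom additive_subgroup.a_subgroup])
    moreover have "cls ` {f \<in> carrier A. f (i, []) = 0} = ?M" by auto
    ultimately show "additive_subgroup ?M L" by (simp add: additive_subgroup.intro)
    fix a x assume "a \<in> carrier L" "x \<in> ?M"
    then obtain f g where fg: "f \<in> carrier A" "a = cls f" "g \<in> carrier A" "x = cls g" "g (i, []) = 0"
      by (auto simp: L_carrier)
    have "a \<otimes>\<^bsub>L\<^esub> x = cls (f \<otimes>\<^bsub>A\<^esub> g)"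
      unfolding fg(2,4) by (rule cls_simps(2)[OF fg(1,3)])
    moreover have "f \<otimes>\<^bsub>A\<^esub> g \<in> carrier A" by (rule A.m_closed[OF fg(1,3)])
    moreover have "(f \<otimes>\<^bsub>A\<^esub> g) (i, []) = 0" unfolding A_mult_0 fg(5) by simp
    ultimately show "a \<otimes>\<^bsub>L\<^esub> x \<in> ?M" by blast
  qed
  moreover have "?M \<noteq> carrier L"
  proof
    assume "?M = carrier L"
    then have "cls \<one>\<^bsub>A\<^esub> \<in> ?M" using cls_simps(1)[OF A.one_closed] by simp
    from key[OF A.one_closed this] show False using assms by (simp add: A_simps(4))
  qed
  moreover have "N = ?M \<or> N = carrier L" if N: "left_ideal N L" "?M \<subseteq> N" for N
  proof (rule disjCI)
    assume ne: "N \<noteq> carrier L"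
    interpret N: additive_subgroup N L using N(1) by (simp add: left_ideal_def)
    show "N = ?M"
    proof (rule ccontr)
      assume "N \<noteq> ?M"
      then obtain X where X: "X \<in> N" "X \<notin> ?M" using N(2) by blast
      then obtain g where g: "g \<in> carrier A" "X = cls g" using N.a_subset by (auto simp: L_carrier)
      then have c: "g (i, []) \<noteq> 0" using X by auto
      \<comment> \<open>After scaling, the coefficient at the trivial path is 1, so
        \<open>1 - ?g\<close> lies in \<open>?M\<close> and hence in N; adding the class of
        \<open>?g\<close> gives 1 in N.\<close>
      let ?c = "inverse (g (i, []))"
      let ?g = "\<lambda>p. ?c * g p"
      have gc: "?g \<in> carrier A" by (rule scale_closed[OF g(1)])
      have "cls ?g = cls (\<lambda>p. ?c * \<one>\<^bsub>A\<^esub> p) \<otimes>\<^bsub>L\<^esub> X"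
        using scale_one_mult[OF g(1)] g scale_one_closed by (simp add: cls_simps(2))
      then have gN: "cls ?g \<in> N" using X(1) N(1) cls_simps(1)[OF scale_one_closed] by (simp add: left_ideal_def)
      have "(\<one>\<^bsub>A\<^esub> \<ominus>\<^bsub>A\<^esub> ?g) (i, []) = 0"
        unfolding A_minus[OF A.one_closed gc] using c assms by (simp add: A_simps(4))
      then have "cls (\<one>\<^bsub>A\<^esub> \<ominus>\<^bsub>A\<^esub> ?g) \<in> N" using N(2) gc A.minus_closed[OF A.one_closed gc] by blast
      then have "cls (\<one>\<^bsub>A\<^esub> \<ominus>\<^bsub>A\<^esub> ?g) \<oplus>\<^bsub>L\<^esub> cls ?g \<in> N" using gN by (rule N.a_closed)
      moreover have "cls (\<one>\<^bsub>A\<^esub> \<ominus>\<^bsub>A\<^esub> ?g) \<oplus>\<^bsub>L\<^esub> cls ?g = cls ((\<one>\<^bsub>A\<^esub> \<ominus>\<^bsub>A\<^esub> ?g) \<oplus>\<^bsub>A\<^esub> ?g)"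
        using gc by (intro cls_simps(3)) auto
      moreover have "(\<one>\<^bsub>A\<^esub> \<ominus>\<^bsub>A\<^esub> ?g) \<oplus>\<^bsub>A\<^esub> ?g = \<one>\<^bsub>A\<^esub>"
        using gc A.one_closed by (simp add: A_minus A_simps(3))
      ultimately have "\<one>\<^bsub>L\<^esub> \<in> N" by (simp add: cls_simps(4))
      then have "x \<in> N" if "x \<in> carrier L" for x
        using N(1) that L.r_one[OF that] unfolding left_ideal_def by metis
      then show False using ne N.a_subset by blast
    qed
  qed
  ultimately show ?thesis unfolding maximal_left_ideal_def by blast
qed

text \<open>The classes of the arrow ideal form a nil ideal, hence lie in every maximal left ideal.
  Conversely, the maximal left ideals belonging to the vertices together force all coefficients at
  trivial paths to vanish.\<close>

lemma jacobson_eq: "jacobson_radical L = cls ` Z 1"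
proof
  show "cls ` Z 1 \<subseteq> jacobson_radical L"
    using L.nil_ideal_subset_maximal[OF ideal_cls_Arr Arr_nil] Z_carrier cls_simps(1)
    unfolding arrow_ideal_eq jacobson_radical_def by blast
  show "jacobson_radical L \<subseteq> cls ` Z 1"
  proof
    fix X assume X: "X \<in> jacobson_radical L"
    then obtain f where f: "f \<in> carrier A" "X = cls f" by (auto simp: jacobson_radical_def L_carrier)
    have "f (i, []) = 0" for i
    proof (cases "i \<in> verts Q")
      case True
      have "X \<in> {cls f | f. f \<in> carrier A \<and> f (i, []) = 0}"
        using X maximal_vertex[OF True] by (auto simp: jacobson_radical_def)
      then obtain g where g: "g \<in> carrier A" "g (i, []) = 0" "cls f = cls g" using f by auto
      then have "f \<ominus>\<^bsub>A\<^esub> g \<in> Z 2" using cls_eq_iff[OF f(1) g(1)] I_subset by auto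
      then show ?thesis using g by (auto simp: A_minus[OF f(1) g(1)] Z_def)
    next
      case False
      then show ?thesis using carrier_is_path[OF f(1), of "(i, [])"] by (auto simp: is_path_Nil)
    qed
    then show "X \<in> cls ` Z 1" using f by (auto simp: Z_def intro!: imageI)
  qed
qed

text \<open>The hypothesis on the square of the radical enters here: a path of length at least two
  splits into two factors whose classes lie in J, so its own class is zero.\<close>

lemma I_eq: "I = Z 2"
proof
  show "I \<subseteq> Z 2" by (rule I_subset)
  show "Z 2 \<subseteq> I"
  proof (rule Z_subset[OF ideal.axioms(1)[OF ideal_I]])
    fix p :: "('v,'a) path" and c :: 'k assume p: "is_path Q p" "2 \<le> length (snd p)"
    obtain u \<alpha> \<beta> as where e: "p = (u, \<alpha> # \<beta> # as)"
      using p(2) by (cases p; cases "snd p"; cases "tl (snd p)") auto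
    have pa: "is_path Q (tail Q \<alpha>, [\<alpha>])" "is_path Q (head Q \<alpha>, \<beta> # as)" "u = tail Q \<alpha>"
      using p(1) by (auto simp: e is_path_Cons is_path_Nil)
    let ?f = "path_term c (head Q \<alpha>, \<beta> # as)" and ?g = "path_term 1 (tail Q \<alpha>, [\<alpha>])"
    have fg: "?f \<in> Z 1" "?g \<in> Z 1"
      using path_term_closed[OF pa(2), of c] path_term_closed[OF pa(1), of 1]
      by (auto simp: Z_def) (auto simp: path_term_def)
    then have "cls ?f \<otimes>\<^bsub>L\<^esub> cls ?g \<in> ideal_prod L (jacobson_radical L) (jacobson_radical L)"
      unfolding jacobson_eq by (intro ideal_prod.prod imageI)
    then have "cls (?f \<otimes>\<^bsub>A\<^esub> ?g) = \<zero>\<^bsub>L\<^esub>"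
      using rad_square fg Z_carrier[of 1] cls_simps(2)[of ?f ?g] by auto
    moreover have "?f \<otimes>\<^bsub>A\<^esub> ?g = path_term c p" by (simp add: path_term_mult e pa(3))
    ultimately show "path_term c p \<in> I" using cls_zero_iff[OF path_term_closed[OF p(1)]] by simp
  qed
qed

text \<open>Since all longer paths lie in I, the scalar multiples of vertices and arrows generate
  \<Lambda> additively. Submodules and homomorphisms are therefore tested on \<open>sc\<close>,
  \<open>vx\<close> and \<open>ar\<close>.\<close>

definition vx :: "'v \<Rightarrow> (('v,'a) path \<Rightarrow> 'k) set" where "vx i = vertex_idem Q I i"
definition ar :: "'a \<Rightarrow> (('v,'a) path \<Rightarrow> 'k) set" where "ar \<alpha> = cls (of_path (tail Q \<alpha>, [\<alpha>]))"
definition sc :: "'k \<Rightarrow> (('v,'a) path \<Rightarrow> 'k) set" where "sc c = scalar Q I c"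

lemma vx_eq: "vx i = cls (path_term 1 (i, []))"
  by (simp add: vx_def vertex_idem_def of_path_eq)

lemma ar_eq: "ar \<alpha> = cls (path_term 1 (tail Q \<alpha>, [\<alpha>]))"
  by (simp add: ar_def of_path_eq)

lemma sc_eq: "sc c = cls (\<lambda>p. c * \<one>\<^bsub>A\<^esub> p)"
  by (simp add: sc_def scalar_def)

lemma is_path_vertex: "i \<in> verts Q \<Longrightarrow> is_path Q (i, [])"
  by (simp add: is_path_Nil)

lemma is_path_arrow: "\<alpha> \<in> arcs Q \<Longrightarrow> is_path Q (tail Q \<alpha>, [\<alpha>])"
  by (simp add: is_path_Nil is_path_Cons)

lemma gens_closed [simp]:
  "i \<in> verts Q \<Longrightarrow> vx i \<in> carrier L" "\<alpha> \<in> arcs Q \<Longrightarrow> ar \<alpha> \<in> carrier L" "sc c \<in> carrier L"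
  unfolding vx_eq ar_eq sc_eq
  by (simp_all add: cls_simps(1) path_term_closed is_path_vertex is_path_arrow scale_one_closed)

lemma cls_null: "cls (\<lambda>_. 0) = \<zero>\<^bsub>L\<^esub>"
  using ring_hom_ring.axioms(1)[OF cls_hom] cls_zero_iff[OF A.zero_closed] I.zero_closed by (simp add: A_simps(2))

lemma vx_vx: "i \<in> verts Q \<Longrightarrow> j \<in> verts Q \<Longrightarrow> vx j \<otimes>\<^bsub>L\<^esub> vx i = (if i = j then vx i else \<zero>\<^bsub>L\<^esub>)"
  unfolding vx_eq
  by (subst cls_simps(2)) (auto simp: path_term_closed is_path_vertex path_term_mult cls_null)

lemma vx_ar: "\<alpha> \<in> arcs Q \<Longrightarrow> j \<in> verts Q \<Longrightarrow> vx j \<otimes>\<^bsub>L\<^esub> ar \<alpha> = (if j = head Q \<alpha> then ar \<alpha> else \<zero>\<^bsub>L\<^esub>)"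
  unfolding vx_eq ar_eq
  by (subst cls_simps(2)) (auto simp: path_term_closed is_path_vertex is_path_arrow path_term_mult cls_null)

lemma ar_vx: "\<alpha> \<in> arcs Q \<Longrightarrow> j \<in> verts Q \<Longrightarrow> ar \<alpha> \<otimes>\<^bsub>L\<^esub> vx j = (if j = tail Q \<alpha> then ar \<alpha> else \<zero>\<^bsub>L\<^esub>)"
  unfolding vx_eq ar_eq
  by (subst cls_simps(2)) (auto simp: path_term_closed is_path_vertex is_path_arrow path_term_mult cls_null)

lemma ar_ar:
  assumes "\<alpha> \<in> arcs Q" "\<beta> \<in> arcs Q"
  shows "ar \<beta> \<otimes>\<^bsub>L\<^esub> ar \<alpha> = \<zero>\<^bsub>L\<^esub>"
proof -
  let ?a = "path_term 1 (tail Q \<alpha>, [\<alpha>]) :: ('v,'a) path \<Rightarrow> 'k"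
  let ?b = "path_term 1 (tail Q \<beta>, [\<beta>]) :: ('v,'a) path \<Rightarrow> 'k"
  have c: "?a \<in> carrier A" "?b \<in> carrier A"
    using path_term_closed[OF is_path_arrow] assms by auto
  then have "?a \<in> Z 1" "?b \<in> Z 1" unfolding Z_def by (auto simp: path_term_def)
  from Z_mult[OF this(2,1)] have "?b \<otimes>\<^bsub>A\<^esub> ?a \<in> I" by (simp only: I_eq one_add_one)
  then show ?thesis
    unfolding ar_eq cls_simps(2)[OF c(2,1)] using cls_zero_iff[OF A.m_closed[OF c(2,1)]] by simp
qed

lemma sc_mult_cls: "f \<in> carrier A \<Longrightarrow> sc c \<otimes>\<^bsub>L\<^esub> cls f = cls (\<lambda>p. c * f p)"
  unfolding sc_eq by (simp add: cls_simps(2) scale_one_closed scale_one_mult)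

lemma cls_mult_sc: "f \<in> carrier A \<Longrightarrow> cls f \<otimes>\<^bsub>L\<^esub> sc c = cls (\<lambda>p. c * f p)"
  unfolding sc_eq by (simp add: cls_simps(2) scale_one_closed mult_scale_one)

lemma sc_comm: "X \<in> carrier L \<Longrightarrow> X \<otimes>\<^bsub>L\<^esub> sc c = sc c \<otimes>\<^bsub>L\<^esub> X"
  by (auto simp: L_carrier sc_mult_cls cls_mult_sc)

lemma sc_add: "sc (c + d) = sc c \<oplus>\<^bsub>L\<^esub> sc d"
  unfolding sc_eq by (subst cls_simps(3)) (auto simp: scale_one_closed A_simps(3) distrib_right)

lemma sc_mult: "sc (c * d) = sc c \<otimes>\<^bsub>L\<^esub> sc d"
  unfolding sc_eq[of d] by (subst sc_mult_cls[OF scale_one_closed]) (simp add: sc_eq mult.assoc)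

lemma sc_one: "sc 1 = \<one>\<^bsub>L\<^esub>"
  by (simp add: sc_eq cls_simps(4)[symmetric])

lemma path_term_in_I:
  assumes "is_path Q p" "2 \<le> length (snd p)"
  shows "path_term c p \<in> I"
proof -
  have "path_term c p q = 0" if "length (snd q) < 2" for q
    using that assms(2) by (cases "q = p") (simp_all add: path_term_def)
  then show ?thesis unfolding I_eq Z_def using path_term_closed[OF assms(1)] by blast
qed

text \<open>A path of length at least two has class zero, so only trivial paths and single arrows
  remain from \<open>path_algebra_induct\<close>.\<close>

lemma L_induct [consumes 1, case_names zero vx ar add]:
  assumes X: "X \<in> carrier L" and 0: "P \<zero>\<^bsub>L\<^esub>"
    and vx: "\<And>c i. i \<in> verts Q \<Longrightarrow> P (sc c \<otimes>\<^bsub>L\<^esub> vx i)"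
    and ar: "\<And>c \<alpha>. \<alpha> \<in> arcs Q \<Longrightarrow> P (sc c \<otimes>\<^bsub>L\<^esub> ar \<alpha>)"
    and add: "\<And>X Y. \<lbrakk>X \<in> carrier L; Y \<in> carrier L; P X; P Y\<rbrakk> \<Longrightarrow> P (X \<oplus>\<^bsub>L\<^esub> Y)"
  shows "P X"
proof -
  obtain f where f: "f \<in> carrier A" "X = cls f" using X by (auto simp: L_carrier)
  have "f \<in> {f \<in> carrier A. P (cls f)}"
  proof (rule path_algebra_induct[OF f(1)])
    show "(\<lambda>_. 0) \<in> {f \<in> carrier A. P (cls f)}"
      using 0 A.zero_closed by (simp add: cls_null A_simps(2))
    fix p c assume p: "is_path Q p"
    have pc: "path_term c p \<in> carrier A" by (rule path_term_closed[OF p])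
    consider u where "p = (u, [])" | u \<alpha> where "p = (u, [\<alpha>])" | "2 \<le> length (snd p)"
      by (cases p; cases "snd p"; cases "tl (snd p)") auto
    then have "P (cls (path_term c p))"
    proof cases
      case 1
      then show ?thesis using vx[of u c] p sc_mult_cls[OF path_term_closed[OF p, of 1], of c]
        by (simp add: vx_eq is_path_Nil path_term_scaled)
    next
      case 2
      then show ?thesis using ar[of \<alpha> c] p sc_mult_cls[OF path_term_closed[OF p, of 1], of c]
        by (simp add: ar_eq is_path_Cons path_term_scaled)
    next
      case 3
      then have "path_term c p \<in> I" by (rule path_term_in_I[OF p])
      then show ?thesis using 0 cls_zero_iff[OF pc] by simp
    qed
    then show "path_term c p \<in> {f \<in> carrier A. P (cls f)}" using pc by simp
  next
    fix g h assume "g \<in> {f \<in> carrier A. P (cls f)}" "h \<in> {f \<in> carrier A. P (cls f)}"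
    then have "g \<in> carrier A" "h \<in> carrier A" "P (cls g)" "P (cls h)" by auto
    then show "(\<lambda>p. g p + h p) \<in> {f \<in> carrier A. P (cls f)}"
      using add[of "cls g" "cls h"] A.a_closed[of g h] by (simp add: cls_simps A_simps(3))
  qed
  then show ?thesis using f by simp
qed

lemma ar_rad: "\<alpha> \<in> arcs Q \<Longrightarrow> ar \<alpha> \<in> jacobson_radical L"
  unfolding jacobson_eq ar_eq using path_term_closed[OF is_path_arrow, of \<alpha> 1]
  by (intro imageI) (auto simp: Z_def path_term_def)

lemma rad_induct [consumes 1, case_names zero ar add]:
  assumes X: "X \<in> jacobson_radical L" and 0: "P \<zero>\<^bsub>L\<^esub>"
    and ar: "\<And>c \<alpha>. \<alpha> \<in> arcs Q \<Longrightarrow> P (sc c \<otimes>\<^bsub>L\<^esub> ar \<alpha>)"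
    and add: "\<And>X Y. \<lbrakk>X \<in> carrier L; Y \<in> carrier L; P X; P Y\<rbrakk> \<Longrightarrow> P (X \<oplus>\<^bsub>L\<^esub> Y)"
  shows "P X"
proof -
  obtain f where f: "f \<in> Z 1" "X = cls f" using X by (auto simp: jacobson_eq)
  have fc: "f \<in> carrier A" using f Z_carrier by auto
  have "f \<in> {f \<in> carrier A. P (cls f)}"
  proof (rule path_algebra_induct[OF fc])
    show "(\<lambda>_. 0) \<in> {f \<in> carrier A. P (cls f)}"
      using 0 A.zero_closed by (simp add: cls_null A_simps(2))
    fix p c assume p: "is_path Q p" and fp: "f p \<noteq> 0"
    have pc: "path_term c p \<in> carrier A" by (rule path_term_closed[OF p])
    have "length (snd p) \<ge> 1" using Z_nonzero[OF f(1) fp] .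
    then consider u \<alpha> where "p = (u, [\<alpha>])" | "2 \<le> length (snd p)"
      by (cases p; cases "snd p"; cases "tl (snd p)") auto
    then have "P (cls (path_term c p))"
    proof cases
      case 1
      then show ?thesis using ar[of \<alpha> c] p sc_mult_cls[OF path_term_closed[OF p, of 1], of c]
        by (simp add: ar_eq is_path_Cons path_term_scaled)
    next
      case 2
      then have "path_term c p \<in> I" by (rule path_term_in_I[OF p])
      then show ?thesis using 0 cls_zero_iff[OF pc] by simp
    qed
    then show "path_term c p \<in> {f \<in> carrier A. P (cls f)}" using pc by simp
  next
    fix g h assume "g \<in> {f \<in> carrier A. P (cls f)}" "h \<in> {f \<in> carrier A. P (cls f)}"
    then have "g \<in> carrier A" "h \<in> carrier A" "P (cls g)" "P (cls h)" by auto
    then show "(\<lambda>p. g p + h p) \<in> {f \<in> carrier A. P (cls f)}"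
      using add[of "cls g" "cls h"] A.a_closed[of g h] by (simp add: cls_simps A_simps(3))
  qed
  then show ?thesis using f by simp
qed

text \<open>Source of the decomposition of a module into its vertex spaces; proved by adding the
  vertices one at a time.\<close>

lemma one_eq_sum: "\<one>\<^bsub>L\<^esub> = (\<Oplus>\<^bsub>L\<^esub>i\<in>verts Q. vx i)"
proof -
  have "cls (\<lambda>(u, as). if u \<in> S \<and> as = [] then 1 else 0) = (\<Oplus>\<^bsub>L\<^esub>i\<in>S. vx i) \<and>
      (\<lambda>(u, as). if u \<in> S \<and> as = [] then 1 else 0) \<in> carrier A"
    if "finite S" "S \<subseteq> verts Q" for S
    using that
  proof (induction S rule: finite_induct)
    case empty
    have e: "(\<lambda>(u :: 'v, as :: 'a list). if u \<in> {} \<and> as = [] then 1 else 0 :: 'k) = (\<lambda>_. 0)" by auto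
    show ?case unfolding e using A.zero_closed by (simp add: cls_null A_simps(2))
  next
    case (insert i S)
    let ?g = "(\<lambda>(u, as). if u \<in> S \<and> as = [] then 1 else 0) :: ('v,'a) path \<Rightarrow> 'k"
    have e: "(\<lambda>(u, as). if u \<in> insert i S \<and> as = [] then 1 else 0) = path_term 1 (i, []) \<oplus>\<^bsub>A\<^esub> ?g"
      using insert.hyps by (auto simp: A_simps(3) path_term_def)
    have ic: "path_term 1 (i, []) \<in> carrier A"
      using insert.prems by (intro path_term_closed is_path_vertex) auto
    have "(\<Oplus>\<^bsub>L\<^esub>i\<in>insert i S. vx i) = vx i \<oplus>\<^bsub>L\<^esub> (\<Oplus>\<^bsub>L\<^esub>i\<in>S. vx i)"
      using insert.prems by (intro L.finsum_insert insert.hyps) auto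
    then show ?case unfolding e using insert ic
      by (simp add: cls_simps(3)[symmetric] vx_eq)
  qed
  from this[OF D.finite_verts order_refl] show ?thesis
    by (simp add: cls_simps(4)[symmetric] A_simps(4))
qed

end

section \<open>Modules and their radicals\<close>

context rad_square_zero
begin

interpretation D: fin_digraph Q by (rule fin_digraph)

lemma smult_zero_left:
  assumes "left_module L M" "x \<in> carrier M"
  shows "\<zero>\<^bsub>L\<^esub> \<odot>\<^bsub>M\<^esub> x = \<zero>\<^bsub>M\<^esub>"
proof -
  interpret M: left_module L M by fact
  have c: "\<zero>\<^bsub>L\<^esub> \<odot>\<^bsub>M\<^esub> x \<in> carrier M" using assms(2) by (intro M.smult_closed) auto
  have "\<zero>\<^bsub>L\<^esub> \<odot>\<^bsub>M\<^esub> x \<oplus>\<^bsub>M\<^esub> \<zero>\<^bsub>L\<^esub> \<odot>\<^bsub>M\<^esub> x = \<zero>\<^bsub>L\<^esub> \<odot>\<^bsub>M\<^esub> x"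
    using M.smult_l_distr[of "\<zero>\<^bsub>L\<^esub>" "\<zero>\<^bsub>L\<^esub>" x] assms(2) by simp
  then show ?thesis using M.M.add.l_cancel_one[OF c c] by blast
qed

lemma smult_zero_right:
  assumes "left_module L M" "X \<in> carrier L"
  shows "X \<odot>\<^bsub>M\<^esub> \<zero>\<^bsub>M\<^esub> = \<zero>\<^bsub>M\<^esub>"
proof -
  interpret M: left_module L M by fact
  have c: "X \<odot>\<^bsub>M\<^esub> \<zero>\<^bsub>M\<^esub> \<in> carrier M" using assms(2) by (intro M.smult_closed) auto
  have "X \<odot>\<^bsub>M\<^esub> \<zero>\<^bsub>M\<^esub> \<oplus>\<^bsub>M\<^esub> X \<odot>\<^bsub>M\<^esub> \<zero>\<^bsub>M\<^esub> = X \<odot>\<^bsub>M\<^esub> \<zero>\<^bsub>M\<^esub>"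
    using M.smult_r_distr[of X "\<zero>\<^bsub>M\<^esub>" "\<zero>\<^bsub>M\<^esub>"] assms(2) by simp
  then show ?thesis using M.M.add.l_cancel_one[OF c c] by blast
qed

lemma a_inv_smult:
  assumes "left_module L M" "x \<in> carrier M"
  shows "\<ominus>\<^bsub>M\<^esub> x = sc (-1) \<odot>\<^bsub>M\<^esub> x"
proof -
  interpret M: left_module L M by fact
  have c: "sc (-1) \<odot>\<^bsub>M\<^esub> x \<in> carrier M" using assms(2) by (intro M.smult_closed) auto
  have "sc (-1) \<odot>\<^bsub>M\<^esub> x \<oplus>\<^bsub>M\<^esub> sc 1 \<odot>\<^bsub>M\<^esub> x = (sc (-1) \<oplus>\<^bsub>L\<^esub> sc 1) \<odot>\<^bsub>M\<^esub> x"
    using M.smult_l_distr assms(2) by simp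
  also have "\<dots> = sc 0 \<odot>\<^bsub>M\<^esub> x" by (simp add: sc_add[symmetric])
  also have "sc 0 = \<zero>\<^bsub>L\<^esub>" by (simp add: sc_eq cls_null)
  finally show ?thesis using c assms(2) M.M.minus_equality
    by (simp add: smult_zero_left[OF assms] sc_one M.smult_one)
qed

lemma submoduleD:
  assumes "Module.submodule N L M"
  shows "N \<subseteq> carrier M" "\<zero>\<^bsub>M\<^esub> \<in> N" "\<And>x y. x \<in> N \<Longrightarrow> y \<in> N \<Longrightarrow> x \<oplus>\<^bsub>M\<^esub> y \<in> N"
    "\<And>X x. X \<in> carrier L \<Longrightarrow> x \<in> N \<Longrightarrow> X \<odot>\<^bsub>M\<^esub> x \<in> N"
proof -
  interpret Module.submodule N L M by fact
  show "N \<subseteq> carrier M" "\<zero>\<^bsub>M\<^esub> \<in> N" "\<And>x y. x \<in> N \<Longrightarrow> y \<in> N \<Longrightarrow> x \<oplus>\<^bsub>M\<^esub> y \<in> N"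
    using subset one_closed m_closed by auto
  show "\<And>X x. X \<in> carrier L \<Longrightarrow> x \<in> N \<Longrightarrow> X \<odot>\<^bsub>M\<^esub> x \<in> N" by (rule smult_closed)
qed

text \<open>\<open>L_induct\<close> extends closure from the generators to all of \<Lambda>, and the
  scalar -1 supplies negatives.\<close>

lemma submoduleI:
  assumes M: "left_module L M" and N: "N \<subseteq> carrier M" "\<zero>\<^bsub>M\<^esub> \<in> N"
    "\<And>x y. x \<in> N \<Longrightarrow> y \<in> N \<Longrightarrow> x \<oplus>\<^bsub>M\<^esub> y \<in> N"
    "\<And>c x. x \<in> N \<Longrightarrow> sc c \<odot>\<^bsub>M\<^esub> x \<in> N"
    "\<And>i x. i \<in> verts Q \<Longrightarrow> x \<in> N \<Longrightarrow> vx i \<odot>\<^bsub>M\<^esub> x \<in> N"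
    "\<And>\<alpha> x. \<alpha> \<in> arcs Q \<Longrightarrow> x \<in> N \<Longrightarrow> ar \<alpha> \<odot>\<^bsub>M\<^esub> x \<in> N"
  shows "Module.submodule N L M"
proof -
  interpret M: left_module L M by fact
  have inM: "x \<in> carrier M" if "x \<in> N" for x using N(1) that by blast
  have sm: "\<forall>x\<in>N. X \<odot>\<^bsub>M\<^esub> x \<in> N" if "X \<in> carrier L" for X
    using that
  proof (induction rule: L_induct)
    case zero
    show ?case using inM N(2) by (simp add: smult_zero_left[OF M])
  next
    case (vx c i)
    then show ?case using inM N(4,5) by (simp add: M.smult_assoc)
  next
    case (ar c \<alpha>)
    then show ?case using inM N(4,6) by (simp add: M.smult_assoc)
  next
    case (add X Y)
    then show ?case using inM N(3) by (simp add: M.smult_l_distr)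
  qed
  have "\<ominus>\<^bsub>M\<^esub> x \<in> N" if "x \<in> N" for x
    using a_inv_smult[OF M inM[OF that]] N(4)[OF that] by simp
  then show ?thesis
    using N(1-3) sm by unfold_locales (auto simp: a_inv_def)
qed

lemma submodule_carrier: "left_module L M \<Longrightarrow> Module.submodule (carrier M) L M"
proof -
  assume M: "left_module L M"
  interpret M: left_module L M by fact
  show ?thesis by (intro submoduleI[OF M]) (auto intro: M.smult_closed)
qed

lemma submodule_left_module:
  assumes M: "left_module L M" and N: "Module.submodule N L M"
  shows "left_module L (submod M N)"
proof -
  interpret M: left_module L M by fact
  note N' = submoduleD[OF N]
  have inM: "x \<in> carrier M" if "x \<in> N" for x using N'(1) that by blast
  have "abelian_group (submod M N)"
  proof (rule abelian_groupI)
    fix x assume x: "x \<in> carrier (submod M N)"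
    have "sc (-1) \<odot>\<^bsub>M\<^esub> x \<in> N" using N'(4) x by simp
    moreover have "sc (-1) \<odot>\<^bsub>M\<^esub> x \<oplus>\<^bsub>M\<^esub> x = \<zero>\<^bsub>M\<^esub>"
      using a_inv_smult[OF M, of x] M.M.l_neg[of x] x inM by simp
    ultimately show "\<exists>y\<in>carrier (submod M N). y \<oplus>\<^bsub>submod M N\<^esub> x = \<zero>\<^bsub>submod M N\<^esub>" by auto
  next
    fix x y z assume "x \<in> carrier (submod M N)" "y \<in> carrier (submod M N)" "z \<in> carrier (submod M N)"
    then have "x \<in> carrier M" "y \<in> carrier M" "z \<in> carrier M" using inM by auto
    then show "(x \<oplus>\<^bsub>submod M N\<^esub> y) \<oplus>\<^bsub>submod M N\<^esub> z = x \<oplus>\<^bsub>submod M N\<^esub> (y \<oplus>\<^bsub>submod M N\<^esub> z)"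
      using M.M.a_assoc by simp
  next
    fix x y assume "x \<in> carrier (submod M N)" "y \<in> carrier (submod M N)"
    then have "x \<in> carrier M" "y \<in> carrier M" using inM by auto
    then show "x \<oplus>\<^bsub>submod M N\<^esub> y = y \<oplus>\<^bsub>submod M N\<^esub> x" using M.M.a_comm by simp
  qed (use N' inM in auto)
  then show ?thesis
    using N' inM
    by (auto simp: left_module_def left_module_axioms_def L.ring_axioms M.smult_l_distr M.smult_r_distr
        M.smult_assoc M.smult_one)
qed

lemma module_homD:
  assumes "h \<in> module_hom L M N"
  shows "\<And>x. x \<in> carrier M \<Longrightarrow> h x \<in> carrier N"
    "\<And>x y. x \<in> carrier M \<Longrightarrow> y \<in> carrier M \<Longrightarrow> h (x \<oplus>\<^bsub>M\<^esub> y) = h x \<oplus>\<^bsub>N\<^esub> h y"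
    "\<And>X x. X \<in> carrier L \<Longrightarrow> x \<in> carrier M \<Longrightarrow> h (X \<odot>\<^bsub>M\<^esub> x) = X \<odot>\<^bsub>N\<^esub> h x"
  using assms by (auto simp: module_hom_def)

lemma additive_zero:
  assumes M: "left_module L M" and N: "left_module L N"
    and h: "\<And>x. x \<in> carrier M \<Longrightarrow> h x \<in> carrier N"
    "\<And>x y. x \<in> carrier M \<Longrightarrow> y \<in> carrier M \<Longrightarrow> h (x \<oplus>\<^bsub>M\<^esub> y) = h x \<oplus>\<^bsub>N\<^esub> h y"
  shows "h \<zero>\<^bsub>M\<^esub> = \<zero>\<^bsub>N\<^esub>"
proof -
  interpret M: left_module L M by fact
  interpret N: left_module L N by fact
  have c: "h \<zero>\<^bsub>M\<^esub> \<in> carrier N" using h(1) by simp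
  have "h \<zero>\<^bsub>M\<^esub> \<oplus>\<^bsub>N\<^esub> h \<zero>\<^bsub>M\<^esub> = h \<zero>\<^bsub>M\<^esub>"
    using h(2)[of "\<zero>\<^bsub>M\<^esub>" "\<zero>\<^bsub>M\<^esub>"] by simp
  then show ?thesis using N.M.add.l_cancel_one[OF c c] by blast
qed

lemma hom_zero:
  assumes "left_module L M" "left_module L N" "h \<in> module_hom L M N"
  shows "h \<zero>\<^bsub>M\<^esub> = \<zero>\<^bsub>N\<^esub>"
  by (rule additive_zero[OF assms(1,2) module_homD(1,2)[OF assms(3)]])

lemma module_homI:
  assumes M: "left_module L M" and N: "left_module L N"
    and h: "\<And>x. x \<in> carrier M \<Longrightarrow> h x \<in> carrier N"
    "\<And>x y. x \<in> carrier M \<Longrightarrow> y \<in> carrier M \<Longrightarrow> h (x \<oplus>\<^bsub>M\<^esub> y) = h x \<oplus>\<^bsub>N\<^esub> h y"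
    "\<And>c x. x \<in> carrier M \<Longrightarrow> h (sc c \<odot>\<^bsub>M\<^esub> x) = sc c \<odot>\<^bsub>N\<^esub> h x"
    "\<And>i x. i \<in> verts Q \<Longrightarrow> x \<in> carrier M \<Longrightarrow> h (vx i \<odot>\<^bsub>M\<^esub> x) = vx i \<odot>\<^bsub>N\<^esub> h x"
    "\<And>\<alpha> x. \<alpha> \<in> arcs Q \<Longrightarrow> x \<in> carrier M \<Longrightarrow> h (ar \<alpha> \<odot>\<^bsub>M\<^esub> x) = ar \<alpha> \<odot>\<^bsub>N\<^esub> h x"
  shows "h \<in> module_hom L M N"
proof -
  interpret M: left_module L M by fact
  interpret N: left_module L N by fact
  have "\<forall>x\<in>carrier M. h (X \<odot>\<^bsub>M\<^esub> x) = X \<odot>\<^bsub>N\<^esub> h x" if "X \<in> carrier L" for X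
    using that
  proof (induction rule: L_induct)
    case zero
    show ?case using additive_zero[OF M N h(1,2)] h(1) by (simp add: smult_zero_left[OF M] smult_zero_left[OF N])
  next
    case (vx c i)
    then show ?case using h by (simp add: M.smult_assoc N.smult_assoc M.smult_closed)
  next
    case (ar c \<alpha>)
    then show ?case using h by (simp add: M.smult_assoc N.smult_assoc M.smult_closed)
  next
    case (add X Y)
    then show ?case using h by (simp add: M.smult_l_distr N.smult_l_distr M.smult_closed)
  qed
  then show ?thesis using h(1,2) by (auto simp: module_hom_def)
qed

lemma hom_image_submodule:
  assumes M: "left_module L M" and N: "left_module L N" and h: "h \<in> module_hom L M N"
    and U: "Module.submodule U L M"
  shows "Module.submodule (h ` U) L N"
proof -
  note U' = submoduleD[OF U] and h' = module_homD[OF h]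
  have inM: "x \<in> carrier M" if "x \<in> U" for x using U'(1) that by blast
  have sm: "X \<odot>\<^bsub>N\<^esub> y \<in> h ` U" if X: "X \<in> carrier L" and y: "y \<in> h ` U" for X y
  proof -
    obtain x where x: "x \<in> U" "y = h x" using y by auto
    then have "X \<odot>\<^bsub>N\<^esub> y = h (X \<odot>\<^bsub>M\<^esub> x)" using h'(3)[OF X] inM by simp
    then show ?thesis using U'(4)[OF X x(1)] by simp
  qed
  show ?thesis
  proof (rule submoduleI[OF N])
    show "\<zero>\<^bsub>N\<^esub> \<in> h ` U" using hom_zero[OF M N h] U'(2) by (metis imageI)
    fix x y assume "x \<in> h ` U" "y \<in> h ` U"
    then obtain a b where "a \<in> U" "b \<in> U" "x = h a" "y = h b" by auto
    then show "x \<oplus>\<^bsub>N\<^esub> y \<in> h ` U" using h'(2) inM U'(3)[of a b] by (metis imageI)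
  qed (use sm h'(1) inM in auto)
qed

lemma hom_kernel_submodule:
  assumes M: "left_module L M" and N: "left_module L N" and h: "h \<in> module_hom L M N"
  shows "Module.submodule {x \<in> carrier M. h x = \<zero>\<^bsub>N\<^esub>} L M"
proof -
  interpret M: left_module L M by fact
  interpret N: left_module L N by fact
  note h' = module_homD[OF h]
  show ?thesis
    by (rule submoduleI[OF M]) (auto simp: h' hom_zero[OF M N h] smult_zero_right[OF N] M.smult_closed)
qed

lemma hom_submod: "h \<in> module_hom L M N \<Longrightarrow> Module.submodule U L M \<Longrightarrow> h \<in> module_hom L (submod M U) N"
  using submoduleD(1)[of U M] by (auto simp: module_hom_def subset_iff)

lemma hom_comp: "h \<in> module_hom L M N \<Longrightarrow> g \<in> module_hom L N P \<Longrightarrow> (\<lambda>x. g (h x)) \<in> module_hom L M P"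
  by (auto simp: module_hom_def Pi_iff)

lemma hom_inverse:
  assumes M: "left_module L M" and h: "h \<in> module_hom L M N" and b: "bij_betw h (carrier M) (carrier N)"
  shows "inv_into (carrier M) h \<in> module_hom L N M"
proof -
  interpret M: left_module L M by fact
  note h' = module_homD[OF h]
  have inj: "inj_on h (carrier M)" and sj: "h ` carrier M = carrier N" using b by (auto simp: bij_betw_def)
  have g: "inv_into (carrier M) h (h x) = x" if "x \<in> carrier M" for x by (rule inv_into_f_f[OF inj that])
  show ?thesis
    unfolding module_hom_def
  proof (safe)
    fix y assume "y \<in> carrier N"
    then show "inv_into (carrier M) h y \<in> carrier M" unfolding sj[symmetric] by (rule inv_into_into)
  next
    fix y z assume "y \<in> carrier N" "z \<in> carrier N"
    then obtain a b where "a \<in> carrier M" "b \<in> carrier M" "y = h a" "z = h b" unfolding sj[symmetric] by auto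
    then show "inv_into (carrier M) h (y \<oplus>\<^bsub>N\<^esub> z) = inv_into (carrier M) h y \<oplus>\<^bsub>M\<^esub> inv_into (carrier M) h z"
      using h'(2)[of a b, symmetric] g by simp
  next
    fix X y assume X: "X \<in> carrier L" and "y \<in> carrier N"
    then obtain a where "a \<in> carrier M" "y = h a" unfolding sj[symmetric] by auto
    then show "inv_into (carrier M) h (X \<odot>\<^bsub>N\<^esub> y) = X \<odot>\<^bsub>M\<^esub> inv_into (carrier M) h y"
      using h'(3)[of X a, symmetric] g X M.smult_closed by simp
  qed
qed

lemma rad_mem: "\<alpha> \<in> arcs Q \<Longrightarrow> x \<in> carrier M \<Longrightarrow> ar \<alpha> \<odot>\<^bsub>M\<^esub> x \<in> rad L M"
  unfolding rad_def using ar_rad by (auto intro!: generate.incl)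

text \<open>Together with \<open>rad_mem\<close> and \<open>rad_submodule\<close> this describes
  \<open>rad\<close> as the least submodule containing all images of arrows, which is handier than
  the generated subgroup of its definition.\<close>

lemma rad_least:
  assumes M: "left_module L M" and N: "Module.submodule N L M"
    and arN: "\<And>\<alpha> x. \<alpha> \<in> arcs Q \<Longrightarrow> x \<in> carrier M \<Longrightarrow> ar \<alpha> \<odot>\<^bsub>M\<^esub> x \<in> N"
  shows "rad L M \<subseteq> N"
proof -
  interpret M: left_module L M by fact
  note N' = submoduleD[OF N]
  have "\<forall>x\<in>carrier M. X \<odot>\<^bsub>M\<^esub> x \<in> N" if "X \<in> jacobson_radical L" for X
    using that
  proof (induction rule: rad_induct)
    case zero
    show ?case using N'(2) by (simp add: smult_zero_left[OF M])
  next
    case (ar c \<alpha>)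
    then show ?case using N'(4) arN by (simp add: M.smult_assoc)
  next
    case (add X Y)
    then show ?case using N'(3) by (simp add: M.smult_l_distr)
  qed
  then have "{a \<odot>\<^bsub>M\<^esub> x |a x. a \<in> jacobson_radical L \<and> x \<in> carrier M} \<subseteq> N" by blast
  then show ?thesis
    unfolding rad_def using M.M.add.generate_subgroup_incl Module.submodule.axioms(1)[OF N] by blast
qed

lemma jacobson_carrier: "X \<in> jacobson_radical L \<Longrightarrow> X \<in> carrier L"
  by (auto simp: jacobson_radical_def)

lemma ideal_jacobson: "ideal (jacobson_radical L) L"
  using ideal_cls_Arr by (simp add: jacobson_eq arrow_ideal_eq)

lemma rad_submodule:
  assumes M: "left_module L M"
  shows "Module.submodule (rad L M) L M"
proof -
  interpret M: left_module L M by fact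
  let ?S = "{a \<odot>\<^bsub>M\<^esub> x |a x. a \<in> jacobson_radical L \<and> x \<in> carrier M}"
  have S: "?S \<subseteq> carrier M" using jacobson_carrier M.smult_closed by blast
  have sub: "subgroup (rad L M) (add_monoid M)"
    unfolding rad_def using M.M.add.generate_is_subgroup S by simp
  have sc: "X \<odot>\<^bsub>M\<^esub> x \<in> rad L M" if X: "X \<in> carrier L" and "x \<in> rad L M" for X x
  proof -
    have "x \<in> {x \<in> carrier M. X \<odot>\<^bsub>M\<^esub> x \<in> rad L M}" if "x \<in> rad L M" for x
      using that[unfolded rad_def]
    proof (induction rule: generate.induct)
      case one
      then show ?case using smult_zero_right[OF M X] subgroup.one_closed[OF sub] by simp
    next
      case (incl h)
      then obtain a y where ay: "h = a \<odot>\<^bsub>M\<^esub> y" "a \<in> jacobson_radical L" "y \<in> carrier M" by auto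
      then have "X \<odot>\<^bsub>M\<^esub> h = (X \<otimes>\<^bsub>L\<^esub> a) \<odot>\<^bsub>M\<^esub> y" using X jacobson_carrier by (simp add: M.smult_assoc)
      moreover have "X \<otimes>\<^bsub>L\<^esub> a \<in> jacobson_radical L" using ideal.I_l_closed[OF ideal_jacobson ay(2) X] .
      ultimately have "X \<odot>\<^bsub>M\<^esub> h \<in> ?S" using ay(3) by auto
      then show ?case using incl S unfolding rad_def by (auto intro: generate.incl)
    next
      \<comment> \<open>The generated subgroup also admits inverses of generators. Such an inverse
        is the multiple by the scalar -1, which the two-sided ideal J absorbs.\<close>
      case (inv h)
      then obtain a y where ay: "h = a \<odot>\<^bsub>M\<^esub> y" "a \<in> jacobson_radical L" "y \<in> carrier M" by auto
      have hc: "h \<in> carrier M" using inv S by auto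
      have i: "inv\<^bsub>add_monoid M\<^esub> h = sc (-1) \<odot>\<^bsub>M\<^esub> h"
        using a_inv_smult[OF M hc] by (simp add: a_inv_def)
      have "X \<odot>\<^bsub>M\<^esub> (sc (-1) \<odot>\<^bsub>M\<^esub> h) = ((X \<otimes>\<^bsub>L\<^esub> sc (-1)) \<otimes>\<^bsub>L\<^esub> a) \<odot>\<^bsub>M\<^esub> y"
        using ay X jacobson_carrier by (simp add: M.smult_assoc M.smult_closed)
      moreover have "(X \<otimes>\<^bsub>L\<^esub> sc (-1)) \<otimes>\<^bsub>L\<^esub> a \<in> jacobson_radical L"
        using X by (intro ideal.I_l_closed[OF ideal_jacobson ay(2)]) auto
      ultimately have "X \<odot>\<^bsub>M\<^esub> (sc (-1) \<odot>\<^bsub>M\<^esub> h) \<in> ?S" using ay(3) by auto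
      then show ?case unfolding i using hc M.smult_closed unfolding rad_def by (auto intro: generate.incl)
    next
      case (eng h1 h2)
      then show ?case using X subgroup.m_closed[OF sub] by (auto simp: M.smult_r_distr)
    qed
    then show ?thesis using that by blast
  qed
  show ?thesis using sub sc by (intro Module.submodule.intro) (auto simp: submodule_axioms_def)
qed

lemma hom_rad:
  assumes M: "left_module L M" and N: "left_module L N" and h: "h \<in> module_hom L M N"
  shows "h ` rad L M \<subseteq> rad L N"
proof -
  interpret M: left_module L M by fact
  note h' = module_homD[OF h] and R = submoduleD[OF rad_submodule[OF N]]
  have "rad L M \<subseteq> {x \<in> carrier M. h x \<in> rad L N}"
  proof (rule rad_least[OF M])
    show "Module.submodule {x \<in> carrier M. h x \<in> rad L N} L M"
      by (rule submoduleI[OF M]) (auto simp: h' hom_zero[OF M N h] R M.smult_closed)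
  qed (auto simp: M.smult_closed h' rad_mem)
  then show ?thesis by auto
qed

lemma hom_rad_surj:
  assumes M: "left_module L M" and N: "left_module L N" and h: "h \<in> module_hom L M N"
    and sj: "h ` carrier M = carrier N"
  shows "h ` rad L M = rad L N"
proof
  show "h ` rad L M \<subseteq> rad L N" by (rule hom_rad[OF M N h])
  show "rad L N \<subseteq> h ` rad L M"
  proof (rule rad_least[OF N hom_image_submodule[OF M N h rad_submodule[OF M]]])
    fix \<alpha> y assume a: "\<alpha> \<in> arcs Q" and "y \<in> carrier N"
    then obtain x where x: "x \<in> carrier M" "y = h x" using sj by auto
    then have "ar \<alpha> \<odot>\<^bsub>N\<^esub> y = h (ar \<alpha> \<odot>\<^bsub>M\<^esub> x)" using module_homD(3)[OF h] a by simp
    then show "ar \<alpha> \<odot>\<^bsub>N\<^esub> y \<in> h ` rad L M" using rad_mem[OF a x(1)] by blast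
  qed
qed

lemma rad_rad:
  assumes M: "left_module L M" and x: "x \<in> rad L M" and a: "\<alpha> \<in> arcs Q"
  shows "ar \<alpha> \<odot>\<^bsub>M\<^esub> x = \<zero>\<^bsub>M\<^esub>"
proof -
  interpret M: left_module L M by fact
  have ac: "ar \<alpha> \<in> carrier L" using a by simp
  have "rad L M \<subseteq> {x \<in> carrier M. \<forall>\<beta>\<in>arcs Q. ar \<beta> \<odot>\<^bsub>M\<^esub> x = \<zero>\<^bsub>M\<^esub>}"
  proof (rule rad_least[OF M])
    show "Module.submodule {x \<in> carrier M. \<forall>\<beta>\<in>arcs Q. ar \<beta> \<odot>\<^bsub>M\<^esub> x = \<zero>\<^bsub>M\<^esub>} L M"
    proof (rule submoduleI[OF M])
      fix c x assume "x \<in> {x \<in> carrier M. \<forall>\<beta>\<in>arcs Q. ar \<beta> \<odot>\<^bsub>M\<^esub> x = \<zero>\<^bsub>M\<^esub>}"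
      then show "sc c \<odot>\<^bsub>M\<^esub> x \<in> {x \<in> carrier M. \<forall>\<beta>\<in>arcs Q. ar \<beta> \<odot>\<^bsub>M\<^esub> x = \<zero>\<^bsub>M\<^esub>}"
        by (auto simp: M.smult_closed M.smult_assoc[symmetric] sc_comm)
          (auto simp: M.smult_assoc smult_zero_right[OF M])
    next
      fix i x assume i: "i \<in> verts Q" and x: "x \<in> {x \<in> carrier M. \<forall>\<beta>\<in>arcs Q. ar \<beta> \<odot>\<^bsub>M\<^esub> x = \<zero>\<^bsub>M\<^esub>}"
      then show "vx i \<odot>\<^bsub>M\<^esub> x \<in> {x \<in> carrier M. \<forall>\<beta>\<in>arcs Q. ar \<beta> \<odot>\<^bsub>M\<^esub> x = \<zero>\<^bsub>M\<^esub>}"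
        by (auto simp: M.smult_closed M.smult_assoc[symmetric] ar_vx smult_zero_left[OF M])
    next
      fix \<gamma> x assume i: "\<gamma> \<in> arcs Q" and x: "x \<in> {x \<in> carrier M. \<forall>\<beta>\<in>arcs Q. ar \<beta> \<odot>\<^bsub>M\<^esub> x = \<zero>\<^bsub>M\<^esub>}"
      then show "ar \<gamma> \<odot>\<^bsub>M\<^esub> x \<in> {x \<in> carrier M. \<forall>\<beta>\<in>arcs Q. ar \<beta> \<odot>\<^bsub>M\<^esub> x = \<zero>\<^bsub>M\<^esub>}"
        by (auto simp: smult_zero_right[OF M])
    qed (auto simp: smult_zero_right[OF M] M.smult_r_distr)
  qed (auto simp: M.smult_closed M.smult_assoc[symmetric] ar_ar smult_zero_left[OF M])
  then show ?thesis using x a by auto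
qed

end

section \<open>Vertex spaces and dimension vectors\<close>

context rad_square_zero
begin

interpretation D: fin_digraph Q by (rule fin_digraph)

abbreviation dv :: "('v,'a,'k,'m) quiver_module \<Rightarrow> 'v \<Rightarrow> nat" where
  "dv M i \<equiv> dimension_vector Q I M i"

text \<open>The vertex space of a submodule N, kept as a subset of M so that the vertex spaces of
  all submodules live in one vector space and their dimensions can be compared.\<close>

definition gr :: "('v,'a,'k,'m) quiver_module \<Rightarrow> 'm set \<Rightarrow> 'v \<Rightarrow> 'm set" where
  "gr M N i = (\<lambda>x. vx i \<odot>\<^bsub>M\<^esub> x) ` N"

lemma K_space_simps [simp]:
  "carrier (K_space Q I M) = carrier M" "zero (K_space Q I M) = zero M" "add (K_space Q I M) = add M"
  "smult (K_space Q I M) c x = sc c \<odot>\<^bsub>M\<^esub> x"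
  by (simp_all add: K_space_def sc_def)

lemma dv_submod:
  "dv (submod M N) i = vectorspace.dim class_ring ((K_space Q I M)\<lparr>carrier := gr M N i\<rparr>)"
  by (simp add: dimension_vector_def K_space_def gr_def vx_def)

lemma dv_carrier: "dv M i = vectorspace.dim class_ring ((K_space Q I M)\<lparr>carrier := gr M (carrier M) i\<rparr>)"
  by (simp add: dimension_vector_def gr_def vx_def)

lemma K_space_vectorspace:
  assumes M: "left_module L M"
  shows "vectorspace class_ring (K_space Q I M)"
proof -
  interpret M: left_module L M by fact
  show ?thesis
  proof (rule vs_criteria[OF class_field])
    show "\<forall>v\<in>carrier (K_space Q I M). \<exists>neg_v\<in>carrier (K_space Q I M). v \<oplus>\<^bsub>K_space Q I M\<^esub> neg_v = \<zero>\<^bsub>K_space Q I M\<^esub>"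
      using M.M.r_neg M.M.a_inv_closed by (simp only: K_space_simps) blast
  qed (auto simp: M.smult_closed M.M.a_ac M.smult_assoc sc_mult sc_one M.smult_one sc_add
      M.smult_l_distr M.smult_r_distr)
qed

lemma submodule_subspace:
  assumes M: "left_module L M" and N: "Module.submodule N L M"
  shows "VectorSpace.subspace class_ring N (K_space Q I M)"
  using submoduleD[OF N]
  by (intro vectorspace.subspaceI[OF K_space_vectorspace[OF M]]) auto

lemma gr_eq:
  assumes M: "left_module L M" and N: "Module.submodule N L M" and i: "i \<in> verts Q"
  shows "gr M N i = {x \<in> N. vx i \<odot>\<^bsub>M\<^esub> x = x}"
proof -
  interpret M: left_module L M by fact
  note N' = submoduleD[OF N]
  have "vx i \<odot>\<^bsub>M\<^esub> (vx i \<odot>\<^bsub>M\<^esub> x) = vx i \<odot>\<^bsub>M\<^esub> x" if "x \<in> N" for x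
    using M.smult_assoc[of "vx i" "vx i" x] vx_vx[OF i i] i that N'(1) by auto
  then have "gr M N i \<subseteq> {x \<in> N. vx i \<odot>\<^bsub>M\<^esub> x = x}"
    using N'(4)[OF gens_closed(1)[OF i]] by (auto simp: gr_def)
  moreover have "{x \<in> N. vx i \<odot>\<^bsub>M\<^esub> x = x} \<subseteq> gr M N i"
    unfolding gr_def by (auto intro: rev_image_eqI)
  ultimately show ?thesis by (rule equalityI)
qed

lemma gr_subspace:
  assumes M: "left_module L M" and N: "Module.submodule N L M" and i: "i \<in> verts Q"
  shows "VectorSpace.subspace class_ring (gr M N i) (K_space Q I M)"
proof -
  interpret M: left_module L M by fact
  note N' = submoduleD[OF N]
  have inM: "x \<in> carrier M" if "x \<in> N" for x using N'(1) that by blast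
  have vs: "vectorspace class_ring (K_space Q I M)" by (rule K_space_vectorspace[OF M])
  show ?thesis
    unfolding gr_eq[OF M N i]
  proof (rule vectorspace.subspaceI[OF vs])
    fix c x assume x: "x \<in> {x \<in> N. vx i \<odot>\<^bsub>M\<^esub> x = x}"
    have "vx i \<odot>\<^bsub>M\<^esub> (sc c \<odot>\<^bsub>M\<^esub> x) = (vx i \<otimes>\<^bsub>L\<^esub> sc c) \<odot>\<^bsub>M\<^esub> x"
      using x inM i by (simp add: M.smult_assoc)
    also have "\<dots> = sc c \<odot>\<^bsub>M\<^esub> x" using x inM i by (simp add: sc_comm M.smult_assoc)
    finally show "c \<odot>\<^bsub>K_space Q I M\<^esub> x \<in> {x \<in> N. vx i \<odot>\<^bsub>M\<^esub> x = x}" using x N' by simp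
  qed (use N' inM i smult_zero_right[OF M, of "vx i"] in \<open>auto simp: M.smult_r_distr\<close>)
qed

lemma fd_moduleD:
  assumes "fd_module Q I M"
  shows "left_module L M" "vectorspace.fin_dim class_ring (K_space Q I M)"
  using assms by (auto simp: fd_module_def)

lemma submod_K_space: "K_space Q I (submod M N) = (K_space Q I M)\<lparr>carrier := N\<rparr>"
  by (simp add: K_space_def)

lemma fd_submod:
  assumes M: "fd_module Q I M" and N: "Module.submodule N L M"
  shows "fd_module Q I (submod M N)"
  using submodule_left_module[OF fd_moduleD(1)[OF M] N]
    vectorspace.fin_dim_subspace[OF K_space_vectorspace[OF fd_moduleD(1)[OF M]] fd_moduleD(2)[OF M]
      submodule_subspace[OF fd_moduleD(1)[OF M] N]]
  by (simp add: fd_module_def submod_K_space)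

lemma fd_gr:
  assumes M: "fd_module Q I M" and N: "Module.submodule N L M" and i: "i \<in> verts Q"
  shows "vectorspace class_ring ((K_space Q I M)\<lparr>carrier := gr M N i\<rparr>)"
    "vectorspace.fin_dim class_ring ((K_space Q I M)\<lparr>carrier := gr M N i\<rparr>)"
proof -
  note vs = K_space_vectorspace[OF fd_moduleD(1)[OF M]]
  note sb = gr_subspace[OF fd_moduleD(1)[OF M] N i]
  show "vectorspace class_ring ((K_space Q I M)\<lparr>carrier := gr M N i\<rparr>)"
    by (rule vectorspace.subspaceD(5)[OF vs sb])
  show "vectorspace.fin_dim class_ring ((K_space Q I M)\<lparr>carrier := gr M N i\<rparr>)"
    by (rule vectorspace.fin_dim_subspace[OF vs fd_moduleD(2)[OF M] sb])
qed

lemma hom_K_space: "h \<in> module_hom L M N \<Longrightarrow> h \<in> module_hom class_ring (K_space Q I M) (K_space Q I N)"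
  by (auto simp: module_hom_def)

lemma hom_gr:
  assumes M: "left_module L M" and h: "h \<in> module_hom L M N" and i: "i \<in> verts Q"
  shows "h \<in> module_hom class_ring ((K_space Q I M)\<lparr>carrier := gr M (carrier M) i\<rparr>) (K_space Q I N)"
proof -
  interpret M: left_module L M by fact
  have "gr M (carrier M) i \<subseteq> carrier M" using i by (auto simp: gr_def M.smult_closed)
  then show ?thesis using module_homD[OF h] by (auto simp: module_hom_def subset_iff)
qed

lemma fd_image:
  assumes M: "fd_module Q I M" and N: "left_module L N" and h: "h \<in> module_hom L M N"
    and s: "h ` carrier M = carrier N"
  shows "fd_module Q I N"
proof -
  interpret linear_map class_ring "K_space Q I M" "K_space Q I N" h
    using K_space_vectorspace[OF fd_moduleD(1)[OF M]] K_space_vectorspace[OF N] hom_K_space[OF h]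
    by (rule linear_mapI)
  have "vectorspace.fin_dim class_ring (K_space Q I N)"
    using rank_nullity_main(2)[OF fd_moduleD(2)[OF M]] s by simp
  then show ?thesis using N by (simp add: fd_module_def)
qed

text \<open>Multiplication by a vertex idempotent commutes with taking images and kernels of
  homomorphisms, so the linear rank-nullity theorem applies at each vertex.\<close>

lemma dv_rank_nullity:
  assumes M: "fd_module Q I M" and N: "left_module L N" and h: "h \<in> module_hom L M N" and i: "i \<in> verts Q"
  shows "dv (submod N (h ` carrier M)) i + dv (submod M {x \<in> carrier M. h x = \<zero>\<^bsub>N\<^esub>}) i = dv M i"
proof -
  note M' = fd_moduleD(1)[OF M]
  interpret M: left_module L M by (rule M')
  note h' = module_homD[OF h] and sM = submodule_carrier[OF M']
  let ?V = "(K_space Q I M)\<lparr>carrier := gr M (carrier M) i\<rparr>"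
  have "h ` gr M (carrier M) i = gr N (h ` carrier M) i"
    using h'(3)[OF gens_closed(1)[OF i]] unfolding gr_def image_image by (intro image_cong) auto
  moreover have "{x \<in> gr M (carrier M) i. h x = \<zero>\<^bsub>N\<^esub>} = gr M {x \<in> carrier M. h x = \<zero>\<^bsub>N\<^esub>} i"
    unfolding gr_eq[OF M' sM i] gr_eq[OF M' hom_kernel_submodule[OF M' N h] i] by auto
  moreover have "vectorspace.dim class_ring ((K_space Q I N)\<lparr>carrier := h ` carrier ?V\<rparr>) +
      vectorspace.dim class_ring (?V\<lparr>carrier := {v \<in> carrier ?V. h v = \<zero>\<^bsub>K_space Q I N\<^esub>}\<rparr>) =
      vectorspace.dim class_ring ?V"
    by (rule rank_nullity_hom[OF fd_gr(1)[OF M sM i] K_space_vectorspace[OF N] hom_gr[OF M' h i] fd_gr(2)[OF M sM i]])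
  ultimately show ?thesis by (simp add: dv_submod dv_carrier[of M])
qed

lemma dv_mono:
  assumes M: "fd_module Q I M" and U: "Module.submodule U L M" and W: "Module.submodule W L M"
    and UW: "U \<subseteq> W" and i: "i \<in> verts Q"
  shows "dv (submod M U) i \<le> dv (submod M W) i"
  unfolding dv_submod
  using fd_moduleD[OF M] UW
  by (intro vectorspace.dim_subspace_mono[OF K_space_vectorspace] gr_subspace U W i) (auto simp: gr_def)

lemma dv_zero: "left_module L M \<Longrightarrow> i \<in> verts Q \<Longrightarrow> dv (submod M {\<zero>\<^bsub>M\<^esub>}) i = 0"
proof -
  assume M: "left_module L M" and i: "i \<in> verts Q"
  interpret V: vectorspace class_ring "K_space Q I M" by (rule K_space_vectorspace[OF M])
  have "gr M {\<zero>\<^bsub>M\<^esub>} i = V.span {}" using V.span_empty smult_zero_right[OF M, of "vx i"] i by (auto simp: gr_def)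
  then show ?thesis using V.dim_span_indpt[of "{}"] by (simp add: dv_submod V.lin_dep_def)
qed

lemma inj_on_kernel:
  fixes M :: "('v,'a,'k,'m) quiver_module" and N :: "('v,'a,'k,'n) quiver_module"
  assumes M: "left_module L M" and N: "left_module L N" and h: "h \<in> module_hom L M N"
  shows "inj_on h (carrier M) \<longleftrightarrow> {x \<in> carrier M. h x = \<zero>\<^bsub>N\<^esub>} = {\<zero>\<^bsub>M\<^esub>}"
proof -
  interpret M: left_module L M by fact
  interpret N: left_module L N by fact
  interpret linear_map class_ring "K_space Q I M" "K_space Q I N" h
    using K_space_vectorspace[OF M] K_space_vectorspace[OF N] hom_K_space[OF h] by (rule linear_mapI)
  show ?thesis using Ke0_iff_inj by (simp add: ker_def)
qed

lemma dv_inj_image: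
  assumes M: "fd_module Q I M" and N: "left_module L N" and h: "h \<in> module_hom L M N" and i: "i \<in> verts Q"
    and inj: "inj_on h (carrier M)"
  shows "dv (submod N (h ` carrier M)) i = dv M i"
  using dv_rank_nullity[OF M N h i] inj inj_on_kernel[OF fd_moduleD(1)[OF M] N h]
    dv_zero[OF fd_moduleD(1)[OF M] i] by simp

lemma dv_embeds:
  assumes M: "fd_module Q I M" and N: "fd_module Q I N" and e: "module_embeds L M N" and i: "i \<in> verts Q"
  shows "dv M i \<le> dv N i"
proof -
  note M' = fd_moduleD(1)[OF M] and N' = fd_moduleD(1)[OF N]
  obtain h where h: "h \<in> module_hom L M N" "inj_on h (carrier M)" using e by (auto simp: module_embeds_def)
  have "dv (submod N (h ` carrier M)) i \<le> dv (submod N (carrier N)) i"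
    using hom_image_submodule[OF M' N' h(1) submodule_carrier[OF M']] submodule_carrier[OF N'] module_homD(1)[OF h(1)]
    by (intro dv_mono[OF N] i) auto
  then show ?thesis using dv_inj_image[OF M N' h(1) i h(2)] by simp
qed

lemma smult_finsum:
  assumes M: "left_module L M" and m: "m \<in> carrier M" and S: "finite S" "f \<in> S \<rightarrow> carrier L"
  shows "(\<Oplus>\<^bsub>L\<^esub>i\<in>S. f i) \<odot>\<^bsub>M\<^esub> m = (\<Oplus>\<^bsub>M\<^esub>i\<in>S. f i \<odot>\<^bsub>M\<^esub> m)"
proof -
  interpret M: left_module L M by fact
  show ?thesis using S
  proof (induction S rule: finite_induct)
    case (insert i S)
    have "(\<Oplus>\<^bsub>L\<^esub>i\<in>insert i S. f i) = f i \<oplus>\<^bsub>L\<^esub> (\<Oplus>\<^bsub>L\<^esub>i\<in>S. f i)"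
      using insert by (intro L.finsum_insert) auto
    moreover have "(\<Oplus>\<^bsub>M\<^esub>i\<in>insert i S. f i \<odot>\<^bsub>M\<^esub> m) = f i \<odot>\<^bsub>M\<^esub> m \<oplus>\<^bsub>M\<^esub> (\<Oplus>\<^bsub>M\<^esub>i\<in>S. f i \<odot>\<^bsub>M\<^esub> m)"
      using insert m by (intro M.M.finsum_insert) (auto intro!: M.smult_closed)
    moreover have "(\<Oplus>\<^bsub>L\<^esub>i\<in>S. f i) \<in> carrier L" using insert by (intro L.finsum_closed) auto
    ultimately show ?case using insert m by (simp add: M.smult_l_distr)
  qed (simp add: smult_zero_left[OF M m])
qed

lemma vertex_decomposition:
  assumes M: "left_module L M" and m: "m \<in> carrier M"
  shows "m = (\<Oplus>\<^bsub>M\<^esub>i\<in>verts Q. vx i \<odot>\<^bsub>M\<^esub> m)"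
proof -
  interpret M: left_module L M by fact
  have "\<one>\<^bsub>L\<^esub> \<odot>\<^bsub>M\<^esub> m = (\<Oplus>\<^bsub>M\<^esub>i\<in>verts Q. vx i \<odot>\<^bsub>M\<^esub> m)"
    unfolding one_eq_sum by (rule smult_finsum[OF M m]) auto
  then show ?thesis using M.smult_one[OF m] by simp
qed

lemma finsum_submodule:
  assumes M: "left_module L M" and N: "Module.submodule N L M" and S: "finite S" "\<And>i. i \<in> S \<Longrightarrow> f i \<in> N"
  shows "(\<Oplus>\<^bsub>M\<^esub>i\<in>S. f i) \<in> N"
proof -
  interpret M: left_module L M by fact
  note N' = submoduleD[OF N]
  show ?thesis using S
  proof (induction S rule: finite_induct)
    case (insert i S)
    have "(\<Oplus>\<^bsub>M\<^esub>i\<in>insert i S. f i) = f i \<oplus>\<^bsub>M\<^esub> (\<Oplus>\<^bsub>M\<^esub>i\<in>S. f i)"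
      using insert N'(1) by (intro M.M.finsum_insert) auto
    then show ?case using insert N'(3) by simp
  qed (simp add: N'(2))
qed

lemma mem_submodule_vertex:
  assumes M: "left_module L M" and N: "Module.submodule N L M" and m: "m \<in> carrier M"
    and "\<And>i. i \<in> verts Q \<Longrightarrow> vx i \<odot>\<^bsub>M\<^esub> m \<in> N"
  shows "m \<in> N"
  using finsum_submodule[OF M N D.finite_verts, of "\<lambda>i. vx i \<odot>\<^bsub>M\<^esub> m"] assms(4)
    vertex_decomposition[OF M m] by simp

lemma submodule_eq_dv:
  assumes M: "fd_module Q I M" and N: "Module.submodule N L M"
    and d: "\<And>i. i \<in> verts Q \<Longrightarrow> dv (submod M N) i = dv M i"
  shows "N = carrier M"
proof -
  note M' = fd_moduleD(1)[OF M]
  interpret M: left_module L M by (rule M')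
  note N' = submoduleD[OF N]
  have "m \<in> N" if m: "m \<in> carrier M" for m
  proof (rule mem_submodule_vertex[OF M' N m])
    fix i assume i: "i \<in> verts Q"
    note sM = submodule_carrier[OF M']
    let ?V = "(K_space Q I M)\<lparr>carrier := gr M (carrier M) i\<rparr>"
    have "VectorSpace.subspace class_ring (gr M N i) ?V"
      using N'(1) by (intro vectorspace.nested_subspaces[OF K_space_vectorspace[OF M'], of "gr M (carrier M) i", simplified]
          gr_subspace[OF M'] sM N i) (auto simp: gr_def)
    then have "gr M N i = carrier ?V"
      using d[OF i, unfolded dv_submod dv_carrier[of M]]
      by (intro vectorspace.subspace_dim_eq[OF fd_gr[OF M sM i]]) simp_all
    then have "vx i \<odot>\<^bsub>M\<^esub> m \<in> gr M N i" using m by (auto simp: gr_def)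
    then show "vx i \<odot>\<^bsub>M\<^esub> m \<in> N" using N'(4) i by (auto simp: gr_def)
  qed
  then show ?thesis using N'(1) by auto
qed

end

section \<open>The module of a representation\<close>

lemma mat_eq_of_mult_vec:
  fixes X Y :: "'k::comm_ring_1 mat"
  assumes "X \<in> carrier_mat n m" "Y \<in> carrier_mat n m" "\<And>v. v \<in> carrier_vec m \<Longrightarrow> X *\<^sub>v v = Y *\<^sub>v v"
  shows "X = Y"
proof (rule eq_matI)
  fix i j assume ij: "i < dim_row Y" "j < dim_col Y"
  have "Z $$ (i, j) = (Z *\<^sub>v unit_vec m j) $ i" if "Z \<in> carrier_mat n m" for Z :: "'k mat"
    using ij assms(2) that by simp
  then show "X $$ (i, j) = Y $$ (i, j)" using assms by simp
qed (use assms in auto)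

context rad_square_zero
begin

interpretation D: fin_digraph Q by (rule fin_digraph)

lemma rep_ambientD: "x \<in> rep_ambient Q d \<Longrightarrow> \<alpha> \<in> arcs Q \<Longrightarrow> x \<alpha> \<in> carrier_mat (d (head Q \<alpha>)) (d (tail Q \<alpha>))"
  by (auto simp: rep_ambient_def)

lemma rep_spaceD: "m \<in> rep_space Q d \<Longrightarrow> i \<in> verts Q \<Longrightarrow> m i \<in> carrier_vec (d i)"
  by (auto simp: rep_space_def)

lemma rep_spaceI: "(\<And>i. i \<in> verts Q \<Longrightarrow> f i \<in> carrier_vec (d i)) \<Longrightarrow> (\<lambda>i\<in>verts Q. f i) \<in> rep_space Q d"
  by (auto simp: rep_space_def)

lemma rep_space_eqI:
  assumes "m \<in> rep_space Q d" "n \<in> rep_space Q d" "\<And>i. i \<in> verts Q \<Longrightarrow> m i = n i"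
  shows "m = n"
  using assms unfolding rep_space_def by (rule PiE_ext)

lemma rep_variety_ambient: "x \<in> rep_variety Q I d \<Longrightarrow> x \<in> rep_ambient Q d"
  by (simp add: rep_variety_def)

lemma path_map_carrier:
  assumes x: "x \<in> rep_ambient Q d"
  shows "D.awalk u as v \<Longrightarrow> path_map Q d x u as \<in> carrier_mat (d v) (d u)"
  by (induction as arbitrary: u)
    (auto simp: D.awalk_Nil_iff D.awalk_Cons_iff intro!: mult_carrier_mat rep_ambientD[OF x])

lemma path_map_append:
  assumes x: "x \<in> rep_ambient Q d" and w: "D.awalk w bs v"
  shows "D.awalk u as w \<Longrightarrow> path_map Q d x u (as @ bs) = path_map Q d x w bs * path_map Q d x u as"
proof (induction as arbitrary: u)
  case Nil
  then show ?case using path_map_carrier[OF x w] by (auto simp: D.awalk_Nil_iff)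
next
  case (Cons \<alpha> as)
  then have a: "\<alpha> \<in> arcs Q" "u = tail Q \<alpha>" "D.awalk (head Q \<alpha>) as w" by (auto simp: D.awalk_Cons_iff)
  show ?case
    using Cons.IH[OF a(3)] path_map_carrier[OF x w] path_map_carrier[OF x a(3)] rep_ambientD[OF x a(1)]
    by (simp add: assoc_mult_mat)
qed

text \<open>The sum over the support is enlarged to any finite superset, with zero terms for paths
  that end elsewhere. Only then can the actions of different f be added term by term.\<close>

lemma rep_act_index:
  assumes S: "finite S" "{p. f p \<noteq> 0} \<subseteq> S" and j: "j \<in> verts Q" "r < d j"
  shows "rep_act Q d x f m j $ r =
    (\<Sum>p\<in>S. if D.awalk (fst p) (snd p) j then f p * ((path_map Q d x (fst p) (snd p) *\<^sub>v m (fst p)) $ r) else 0)"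
proof -
  have "rep_act Q d x f m j $ r = (\<Sum>p | f p \<noteq> 0 \<and> D.awalk (fst p) (snd p) j.
      f p * ((path_map Q d x (fst p) (snd p) *\<^sub>v m (fst p)) $ r))"
    using j by (simp add: rep_act_def)
  also have "\<dots> = (\<Sum>p\<in>S. if D.awalk (fst p) (snd p) j then f p * ((path_map Q d x (fst p) (snd p) *\<^sub>v m (fst p)) $ r) else 0)"
    using S by (intro sum.mono_neutral_cong_left) auto
  finally show ?thesis .
qed

lemma rep_act_closed: "rep_act Q d x f m \<in> rep_space Q d"
  unfolding rep_act_def by (rule rep_spaceI) simp

lemma finite_support: "f \<in> carrier A \<Longrightarrow> finite {p. f p \<noteq> 0}"
  by (simp add: A_simps)

lemma rep_act_add:
  assumes f: "f \<in> carrier A" and g: "g \<in> carrier A"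
  shows "rep_act Q d x (\<lambda>p. f p + g p) m = (\<lambda>j\<in>verts Q. rep_act Q d x f m j + rep_act Q d x g m j)"
proof (rule rep_space_eqI[OF rep_act_closed rep_spaceI])
  show "rep_act Q d x f m i + rep_act Q d x g m i \<in> carrier_vec (d i)" if "i \<in> verts Q" for i
    using rep_spaceD[OF rep_act_closed that] by (intro add_carrier_vec)
  fix i assume i: "i \<in> verts Q"
  note c = rep_spaceD[OF rep_act_closed i, of d x]
  let ?S = "{p. f p \<noteq> 0} \<union> {p. g p \<noteq> 0}"
  have S: "finite ?S" using finite_support f g by simp
  show "rep_act Q d x (\<lambda>p. f p + g p) m i = (\<lambda>j\<in>verts Q. rep_act Q d x f m j + rep_act Q d x g m j) i"
  proof (rule eq_vecI)
    fix r assume "r < dim_vec ((\<lambda>j\<in>verts Q. rep_act Q d x f m j + rep_act Q d x g m j) i)"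
    then have r: "r < d i" using c[of g m] i by simp
    have "rep_act Q d x (\<lambda>p. f p + g p) m i $ r = (\<Sum>p\<in>?S. if D.awalk (fst p) (snd p) i
        then (f p + g p) * ((path_map Q d x (fst p) (snd p) *\<^sub>v m (fst p)) $ r) else 0)"
      by (rule rep_act_index[where d = d and r = r, OF S _ i r]) auto
    also have "\<dots> = rep_act Q d x f m i $ r + rep_act Q d x g m i $ r"
      unfolding rep_act_index[where S = ?S and f = f and d = d and r = r and j = i, OF S Un_upper1 i r]
        rep_act_index[where S = ?S and f = g and d = d and r = r and j = i, OF S Un_upper2 i r] sum.distrib[symmetric]
      by (rule sum.cong[OF refl]) (simp add: distrib_right)
    finally have "rep_act Q d x (\<lambda>p. f p + g p) m i $ r = rep_act Q d x f m i $ r + rep_act Q d x g m i $ r" .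
    then show "rep_act Q d x (\<lambda>p. f p + g p) m i $ r = (\<lambda>j\<in>verts Q. rep_act Q d x f m j + rep_act Q d x g m j) i $ r"
      using i r c[of f m] c[of g m] by simp
  qed (use i c[of f m] c[of g m] c[of "\<lambda>p. f p + g p" m] in simp)
qed

lemma rep_act_scale:
  assumes f: "f \<in> carrier A"
  shows "rep_act Q d x (\<lambda>p. c * f p) m = (\<lambda>j\<in>verts Q. c \<cdot>\<^sub>v rep_act Q d x f m j)"
proof (rule rep_space_eqI[OF rep_act_closed rep_spaceI])
  show "c \<cdot>\<^sub>v rep_act Q d x f m i \<in> carrier_vec (d i)" if "i \<in> verts Q" for i
    using rep_spaceD[OF rep_act_closed that] by (intro smult_carrier_vec[THEN iffD2])
  fix i assume i: "i \<in> verts Q"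
  note cc = rep_spaceD[OF rep_act_closed i, of d x]
  let ?S = "{p. f p \<noteq> 0}"
  have S: "finite ?S" using finite_support f by simp
  show "rep_act Q d x (\<lambda>p. c * f p) m i = (\<lambda>j\<in>verts Q. c \<cdot>\<^sub>v rep_act Q d x f m j) i"
  proof (rule eq_vecI)
    fix r assume "r < dim_vec ((\<lambda>j\<in>verts Q. c \<cdot>\<^sub>v rep_act Q d x f m j) i)"
    then have r: "r < d i" using cc[of f m] i by simp
    have "rep_act Q d x (\<lambda>p. c * f p) m i $ r = (\<Sum>p\<in>?S. if D.awalk (fst p) (snd p) i
        then (c * f p) * ((path_map Q d x (fst p) (snd p) *\<^sub>v m (fst p)) $ r) else 0)"
      by (rule rep_act_index[where d = d and r = r, OF S _ i r]) auto
    also have "\<dots> = c * rep_act Q d x f m i $ r"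
      unfolding rep_act_index[where S = ?S and f = f and d = d and r = r and j = i, OF S order_refl i r] sum_distrib_left
      by (rule sum.cong[OF refl]) simp
    finally have "rep_act Q d x (\<lambda>p. c * f p) m i $ r = c * rep_act Q d x f m i $ r" .
    then show "rep_act Q d x (\<lambda>p. c * f p) m i $ r = (\<lambda>j\<in>verts Q. c \<cdot>\<^sub>v rep_act Q d x f m j) i $ r"
      using i r cc[of f m] by simp
  qed (use i cc[of f m] cc[of "\<lambda>p. c * f p" m] in simp)
qed

lemma rep_act_path_term:
  assumes j: "j \<in> verts Q" and x: "x \<in> rep_ambient Q d" and m: "m \<in> rep_space Q d"
  shows "rep_act Q d x (path_term c (w, bs)) m j =
    (if D.awalk w bs j then c \<cdot>\<^sub>v (path_map Q d x w bs *\<^sub>v m w) else 0\<^sub>v (d j))"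
proof (rule eq_vecI)
  have dm: "dim_vec (path_map Q d x w bs *\<^sub>v m w) = d j" if "D.awalk w bs j"
    using path_map_carrier[OF x that] by simp
  then show "dim_vec (rep_act Q d x (path_term c (w, bs)) m j) =
      dim_vec (if D.awalk w bs j then c \<cdot>\<^sub>v (path_map Q d x w bs *\<^sub>v m w) else 0\<^sub>v (d j))"
    using rep_spaceD[OF rep_act_closed j, of d x "path_term c (w, bs)" m] by simp
  fix r assume "r < dim_vec (if D.awalk w bs j then c \<cdot>\<^sub>v (path_map Q d x w bs *\<^sub>v m w) else 0\<^sub>v (d j))"
  then have r: "r < d j" using dm by (auto split: if_splits)
  have "{p. path_term c (w, bs) p \<noteq> 0} \<subseteq> {(w, bs)}" by (auto simp: path_term_def split: if_splits)
  from rep_act_index[where d = d and r = r, OF _ this j r, of x m]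
  show "rep_act Q d x (path_term c (w, bs)) m j $ r =
      (if D.awalk w bs j then c \<cdot>\<^sub>v (path_map Q d x w bs *\<^sub>v m w) else 0\<^sub>v (d j)) $ r"
    using r dm by (auto simp: path_term_def)
qed

lemma rep_act_zero: "rep_act Q d x (\<lambda>_. 0) m = (\<lambda>j\<in>verts Q. 0\<^sub>v (d j))"
  unfolding rep_act_def by (auto intro!: restrict_ext eq_vecI)

lemma rep_act_add_right:
  assumes f: "f \<in> carrier A" and x: "x \<in> rep_ambient Q d" and m: "m \<in> rep_space Q d" and n: "n \<in> rep_space Q d"
  shows "rep_act Q d x f (\<lambda>j\<in>verts Q. m j + n j) = (\<lambda>j\<in>verts Q. rep_act Q d x f m j + rep_act Q d x f n j)"
proof (rule rep_space_eqI[OF rep_act_closed rep_spaceI])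
  show "rep_act Q d x f m i + rep_act Q d x f n i \<in> carrier_vec (d i)" if "i \<in> verts Q" for i
    using rep_spaceD[OF rep_act_closed that] by (intro add_carrier_vec)
  fix i assume i: "i \<in> verts Q"
  note c = rep_spaceD[OF rep_act_closed i, of d x]
  let ?S = "{p. f p \<noteq> 0}"
  have S: "finite ?S" using finite_support f by simp
  show "rep_act Q d x f (\<lambda>j\<in>verts Q. m j + n j) i = (\<lambda>j\<in>verts Q. rep_act Q d x f m j + rep_act Q d x f n j) i"
  proof (rule eq_vecI)
    fix r assume "r < dim_vec ((\<lambda>j\<in>verts Q. rep_act Q d x f m j + rep_act Q d x f n j) i)"
    then have r: "r < d i" using c[of f n] i by simp
    have "rep_act Q d x f (\<lambda>j\<in>verts Q. m j + n j) i $ r = rep_act Q d x f m i $ r + rep_act Q d x f n i $ r"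
      unfolding rep_act_index[where S = ?S and f = f and d = d and r = r and j = i, OF S order_refl i r] sum.distrib[symmetric]
    proof (rule sum.cong[OF refl])
      fix p assume "p \<in> ?S"
      show "(if D.awalk (fst p) (snd p) i
         then f p * (path_map Q d x (fst p) (snd p) *\<^sub>v (\<lambda>j\<in>verts Q. m j + n j) (fst p)) $ r else 0) =
        (if D.awalk (fst p) (snd p) i then f p * (path_map Q d x (fst p) (snd p) *\<^sub>v m (fst p)) $ r else 0) +
        (if D.awalk (fst p) (snd p) i then f p * (path_map Q d x (fst p) (snd p) *\<^sub>v n (fst p)) $ r else 0)"
      proof (cases "D.awalk (fst p) (snd p) i")
        case True
        then have v: "fst p \<in> verts Q" by (auto simp: D.awalk_def)
        have "path_map Q d x (fst p) (snd p) *\<^sub>v (m (fst p) + n (fst p)) =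
            path_map Q d x (fst p) (snd p) *\<^sub>v m (fst p) + path_map Q d x (fst p) (snd p) *\<^sub>v n (fst p)"
          using path_map_carrier[OF x True] rep_spaceD[OF m v] rep_spaceD[OF n v]
          by (intro mult_add_distrib_mat_vec)
        then show ?thesis using True v r path_map_carrier[OF x True] by (simp add: distrib_left)
      qed simp
    qed
    then show "rep_act Q d x f (\<lambda>j\<in>verts Q. m j + n j) i $ r = (\<lambda>j\<in>verts Q. rep_act Q d x f m j + rep_act Q d x f n j) i $ r"
      using i r c[of f m] c[of f n] by simp
  qed (use i c[of f m] c[of f n] c[of f "\<lambda>j\<in>verts Q. m j + n j"] in simp)
qed

lemma is_path_awalk: "is_path Q (u, as) \<longleftrightarrow> D.awalk u as (D.awlast u as)"
  by (auto simp: is_path_def)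

lemma rep_act_mult_path_term:
  assumes x: "x \<in> rep_ambient Q d" and m: "m \<in> rep_space Q d"
    and p: "is_path Q (w, bs)" "is_path Q (u, as)"
  shows "rep_act Q d x (path_term c (w, bs) \<otimes>\<^bsub>A\<^esub> path_term e (u, as)) m =
    rep_act Q d x (path_term c (w, bs)) (rep_act Q d x (path_term e (u, as)) m)"
proof (rule rep_space_eqI[OF rep_act_closed rep_act_closed])
  fix j assume j: "j \<in> verts Q"
  have w: "w \<in> verts Q" and u: "u \<in> verts Q" using p by (auto simp: is_path_def D.awalk_def)
  note as = p(2)[unfolded is_path_awalk]
  have rhs: "rep_act Q d x (path_term c (w, bs)) (rep_act Q d x (path_term e (u, as)) m) j =
    (if D.awalk w bs j then c \<cdot>\<^sub>v (path_map Q d x w bs *\<^sub>v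
        (if D.awalk u as w then e \<cdot>\<^sub>v (path_map Q d x u as *\<^sub>v m u) else 0\<^sub>v (d w))) else 0\<^sub>v (d j))"
    by (simp add: rep_act_path_term[OF j x rep_act_closed] rep_act_path_term[OF w x m])
  show "rep_act Q d x (path_term c (w, bs) \<otimes>\<^bsub>A\<^esub> path_term e (u, as)) m j =
    rep_act Q d x (path_term c (w, bs)) (rep_act Q d x (path_term e (u, as)) m) j"
  proof (cases "D.awlast u as = w")
    case True
    then have uw: "D.awalk u as w" using as by simp
    have iff: "D.awalk u (as @ bs) j \<longleftrightarrow> D.awalk w bs j"
      using uw True by (simp add: D.awalk_append_iff)
    show ?thesis
    proof (cases "D.awalk w bs j")
      case wj: True
      have "c \<cdot>\<^sub>v (path_map Q d x w bs *\<^sub>v (e \<cdot>\<^sub>v (path_map Q d x u as *\<^sub>v m u))) =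
          (c * e) \<cdot>\<^sub>v (path_map Q d x u (as @ bs) *\<^sub>v m u)"
        using path_map_carrier[OF x wj] path_map_carrier[OF x uw] rep_spaceD[OF m u]
        by (simp add: path_map_append[OF x wj uw] mult_mat_vec[of _ "d j" "d w"] smult_smult_assoc assoc_mult_mat_vec)
      then show ?thesis
        using True uw wj by (simp add: rhs path_term_mult rep_act_path_term[OF j x m] iff)
    qed (use True in \<open>simp add: rhs path_term_mult rep_act_path_term[OF j x m] iff\<close>)
  next
    case False
    then have "\<not> D.awalk u as w" by auto
    then show ?thesis
      using False j path_map_carrier[OF x, of w bs j]
      by (auto simp: rhs path_term_mult rep_act_zero)
  qed
qed

text \<open>Both sides are additive in f and in g. The claim for two paths is extended to all g with
  the left path fixed, and then to all f.\<close>

lemma rep_act_mult: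
  assumes x: "x \<in> rep_ambient Q d" and m: "m \<in> rep_space Q d" and f: "f \<in> carrier A" and g: "g \<in> carrier A"
  shows "rep_act Q d x (f \<otimes>\<^bsub>A\<^esub> g) m = rep_act Q d x f (rep_act Q d x g m)"
proof -
  have pt: "rep_act Q d x (path_term c p \<otimes>\<^bsub>A\<^esub> g) m = rep_act Q d x (path_term c p) (rep_act Q d x g m)"
    if p: "is_path Q p" for p c
  proof -
    have pc: "path_term c p \<in> carrier A" by (rule path_term_closed[OF p])
    have "g \<in> {g. rep_act Q d x (path_term c p \<otimes>\<^bsub>A\<^esub> g) m = rep_act Q d x (path_term c p) (rep_act Q d x g m)}"
    proof (rule path_algebra_induct[OF g])
      have "path_term c p \<otimes>\<^bsub>A\<^esub> (\<lambda>_. 0) = (\<lambda>_. 0)" using A.r_null[OF pc] by (simp add: A_simps)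
      moreover have "rep_act Q d x (path_term c p) (\<lambda>j\<in>verts Q. 0\<^sub>v (d j)) = (\<lambda>j\<in>verts Q. 0\<^sub>v (d j))"
      proof (rule rep_space_eqI[OF rep_act_closed rep_spaceI])
        fix j assume j: "j \<in> verts Q"
        have z: "(\<lambda>j\<in>verts Q. 0\<^sub>v (d j)) \<in> rep_space Q d" by (rule rep_spaceI) simp
        show "rep_act Q d x (path_term c p) (\<lambda>j\<in>verts Q. 0\<^sub>v (d j)) j = (\<lambda>j\<in>verts Q. 0\<^sub>v (d j)) j"
          using rep_act_path_term[OF j x z, of c "fst p" "snd p"] path_map_carrier[OF x, of "fst p" "snd p" j] j
          by (auto simp: D.awalk_def)
      qed simp
      ultimately show "(\<lambda>_. 0) \<in> {g. rep_act Q d x (path_term c p \<otimes>\<^bsub>A\<^esub> g) m = rep_act Q d x (path_term c p) (rep_act Q d x g m)}"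
        by (simp add: rep_act_zero)
    next
      fix q e assume "is_path Q q"
      then show "path_term e q \<in> {g. rep_act Q d x (path_term c p \<otimes>\<^bsub>A\<^esub> g) m = rep_act Q d x (path_term c p) (rep_act Q d x g m)}"
        using rep_act_mult_path_term[OF x m, of "fst p" "snd p" "fst q" "snd q" c e] p by simp
    next
      fix g h assume gh: "g \<in> {g. rep_act Q d x (path_term c p \<otimes>\<^bsub>A\<^esub> g) m = rep_act Q d x (path_term c p) (rep_act Q d x g m)}"
        "h \<in> {g. rep_act Q d x (path_term c p \<otimes>\<^bsub>A\<^esub> g) m = rep_act Q d x (path_term c p) (rep_act Q d x g m)}"
        "g \<in> carrier A" "h \<in> carrier A"
      have "path_term c p \<otimes>\<^bsub>A\<^esub> (\<lambda>p. g p + h p) = (\<lambda>q. (path_term c p \<otimes>\<^bsub>A\<^esub> g) q + (path_term c p \<otimes>\<^bsub>A\<^esub> h) q)"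
        using A.r_distr[OF gh(3,4) pc] by (simp add: A_simps(3))
      then show "(\<lambda>p. g p + h p) \<in> {g. rep_act Q d x (path_term c p \<otimes>\<^bsub>A\<^esub> g) m = rep_act Q d x (path_term c p) (rep_act Q d x g m)}"
        using gh pc by (simp add: rep_act_add rep_act_add_right[OF pc x rep_act_closed rep_act_closed])
    qed
    then show ?thesis by simp
  qed
  have "f \<in> {f. rep_act Q d x (f \<otimes>\<^bsub>A\<^esub> g) m = rep_act Q d x f (rep_act Q d x g m)}"
  proof (rule path_algebra_induct[OF f])
    have "(\<lambda>_. 0) \<otimes>\<^bsub>A\<^esub> g = (\<lambda>_. 0)" using A.l_null[OF g] by (simp add: A_simps)
    then show "(\<lambda>_. 0) \<in> {f. rep_act Q d x (f \<otimes>\<^bsub>A\<^esub> g) m = rep_act Q d x f (rep_act Q d x g m)}"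
      by (simp add: rep_act_zero)
  next
    fix f h assume fh: "f \<in> {f. rep_act Q d x (f \<otimes>\<^bsub>A\<^esub> g) m = rep_act Q d x f (rep_act Q d x g m)}"
      "h \<in> {f. rep_act Q d x (f \<otimes>\<^bsub>A\<^esub> g) m = rep_act Q d x f (rep_act Q d x g m)}" "f \<in> carrier A" "h \<in> carrier A"
    have "(\<lambda>p. f p + h p) \<otimes>\<^bsub>A\<^esub> g = (\<lambda>q. (f \<otimes>\<^bsub>A\<^esub> g) q + (h \<otimes>\<^bsub>A\<^esub> g) q)"
      using A.l_distr[OF fh(3,4) g] by (simp add: A_simps(3))
    then show "(\<lambda>p. f p + h p) \<in> {f. rep_act Q d x (f \<otimes>\<^bsub>A\<^esub> g) m = rep_act Q d x f (rep_act Q d x g m)}"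
      using fh g by (simp add: rep_act_add)
  qed (use pt in simp)
  then show ?thesis by simp
qed

lemma rep_act_vertex:
  assumes x: "x \<in> rep_ambient Q d" and m: "m \<in> rep_space Q d" and i: "i \<in> verts Q"
  shows "rep_act Q d x (path_term c (i, [])) m = (\<lambda>j\<in>verts Q. if j = i then c \<cdot>\<^sub>v m i else 0\<^sub>v (d j))"
proof (rule rep_space_eqI[OF rep_act_closed rep_spaceI])
  show "(if j = i then c \<cdot>\<^sub>v m i else 0\<^sub>v (d j)) \<in> carrier_vec (d j)" if "j \<in> verts Q" for j
    using rep_spaceD[OF m that] by auto
  fix j assume j: "j \<in> verts Q"
  then show "rep_act Q d x (path_term c (i, [])) m j = (\<lambda>j\<in>verts Q. if j = i then c \<cdot>\<^sub>v m i else 0\<^sub>v (d j)) j"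
    using rep_spaceD[OF m i] by (auto simp: rep_act_path_term[OF j x m] D.awalk_Nil_iff)
qed

lemma rep_act_arrow:
  assumes x: "x \<in> rep_ambient Q d" and m: "m \<in> rep_space Q d" and a: "\<alpha> \<in> arcs Q"
  shows "rep_act Q d x (path_term 1 (tail Q \<alpha>, [\<alpha>])) m =
    (\<lambda>j\<in>verts Q. if j = head Q \<alpha> then x \<alpha> *\<^sub>v m (tail Q \<alpha>) else 0\<^sub>v (d j))"
proof (rule rep_space_eqI[OF rep_act_closed rep_spaceI])
  note xa = rep_ambientD[OF x a]
  show "(if j = head Q \<alpha> then x \<alpha> *\<^sub>v m (tail Q \<alpha>) else 0\<^sub>v (d j)) \<in> carrier_vec (d j)" if "j \<in> verts Q" for j
    using xa rep_spaceD[OF m, of "tail Q \<alpha>"] a by auto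
  fix j assume j: "j \<in> verts Q"
  then show "rep_act Q d x (path_term 1 (tail Q \<alpha>, [\<alpha>])) m j =
      (\<lambda>j\<in>verts Q. if j = head Q \<alpha> then x \<alpha> *\<^sub>v m (tail Q \<alpha>) else 0\<^sub>v (d j)) j"
    using xa a by (auto simp: rep_act_path_term[OF j x m] D.awalk_Nil_iff D.awalk_Cons_iff)
qed

lemma rep_act_one:
  assumes x: "x \<in> rep_ambient Q d" and m: "m \<in> rep_space Q d"
  shows "rep_act Q d x \<one>\<^bsub>A\<^esub> m = m"
proof (rule rep_space_eqI[OF rep_act_closed m])
  fix j assume j: "j \<in> verts Q"
  note c = rep_spaceD[OF rep_act_closed j, of d x "\<one>\<^bsub>A\<^esub>" m] and mj = rep_spaceD[OF m j]
  show "rep_act Q d x \<one>\<^bsub>A\<^esub> m j = m j"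
  proof (rule eq_vecI)
    fix r assume "r < dim_vec (m j)"
    then have r: "r < d j" using mj by simp
    let ?S = "(\<lambda>i. (i, [])) ` verts Q :: ('v,'a) path set"
    have "rep_act Q d x \<one>\<^bsub>A\<^esub> m j $ r = (\<Sum>p\<in>?S. if D.awalk (fst p) (snd p) j
        then \<one>\<^bsub>A\<^esub> p * ((path_map Q d x (fst p) (snd p) *\<^sub>v m (fst p)) $ r) else 0)"
      by (rule rep_act_index[where d = d and r = r, OF _ _ j r]) (auto simp: A_simps(4) split: if_splits)
    also have "\<dots> = (\<Sum>p\<in>?S. if p = (j, []) then m j $ r else 0)"
    proof (rule sum.cong[OF refl])
      fix p assume "p \<in> ?S"
      then obtain i where "p = (i, [])" "i \<in> verts Q" by auto
      then show "(if D.awalk (fst p) (snd p) j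
        then \<one>\<^bsub>A\<^esub> p * ((path_map Q d x (fst p) (snd p) *\<^sub>v m (fst p)) $ r) else 0) = (if p = (j, []) then m j $ r else 0)"
        using mj r by (auto simp: A_simps(4) D.awalk_Nil_iff)
    qed
    also have "\<dots> = m j $ r" using j by (subst sum.delta) auto
    finally show "rep_act Q d x \<one>\<^bsub>A\<^esub> m j $ r = m j $ r" .
  qed (use c mj in simp)
qed

end

lemma zero_mat_mult_vec: "v \<in> carrier_vec m \<Longrightarrow> 0\<^sub>m n m *\<^sub>v v = (0\<^sub>v n :: 'k::semiring_0 vec)"
  by (intro eq_vecI) auto

section \<open>Equations of the variety and the module of a point\<close>

context rad_square_zero
begin

interpretation D: fin_digraph Q by (rule fin_digraph)

abbreviation rm :: "('v \<Rightarrow> nat) \<Rightarrow> ('a \<Rightarrow> 'k mat) \<Rightarrow> ('v,'a,'k,'v \<Rightarrow> 'k vec) quiver_module" where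
  "rm d x \<equiv> rep_module Q d x"

text \<open>By \<open>I_eq\<close> the relations say that paths of length at least two act as zero.
  Such a path map contains the product of its first two matrices as a factor; conversely, a path of
  length two is tested on vectors concentrated at its starting vertex.\<close>

lemma rep_variety_iff:
  "x \<in> rep_variety Q I d \<longleftrightarrow> x \<in> rep_ambient Q d \<and>
    (\<forall>\<alpha>\<in>arcs Q. \<forall>\<beta>\<in>arcs Q. head Q \<alpha> = tail Q \<beta> \<longrightarrow> x \<beta> * x \<alpha> = 0\<^sub>m (d (head Q \<beta>)) (d (tail Q \<alpha>)))"
  (is "_ \<longleftrightarrow> _ \<and> ?P")
proof (intro iffI conjI ballI impI)
  assume x: "x \<in> rep_variety Q I d"
  show xa: "x \<in> rep_ambient Q d" by (rule rep_variety_ambient[OF x])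
  fix \<alpha> \<beta> assume ab: "\<alpha> \<in> arcs Q" "\<beta> \<in> arcs Q" "head Q \<alpha> = tail Q \<beta>"
  note c = rep_ambientD[OF xa ab(1)] rep_ambientD[OF xa ab(2)]
  have p: "is_path Q (tail Q \<alpha>, [\<alpha>, \<beta>])" using ab by (simp add: is_path_Cons is_path_Nil)
  have tI: "path_term 1 (tail Q \<alpha>, [\<alpha>, \<beta>]) \<in> I" by (rule path_term_in_I[OF p]) simp
  show "x \<beta> * x \<alpha> = 0\<^sub>m (d (head Q \<beta>)) (d (tail Q \<alpha>))"
  proof (rule mat_eq_of_mult_vec)
    show "x \<beta> * x \<alpha> \<in> carrier_mat (d (head Q \<beta>)) (d (tail Q \<alpha>))"
      using c ab(3) by auto
    fix v :: "'k vec" assume v: "v \<in> carrier_vec (d (tail Q \<alpha>))"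
    let ?m = "\<lambda>j\<in>verts Q. if j = tail Q \<alpha> then v else 0\<^sub>v (d j)"
    have m: "?m \<in> rep_space Q d" using v by (intro rep_spaceI) auto
    have h: "head Q \<beta> \<in> verts Q" using ab by simp
    have "rep_act Q d x (path_term 1 (tail Q \<alpha>, [\<alpha>, \<beta>])) ?m (head Q \<beta>) = 0\<^sub>v (d (head Q \<beta>))"
      using x m tI h by (simp add: rep_variety_def)
    then show "x \<beta> * x \<alpha> *\<^sub>v v = 0\<^sub>m (d (head Q \<beta>)) (d (tail Q \<alpha>)) *\<^sub>v v"
      using ab c v by (simp add: rep_act_path_term[OF h xa m] D.awalk_Cons_iff D.awalk_Nil_iff zero_mat_mult_vec)
  qed simp
next
  assume x: "x \<in> rep_ambient Q d \<and> ?P"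
  then have xa: "x \<in> rep_ambient Q d" by simp
  have pm: "path_map Q d x u as *\<^sub>v m u = 0\<^sub>v (d j)"
    if as: "2 \<le> length as" "D.awalk u as j" and m: "m \<in> rep_space Q d" for u as j m
  proof -
    obtain \<alpha> \<beta> bs where e: "as = \<alpha> # \<beta> # bs" using as(1) by (cases as; cases "tl as") auto
    then have ab: "\<alpha> \<in> arcs Q" "\<beta> \<in> arcs Q" "head Q \<alpha> = tail Q \<beta>" "u = tail Q \<alpha>" "D.awalk (head Q \<beta>) bs j"
      using as(2) by (auto simp: D.awalk_Cons_iff)
    note c = rep_ambientD[OF xa ab(1)] rep_ambientD[OF xa ab(2)] path_map_carrier[OF xa ab(5)]
    have "path_map Q d x u as = path_map Q d x (head Q \<beta>) bs * (x \<beta> * x \<alpha>)"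
      using c ab(3) by (simp add: e assoc_mult_mat)
    also have "\<dots> = 0\<^sub>m (d j) (d u)" using x ab c by simp
    finally show ?thesis using rep_spaceD[OF m, of u] ab(1,4) by (simp add: zero_mat_mult_vec)
  qed
  have "rep_act Q d x f m = (\<lambda>i\<in>verts Q. 0\<^sub>v (d i))" if f: "f \<in> I" and m: "m \<in> rep_space Q d" for f m
  proof (rule rep_space_eqI[OF rep_act_closed rep_spaceI])
    fix j assume j: "j \<in> verts Q"
    have fZ: "f \<in> Z 2" using f I_eq by simp
    have fc: "finite {p. f p \<noteq> 0}" using fZ Z_carrier finite_support by blast
    show "rep_act Q d x f m j = (\<lambda>i\<in>verts Q. 0\<^sub>v (d i)) j"
    proof (rule eq_vecI)
      fix r assume "r < dim_vec ((\<lambda>i\<in>verts Q. 0\<^sub>v (d i) :: 'k vec) j)"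
      then have r: "r < d j" using j by simp
      have "rep_act Q d x f m j $ r = (\<Sum>p | f p \<noteq> 0. if D.awalk (fst p) (snd p) j
        then f p * ((path_map Q d x (fst p) (snd p) *\<^sub>v m (fst p)) $ r) else 0)"
        by (rule rep_act_index[where d = d and r = r, OF fc order_refl j r])
      also have "\<dots> = 0"
        using pm[OF Z_nonzero[OF fZ] _ m] r by (intro sum.neutral) auto
      finally show "rep_act Q d x f m j $ r = (\<lambda>i\<in>verts Q. 0\<^sub>v (d i)) j $ r" using j r by simp
    qed (use carrier_vecD[OF rep_spaceD[OF rep_act_closed j]] j in simp)
  qed simp
  then show "x \<in> rep_variety Q I d" using xa by (simp add: rep_variety_def)
qed

lemma rm_simps:
  "carrier (rm d x) = rep_space Q d" "\<zero>\<^bsub>rm d x\<^esub> = (\<lambda>i\<in>verts Q. 0\<^sub>v (d i))"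
  "m \<oplus>\<^bsub>rm d x\<^esub> n = (\<lambda>i\<in>verts Q. m i + n i)"
  by (simp_all add: rep_module_def)

text \<open>Elements of I act as zero, so all representatives of a coset act alike and the image
  from which \<open>the_elem\<close> reads its value is a singleton.\<close>

lemma rm_smult:
  assumes x: "x \<in> rep_variety Q I d" and f: "f \<in> carrier A" and m: "m \<in> rep_space Q d"
  shows "cls f \<odot>\<^bsub>rm d x\<^esub> m = rep_act Q d x f m"
proof -
  interpret I: ideal I A by (rule ideal_I)
  have "rep_act Q d x g m = rep_act Q d x f m" if "g \<in> cls f" for g
  proof -
    obtain h where h: "h \<in> I" "g = h \<oplus>\<^bsub>A\<^esub> f" using \<open>g \<in> cls f\<close> by (auto simp: a_r_coset_def')
    have hc: "h \<in> carrier A" using h(1) I_subset Z_carrier by blast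
    have "rep_act Q d x g m = (\<lambda>j\<in>verts Q. rep_act Q d x h m j + rep_act Q d x f m j)"
      unfolding h(2) A_simps(3) by (rule rep_act_add[OF hc f])
    also have "rep_act Q d x h m = (\<lambda>i\<in>verts Q. 0\<^sub>v (d i))" using x h(1) m by (simp add: rep_variety_def)
    finally show ?thesis
      by (intro rep_space_eqI[OF rep_act_closed rep_act_closed]) (simp add: left_zero_vec[OF rep_spaceD[OF rep_act_closed]])
  qed
  moreover have "f \<in> cls f" using I.a_rcos_self f by simp
  ultimately have "(\<lambda>f. rep_act Q d x f m) ` cls f = {rep_act Q d x f m}" by blast
  then show ?thesis by (simp add: rep_module_def)
qed

lemma rm_left_module:
  assumes x: "x \<in> rep_variety Q I d"
  shows "left_module L (rm d x)"
proof -
  note xa = rep_variety_ambient[OF x]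
  have ag: "abelian_group (rm d x)"
  proof (rule abelian_groupI)
    fix m assume "m \<in> carrier (rm d x)"
    then have m: "m \<in> rep_space Q d" by (simp add: rm_simps)
    then have n1: "(\<lambda>i\<in>verts Q. - m i) \<in> rep_space Q d" by (intro rep_spaceI) (simp add: rep_spaceD)
    have n2: "(\<lambda>i\<in>verts Q. (\<lambda>i\<in>verts Q. - m i) i + m i) = (\<lambda>i\<in>verts Q. 0\<^sub>v (d i))"
      using rep_spaceD[OF m] by (intro restrict_ext) simp
    show "\<exists>n\<in>carrier (rm d x). n \<oplus>\<^bsub>rm d x\<^esub> m = \<zero>\<^bsub>rm d x\<^esub>"
      unfolding rm_simps by (intro bexI[of _ "\<lambda>i\<in>verts Q. - m i"]) (rule n2, rule n1)
  next
    fix m assume "m \<in> carrier (rm d x)"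
    then have m: "m \<in> rep_space Q d" by (simp add: rm_simps)
    then show "\<zero>\<^bsub>rm d x\<^esub> \<oplus>\<^bsub>rm d x\<^esub> m = m"
      unfolding rm_simps by (intro rep_space_eqI[OF rep_spaceI m]) (auto dest: rep_spaceD[OF m])
  qed (auto simp: rm_simps intro!: rep_spaceI restrict_ext dest: rep_spaceD simp: comm_add_vec rep_spaceD assoc_add_vec)
  show ?thesis
  proof (intro left_module.intro left_module_axioms.intro)
    show "ring L" by (rule L.ring_axioms)
    show "abelian_group (rm d x)" by (rule ag)
  next
    fix X m assume "X \<in> carrier L" "m \<in> carrier (rm d x)"
    then show "X \<odot>\<^bsub>rm d x\<^esub> m \<in> carrier (rm d x)"
      by (auto simp: L_carrier rm_simps rm_smult[OF x] rep_act_closed)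
  next
    fix X Y m assume "X \<in> carrier L" "Y \<in> carrier L" "m \<in> carrier (rm d x)"
    then obtain f g where *: "f \<in> carrier A" "X = cls f" "g \<in> carrier A" "Y = cls g" "m \<in> rep_space Q d"
      by (auto simp: L_carrier rm_simps)
    show "(X \<oplus>\<^bsub>L\<^esub> Y) \<odot>\<^bsub>rm d x\<^esub> m = X \<odot>\<^bsub>rm d x\<^esub> m \<oplus>\<^bsub>rm d x\<^esub> Y \<odot>\<^bsub>rm d x\<^esub> m"
      using rm_smult[OF x A.a_closed[OF *(1,3)] *(5)] rep_act_add[OF *(1,3)]
      by (simp add: * cls_simps(3) rm_smult[OF x] rm_simps A_simps(3))
    show "(X \<otimes>\<^bsub>L\<^esub> Y) \<odot>\<^bsub>rm d x\<^esub> m = X \<odot>\<^bsub>rm d x\<^esub> (Y \<odot>\<^bsub>rm d x\<^esub> m)"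
      using * by (simp add: cls_simps(2) rm_smult[OF x] rep_act_closed rep_act_mult[OF xa])
  next
    fix X m n assume "X \<in> carrier L" "m \<in> carrier (rm d x)" "n \<in> carrier (rm d x)"
    then obtain f where *: "f \<in> carrier A" "X = cls f" "m \<in> rep_space Q d" "n \<in> rep_space Q d"
      by (auto simp: L_carrier rm_simps)
    have "(\<lambda>i\<in>verts Q. m i + n i) \<in> rep_space Q d"
      using * by (intro rep_spaceI) (simp add: rep_spaceD)
    then show "X \<odot>\<^bsub>rm d x\<^esub> (m \<oplus>\<^bsub>rm d x\<^esub> n) = X \<odot>\<^bsub>rm d x\<^esub> m \<oplus>\<^bsub>rm d x\<^esub> X \<odot>\<^bsub>rm d x\<^esub> n"
      using * by (simp add: rm_simps rm_smult[OF x] rep_act_add_right[OF *(1) xa])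
  next
    fix m assume "m \<in> carrier (rm d x)"
    then show "\<one>\<^bsub>L\<^esub> \<odot>\<^bsub>rm d x\<^esub> m = m"
      by (simp add: cls_simps(4)[symmetric] rm_smult[OF x] rm_simps rep_act_one[OF xa])
  qed
qed

lemma rm_vx:
  assumes x: "x \<in> rep_variety Q I d" and m: "m \<in> rep_space Q d" and i: "i \<in> verts Q"
  shows "vx i \<odot>\<^bsub>rm d x\<^esub> m = (\<lambda>j\<in>verts Q. if j = i then m i else 0\<^sub>v (d j))"
  unfolding vx_eq rm_smult[OF x path_term_closed[OF is_path_vertex[OF i]] m] rep_act_vertex[OF rep_variety_ambient[OF x] m i]
  by (intro restrict_ext) simp

lemma rm_ar:
  assumes x: "x \<in> rep_variety Q I d" and m: "m \<in> rep_space Q d" and a: "\<alpha> \<in> arcs Q"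
  shows "ar \<alpha> \<odot>\<^bsub>rm d x\<^esub> m = (\<lambda>j\<in>verts Q. if j = head Q \<alpha> then x \<alpha> *\<^sub>v m (tail Q \<alpha>) else 0\<^sub>v (d j))"
  unfolding ar_eq rm_smult[OF x path_term_closed[OF is_path_arrow[OF a]] m] rep_act_arrow[OF rep_variety_ambient[OF x] m a] ..

lemma rm_sc:
  assumes x: "x \<in> rep_variety Q I d" and m: "m \<in> rep_space Q d"
  shows "sc c \<odot>\<^bsub>rm d x\<^esub> m = (\<lambda>j\<in>verts Q. c \<cdot>\<^sub>v m j)"
  unfolding sc_eq rm_smult[OF x scale_one_closed m]
  by (simp add: rep_act_scale rep_act_one[OF rep_variety_ambient[OF x] m])

text \<open>Listing all coordinates of all vertices in one long vector presents the module as a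
  linear image of a coordinate space.\<close>

lemma rm_fd:
  assumes x: "x \<in> rep_variety Q I d"
  shows "fd_module Q I (rm d x)"
proof -
  let ?S = "SIGMA j:verts Q. {0..<d j}"
  have S: "finite ?S" by simp
  obtain e where e: "bij_betw e ?S {0..<card ?S}" using ex_bij_betw_finite_nat[OF S] by auto
  let ?N = "card ?S"
  let ?T = "\<lambda>v :: 'k vec. \<lambda>j\<in>verts Q. vec (d j) (\<lambda>s. v $ (e (j, s)))"
  have lt: "e (j, s) < ?N" if "j \<in> verts Q" "s < d j" for j s
    using bij_betwE[OF e] that by fastforce
  have hom: "?T \<in> module_hom class_ring (module_vec TYPE('k) ?N) (K_space Q I (rm d x))"
    unfolding module_hom_def
  proof (safe)
    fix v :: "'k vec" assume v: "v \<in> carrier (module_vec TYPE('k) ?N)"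
    show T: "?T v \<in> carrier (K_space Q I (rm d x))" by (simp add: rm_simps rep_spaceI)
    fix c :: 'k
    show "?T (c \<odot>\<^bsub>module_vec TYPE('k) ?N\<^esub> v) = c \<odot>\<^bsub>K_space Q I (rm d x)\<^esub> ?T v"
      using v lt T by (auto simp: rm_simps rm_sc[OF x] module_vec_simps intro!: restrict_ext eq_vecI)
  next
    fix v w :: "'k vec" assume "v \<in> carrier (module_vec TYPE('k) ?N)" "w \<in> carrier (module_vec TYPE('k) ?N)"
    then show "?T (v \<oplus>\<^bsub>module_vec TYPE('k) ?N\<^esub> w) = ?T v \<oplus>\<^bsub>K_space Q I (rm d x)\<^esub> ?T w"
      using lt by (auto simp: rm_simps module_vec_simps intro!: restrict_ext eq_vecI)
  qed
  interpret vec_space "TYPE('k)" ?N .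
  interpret T: linear_map class_ring "module_vec TYPE('k) ?N" "K_space Q I (rm d x)" ?T
    using vec_vs K_space_vectorspace[OF rm_left_module[OF x]] hom by (rule linear_mapI)
  have "?T ` carrier_vec ?N = rep_space Q d"
  proof
    show "?T ` carrier_vec ?N \<subseteq> rep_space Q d" by (auto intro!: rep_spaceI)
    show "rep_space Q d \<subseteq> ?T ` carrier_vec ?N"
    proof
      fix m :: "'v \<Rightarrow> 'k vec" assume m: "m \<in> rep_space Q d"
      let ?v = "vec ?N (\<lambda>k. m (fst (inv_into ?S e k)) $ snd (inv_into ?S e k))"
      have "inv_into ?S e (e (j, s)) = (j, s)" if "j \<in> verts Q" "s < d j" for j s
        using that e by (intro inv_into_f_f) (auto simp: bij_betw_def)
      then have inv: "?v $ e (j, s) = m j $ s" if "j \<in> verts Q" "s < d j" for j s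
        using that lt[OF that] by (simp only: index_vec) simp
      have "?T ?v = m"
      proof (rule rep_space_eqI[OF rep_spaceI m])
        fix j assume j: "j \<in> verts Q"
        show "?T ?v j = m j"
          using rep_spaceD[OF m j] inv[OF j] j by (intro eq_vecI) (simp_all del: card_SigmaI)
      qed simp
      then show "m \<in> ?T ` carrier_vec ?N" by (rule rev_image_eqI[OF vec_carrier, OF sym])
    qed
  qed
  then have "vectorspace.fin_dim class_ring (K_space Q I (rm d x))"
    using T.rank_nullity_main(2) fin_dim by (simp add: rm_simps module_vec_simps)
  then show ?thesis using rm_left_module[OF x] by (simp add: fd_module_def)
qed

text \<open>Evaluation at i is injective on the vertex space at i, and it has the same image there
  as on all of U. Abstract dimensions become dimensions of subspaces of
  \<open>K^(d i)\<close>.\<close>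

lemma dv_rm_submod:
  assumes x: "x \<in> rep_variety Q I d" and U: "Module.submodule U L (rm d x)" and i: "i \<in> verts Q"
  shows "dv (submod (rm d x) U) i =
    vectorspace.dim class_ring ((module_vec TYPE('k) (d i))\<lparr>carrier := (\<lambda>m. m i) ` U\<rparr>)"
proof -
  note lm = rm_left_module[OF x] and fd = rm_fd[OF x] and U' = submoduleD[OF U]
  have Uc: "m \<in> rep_space Q d" if "m \<in> U" for m using U'(1) that by (auto simp: rm_simps)
  let ?G = "(K_space Q I (rm d x))\<lparr>carrier := gr (rm d x) U i\<rparr>"
  have ge: "gr (rm d x) U i = {m \<in> U. vx i \<odot>\<^bsub>rm d x\<^esub> m = m}" by (rule gr_eq[OF lm U i])
  interpret vec_space "TYPE('k)" "d i" .
  have hom: "(\<lambda>m. m i) \<in> module_hom class_ring ?G (module_vec TYPE('k) (d i))"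
    unfolding module_hom_def ge using Uc i
    by (auto simp: rm_simps module_vec_simps rep_spaceD rm_sc[OF x])
  have "inj_on (\<lambda>m. m i) (carrier ?G)"
  proof (rule inj_onI)
    fix m n assume mn: "m \<in> carrier ?G" "n \<in> carrier ?G" "m i = n i"
    then have c: "m \<in> rep_space Q d" "n \<in> rep_space Q d" "vx i \<odot>\<^bsub>rm d x\<^esub> m = m" "vx i \<odot>\<^bsub>rm d x\<^esub> n = n"
      using Uc by (auto simp: ge)
    have "vx i \<odot>\<^bsub>rm d x\<^esub> m = vx i \<odot>\<^bsub>rm d x\<^esub> n"
      unfolding rm_vx[OF x c(1) i] rm_vx[OF x c(2) i] mn(3) ..
    then show "m = n" unfolding c(3,4) .
  qed
  from dim_inj_hom[OF fd_gr(1)[OF fd U i] vec_vs hom fd_gr(2)[OF fd U i] this]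
  have "vectorspace.dim class_ring ((module_vec TYPE('k) (d i))\<lparr>carrier := (\<lambda>m. m i) ` gr (rm d x) U i\<rparr>) = dv (submod (rm d x) U) i"
    by (simp add: dv_submod)
  moreover have "(\<lambda>m. m i) ` gr (rm d x) U i = (\<lambda>m. m i) ` U"
    unfolding gr_def image_image using Uc i by (intro image_cong refl) (simp add: rm_vx[OF x])
  ultimately show ?thesis by simp
qed

lemma dv_rm:
  assumes x: "x \<in> rep_variety Q I d" and i: "i \<in> verts Q"
  shows "dv (rm d x) i = d i"
proof -
  interpret vec_space "TYPE('k)" "d i" .
  have "(\<lambda>m. m i) ` rep_space Q d = (carrier_vec (d i) :: 'k vec set)"
  proof
    show "(\<lambda>m. m i) ` rep_space Q d \<subseteq> (carrier_vec (d i) :: 'k vec set)" using rep_spaceD i by blast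
    show "carrier_vec (d i) \<subseteq> (\<lambda>m. m i) ` (rep_space Q d :: ('v \<Rightarrow> 'k vec) set)"
    proof
      fix v :: "'k vec" assume "v \<in> carrier_vec (d i)"
      then have "(\<lambda>j\<in>verts Q. if j = i then v else 0\<^sub>v (d j)) \<in> rep_space Q d" by (intro rep_spaceI) auto
      then show "v \<in> (\<lambda>m. m i) ` rep_space Q d" by (rule rev_image_eqI) (simp add: i)
    qed
  qed
  moreover have "dv (submod (rm d x) (rep_space Q d)) i = dv (rm d x) i"
    using rm_simps(1)[of d x] by (simp add: dv_submod dv_carrier[of "rm d x"])
  moreover have "vectorspace.dim class_ring ((module_vec TYPE('k) (d i))\<lparr>carrier := carrier_vec (d i)\<rparr>) = d i"
  proof -
    have e: "(module_vec TYPE('k) (d i))\<lparr>carrier := carrier_vec (d i)\<rparr> = module_vec TYPE('k) (d i)"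
      by (simp add: module_vec_def)
    show ?thesis unfolding e by (rule dim_is_n)
  qed
  ultimately show ?thesis
    using dv_rm_submod[OF x _ i, of "rep_space Q d"] submodule_carrier[OF rm_left_module[OF x]]
    by (simp add: rm_simps)
qed

end

lemma (in vec_space) hom_zero_vec:
  assumes "f \<in> module_hom class_ring (module_vec TYPE('a) n) W" "vectorspace class_ring W"
  shows "f (0\<^sub>v n) = \<zero>\<^bsub>W\<^esub>"
proof -
  interpret linear_map class_ring V W f using vec_vs assms(2,1) by (rule linear_mapI)
  show ?thesis using f0_is_0 by simp
qed

section \<open>Homomorphisms given vertexwise, and coordinates for abstract modules\<close>

context rad_square_zero
begin

interpretation D: fin_digraph Q by (rule fin_digraph)

lemma smult_finsum_right:
  assumes M: "left_module L M" and X: "X \<in> carrier L" and S: "finite S" "f \<in> S \<rightarrow> carrier M"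
  shows "X \<odot>\<^bsub>M\<^esub> (\<Oplus>\<^bsub>M\<^esub>i\<in>S. f i) = (\<Oplus>\<^bsub>M\<^esub>i\<in>S. X \<odot>\<^bsub>M\<^esub> f i)"
proof -
  interpret M: left_module L M by fact
  show ?thesis using S
  proof (induction S rule: finite_induct)
    case (insert i S)
    have "(\<Oplus>\<^bsub>M\<^esub>i\<in>insert i S. f i) = f i \<oplus>\<^bsub>M\<^esub> (\<Oplus>\<^bsub>M\<^esub>i\<in>S. f i)"
      using insert by (intro M.M.finsum_insert) auto
    moreover have "(\<Oplus>\<^bsub>M\<^esub>i\<in>insert i S. X \<odot>\<^bsub>M\<^esub> f i) = X \<odot>\<^bsub>M\<^esub> f i \<oplus>\<^bsub>M\<^esub> (\<Oplus>\<^bsub>M\<^esub>i\<in>S. X \<odot>\<^bsub>M\<^esub> f i)"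
      using insert X by (intro M.M.finsum_insert) (auto intro!: M.smult_closed)
    moreover have "(\<Oplus>\<^bsub>M\<^esub>i\<in>S. f i) \<in> carrier M" using insert by (intro M.M.finsum_closed) auto
    ultimately show ?case using insert X by (simp add: M.smult_r_distr)
  qed (simp add: smult_zero_right[OF M X])
qed

lemma vx_finsum:
  assumes M: "left_module L M" and f: "\<And>i. i \<in> verts Q \<Longrightarrow> f i \<in> gr M (carrier M) i" and j: "j \<in> verts Q"
  shows "vx j \<odot>\<^bsub>M\<^esub> (\<Oplus>\<^bsub>M\<^esub>i\<in>verts Q. f i) = f j"
proof -
  interpret M: left_module L M by fact
  have fe: "f i \<in> carrier M" "vx i \<odot>\<^bsub>M\<^esub> f i = f i" if "i \<in> verts Q" for i
    using f[OF that] gr_eq[OF M submodule_carrier[OF M] that] by auto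
  have e: "vx j \<odot>\<^bsub>M\<^esub> f i = (if j = i then f i else \<zero>\<^bsub>M\<^esub>)" if i: "i \<in> verts Q" for i
  proof -
    have "vx j \<odot>\<^bsub>M\<^esub> f i = (vx j \<otimes>\<^bsub>L\<^esub> vx i) \<odot>\<^bsub>M\<^esub> f i"
      using fe[OF i] i j M.smult_assoc[of "vx j" "vx i" "f i"] by simp
    then show ?thesis using fe[OF i] i j by (auto simp: vx_vx smult_zero_left[OF M])
  qed
  have "vx j \<odot>\<^bsub>M\<^esub> (\<Oplus>\<^bsub>M\<^esub>i\<in>verts Q. f i) = (\<Oplus>\<^bsub>M\<^esub>i\<in>verts Q. vx j \<odot>\<^bsub>M\<^esub> f i)"
    using fe j by (intro smult_finsum_right[OF M]) auto
  also have "\<dots> = (\<Oplus>\<^bsub>M\<^esub>i\<in>verts Q. if j = i then f i else \<zero>\<^bsub>M\<^esub>)"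
    using fe j e by (intro M.M.finsum_cong') auto
  also have "\<dots> = f j" using fe j by (intro M.M.finsum_singleton) auto
  finally show ?thesis .
qed

lemma ar_tail:
  assumes M: "left_module L M" and m: "m \<in> carrier M" and a: "\<alpha> \<in> arcs Q"
  shows "ar \<alpha> \<odot>\<^bsub>M\<^esub> (vx (tail Q \<alpha>) \<odot>\<^bsub>M\<^esub> m) = ar \<alpha> \<odot>\<^bsub>M\<^esub> m"
proof -
  interpret M: left_module L M by fact
  show ?thesis using M.smult_assoc[of "ar \<alpha>" "vx (tail Q \<alpha>)" m] a m by (simp add: ar_vx)
qed

lemma vx_ar_smult:
  assumes M: "left_module L M" and m: "m \<in> carrier M" and a: "\<alpha> \<in> arcs Q" and j: "j \<in> verts Q"
  shows "vx j \<odot>\<^bsub>M\<^esub> (ar \<alpha> \<odot>\<^bsub>M\<^esub> m) = (if j = head Q \<alpha> then ar \<alpha> \<odot>\<^bsub>M\<^esub> m else \<zero>\<^bsub>M\<^esub>)"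
proof -
  interpret M: left_module L M by fact
  show ?thesis using M.smult_assoc[of "vx j" "ar \<alpha>" m] a m j
    by (cases "j = head Q \<alpha>") (simp_all add: vx_ar smult_zero_left[OF M])
qed

lemma vx_eqI:
  assumes M: "left_module L M" and "m \<in> carrier M" "n \<in> carrier M"
    and "\<And>i. i \<in> verts Q \<Longrightarrow> vx i \<odot>\<^bsub>M\<^esub> m = vx i \<odot>\<^bsub>M\<^esub> n"
  shows "m = n"
proof -
  interpret M: left_module L M by fact
  have "m = (\<Oplus>\<^bsub>M\<^esub>i\<in>verts Q. vx i \<odot>\<^bsub>M\<^esub> m)" by (rule vertex_decomposition[OF M assms(2)])
  also have "\<dots> = (\<Oplus>\<^bsub>M\<^esub>i\<in>verts Q. vx i \<odot>\<^bsub>M\<^esub> n)"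
    using assms by (intro M.M.finsum_cong') (auto intro!: M.smult_closed)
  also have "\<dots> = n" by (rule vertex_decomposition[OF M assms(3), symmetric])
  finally show ?thesis .
qed

lemma smult_vec_zero: "c \<cdot>\<^sub>v 0\<^sub>v n = (0\<^sub>v n :: 'k vec)"
  by (rule eq_vecI) auto

text \<open>A homomorphism out of the module of a point amounts to linear maps at the vertices that
  commute with the arrows; the map is the sum of its vertex parts. It serves for the coordinates of
  a module and for maps out of projectives.\<close>

lemma rm_hom:
  fixes M :: "('v,'a,'k,'m) quiver_module" and \<theta> :: "'v \<Rightarrow> 'k vec \<Rightarrow> 'm"
  assumes M: "left_module L M" and x: "x \<in> rep_variety Q I d"
    and th_gr: "\<And>i v. i \<in> verts Q \<Longrightarrow> v \<in> carrier_vec (d i) \<Longrightarrow> \<theta> i v \<in> gr M (carrier M) i"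
    and th_add: "\<And>i v w. i \<in> verts Q \<Longrightarrow> v \<in> carrier_vec (d i) \<Longrightarrow> w \<in> carrier_vec (d i) \<Longrightarrow>
      \<theta> i (v + w) = \<theta> i v \<oplus>\<^bsub>M\<^esub> \<theta> i w"
    and th_sc: "\<And>i c v. i \<in> verts Q \<Longrightarrow> v \<in> carrier_vec (d i) \<Longrightarrow> \<theta> i (c \<cdot>\<^sub>v v) = sc c \<odot>\<^bsub>M\<^esub> \<theta> i v"
    and th_x: "\<And>\<alpha> v. \<alpha> \<in> arcs Q \<Longrightarrow> v \<in> carrier_vec (d (tail Q \<alpha>)) \<Longrightarrow>
      \<theta> (head Q \<alpha>) (x \<alpha> *\<^sub>v v) = ar \<alpha> \<odot>\<^bsub>M\<^esub> \<theta> (tail Q \<alpha>) v"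
  shows "\<exists>h \<in> module_hom L (rm d x) M. \<forall>m \<in> rep_space Q d. \<forall>j \<in> verts Q. vx j \<odot>\<^bsub>M\<^esub> h m = \<theta> j (m j)"
proof -
  interpret M: left_module L M by (rule M)
  have grc: "y \<in> carrier M" "vx i \<odot>\<^bsub>M\<^esub> y = y" if "i \<in> verts Q" "y \<in> gr M (carrier M) i" for i y
    using gr_eq[OF M submodule_carrier[OF M] that(1)] that(2) by auto
  have th_0: "\<theta> i (0\<^sub>v (d i)) = \<zero>\<^bsub>M\<^esub>" if i: "i \<in> verts Q" for i
    using th_sc[OF i, of "0\<^sub>v (d i)" 0] smult_zero_left[OF M grc(1)[OF i th_gr[OF i]], of "0\<^sub>v (d i)"]
    by (simp add: sc_eq cls_null smult_vec_zero)
  define h where "h m = (\<Oplus>\<^bsub>M\<^esub>i\<in>verts Q. \<theta> i (m i))" for m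
  have hgr: "\<theta> i (m i) \<in> gr M (carrier M) i" if "m \<in> rep_space Q d" "i \<in> verts Q" for m i
    using th_gr[OF that(2) rep_spaceD[OF that]] .
  have hc: "h m \<in> carrier M" if "m \<in> rep_space Q d" for m
    unfolding h_def using grc(1)[OF _ hgr[OF that]] by (intro M.M.finsum_closed) auto
  have hv: "vx j \<odot>\<^bsub>M\<^esub> h m = \<theta> j (m j)" if "m \<in> rep_space Q d" "j \<in> verts Q" for m j
    unfolding h_def using vx_finsum[OF M _ that(2), of "\<lambda>i. \<theta> i (m i)"] hgr[OF that(1)] by blast
  have hI: "h m = n" if "m \<in> rep_space Q d" "n \<in> carrier M" "\<And>i. i \<in> verts Q \<Longrightarrow> \<theta> i (m i) = vx i \<odot>\<^bsub>M\<^esub> n" for m n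
    using that hv by (intro vx_eqI[OF M hc]) auto
  have mr: "m \<oplus>\<^bsub>rm d x\<^esub> n \<in> rep_space Q d" "X \<odot>\<^bsub>rm d x\<^esub> m \<in> rep_space Q d"
    if "m \<in> rep_space Q d" "n \<in> rep_space Q d" "X \<in> carrier L" for m n X
    using submoduleD[OF submodule_carrier[OF rm_left_module[OF x]]] that rm_simps(1) by auto
  have hom: "h \<in> module_hom L (rm d x) M"
  proof (rule module_homI[OF rm_left_module[OF x] M], unfold rm_simps(1))
    show "h m \<in> carrier M" if "m \<in> rep_space Q d" for m by (rule hc[OF that])
    show "h (m \<oplus>\<^bsub>rm d x\<^esub> n) = h m \<oplus>\<^bsub>M\<^esub> h n" if "m \<in> rep_space Q d" "n \<in> rep_space Q d" for m n
      using that mr(1)[OF that gens_closed(3)]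
      by (intro hI) (auto simp: hc hv M.smult_r_distr rm_simps th_add rep_spaceD)
    show "h (sc c \<odot>\<^bsub>rm d x\<^esub> m) = sc c \<odot>\<^bsub>M\<^esub> h m" if m: "m \<in> rep_space Q d" for c m
    proof (rule hI)
      fix i assume i: "i \<in> verts Q"
      have "vx i \<odot>\<^bsub>M\<^esub> (sc c \<odot>\<^bsub>M\<^esub> h m) = sc c \<odot>\<^bsub>M\<^esub> (vx i \<odot>\<^bsub>M\<^esub> h m)"
        using M.smult_assoc[of "vx i" "sc c" "h m"] M.smult_assoc[of "sc c" "vx i" "h m"] hc[OF m] i
        by (simp add: sc_comm)
      then show "\<theta> i ((sc c \<odot>\<^bsub>rm d x\<^esub> m) i) = vx i \<odot>\<^bsub>M\<^esub> (sc c \<odot>\<^bsub>M\<^esub> h m)"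
        using m i by (simp add: hv rm_sc[OF x] th_sc rep_spaceD)
    qed (use mr(2)[OF m m] hc[OF m] in \<open>auto intro: M.smult_closed\<close>)
    show "h (vx j \<odot>\<^bsub>rm d x\<^esub> m) = vx j \<odot>\<^bsub>M\<^esub> h m" if j: "j \<in> verts Q" and m: "m \<in> rep_space Q d" for j m
    proof (rule hI)
      fix i assume i: "i \<in> verts Q"
      have "vx i \<odot>\<^bsub>M\<^esub> (vx j \<odot>\<^bsub>M\<^esub> h m) = (if i = j then vx j \<odot>\<^bsub>M\<^esub> h m else \<zero>\<^bsub>M\<^esub>)"
        using M.smult_assoc[of "vx i" "vx j" "h m"] hc[OF m] i j
        by (cases "i = j") (simp_all add: vx_vx smult_zero_left[OF M])
      then show "\<theta> i ((vx j \<odot>\<^bsub>rm d x\<^esub> m) i) = vx i \<odot>\<^bsub>M\<^esub> (vx j \<odot>\<^bsub>M\<^esub> h m)"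
        using m i j by (simp add: hv rm_vx[OF x] th_0)
    qed (use mr(2)[OF m m] hc[OF m] j in \<open>auto intro: M.smult_closed\<close>)
    show "h (ar \<alpha> \<odot>\<^bsub>rm d x\<^esub> m) = ar \<alpha> \<odot>\<^bsub>M\<^esub> h m" if a: "\<alpha> \<in> arcs Q" and m: "m \<in> rep_space Q d" for \<alpha> m
    proof (rule hI)
      fix i assume i: "i \<in> verts Q"
      have t: "tail Q \<alpha> \<in> verts Q" using a by simp
      have "ar \<alpha> \<odot>\<^bsub>M\<^esub> h m = ar \<alpha> \<odot>\<^bsub>M\<^esub> \<theta> (tail Q \<alpha>) (m (tail Q \<alpha>))"
        using ar_tail[OF M hc[OF m] a] hv[OF m t] by simp
      then show "\<theta> i ((ar \<alpha> \<odot>\<^bsub>rm d x\<^esub> m) i) = vx i \<odot>\<^bsub>M\<^esub> (ar \<alpha> \<odot>\<^bsub>M\<^esub> h m)"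
        using vx_ar_smult[OF M hc[OF m] a i] i th_x[OF a rep_spaceD[OF m t]]
        by (simp add: rm_ar[OF x m a] th_0)
    qed (use mr(2)[OF m m] hc[OF m] a in \<open>auto intro: M.smult_closed\<close>)
  qed
  show ?thesis using hom hv by blast
qed

text \<open>Choosing a basis of every vertex space turns the arrows into matrices, and the relations
  hold because products of two arrows vanish in \<Lambda>. Thus every finite dimensional module,
  whatever the type of its elements, is isomorphic to the module of a point.\<close>

lemma module_coordinates:
  fixes M :: "('v,'a,'k,'m) quiver_module"
  assumes fd: "fd_module Q I M" and d: "\<And>i. i \<in> verts Q \<Longrightarrow> dv M i = d i"
  obtains x h where "x \<in> rep_variety Q I d" "h \<in> module_hom L (rm d x) M"
    "bij_betw h (rep_space Q d) (carrier M)"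
proof -
  note M = fd_moduleD(1)[OF fd]
  interpret M: left_module L M by (rule M)
  note sM = submodule_carrier[OF M]
  let ?G = "\<lambda>i. (K_space Q I M)\<lparr>carrier := gr M (carrier M) i\<rparr>"
  have "\<exists>\<theta>. \<theta> \<in> module_hom class_ring (module_vec TYPE('k) (d i)) (?G i) \<and>
      bij_betw \<theta> (carrier_vec (d i)) (gr M (carrier M) i)" if i: "i \<in> verts Q" for i
    using vector_space_coordinates[OF fd_gr[OF fd sM i]] d[OF i] by (simp add: dv_carrier) blast
  then obtain \<theta> where th: "\<And>i. i \<in> verts Q \<Longrightarrow> \<theta> i \<in> module_hom class_ring (module_vec TYPE('k) (d i)) (?G i)"
    and thb: "\<And>i. i \<in> verts Q \<Longrightarrow> bij_betw (\<theta> i) (carrier_vec (d i)) (gr M (carrier M) i)"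
    by metis
  have th_add: "\<theta> i (v + w) = \<theta> i v \<oplus>\<^bsub>M\<^esub> \<theta> i w" if "i \<in> verts Q" "v \<in> carrier_vec (d i)" "w \<in> carrier_vec (d i)" for i v w
    using th[OF that(1)] that by (auto simp: module_hom_def module_vec_simps)
  have th_sc: "\<theta> i (c \<cdot>\<^sub>v v) = sc c \<odot>\<^bsub>M\<^esub> \<theta> i v" if "i \<in> verts Q" "v \<in> carrier_vec (d i)" for i c v
    using th[OF that(1)] that by (auto simp: module_hom_def module_vec_simps)
  have th_gr: "\<theta> i v \<in> gr M (carrier M) i" if "i \<in> verts Q" "v \<in> carrier_vec (d i)" for i v
    using bij_betwE[OF thb[OF that(1)]] that(2) by blast
  have grc: "y \<in> carrier M" "vx i \<odot>\<^bsub>M\<^esub> y = y" if "i \<in> verts Q" "y \<in> gr M (carrier M) i" for i y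
    using gr_eq[OF M sM that(1)] that(2) by auto
  have th_0: "\<theta> i (0\<^sub>v (d i)) = \<zero>\<^bsub>M\<^esub>" if "i \<in> verts Q" for i
    using vec_space.hom_zero_vec[OF th[OF that] fd_gr(1)[OF fd sM that]] by simp
  have th_inj: "v = w" if "i \<in> verts Q" "v \<in> carrier_vec (d i)" "w \<in> carrier_vec (d i)" "\<theta> i v = \<theta> i w" for i v w
    using thb[OF that(1)] that by (auto simp: bij_betw_def inj_on_def)
  have th_inv: "inv_into (carrier_vec (d i)) (\<theta> i) y \<in> carrier_vec (d i)"
    "\<theta> i (inv_into (carrier_vec (d i)) (\<theta> i) y) = y" if "i \<in> verts Q" "y \<in> gr M (carrier M) i" for i y
    using thb[OF that(1)] that(2) by (auto simp: bij_betw_def inv_into_into f_inv_into_f)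
  have ar_gr: "ar \<alpha> \<odot>\<^bsub>M\<^esub> y \<in> gr M (carrier M) (head Q \<alpha>)" if "\<alpha> \<in> arcs Q" "y \<in> carrier M" for \<alpha> y
    using vx_ar_smult[OF M that(2,1), of "head Q \<alpha>"] that by (simp add: gr_eq[OF M sM] M.smult_closed)
  \<comment> \<open>The matrix of an arrow in the chosen coordinates: go to the module, act, and
    return by the inverse of the coordinate map at the head.\<close>
  have "\<exists>A \<in> carrier_mat (d (head Q \<alpha>)) (d (tail Q \<alpha>)).
      \<forall>v\<in>carrier_vec (d (tail Q \<alpha>)). \<theta> (head Q \<alpha>) (A *\<^sub>v v) = ar \<alpha> \<odot>\<^bsub>M\<^esub> \<theta> (tail Q \<alpha>) v" if a: "\<alpha> \<in> arcs Q" for \<alpha>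
  proof -
    let ?h = "head Q \<alpha>" and ?t = "tail Q \<alpha>"
    have ht: "?h \<in> verts Q" "?t \<in> verts Q" using a by auto
    let ?f = "\<lambda>v. inv_into (carrier_vec (d ?h)) (\<theta> ?h) (ar \<alpha> \<odot>\<^bsub>M\<^esub> \<theta> ?t v)"
    have fc: "?f v \<in> carrier_vec (d ?h)" "\<theta> ?h (?f v) = ar \<alpha> \<odot>\<^bsub>M\<^esub> \<theta> ?t v" if "v \<in> carrier_vec (d ?t)" for v
      using th_inv[OF ht(1) ar_gr[OF a grc(1)[OF ht(2) th_gr[OF ht(2) that]]]] by auto
    have "?f \<in> module_hom class_ring (module_vec TYPE('k) (d ?t)) (module_vec TYPE('k) (d ?h))"
      unfolding module_hom_def
    proof (safe)
      fix v :: "'k vec" assume "v \<in> carrier (module_vec TYPE('k) (d ?t))"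
      then have v: "v \<in> carrier_vec (d ?t)" by (simp add: module_vec_simps)
      then show "?f v \<in> carrier (module_vec TYPE('k) (d ?h))" using fc by (simp add: module_vec_simps)
      fix w :: "'k vec" assume "w \<in> carrier (module_vec TYPE('k) (d ?t))"
      then have w: "w \<in> carrier_vec (d ?t)" by (simp add: module_vec_simps)
      have "\<theta> ?h (?f (v + w)) = ar \<alpha> \<odot>\<^bsub>M\<^esub> \<theta> ?t (v + w)"
        using v w by (intro fc(2)) simp
      also have "\<dots> = ar \<alpha> \<odot>\<^bsub>M\<^esub> \<theta> ?t v \<oplus>\<^bsub>M\<^esub> ar \<alpha> \<odot>\<^bsub>M\<^esub> \<theta> ?t w"
        using v w a grc(1)[OF ht(2) th_gr[OF ht(2)]] by (simp add: th_add[OF ht(2)] M.smult_r_distr)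
      also have "\<dots> = \<theta> ?h (?f v) \<oplus>\<^bsub>M\<^esub> \<theta> ?h (?f w)"
        by (simp only: fc(2)[OF v] fc(2)[OF w])
      also have "\<dots> = \<theta> ?h (?f v + ?f w)"
        by (rule th_add[OF ht(1) fc(1)[OF v] fc(1)[OF w], symmetric])
      finally have "\<theta> ?h (?f (v + w)) = \<theta> ?h (?f v + ?f w)" .
      then have "?f (v + w) = ?f v + ?f w"
        by (rule th_inj[OF ht(1) fc(1)[OF add_carrier_vec[OF v w]] add_carrier_vec[OF fc(1)[OF v] fc(1)[OF w]]])
      then show "?f (v \<oplus>\<^bsub>module_vec TYPE('k) (d ?t)\<^esub> w) = ?f v \<oplus>\<^bsub>module_vec TYPE('k) (d ?h)\<^esub> ?f w"
        by (simp add: module_vec_simps)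
    next
      fix c :: 'k and v :: "'k vec" assume "v \<in> carrier (module_vec TYPE('k) (d ?t))"
      then have v: "v \<in> carrier_vec (d ?t)" by (simp add: module_vec_simps)
      have tc: "\<theta> ?t v \<in> carrier M" using grc(1)[OF ht(2) th_gr[OF ht(2) v]] .
      have e: "ar \<alpha> \<odot>\<^bsub>M\<^esub> (sc c \<odot>\<^bsub>M\<^esub> \<theta> ?t v) = sc c \<odot>\<^bsub>M\<^esub> (ar \<alpha> \<odot>\<^bsub>M\<^esub> \<theta> ?t v)"
        using M.smult_assoc[of "ar \<alpha>" "sc c" "\<theta> ?t v"] M.smult_assoc[of "sc c" "ar \<alpha>" "\<theta> ?t v"] a tc
        by (simp add: sc_comm)
      note v' = smult_carrier_vec[THEN iffD2, OF v, of c]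
      have "\<theta> ?h (?f (c \<cdot>\<^sub>v v)) = ar \<alpha> \<odot>\<^bsub>M\<^esub> \<theta> ?t (c \<cdot>\<^sub>v v)" by (rule fc(2)[OF v'])
      also have "\<dots> = ar \<alpha> \<odot>\<^bsub>M\<^esub> (sc c \<odot>\<^bsub>M\<^esub> \<theta> ?t v)" by (simp only: th_sc[OF ht(2) v])
      also have "\<dots> = sc c \<odot>\<^bsub>M\<^esub> \<theta> ?h (?f v)" by (simp only: e fc(2)[OF v])
      also have "\<dots> = \<theta> ?h (c \<cdot>\<^sub>v ?f v)" by (simp only: th_sc[OF ht(1) fc(1)[OF v]])
      finally have "?f (c \<cdot>\<^sub>v v) = c \<cdot>\<^sub>v ?f v"
        by (rule th_inj[OF ht(1) fc(1)[OF v'] smult_carrier_vec[THEN iffD2, OF fc(1)[OF v]]])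
      then show "?f (c \<odot>\<^bsub>module_vec TYPE('k) (d ?t)\<^esub> v) = c \<odot>\<^bsub>module_vec TYPE('k) (d ?h)\<^esub> ?f v"
        by (simp add: module_vec_simps)
    qed
    from linear_eq_mat_mult[OF this] obtain A where A: "A \<in> carrier_mat (d ?h) (d ?t)"
      "\<And>v. v \<in> carrier_vec (d ?t) \<Longrightarrow> ?f v = A *\<^sub>v v" by blast
    have "\<theta> ?h (A *\<^sub>v v) = ar \<alpha> \<odot>\<^bsub>M\<^esub> \<theta> ?t v" if "v \<in> carrier_vec (d ?t)" for v
      using A(2)[OF that] fc(2)[OF that] by simp
    then show ?thesis using A(1) by blast
  qed
  then obtain x0 where x0: "\<And>\<alpha>. \<alpha> \<in> arcs Q \<Longrightarrow> x0 \<alpha> \<in> carrier_mat (d (head Q \<alpha>)) (d (tail Q \<alpha>))"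
    "\<And>\<alpha> v. \<alpha> \<in> arcs Q \<Longrightarrow> v \<in> carrier_vec (d (tail Q \<alpha>)) \<Longrightarrow>
      \<theta> (head Q \<alpha>) (x0 \<alpha> *\<^sub>v v) = ar \<alpha> \<odot>\<^bsub>M\<^esub> \<theta> (tail Q \<alpha>) v"
    by metis
  \<comment> \<open>Points of \<open>rep_ambient\<close> are undefined off the arrows, so the chosen
    matrices have to be restricted.\<close>
  define x where "x = restrict x0 (arcs Q)"
  have xa: "x \<in> rep_ambient Q d" using x0(1) by (auto simp: x_def rep_ambient_def)
  have th_x: "\<theta> (head Q \<alpha>) (x \<alpha> *\<^sub>v v) = ar \<alpha> \<odot>\<^bsub>M\<^esub> \<theta> (tail Q \<alpha>) v"
    if "\<alpha> \<in> arcs Q" "v \<in> carrier_vec (d (tail Q \<alpha>))" for \<alpha> v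
    using x0(2)[OF that] that(1) by (simp add: x_def)
  have x: "x \<in> rep_variety Q I d"
    unfolding rep_variety_iff
  proof (intro conjI ballI impI xa)
    fix \<alpha> \<beta> assume ab: "\<alpha> \<in> arcs Q" "\<beta> \<in> arcs Q" "head Q \<alpha> = tail Q \<beta>"
    note c = rep_ambientD[OF xa ab(1)] rep_ambientD[OF xa ab(2)]
    show "x \<beta> * x \<alpha> = 0\<^sub>m (d (head Q \<beta>)) (d (tail Q \<alpha>))"
    proof (rule mat_eq_of_mult_vec)
      show "x \<beta> * x \<alpha> \<in> carrier_mat (d (head Q \<beta>)) (d (tail Q \<alpha>))"
        using c ab(3) by auto
      fix v :: "'k vec" assume v: "v \<in> carrier_vec (d (tail Q \<alpha>))"
      have xv: "x \<alpha> *\<^sub>v v \<in> carrier_vec (d (tail Q \<beta>))" using c(1) v ab(3) by auto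
      have tv: "\<theta> (tail Q \<alpha>) v \<in> carrier M" using grc(1)[OF _ th_gr[OF _ v]] ab(1) by simp
      have "\<theta> (head Q \<beta>) (x \<beta> *\<^sub>v (x \<alpha> *\<^sub>v v)) = ar \<beta> \<odot>\<^bsub>M\<^esub> (ar \<alpha> \<odot>\<^bsub>M\<^esub> \<theta> (tail Q \<alpha>) v)"
        using th_x[OF ab(2) xv] th_x[OF ab(1) v] ab(3) by simp
      also have "\<dots> = \<theta> (head Q \<beta>) (0\<^sub>v (d (head Q \<beta>)))"
        using M.smult_assoc[of "ar \<beta>" "ar \<alpha>" "\<theta> (tail Q \<alpha>) v"] ab tv
        by (simp add: ar_ar smult_zero_left[OF M] th_0)
      finally have "x \<beta> *\<^sub>v (x \<alpha> *\<^sub>v v) = 0\<^sub>v (d (head Q \<beta>))"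
        using c xv ab(2) by (intro th_inj[of "head Q \<beta>"]) auto
      then show "x \<beta> * x \<alpha> *\<^sub>v v = 0\<^sub>m (d (head Q \<beta>)) (d (tail Q \<alpha>)) *\<^sub>v v"
        using c v ab(3) by (simp add: zero_mat_mult_vec)
    qed simp
  qed
  have "\<exists>h \<in> module_hom L (rm d x) M. \<forall>m \<in> rep_space Q d. \<forall>j \<in> verts Q. vx j \<odot>\<^bsub>M\<^esub> h m = \<theta> j (m j)"
    by (rule rm_hom[OF M x]) (rule th_gr th_add th_sc th_x; assumption)+
  then obtain h where hom: "h \<in> module_hom L (rm d x) M"
    and hv: "\<And>m j. m \<in> rep_space Q d \<Longrightarrow> j \<in> verts Q \<Longrightarrow> vx j \<odot>\<^bsub>M\<^esub> h m = \<theta> j (m j)"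
    by blast
  have hc: "h m \<in> carrier M" if "m \<in> rep_space Q d" for m
    using module_homD(1)[OF hom] that by (simp add: rm_simps(1))
  have hI: "h m = n" if "m \<in> rep_space Q d" "n \<in> carrier M" "\<And>i. i \<in> verts Q \<Longrightarrow> \<theta> i (m i) = vx i \<odot>\<^bsub>M\<^esub> n" for m n
    using that hv by (intro vx_eqI[OF M hc]) auto
  have "inj_on h (rep_space Q d)"
  proof (rule inj_onI)
    fix m n assume mn: "m \<in> rep_space Q d" "n \<in> rep_space Q d" "h m = h n"
    show "m = n"
    proof (rule rep_space_eqI[OF mn(1,2)])
      fix i assume i: "i \<in> verts Q"
      show "m i = n i" using hv[OF mn(1) i] hv[OF mn(2) i] mn(3)
        by (intro th_inj[OF i rep_spaceD[OF mn(1) i] rep_spaceD[OF mn(2) i]]) simp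
    qed
  qed
  moreover have "h ` rep_space Q d = carrier M"
  proof
    show "h ` rep_space Q d \<subseteq> carrier M" using hc by auto
    show "carrier M \<subseteq> h ` rep_space Q d"
    proof
      fix n assume n: "n \<in> carrier M"
      let ?m = "\<lambda>i\<in>verts Q. inv_into (carrier_vec (d i)) (\<theta> i) (vx i \<odot>\<^bsub>M\<^esub> n)"
      have g: "vx i \<odot>\<^bsub>M\<^esub> n \<in> gr M (carrier M) i" for i using n by (auto simp: gr_def)
      have m: "?m \<in> rep_space Q d" using th_inv(1)[OF _ g] by (intro rep_spaceI) auto
      have "h ?m = n" using th_inv(2)[OF _ g] n by (intro hI[OF m]) auto
      then show "n \<in> h ` rep_space Q d" by (rule rev_image_eqI[OF m, OF sym])
    qed
  qed
  ultimately show thesis using that[OF x hom] by (simp add: bij_betw_def)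
qed

end

section \<open>Semisimple modules and tops\<close>

context rad_square_zero
begin

interpretation D: fin_digraph Q by (rule fin_digraph)

text \<open>Annihilation by J, tested on the arrows. By \<open>killed_rad_zero\<close> it means that
  the radical is zero; semisimple modules have this property.\<close>

definition killed :: "('v,'a,'k,'m) quiver_module \<Rightarrow> bool" where
  "killed M \<longleftrightarrow> (\<forall>\<alpha>\<in>arcs Q. \<forall>m\<in>carrier M. ar \<alpha> \<odot>\<^bsub>M\<^esub> m = \<zero>\<^bsub>M\<^esub>)"

definition zero_rep :: "('v \<Rightarrow> nat) \<Rightarrow> 'a \<Rightarrow> 'k mat" where
  "zero_rep d = (\<lambda>\<alpha>\<in>arcs Q. 0\<^sub>m (d (head Q \<alpha>)) (d (tail Q \<alpha>)))"

lemma zero_rep_variety: "zero_rep d \<in> rep_variety Q I d"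
  unfolding rep_variety_iff by (auto simp: zero_rep_def rep_ambient_def)

text \<open>The matrices of a killed module must all vanish. Hence its dimension vector determines
  it up to isomorphism.\<close>

lemma killed_coordinates:
  fixes M :: "('v,'a,'k,'m) quiver_module"
  assumes fd: "fd_module Q I M" and k: "killed M" and d: "\<And>i. i \<in> verts Q \<Longrightarrow> dv M i = d i"
  obtains h where "h \<in> module_hom L (rm d (zero_rep d)) M" "bij_betw h (rep_space Q d) (carrier M)"
proof -
  note M = fd_moduleD(1)[OF fd]
  obtain x h where x: "x \<in> rep_variety Q I d" and h: "h \<in> module_hom L (rm d x) M"
    and b: "bij_betw h (rep_space Q d) (carrier M)"
    using module_coordinates[OF fd d] by blast
  note xa = rep_variety_ambient[OF x] and lm = rm_left_module[OF x]
  have "x \<alpha> = 0\<^sub>m (d (head Q \<alpha>)) (d (tail Q \<alpha>))" if a: "\<alpha> \<in> arcs Q" for \<alpha>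
  proof (rule mat_eq_of_mult_vec[OF rep_ambientD[OF xa a]])
    fix v :: "'k vec" assume v: "v \<in> carrier_vec (d (tail Q \<alpha>))"
    let ?m = "\<lambda>j\<in>verts Q. if j = tail Q \<alpha> then v else 0\<^sub>v (d j)"
    have m: "?m \<in> rep_space Q d" using v by (intro rep_spaceI) auto
    have am: "ar \<alpha> \<odot>\<^bsub>rm d x\<^esub> ?m \<in> rep_space Q d" and zm: "\<zero>\<^bsub>rm d x\<^esub> \<in> rep_space Q d"
      using submoduleD[OF submodule_carrier[OF lm]] m a by (auto simp: rm_simps(1))
    have "h (ar \<alpha> \<odot>\<^bsub>rm d x\<^esub> ?m) = ar \<alpha> \<odot>\<^bsub>M\<^esub> h ?m"
      using module_homD(3)[OF h, of "ar \<alpha>" ?m] a m by (simp add: rm_simps(1))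
    also have "\<dots> = h \<zero>\<^bsub>rm d x\<^esub>"
      using k a module_homD(1)[OF h, of ?m] m hom_zero[OF lm M h] by (simp add: killed_def rm_simps(1))
    finally have "ar \<alpha> \<odot>\<^bsub>rm d x\<^esub> ?m = \<zero>\<^bsub>rm d x\<^esub>"
      using b am zm by (meson bij_betw_def inj_onD)
    then have "(ar \<alpha> \<odot>\<^bsub>rm d x\<^esub> ?m) (head Q \<alpha>) = \<zero>\<^bsub>rm d x\<^esub> (head Q \<alpha>)" by simp
    then show "x \<alpha> *\<^sub>v v = 0\<^sub>m (d (head Q \<alpha>)) (d (tail Q \<alpha>)) *\<^sub>v v"
      using a v by (simp add: rm_ar[OF x m a] rm_simps zero_mat_mult_vec)
  qed simp
  then have "x = zero_rep d"
    using xa unfolding rep_ambient_def zero_rep_def by (intro ext) (auto simp: PiE_def extensional_def)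
  then show thesis using that h b by simp
qed

text \<open>With all arrows acting as zero, padding coordinate vectors by zeros is already a
  homomorphism. For killed modules this is the converse of \<open>dv_embeds\<close>.\<close>

lemma killed_embeds:
  assumes M: "fd_module Q I M" "killed M" and N: "fd_module Q I N" "killed N"
    and d: "\<And>i. i \<in> verts Q \<Longrightarrow> dv M i \<le> dv N i"
  shows "module_embeds L M N"
proof -
  let ?d = "dv M" and ?e = "dv N"
  let ?A = "rm ?d (zero_rep ?d)" and ?B = "rm ?e (zero_rep ?e)"
  note zd = zero_rep_variety[of ?d] and ze = zero_rep_variety[of ?e]
  obtain h where h: "h \<in> module_hom L ?A M" "bij_betw h (rep_space Q ?d) (carrier M)"
    using killed_coordinates[OF M] by blast
  obtain g where g: "g \<in> module_hom L ?B N" "bij_betw g (rep_space Q ?e) (carrier N)"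
    using killed_coordinates[OF N] by blast
  let ?p = "\<lambda>m. \<lambda>j\<in>verts Q. vec (?e j) (\<lambda>s. if s < ?d j then m j $ s else 0) :: 'k vec"
  have pc: "?p m \<in> rep_space Q ?e" for m by (intro rep_spaceI) simp
  have p: "?p \<in> module_hom L ?A ?B"
  proof (rule module_homI[OF rm_left_module[OF zd] rm_left_module[OF ze]], unfold rm_simps(1))
    fix m n :: "'v \<Rightarrow> 'k vec" assume m: "m \<in> rep_space Q ?d" and n: "n \<in> rep_space Q ?d"
    show "?p (m \<oplus>\<^bsub>?A\<^esub> n) = ?p m \<oplus>\<^bsub>?B\<^esub> ?p n"
      by (auto simp: rm_simps carrier_vecD[OF rep_spaceD[OF m]] carrier_vecD[OF rep_spaceD[OF n]] intro!: restrict_ext eq_vecI)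
  next
    fix c and m :: "'v \<Rightarrow> 'k vec" assume m: "m \<in> rep_space Q ?d"
    show "?p (sc c \<odot>\<^bsub>?A\<^esub> m) = sc c \<odot>\<^bsub>?B\<^esub> ?p m"
      unfolding rm_sc[OF zd m] rm_sc[OF ze pc] by (auto simp: carrier_vecD[OF rep_spaceD[OF m]] intro!: restrict_ext eq_vecI)
  next
    fix i and m :: "'v \<Rightarrow> 'k vec" assume i: "i \<in> verts Q" and m: "m \<in> rep_space Q ?d"
    show "?p (vx i \<odot>\<^bsub>?A\<^esub> m) = vx i \<odot>\<^bsub>?B\<^esub> ?p m"
      unfolding rm_vx[OF zd m i] rm_vx[OF ze pc i] using i by (auto simp: carrier_vecD[OF rep_spaceD[OF m]] intro!: restrict_ext eq_vecI)
  next
    fix \<alpha> and m :: "'v \<Rightarrow> 'k vec" assume a: "\<alpha> \<in> arcs Q" and m: "m \<in> rep_space Q ?d"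
    have "zero_rep ?d \<alpha> *\<^sub>v m (tail Q \<alpha>) = 0\<^sub>v (?d (head Q \<alpha>))"
      "zero_rep ?e \<alpha> *\<^sub>v ?p m (tail Q \<alpha>) = 0\<^sub>v (?e (head Q \<alpha>))"
      using a rep_spaceD[OF m, of "tail Q \<alpha>"] rep_spaceD[OF pc, of "tail Q \<alpha>" m] by (simp_all add: zero_rep_def zero_mat_mult_vec)
    then show "?p (ar \<alpha> \<odot>\<^bsub>?A\<^esub> m) = ar \<alpha> \<odot>\<^bsub>?B\<^esub> ?p m"
      unfolding rm_ar[OF zd m a] rm_ar[OF ze pc a] using d by (auto intro!: restrict_ext eq_vecI)
  qed (rule pc)
  have "inj_on ?p (rep_space Q ?d)"
  proof (rule inj_onI)
    fix m n assume m: "m \<in> rep_space Q ?d" and n: "n \<in> rep_space Q ?d" and e: "?p m = ?p n"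
    show "m = n"
    proof (rule rep_space_eqI[OF m n])
      fix i assume i: "i \<in> verts Q"
      show "m i = n i"
      proof (rule eq_vecI)
        fix s assume "s < dim_vec (n i)"
        then have s: "s < ?d i" "s < ?e i" using rep_spaceD[OF n i] d[OF i] by auto
        have "?p m i $ s = ?p n i $ s" using e by simp
        then show "m i $ s = n i $ s" using s i by simp
      qed (use rep_spaceD[OF m i] rep_spaceD[OF n i] in simp)
    qed
  qed
  note pi = this
  have hi: "inv_into (carrier ?A) h \<in> module_hom L M ?A" "bij_betw (inv_into (rep_space Q ?d) h) (carrier M) (rep_space Q ?d)"
    using hom_inverse[OF rm_left_module[OF zd] h(1)] h(2) bij_betw_inv_into[OF h(2)] by (auto simp: rm_simps(1))
  have f1: "inj_on (\<lambda>x. g (?p (inv_into (rep_space Q ?d) h x))) (carrier M)"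
  proof (rule inj_onI)
    let ?k = "inv_into (rep_space Q ?d) h"
    fix x y assume x: "x \<in> carrier M" and y: "y \<in> carrier M" and e: "g (?p (?k x)) = g (?p (?k y))"
    have "?p (?k x) = ?p (?k y)" using inj_onD[OF bij_betw_imp_inj_on[OF g(2)] e pc pc] .
    then have "?k x = ?k y" by (rule inj_onD[OF pi]) (use bij_betwE[OF hi(2)] x y in auto)
    then show "x = y" by (rule inj_onD[OF bij_betw_imp_inj_on[OF hi(2)] _ x y])
  qed
  have f2: "(\<lambda>x. g (?p (inv_into (rep_space Q ?d) h x))) \<in> module_hom L M N"
    by (rule hom_comp[OF hom_comp[OF hi(1)[unfolded rm_simps(1)] p] g(1)])
  show ?thesis unfolding module_embeds_def by (rule bexI, rule f1, rule f2)
qed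

lemma killed_rad: "left_module L M \<Longrightarrow> killed (submod M (rad L M))"
  using rad_rad by (auto simp: killed_def)

lemma killed_rad_zero:
  assumes M: "left_module L M"
  shows "killed M \<longleftrightarrow> rad L M = {\<zero>\<^bsub>M\<^esub>}"
proof -
  interpret M: left_module L M by fact
  have z: "Module.submodule {\<zero>\<^bsub>M\<^esub>} L M"
    by (rule submoduleI[OF M]) (auto simp: smult_zero_right[OF M])
  show ?thesis
  proof
    assume "killed M"
    then have "rad L M \<subseteq> {\<zero>\<^bsub>M\<^esub>}" by (intro rad_least[OF M z]) (auto simp: killed_def)
    then show "rad L M = {\<zero>\<^bsub>M\<^esub>}" using submoduleD(2)[OF rad_submodule[OF M]] by auto
  next
    assume "rad L M = {\<zero>\<^bsub>M\<^esub>}"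
    then show "killed M" using rad_mem[of _ _ M] by (auto simp: killed_def)
  qed
qed

lemma line_submodule:
  assumes M: "left_module L M" and v: "v \<in> carrier M" and i: "i \<in> verts Q" and vi: "vx i \<odot>\<^bsub>M\<^esub> v = v"
    and k: "\<And>\<alpha>. \<alpha> \<in> arcs Q \<Longrightarrow> ar \<alpha> \<odot>\<^bsub>M\<^esub> v = \<zero>\<^bsub>M\<^esub>"
  shows "Module.submodule (range (\<lambda>c. sc c \<odot>\<^bsub>M\<^esub> v)) L M"
proof -
  interpret M: left_module L M by fact
  have z: "\<zero>\<^bsub>M\<^esub> = sc 0 \<odot>\<^bsub>M\<^esub> v"
    using smult_zero_left[OF M v] by (simp add: sc_eq cls_null)
  have comm: "X \<odot>\<^bsub>M\<^esub> (sc c \<odot>\<^bsub>M\<^esub> v) = sc c \<odot>\<^bsub>M\<^esub> (X \<odot>\<^bsub>M\<^esub> v)" if "X \<in> carrier L" for X c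
    using M.smult_assoc[of X "sc c" v] M.smult_assoc[of "sc c" X v] that v by (simp add: sc_comm)
  show ?thesis
  proof (rule submoduleI[OF M])
    show "range (\<lambda>c. sc c \<odot>\<^bsub>M\<^esub> v) \<subseteq> carrier M" using v by (auto intro: M.smult_closed)
    show "\<zero>\<^bsub>M\<^esub> \<in> range (\<lambda>c. sc c \<odot>\<^bsub>M\<^esub> v)" using z by blast
    fix x y assume "x \<in> range (\<lambda>c. sc c \<odot>\<^bsub>M\<^esub> v)" "y \<in> range (\<lambda>c. sc c \<odot>\<^bsub>M\<^esub> v)"
    then obtain c e where "x = sc c \<odot>\<^bsub>M\<^esub> v" "y = sc e \<odot>\<^bsub>M\<^esub> v" by auto
    then have "x \<oplus>\<^bsub>M\<^esub> y = sc (c + e) \<odot>\<^bsub>M\<^esub> v" using v by (simp add: sc_add M.smult_l_distr)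
    then show "x \<oplus>\<^bsub>M\<^esub> y \<in> range (\<lambda>c. sc c \<odot>\<^bsub>M\<^esub> v)" by blast
  next
    fix e x assume "x \<in> range (\<lambda>c. sc c \<odot>\<^bsub>M\<^esub> v)"
    then obtain c where "x = sc c \<odot>\<^bsub>M\<^esub> v" by auto
    then have "sc e \<odot>\<^bsub>M\<^esub> x = sc (e * c) \<odot>\<^bsub>M\<^esub> v" using v by (simp add: sc_mult M.smult_assoc)
    then show "sc e \<odot>\<^bsub>M\<^esub> x \<in> range (\<lambda>c. sc c \<odot>\<^bsub>M\<^esub> v)" by blast
  next
    fix j x assume j: "j \<in> verts Q" and "x \<in> range (\<lambda>c. sc c \<odot>\<^bsub>M\<^esub> v)"
    then obtain c where x: "x = sc c \<odot>\<^bsub>M\<^esub> v" by auto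
    have "vx j \<odot>\<^bsub>M\<^esub> v = (if i = j then v else \<zero>\<^bsub>M\<^esub>)"
      using M.smult_assoc[of "vx j" "vx i" v] v i j vi by (cases "i = j") (simp_all add: vx_vx smult_zero_left[OF M])
    then have "vx j \<odot>\<^bsub>M\<^esub> x = (if i = j then x else \<zero>\<^bsub>M\<^esub>)"
      using comm[of "vx j" c] j by (cases "i = j") (simp_all add: x smult_zero_right[OF M])
    then show "vx j \<odot>\<^bsub>M\<^esub> x \<in> range (\<lambda>c. sc c \<odot>\<^bsub>M\<^esub> v)" using x z by (cases "i = j") auto
  next
    fix \<alpha> x assume a: "\<alpha> \<in> arcs Q" and "x \<in> range (\<lambda>c. sc c \<odot>\<^bsub>M\<^esub> v)"
    then obtain c where x: "x = sc c \<odot>\<^bsub>M\<^esub> v" by auto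
    have "ar \<alpha> \<odot>\<^bsub>M\<^esub> x = \<zero>\<^bsub>M\<^esub>" using comm[of "ar \<alpha>" c] a by (simp add: x k smult_zero_right[OF M])
    then show "ar \<alpha> \<odot>\<^bsub>M\<^esub> x \<in> range (\<lambda>c. sc c \<odot>\<^bsub>M\<^esub> v)" using z by simp
  qed
qed

text \<open>If JS were nonzero it would be all of S, and then \<open>rad_rad\<close> would make
  every arrow vanish on S, so that JS = 0 after all. Once S is killed, any nonzero vertex component
  of an element spans a submodule, which must be S.\<close>

lemma simple_moduleE:
  assumes S: "simple_module L S"
  obtains i v where "i \<in> verts Q" "v \<in> carrier S" "v \<noteq> \<zero>\<^bsub>S\<^esub>" "vx i \<odot>\<^bsub>S\<^esub> v = v" "killed S"
    "carrier S = range (\<lambda>c. sc c \<odot>\<^bsub>S\<^esub> v)"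
proof -
  have M: "left_module L S" and ne: "carrier S \<noteq> {\<zero>\<^bsub>S\<^esub>}"
    and sub: "\<And>N. Module.submodule N L S \<Longrightarrow> N = {\<zero>\<^bsub>S\<^esub>} \<or> N = carrier S"
    using S by (auto simp: simple_module_def)
  interpret M: left_module L S by fact
  have k: "killed S"
    unfolding killed_rad_zero[OF M]
  proof (rule ccontr)
    assume "rad L S \<noteq> {\<zero>\<^bsub>S\<^esub>}"
    then have r: "rad L S = carrier S" using sub[OF rad_submodule[OF M]] by simp
    then have "killed S" using rad_rad[OF M] by (auto simp: killed_def)
    then show False using \<open>rad L S \<noteq> {\<zero>\<^bsub>S\<^esub>}\<close> killed_rad_zero[OF M] by simp
  qed
  obtain x where x: "x \<in> carrier S" "x \<noteq> \<zero>\<^bsub>S\<^esub>" using ne M.M.zero_closed by blast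
  have z: "Module.submodule {\<zero>\<^bsub>S\<^esub>} L S"
    by (rule submoduleI[OF M]) (auto simp: smult_zero_right[OF M])
  obtain i where i: "i \<in> verts Q" "vx i \<odot>\<^bsub>S\<^esub> x \<noteq> \<zero>\<^bsub>S\<^esub>"
    using mem_submodule_vertex[OF M z x(1)] x(2) by blast
  let ?v = "vx i \<odot>\<^bsub>S\<^esub> x"
  have v: "?v \<in> carrier S" "vx i \<odot>\<^bsub>S\<^esub> ?v = ?v"
    using i x M.smult_closed M.smult_assoc[of "vx i" "vx i" x] by (auto simp: vx_vx)
  have "Module.submodule (range (\<lambda>c. sc c \<odot>\<^bsub>S\<^esub> ?v)) L S"
    using k v(1) by (intro line_submodule[OF M v(1) i(1) v(2)]) (simp add: killed_def)
  moreover have "sc 1 \<odot>\<^bsub>S\<^esub> ?v \<in> range (\<lambda>c. sc c \<odot>\<^bsub>S\<^esub> ?v)" by blast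
  then have "?v \<in> range (\<lambda>c. sc c \<odot>\<^bsub>S\<^esub> ?v)" using v(1) by (simp add: sc_one M.smult_one)
  ultimately have "carrier S = range (\<lambda>c. sc c \<odot>\<^bsub>S\<^esub> ?v)" using sub i(2) by blast
  then show thesis using that[OF i(1) v(1) i(2) v(2) k] by simp
qed

lemma semisimple_killed:
  assumes T: "semisimple_module L T"
  shows "killed T"
proof -
  have M: "left_module L T"
    and gen: "generate (add_monoid T) (\<Union>{N. Module.submodule N L T \<and> simple_module L (submod T N)}) = carrier T"
    using T by (auto simp: semisimple_module_def)
  interpret M: left_module L T by fact
  have "x \<in> {x \<in> carrier T. \<forall>\<alpha>\<in>arcs Q. ar \<alpha> \<odot>\<^bsub>T\<^esub> x = \<zero>\<^bsub>T\<^esub>}"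
    if "x \<in> generate (add_monoid T) (\<Union>{N. Module.submodule N L T \<and> simple_module L (submod T N)})" for x
    using that
  proof (induction rule: generate.induct)
    case one
    then show ?case using smult_zero_right[OF M] by simp
  next
    case (incl h)
    then obtain N where N: "Module.submodule N L T" "simple_module L (submod T N)" "h \<in> N" by auto
    have "killed (submod T N)" by (rule simple_moduleE[OF N(2)])
    then show ?case using N(3) submoduleD(1)[OF N(1)] by (auto simp: killed_def)
  next
    case (inv h)
    then obtain N where N: "Module.submodule N L T" "simple_module L (submod T N)" "h \<in> N" by auto
    have hc: "h \<in> carrier T" using N submoduleD(1)[OF N(1)] by blast
    have "sc (-1) \<odot>\<^bsub>T\<^esub> h \<in> N" by (rule submoduleD(4)[OF N(1) _ N(3)]) simp
    moreover have "inv\<^bsub>add_monoid T\<^esub> h = sc (-1) \<odot>\<^bsub>T\<^esub> h" using a_inv_smult[OF M hc] by (simp add: a_inv_def)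
    moreover have "killed (submod T N)" by (rule simple_moduleE[OF N(2)])
    ultimately show ?case using submoduleD(1)[OF N(1)] by (auto simp: killed_def)
  next
    case (eng h1 h2)
    then show ?case by (auto simp: M.smult_r_distr)
  qed
  then show ?thesis unfolding gen killed_def by blast
qed

lemma dv_line:
  assumes M: "fd_module Q I M" and S: "Module.submodule S L M" and i: "i \<in> verts Q" and v: "v \<in> S" "v \<noteq> \<zero>\<^bsub>M\<^esub>"
    "vx i \<odot>\<^bsub>M\<^esub> v = v" and r: "S = range (\<lambda>c. sc c \<odot>\<^bsub>M\<^esub> v)" and j: "j \<in> verts Q"
  shows "dv (submod M S) j = (if j = i then 1 else 0)"
proof -
  note M' = fd_moduleD(1)[OF M]
  interpret M: left_module L M by (rule M')
  interpret V: vectorspace class_ring "K_space Q I M" by (rule K_space_vectorspace[OF M'])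
  have vc: "v \<in> carrier M" using v(1) submoduleD(1)[OF S] by blast
  have comm: "vx j \<odot>\<^bsub>M\<^esub> (sc c \<odot>\<^bsub>M\<^esub> v) = sc c \<odot>\<^bsub>M\<^esub> (vx j \<odot>\<^bsub>M\<^esub> v)" for c
    using M.smult_assoc[of "vx j" "sc c" v] M.smult_assoc[of "sc c" "vx j" v] vc j by (simp add: sc_comm)
  show ?thesis
  proof (cases "j = i")
    case True
    have "gr M S j = S" unfolding gr_eq[OF M' S j] using comm v(3) True by (auto simp: r)
    moreover have "S = V.span {v}"
      using V.finite_span[of "{v}"] vc M.M.r_zero M.smult_closed by (auto simp: r V.lincomb_def)
    moreover have "V.lin_indpt {v}"
    proof -
      have "c = 0" if "sc c \<odot>\<^bsub>M\<^esub> v = \<zero>\<^bsub>M\<^esub>" for c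
      proof (rule ccontr)
        assume "c \<noteq> 0"
        then have "v = sc (inverse c) \<odot>\<^bsub>M\<^esub> (sc c \<odot>\<^bsub>M\<^esub> v)"
          using M.smult_assoc[of "sc (inverse c)" "sc c" v] vc by (simp add: sc_mult[symmetric] sc_one M.smult_one)
        then show False using that v(2) smult_zero_right[OF M'] by simp
      qed
      then show ?thesis using vc M.smult_closed by (intro V.finite_lin_indpt2) (auto simp: V.lincomb_def)
    qed
    ultimately show ?thesis using V.dim_span_indpt[of "{v}"] vc True by (simp add: dv_submod)
  next
    case False
    have "vx j \<odot>\<^bsub>M\<^esub> v = \<zero>\<^bsub>M\<^esub>"
      using M.smult_assoc[of "vx j" "vx i" v] vc i j v(3) False by (simp add: vx_vx smult_zero_left[OF M'])
    then have "vx j \<odot>\<^bsub>M\<^esub> x = \<zero>\<^bsub>M\<^esub>" if "x \<in> S" for x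
      using comm that by (auto simp: r smult_zero_right[OF M'])
    then have "gr M S j = {\<zero>\<^bsub>M\<^esub>}" using v(1) by (force simp: gr_def)
    moreover have "gr M {\<zero>\<^bsub>M\<^esub>} j = {\<zero>\<^bsub>M\<^esub>}" using smult_zero_right[OF M' gens_closed(1)[OF j]] by (simp add: gr_def)
    ultimately show ?thesis using dv_zero[OF M' j] False by (simp add: dv_submod)
  qed
qed

lemma simple_line:
  assumes M: "left_module L M" and v: "v \<in> carrier M" "v \<noteq> \<zero>\<^bsub>M\<^esub>" and i: "i \<in> verts Q" and vi: "vx i \<odot>\<^bsub>M\<^esub> v = v"
    and k: "\<And>\<alpha>. \<alpha> \<in> arcs Q \<Longrightarrow> ar \<alpha> \<odot>\<^bsub>M\<^esub> v = \<zero>\<^bsub>M\<^esub>"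
  shows "simple_module L (submod M (range (\<lambda>c. sc c \<odot>\<^bsub>M\<^esub> v)))" (is "simple_module L (submod M ?S)")
proof -
  interpret M: left_module L M by fact
  have S: "Module.submodule ?S L M" by (rule line_submodule[OF M v(1) i vi k])
  have vS: "v \<in> ?S"
  proof -
    have "v = sc 1 \<odot>\<^bsub>M\<^esub> v" using v(1) by (simp add: sc_one M.smult_one)
    then show ?thesis by blast
  qed
  have "N = {\<zero>\<^bsub>M\<^esub>} \<or> N = ?S" if N: "Module.submodule N L (submod M ?S)" for N
  proof (rule disjCI)
    note N' = submoduleD[OF N]
    assume "N \<noteq> ?S"
    have zN: "x = \<zero>\<^bsub>M\<^esub>" if x: "x \<in> N" for x
    proof (rule ccontr)
      assume nz: "x \<noteq> \<zero>\<^bsub>M\<^esub>"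
      obtain c where c: "x = sc c \<odot>\<^bsub>M\<^esub> v" using N'(1) x by auto
      have c0: "c \<noteq> 0" using nz smult_zero_left[OF M v(1)] by (auto simp: c sc_eq cls_null)
      have "?S \<subseteq> N"
      proof
        fix y assume "y \<in> ?S"
        then obtain e where e: "y = sc e \<odot>\<^bsub>M\<^esub> v" by auto
        have "y = sc (e * inverse c) \<odot>\<^bsub>M\<^esub> x"
        proof -
          have "e * inverse c * c = e" using c0 by simp
          then have "sc (e * inverse c) \<otimes>\<^bsub>L\<^esub> sc c = sc e" by (simp only: sc_mult[symmetric])
          then show ?thesis using v(1) M.smult_assoc[of "sc (e * inverse c)" "sc c" v] by (simp add: e c)
        qed
        then show "y \<in> N" using N'(4)[of "sc (e * inverse c)" x] x by simp
      qed
      then show False using N'(1) \<open>N \<noteq> ?S\<close> by auto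
    qed
    show "N = {\<zero>\<^bsub>M\<^esub>}"
    proof
      show "N \<subseteq> {\<zero>\<^bsub>M\<^esub>}" using zN by (simp add: subset_iff)
      show "{\<zero>\<^bsub>M\<^esub>} \<subseteq> N" using N'(2) by simp
    qed
  qed
  moreover have "?S \<noteq> {\<zero>\<^bsub>M\<^esub>}" using vS v(2) by auto
  ultimately show ?thesis using submodule_left_module[OF M S] by (simp add: simple_module_def)
qed

lemma direct_sum_simps:
  "carrier (direct_sum M N) = carrier M \<times> carrier N" "\<zero>\<^bsub>direct_sum M N\<^esub> = (\<zero>\<^bsub>M\<^esub>, \<zero>\<^bsub>N\<^esub>)"
  "(a, b) \<oplus>\<^bsub>direct_sum M N\<^esub> (c, e) = (a \<oplus>\<^bsub>M\<^esub> c, b \<oplus>\<^bsub>N\<^esub> e)"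
  "X \<odot>\<^bsub>direct_sum M N\<^esub> (a, b) = (X \<odot>\<^bsub>M\<^esub> a, X \<odot>\<^bsub>N\<^esub> b)"
  by (simp_all add: direct_sum_def)

lemma direct_sum_left_module:
  assumes M: "left_module L M" and N: "left_module L N"
  shows "left_module L (direct_sum M N)"
proof -
  interpret M: left_module L M by fact
  interpret N: left_module L N by fact
  have "abelian_group (direct_sum M N)"
  proof (rule abelian_groupI)
    fix x assume "x \<in> carrier (direct_sum M N)"
    then obtain a b where x: "x = (a, b)" "a \<in> carrier M" "b \<in> carrier N" by (auto simp: direct_sum_simps)
    then have "(\<ominus>\<^bsub>M\<^esub> a, \<ominus>\<^bsub>N\<^esub> b) \<in> carrier (direct_sum M N)"
      "(\<ominus>\<^bsub>M\<^esub> a, \<ominus>\<^bsub>N\<^esub> b) \<oplus>\<^bsub>direct_sum M N\<^esub> x = \<zero>\<^bsub>direct_sum M N\<^esub>"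
      by (auto simp: direct_sum_simps M.M.l_neg N.M.l_neg)
    then show "\<exists>y\<in>carrier (direct_sum M N). y \<oplus>\<^bsub>direct_sum M N\<^esub> x = \<zero>\<^bsub>direct_sum M N\<^esub>" by blast
  next
    fix x y z assume "x \<in> carrier (direct_sum M N)" "y \<in> carrier (direct_sum M N)" "z \<in> carrier (direct_sum M N)"
    then show "(x \<oplus>\<^bsub>direct_sum M N\<^esub> y) \<oplus>\<^bsub>direct_sum M N\<^esub> z = x \<oplus>\<^bsub>direct_sum M N\<^esub> (y \<oplus>\<^bsub>direct_sum M N\<^esub> z)"
      by (cases x; cases y; cases z) (simp add: direct_sum_simps M.M.a_assoc N.M.a_assoc)
  next
    fix x y assume "x \<in> carrier (direct_sum M N)" "y \<in> carrier (direct_sum M N)"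
    then show "x \<oplus>\<^bsub>direct_sum M N\<^esub> y = y \<oplus>\<^bsub>direct_sum M N\<^esub> x"
      by (cases x; cases y) (simp add: direct_sum_simps M.M.a_comm N.M.a_comm)
  qed (auto simp: direct_sum_simps)
  then show ?thesis
    by (intro left_module.intro left_module_axioms.intro L.ring_axioms)
      (auto simp: direct_sum_simps M.smult_closed N.smult_closed M.smult_l_distr N.smult_l_distr
        M.smult_r_distr N.smult_r_distr M.smult_assoc N.smult_assoc M.smult_one N.smult_one)
qed

text \<open>The addition map from the external to the internal sum is injective since U and W meet
  in zero. Its inverse carries finite dimensionality over, and the second projection yields the
  dimensions.\<close>

lemma direct_sum_dv:
  assumes fd: "fd_module Q I M" and U: "Module.submodule U L M" and W: "Module.submodule W L M"
    and UW: "U \<inter> W = {\<zero>\<^bsub>M\<^esub>}"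
  shows "fd_module Q I (direct_sum (submod M U) (submod M W))"
    "\<And>i. i \<in> verts Q \<Longrightarrow> dv (direct_sum (submod M U) (submod M W)) i = dv (submod M U) i + dv (submod M W) i"
    "\<And>i. i \<in> verts Q \<Longrightarrow> dv (submod M (set_add M U W)) i = dv (submod M U) i + dv (submod M W) i"
proof -
  note M = fd_moduleD(1)[OF fd]
  interpret M: left_module L M by (rule M)
  note U' = submoduleD[OF U] and W' = submoduleD[OF W]
  note lU = submodule_left_module[OF M U] and lW = submodule_left_module[OF M W]
  let ?D = "direct_sum (submod M U) (submod M W)"
  note D = direct_sum_left_module[OF lU lW]
  let ?s = "\<lambda>p. fst p \<oplus>\<^bsub>M\<^esub> snd p"
  have inU: "x \<in> carrier M" if "x \<in> U" for x using U'(1) that by blast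
  have inW: "x \<in> carrier M" if "x \<in> W" for x using W'(1) that by blast
  have s: "?s \<in> module_hom L ?D M"
    using inU inW by (auto simp: module_hom_def direct_sum_simps M.M.a_ac M.smult_r_distr)
  have im: "?s ` carrier ?D = set_add M U W"
    by (auto simp: direct_sum_simps set_add_defs image_def)
  have "a = \<zero>\<^bsub>M\<^esub> \<and> b = \<zero>\<^bsub>M\<^esub>" if ab: "a \<in> U" "b \<in> W" "a \<oplus>\<^bsub>M\<^esub> b = \<zero>\<^bsub>M\<^esub>" for a b
  proof -
    have "a = \<ominus>\<^bsub>M\<^esub> b" using M.M.minus_equality[OF ab(3)] inU[OF ab(1)] inW[OF ab(2)] by simp
    then have "a \<in> W" using a_inv_smult[OF M inW[OF ab(2)]] W'(4)[OF gens_closed(3) ab(2)] by simp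
    then have "a = \<zero>\<^bsub>M\<^esub>" using UW ab(1) by blast
    then show ?thesis using ab(3) inW[OF ab(2)] by simp
  qed
  then have "{p \<in> carrier ?D. ?s p = \<zero>\<^bsub>M\<^esub>} = {\<zero>\<^bsub>?D\<^esub>}"
    using U'(2) W'(2) by (auto simp: direct_sum_simps)
  then have inj: "inj_on ?s (carrier ?D)" using inj_on_kernel[OF D M s] by simp
  have sub: "Module.submodule (set_add M U W) L M"
    using hom_image_submodule[OF D M s submodule_carrier[OF D]] im by simp
  have bij: "bij_betw ?s (carrier ?D) (carrier (submod M (set_add M U W)))"
    using inj im by (simp add: bij_betw_def)
  have s': "?s \<in> module_hom L ?D (submod M (set_add M U W))"
    using s im by (auto simp: module_hom_def)
  have "inv_into (carrier ?D) ?s ` carrier (submod M (set_add M U W)) = carrier ?D"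
    using bij_betw_inv_into[OF bij] by (simp add: bij_betw_def)
  from fd_image[OF fd_submod[OF fd sub] D hom_inverse[OF D s' bij] this]
  show fdD: "fd_module Q I ?D" .
  fix i assume i: "i \<in> verts Q"
  have sn: "snd \<in> module_hom L ?D (submod M W)" by (auto simp: module_hom_def direct_sum_simps)
  have in1: "(\<lambda>a. (a, \<zero>\<^bsub>M\<^esub>)) \<in> module_hom L (submod M U) ?D"
    using W'(2) smult_zero_right[OF M] by (auto simp: module_hom_def direct_sum_simps)
  have "snd ` carrier ?D = W" using U'(2) by (force simp: direct_sum_simps)
  moreover have "{p \<in> carrier ?D. snd p = \<zero>\<^bsub>submod M W\<^esub>} = (\<lambda>a. (a, \<zero>\<^bsub>M\<^esub>)) ` carrier (submod M U)"
    using W'(2) by (auto simp: direct_sum_simps)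
  moreover have "dv (submod ?D ((\<lambda>a. (a, \<zero>\<^bsub>M\<^esub>)) ` carrier (submod M U))) i = dv (submod M U) i"
    by (rule dv_inj_image[OF fd_submod[OF fd U] D in1 i]) (auto simp: inj_on_def)
  ultimately show e: "dv ?D i = dv (submod M U) i + dv (submod M W) i"
    using dv_rank_nullity[OF fdD lW sn i] by simp
  show "dv (submod M (set_add M U W)) i = dv (submod M U) i + dv (submod M W) i"
    using dv_inj_image[OF fdD M s i inj] im e by simp
qed

text \<open>The homomorphism theorem for the quotient by JM. From here on the top is handled through
  maps defined on M itself, without cosets.\<close>

lemma module_top_iso:
  fixes M :: "('v,'a,'k,'m) quiver_module" and T :: "('v,'a,'k,'t) quiver_module"
  assumes M: "left_module L M" and T: "left_module L T"
  shows "module_iso L (module_top L M) T \<longleftrightarrow>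
    (\<exists>g \<in> module_hom L M T. g ` carrier M = carrier T \<and> {x \<in> carrier M. g x = \<zero>\<^bsub>T\<^esub>} = rad L M)"
proof -
  interpret M: left_module L M by (rule M)
  interpret T: left_module L T by (rule T)
  let ?R = "rad L M" and ?Q = "module_top L M"
  note R = rad_submodule[OF M]
  note R' = submoduleD[OF R]
  have Rs: "subgroup ?R (add_monoid M)" using R by (rule Module.submodule.axioms(1))
  interpret R: abelian_subgroup ?R M
    using Rs M.M.abelian_group_axioms by (intro abelian_subgroupI3 additive_subgroup.intro)
  let ?c = "\<lambda>x. ?R +>\<^bsub>M\<^esub> x"
  have Qc: "carrier ?Q = ?c ` carrier M"
    by (auto simp: module_top_def quotient_module_def A_RCOSETS_def')
  have Qz: "\<zero>\<^bsub>?Q\<^esub> = ?R" by (simp add: module_top_def quotient_module_def)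
  have Qa: "?c x \<oplus>\<^bsub>?Q\<^esub> ?c y = ?c (x \<oplus>\<^bsub>M\<^esub> y)" if "x \<in> carrier M" "y \<in> carrier M" for x y
    using R.a_rcos_sum[OF that] by (simp add: module_top_def quotient_module_def)
  have ceq: "?c x = ?c y \<longleftrightarrow> (\<exists>r\<in>?R. x = r \<oplus>\<^bsub>M\<^esub> y)" if "x \<in> carrier M" "y \<in> carrier M" for x y
  proof
    assume "?c x = ?c y"
    then have "x \<in> ?c y" using R.a_rcos_self[OF that(1)] by simp
    then show "\<exists>r\<in>?R. x = r \<oplus>\<^bsub>M\<^esub> y" by (auto simp: a_r_coset_def')
  next
    assume "\<exists>r\<in>?R. x = r \<oplus>\<^bsub>M\<^esub> y"
    then have "x \<in> ?c y" by (auto simp: a_r_coset_def')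
    then show "?c x = ?c y" using R.a_repr_independence'[OF _ that(2)] by simp
  qed
  have Qs: "X \<odot>\<^bsub>?Q\<^esub> ?c x = ?c (X \<odot>\<^bsub>M\<^esub> x)" if X: "X \<in> carrier L" and x: "x \<in> carrier M" for X x
  proof -
    have "?c (X \<odot>\<^bsub>M\<^esub> y) = ?c (X \<odot>\<^bsub>M\<^esub> x)" if y: "y \<in> ?c x" for y
    proof -
      obtain r where r: "r \<in> ?R" "y = r \<oplus>\<^bsub>M\<^esub> x" using y by (auto simp: a_r_coset_def')
      then have "r \<in> carrier M" using R'(1) by blast
      then have "X \<odot>\<^bsub>M\<^esub> y = X \<odot>\<^bsub>M\<^esub> r \<oplus>\<^bsub>M\<^esub> X \<odot>\<^bsub>M\<^esub> x" "y \<in> carrier M" using r X x by (auto simp: M.smult_r_distr)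
      then show ?thesis using ceq[of "X \<odot>\<^bsub>M\<^esub> y" "X \<odot>\<^bsub>M\<^esub> x"] R'(4)[OF X r(1)] X x M.smult_closed by blast
    qed
    then have "(\<Union>y\<in>?c x. ?c (X \<odot>\<^bsub>M\<^esub> y)) = ?c (X \<odot>\<^bsub>M\<^esub> x)" using R.a_rcos_self[OF x] by blast
    then show ?thesis by (simp add: module_top_def quotient_module_def)
  qed
  show ?thesis
  proof
    assume "module_iso L ?Q T"
    then obtain h where h: "h \<in> module_hom L ?Q T" and b: "bij_betw h (carrier ?Q) (carrier T)"
      by (auto simp: module_iso_def)
    note h' = module_homD[OF h]
    let ?g = "\<lambda>x. h (?c x)"
    have g: "?g \<in> module_hom L M T"
      using h' by (auto simp: module_hom_def Qa[symmetric] Qs[symmetric] Qc)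
    have c0: "?c \<zero>\<^bsub>M\<^esub> = ?R" using R.a_rcos_const[OF R'(2)] .
    have h0: "h ?R = \<zero>\<^bsub>T\<^esub>" using hom_zero[OF M T g] c0 by simp
    have "{x \<in> carrier M. ?g x = \<zero>\<^bsub>T\<^esub>} = ?R"
    proof (intro equalityI subsetI)
      fix x assume "x \<in> {x \<in> carrier M. ?g x = \<zero>\<^bsub>T\<^esub>}"
      then have x: "x \<in> carrier M" "h (?c x) = h (?c \<zero>\<^bsub>M\<^esub>)" using h0 c0 by auto
      then have "?c x = ?c \<zero>\<^bsub>M\<^esub>" using b by (auto simp: bij_betw_def Qc dest: inj_onD)
      then show "x \<in> ?R" using R.a_rcos_self[OF x(1)] c0 by simp
    next
      fix x assume x: "x \<in> ?R"
      then show "x \<in> {x \<in> carrier M. ?g x = \<zero>\<^bsub>T\<^esub>}" using R.a_rcos_const[OF x] h0 R'(1) by auto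
    qed
    moreover have "?g ` carrier M = carrier T" using b by (simp add: bij_betw_def Qc image_image)
    ultimately show "\<exists>g \<in> module_hom L M T. g ` carrier M = carrier T \<and> {x \<in> carrier M. g x = \<zero>\<^bsub>T\<^esub>} = ?R"
      using g by blast
  next
    assume "\<exists>g \<in> module_hom L M T. g ` carrier M = carrier T \<and> {x \<in> carrier M. g x = \<zero>\<^bsub>T\<^esub>} = ?R"
    then obtain g where g: "g \<in> module_hom L M T" and gs: "g ` carrier M = carrier T"
      and gk: "{x \<in> carrier M. g x = \<zero>\<^bsub>T\<^esub>} = ?R" by blast
    note g' = module_homD[OF g]
    \<comment> \<open>Since g kills JM it is constant on every coset, so its image of a coset is a
      singleton.\<close>
    define h where "h X = the_elem (g ` X)" for X
    have gr0: "g r = \<zero>\<^bsub>T\<^esub>" "r \<in> carrier M" if "r \<in> ?R" for r using gk that by auto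
    have hc: "h (?c x) = g x" if x: "x \<in> carrier M" for x
    proof -
      have "g y = g x" if y: "y \<in> ?c x" for y
      proof -
        obtain r where "r \<in> ?R" "y = r \<oplus>\<^bsub>M\<^esub> x" using y by (auto simp: a_r_coset_def')
        then show ?thesis using g'(1,2) gr0 x by simp
      qed
      then have "g ` ?c x = {g x}" using R.a_rcos_self[OF x] by blast
      then show ?thesis by (simp add: h_def)
    qed
    have h: "h \<in> module_hom L ?Q T"
      unfolding module_hom_def
    proof (intro CollectI conjI allI impI Pi_I)
      fix X assume "X \<in> carrier ?Q"
      then show "h X \<in> carrier T" using hc g'(1) by (auto simp: Qc)
    next
      fix X Y assume "X \<in> carrier ?Q \<and> Y \<in> carrier ?Q"
      then obtain x y where "x \<in> carrier M" "y \<in> carrier M" "X = ?c x" "Y = ?c y" by (auto simp: Qc)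
      then show "h (X \<oplus>\<^bsub>?Q\<^esub> Y) = h X \<oplus>\<^bsub>T\<^esub> h Y" using hc g'(2) by (simp add: Qa)
    next
      fix Y X assume "Y \<in> carrier L \<and> X \<in> carrier ?Q"
      then obtain x where "x \<in> carrier M" "X = ?c x" "Y \<in> carrier L" by (auto simp: Qc)
      then show "h (Y \<odot>\<^bsub>?Q\<^esub> X) = Y \<odot>\<^bsub>T\<^esub> h X" using hc g'(3) M.smult_closed by (simp add: Qs)
    qed
    have "inj_on h (carrier ?Q)"
    proof (rule inj_onI)
      fix X Y assume "X \<in> carrier ?Q" "Y \<in> carrier ?Q" and e: "h X = h Y"
      then obtain x y where xy: "x \<in> carrier M" "y \<in> carrier M" "X = ?c x" "Y = ?c y" by (auto simp: Qc)
      let ?z = "x \<oplus>\<^bsub>M\<^esub> (\<ominus>\<^bsub>M\<^esub> y)"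
      have "g ?z \<oplus>\<^bsub>T\<^esub> g y = g (?z \<oplus>\<^bsub>M\<^esub> y)" using g'(2) xy by simp
      also have z: "?z \<oplus>\<^bsub>M\<^esub> y = x" using xy by (simp add: M.M.a_assoc M.M.l_neg)
      also have "g x = g y" using e xy hc by simp
      finally have "g ?z \<oplus>\<^bsub>T\<^esub> g y = \<zero>\<^bsub>T\<^esub> \<oplus>\<^bsub>T\<^esub> g y" using g'(1) xy by simp
      then have "g ?z = \<zero>\<^bsub>T\<^esub>" using g'(1) xy
        by (metis M.M.a_inv_closed M.M.add.m_closed T.M.add.m_closed T.M.add.right_cancel T.M.zero_closed)
      then have "?z \<in> ?R" using gk xy by auto
      then show "X = Y" using ceq[OF xy(1,2)] z xy(3,4) by metis
    qed
    moreover have "h ` carrier ?Q = carrier T" using hc gs by (simp add: Qc image_image cong: image_cong)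
    ultimately show "module_iso L ?Q T" using h by (auto simp: module_iso_def bij_betw_def)
  qed
qed

end

section \<open>Projective covers\<close>

text \<open>The vectors b complete a basis of W to a basis of V. They are described by the subspaces
  containing them and W because they will be used to recognize submodules that contain the
  radical.\<close>

lemma (in vectorspace) complement_basis:
  assumes fd: fin_dim and W: "VectorSpace.subspace K W V"
  shows "\<exists>b. (\<forall>s < dim - vectorspace.dim K (vs W). b s \<in> carrier V) \<and>
    (\<forall>U. VectorSpace.subspace K U V \<longrightarrow> W \<subseteq> U \<longrightarrow> (\<forall>s < dim - vectorspace.dim K (vs W). b s \<in> U) \<longrightarrow> U = carrier V)"
proof -
  obtain A where A: "finite A" "A \<subseteq> W" "lin_indpt A" "span A = span W"
    using independent_spanning_subset[OF fd subspaceD(1)[OF W]] by blast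
  have Ac: "A \<subseteq> carrier V" using A(2) subspaceD(1)[OF W] by blast
  obtain B where B: "finite B" "A \<inter> B = {}" "basis (A \<union> B)" using extend_to_basis[OF fd Ac A(3)] by blast
  have dW: "vectorspace.dim K (vs W) = card A"
    using dim_span_indpt[OF A(1) Ac A(3)] A(4) span_subspace[OF W] by simp
  have "dim = card A + card B" using dim_basis[OF _ B(3)] A(1) B(1,2) by (simp add: card_Un_disjoint)
  then have n: "dim - vectorspace.dim K (vs W) = card B" using dW by simp
  obtain b where b: "bij_betw b {0..<card B} B" using ex_bij_betw_nat_finite[OF B(1)] by blast
  have BV: "A \<union> B \<subseteq> carrier V" "span (A \<union> B) = carrier V" using B(3) by (auto simp: basis_def)
  have bB: "b s \<in> B" if "s < card B" for s using bij_betwE[OF b] that by simp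
  have "U = carrier V" if U: "VectorSpace.subspace K U V" "W \<subseteq> U" "\<forall>s<card B. b s \<in> U" for U
  proof -
    have "B = b ` {0..<card B}" using b by (simp add: bij_betw_def)
    then have "B \<subseteq> U" using U(3) by (metis atLeastLessThan_iff image_subsetI)
    then have "A \<union> B \<subseteq> U" using A(2) U(2) by blast
    then have "span (A \<union> B) \<subseteq> U" using U(1) by (intro span_is_subset) (simp_all add: VectorSpace.subspace_def)
    then show ?thesis using BV(2) subspaceD(1)[OF U(1)] by blast
  qed
  then show ?thesis unfolding n using bB BV(1) by blast
qed

text \<open>Only unit vectors with a nonzero coefficient need to be tested; in
  \<open>gen_point_rad\<close> the others do not lie in the radical.\<close>

lemma vec_mem_of_units:
  fixes v :: "'k::field vec"
  assumes v: "v \<in> carrier_vec n" and z: "0\<^sub>v n \<in> U" and add: "\<And>v w. v \<in> U \<Longrightarrow> w \<in> U \<Longrightarrow> v + w \<in> U"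
    and u: "\<And>s. s < n \<Longrightarrow> v $ s \<noteq> 0 \<Longrightarrow> v $ s \<cdot>\<^sub>v unit_vec n s \<in> U"
  shows "v \<in> U"
proof -
  have "vec n (\<lambda>s. if s < k then v $ s else 0) \<in> U" if "k \<le> n" for k
    using that
  proof (induction k)
    case 0
    then show ?case using z by (simp add: zero_vec_def)
  next
    case (Suc k)
    let ?w = "vec n (\<lambda>s. if s < k then v $ s else 0)"
    have e: "vec n (\<lambda>s. if s < Suc k then v $ s else 0) = ?w + v $ k \<cdot>\<^sub>v unit_vec n k"
      using Suc.prems by (intro eq_vecI) (auto simp: less_Suc_eq)
    show ?case
    proof (cases "v $ k = 0")
      case True
      then have "?w + v $ k \<cdot>\<^sub>v unit_vec n k = ?w" by (intro eq_vecI) auto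
      then show ?thesis using Suc e by simp
    next
      case False
      then show ?thesis unfolding e using Suc by (intro add u) auto
    qed
  qed
  moreover have "vec n (\<lambda>s. if s < n then v $ s else 0) = v" using v by (intro eq_vecI) auto
  ultimately show ?thesis by (metis order_refl)
qed

lemma mult_mat_unit_vec: "A \<in> carrier_mat n m \<Longrightarrow> s < m \<Longrightarrow> A *\<^sub>v unit_vec m s = (col A s :: 'k::semiring_1 vec)"
  by (intro eq_vecI) (auto simp: carrier_matD)

lemma mult_smult_unit_vec:
  "A \<in> carrier_mat n m \<Longrightarrow> s < m \<Longrightarrow> A *\<^sub>v (c \<cdot>\<^sub>v unit_vec m s) = c \<cdot>\<^sub>v (col A s :: 'k::field vec)"
  by (simp add: mult_mat_vec mult_mat_unit_vec)

lemma dim_trailing: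
  "vectorspace.dim class_ring ((module_vec TYPE('k::field) (t + r))\<lparr>carrier := trailing (t + r) t\<rparr>) = r"
proof -
  interpret W: vec_space "TYPE('k)" "t + r" .
  interpret V: vec_space "TYPE('k)" r .
  let ?f = "\<lambda>v :: 'k vec. 0\<^sub>v t @\<^sub>v v"
  have h: "?f \<in> LinearCombinations.module_hom class_ring (module_vec TYPE('k) r) (module_vec TYPE('k) (t + r))"
    by (auto simp: module_hom_def module_vec_simps append_vec_def Let_def intro!: eq_vecI)
  have "inj_on ?f (carrier_vec r)"
    by (intro inj_onI) (metis append_vec_eq zero_carrier_vec)
  moreover have "?f ` carrier_vec r = trailing (t + r) t"
  proof (intro equalityI subsetI)
    fix v :: "'k vec" assume v: "v \<in> trailing (t + r) t"
    then have "v = ?f (vec r (\<lambda>s. v $ (t + s)))"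
      by (intro eq_vecI) (auto simp: trailing_def append_vec_def Let_def)
    then show "v \<in> ?f ` carrier_vec r" by (rule image_eqI) simp
  qed (auto simp: trailing_def append_vec_def Let_def)
  ultimately show ?thesis
    using dim_inj_hom[OF V.vectorspace_axioms W.vectorspace_axioms h V.fin_dim] V.dim_is_n by (simp add: module_vec_simps)
qed

context rad_square_zero
begin

interpretation D: fin_digraph Q by (rule fin_digraph)

text \<open>The dimension vector of the top without forming the quotient. For finite dimensional
  modules the subtraction does not truncate at vertices, by \<open>dv_submod_le\<close>.\<close>

definition topd :: "('v,'a,'k,'m) quiver_module \<Rightarrow> 'v \<Rightarrow> nat" where
  "topd M i = dv M i - dv (submod M (rad L M)) i"

lemma set_add_submodule:
  fixes M :: "('v,'a,'k,'m) quiver_module"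
  assumes M: "left_module L M" and U: "Module.submodule U L M" and W: "Module.submodule W L M"
  shows "Module.submodule (set_add M U W) L M"
proof -
  interpret M: left_module L M by (rule M)
  note D = direct_sum_left_module[OF submodule_left_module[OF M U] submodule_left_module[OF M W]]
  have "(\<lambda>p. fst p \<oplus>\<^bsub>M\<^esub> snd p) \<in> module_hom L (direct_sum (submod M U) (submod M W)) M"
    using subsetD[OF submoduleD(1)[OF U]] subsetD[OF submoduleD(1)[OF W]]
    by (auto simp: module_hom_def direct_sum_simps M.M.a_ac M.smult_r_distr)
  from hom_image_submodule[OF D M this submodule_carrier[OF D]]
  have "Module.submodule ((\<lambda>p. fst p \<oplus>\<^bsub>M\<^esub> snd p) ` carrier (direct_sum (submod M U) (submod M W))) L M" .
  moreover have "(\<lambda>p. fst p \<oplus>\<^bsub>M\<^esub> snd p) ` carrier (direct_sum (submod M U) (submod M W)) = set_add M U W"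
    by (auto simp: direct_sum_simps set_add_defs image_def)
  ultimately show ?thesis by simp
qed

lemma set_add_supset:
  fixes M :: "('v,'a,'k,'m) quiver_module"
  assumes M: "left_module L M" and U: "Module.submodule U L M" and W: "Module.submodule W L M"
  shows "U \<subseteq> set_add M U W" "W \<subseteq> set_add M U W"
proof -
  interpret M: left_module L M by (rule M)
  note U' = submoduleD[OF U] and W' = submoduleD[OF W]
  show "U \<subseteq> set_add M U W"
  proof
    fix u assume u: "u \<in> U"
    then have "u = u \<oplus>\<^bsub>M\<^esub> \<zero>\<^bsub>M\<^esub>" using U'(1) by auto
    then show "u \<in> set_add M U W" using u W'(2) by (auto simp: set_add_defs)
  qed
  show "W \<subseteq> set_add M U W"
  proof
    fix u assume u: "u \<in> W"
    then have "u = \<zero>\<^bsub>M\<^esub> \<oplus>\<^bsub>M\<^esub> u" using W'(1) by auto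
    then show "u \<in> set_add M U W" using u U'(2) by (auto simp: set_add_defs)
  qed
qed

text \<open>An arrow applied to n + r with r in JM sees only n, because J annihilates JM. Hence N
  contains all images of arrows, thus JM, thus everything.\<close>

lemma nakayama:
  fixes M :: "('v,'a,'k,'m) quiver_module"
  assumes M: "left_module L M" and N: "Module.submodule N L M" and s: "set_add M N (rad L M) = carrier M"
  shows "N = carrier M"
proof -
  interpret M: left_module L M by (rule M)
  note N' = submoduleD[OF N] and R' = submoduleD[OF rad_submodule[OF M]]
  have "rad L M \<subseteq> N"
  proof (rule rad_least[OF M N])
    fix \<alpha> x assume a: "\<alpha> \<in> arcs Q" and "x \<in> carrier M"
    then have "x \<in> set_add M N (rad L M)" using s by simp
    then obtain n r where nr: "n \<in> N" "r \<in> rad L M" "x = n \<oplus>\<^bsub>M\<^esub> r" by (auto simp: set_add_defs)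
    then have c: "n \<in> carrier M" "r \<in> carrier M" using N'(1) R'(1) by auto
    have "ar \<alpha> \<odot>\<^bsub>M\<^esub> x = ar \<alpha> \<odot>\<^bsub>M\<^esub> n"
      using a c by (simp add: nr(3) M.smult_r_distr rad_rad[OF M nr(2)] M.smult_closed)
    then show "ar \<alpha> \<odot>\<^bsub>M\<^esub> x \<in> N" using N'(4)[OF _ nr(1)] a by simp
  qed
  then have "set_add M N (rad L M) \<subseteq> N" using N'(3) by (auto simp: set_add_defs)
  then show ?thesis using s N'(1) by simp
qed

lemma gr_nested:
  assumes M: "left_module L M" and N: "Module.submodule N L M" and i: "i \<in> verts Q"
  shows "VectorSpace.subspace class_ring (gr M N i) ((K_space Q I M)\<lparr>carrier := gr M (carrier M) i\<rparr>)"
  using submoduleD(1)[OF N] by (intro vectorspace.nested_subspaces[OF K_space_vectorspace[OF M], of "gr M (carrier M) i", simplified]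
          gr_subspace[OF M] submodule_carrier[OF M] N i) (auto simp: gr_def)

text \<open>At each vertex a basis of the vertex space of JM is completed to one of the vertex space
  of M. A submodule containing the added vectors fills M modulo JM, and \<open>nakayama\<close>
  removes the radical.\<close>

lemma top_generators:
  assumes fd: "fd_module Q I M"
  obtains \<mu> where "\<And>i s. i \<in> verts Q \<Longrightarrow> s < topd M i \<Longrightarrow> \<mu> i s \<in> gr M (carrier M) i"
    "\<And>N. Module.submodule N L M \<Longrightarrow> (\<And>i s. i \<in> verts Q \<Longrightarrow> s < topd M i \<Longrightarrow> \<mu> i s \<in> N) \<Longrightarrow> N = carrier M"
proof -
  note M = fd_moduleD(1)[OF fd] and R = rad_submodule[OF fd_moduleD(1)[OF fd]]
  note sM = submodule_carrier[OF M]
  let ?V = "\<lambda>i. (K_space Q I M)\<lparr>carrier := gr M (carrier M) i\<rparr>"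
  have "\<exists>b. (\<forall>s < topd M i. b s \<in> gr M (carrier M) i) \<and>
    (\<forall>U. VectorSpace.subspace class_ring U (?V i) \<longrightarrow> gr M (rad L M) i \<subseteq> U \<longrightarrow> (\<forall>s < topd M i. b s \<in> U)
      \<longrightarrow> U = gr M (carrier M) i)" if i: "i \<in> verts Q" for i
    using vectorspace.complement_basis[OF fd_gr[OF fd sM i] gr_nested[OF M R i]]
    by (simp add: topd_def dv_submod dv_carrier[of M])
  then obtain \<mu> where mu: "\<And>i s. i \<in> verts Q \<Longrightarrow> s < topd M i \<Longrightarrow> \<mu> i s \<in> gr M (carrier M) i"
    and mu2: "\<And>i U. i \<in> verts Q \<Longrightarrow> VectorSpace.subspace class_ring U (?V i) \<Longrightarrow> gr M (rad L M) i \<subseteq> U \<Longrightarrow>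
      (\<forall>s < topd M i. \<mu> i s \<in> U) \<Longrightarrow> U = gr M (carrier M) i"
    by metis
  show thesis
  proof (rule that[of \<mu>, OF mu])
    fix N assume N: "Module.submodule N L M" and g: "\<And>i s. i \<in> verts Q \<Longrightarrow> s < topd M i \<Longrightarrow> \<mu> i s \<in> N"
    let ?W = "set_add M N (rad L M)"
    note W = set_add_submodule[OF M N R] and NW = set_add_supset[OF M N R]
    have "?W = carrier M"
    proof
      show "?W \<subseteq> carrier M" by (rule submoduleD(1)[OF W])
      show "carrier M \<subseteq> ?W"
      proof
        fix m assume m: "m \<in> carrier M"
        show "m \<in> ?W"
        proof (rule mem_submodule_vertex[OF M W m])
          fix i assume i: "i \<in> verts Q"
          have "gr M ?W i = gr M (carrier M) i"
          proof (rule mu2[OF i gr_nested[OF M W i]])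
            show "gr M (rad L M) i \<subseteq> gr M ?W i" using NW(2) by (auto simp: gr_def)
            show "\<forall>s < topd M i. \<mu> i s \<in> gr M ?W i"
              using mu[OF i] g[OF i] NW(1) gr_eq[OF M sM i] by (auto simp: gr_eq[OF M W i])
          qed
          moreover have "vx i \<odot>\<^bsub>M\<^esub> m \<in> gr M (carrier M) i" using m by (auto simp: gr_def)
          ultimately show "vx i \<odot>\<^bsub>M\<^esub> m \<in> ?W" using gr_eq[OF M W i] by auto
        qed
      qed
    qed
    then show "N = carrier M" by (rule nakayama[OF M N])
  qed
qed

definition vsp :: "('v \<Rightarrow> nat) \<Rightarrow> 'v \<Rightarrow> 'k vec \<Rightarrow> 'v \<Rightarrow> 'k vec" where
  "vsp e i v = (\<lambda>j\<in>verts Q. if j = i then v else 0\<^sub>v (e j))"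

lemma vsp_space: "v \<in> carrier_vec (e i) \<Longrightarrow> vsp e i v \<in> rep_space Q e"
  unfolding vsp_def by (rule rep_spaceI) auto

lemma vsp_apply: "j \<in> verts Q \<Longrightarrow> vsp e i v j = (if j = i then v else 0\<^sub>v (e j))"
  by (simp add: vsp_def)

lemma vsp_rm:
  assumes x: "x \<in> rep_variety Q I e" and i: "i \<in> verts Q" and v: "v \<in> carrier_vec (e i)" "w \<in> carrier_vec (e i)"
  shows "vsp e i v \<oplus>\<^bsub>rm e x\<^esub> vsp e i w = vsp e i (v + w)" "sc c \<odot>\<^bsub>rm e x\<^esub> vsp e i v = vsp e i (c \<cdot>\<^sub>v v)"
    "vsp e i (0\<^sub>v (e i)) = \<zero>\<^bsub>rm e x\<^esub>"
    "j \<in> verts Q \<Longrightarrow> vx j \<odot>\<^bsub>rm e x\<^esub> vsp e i v = (if j = i then vsp e i v else \<zero>\<^bsub>rm e x\<^esub>)"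
    "\<alpha> \<in> arcs Q \<Longrightarrow> tail Q \<alpha> = i \<Longrightarrow> ar \<alpha> \<odot>\<^bsub>rm e x\<^esub> vsp e i v = vsp e (head Q \<alpha>) (x \<alpha> *\<^sub>v v)"
  using i v unfolding rm_simps rm_sc[OF x vsp_space[where e = e and i = i, OF v(1)]]
  by (auto simp: vsp_def rm_vx[OF x vsp_space[where e = e and i = i, OF v(1), unfolded vsp_def]]
      rm_ar[OF x vsp_space[where e = e and i = i, OF v(1), unfolded vsp_def]] smult_vec_zero
      intro!: restrict_ext)

lemma vx_rm_vsp: "x \<in> rep_variety Q I e \<Longrightarrow> m \<in> rep_space Q e \<Longrightarrow> i \<in> verts Q \<Longrightarrow> vx i \<odot>\<^bsub>rm e x\<^esub> m = vsp e i (m i)"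
  by (simp add: rm_vx vsp_def)

lemma vsp_mem_submodule:
  assumes x: "x \<in> rep_variety Q I e" and N: "Module.submodule N L (rm e x)" and i: "i \<in> verts Q"
    and v: "v \<in> carrier_vec (e i)" and u: "\<And>s. s < e i \<Longrightarrow> v $ s \<noteq> 0 \<Longrightarrow> vsp e i (unit_vec (e i) s) \<in> N"
  shows "vsp e i v \<in> N"
proof -
  note N' = submoduleD[OF N]
  have "v \<in> {v \<in> carrier_vec (e i). vsp e i v \<in> N}"
  proof (rule vec_mem_of_units[OF v])
    show "0\<^sub>v (e i) \<in> {v \<in> carrier_vec (e i). vsp e i v \<in> N}"
      using vsp_rm(3)[OF x i v v] N'(2) by simp
    show "v + w \<in> {v \<in> carrier_vec (e i). vsp e i v \<in> N}"
      if "v \<in> {v \<in> carrier_vec (e i). vsp e i v \<in> N}" "w \<in> {v \<in> carrier_vec (e i). vsp e i v \<in> N}" for v w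
      using that vsp_rm(1)[OF x i, of v w] N'(3)[of "vsp e i v" "vsp e i w"] by auto
    show "v $ s \<cdot>\<^sub>v unit_vec (e i) s \<in> {v \<in> carrier_vec (e i). vsp e i v \<in> N}" if "s < e i" "v $ s \<noteq> 0" for s
      using u[OF that] vsp_rm(2)[OF x i, of "unit_vec (e i) s" "unit_vec (e i) s" "v $ s"] N'(4)[of "sc (v $ s)" "vsp e i (unit_vec (e i) s)"] by auto
  qed
  then show ?thesis by simp
qed

lemma equalizer_submodule:
  assumes M: "left_module L M" and N: "left_module L N" and h: "h \<in> module_hom L M N" "k \<in> module_hom L M N"
  shows "Module.submodule {x \<in> carrier M. h x = k x} L M"
proof -
  interpret M: left_module L M by (rule M)
  show ?thesis
    by (rule submoduleI[OF M]) (auto simp: hom_zero[OF M N h(1)] hom_zero[OF M N h(2)] module_homD[OF h(1)] module_homD[OF h(2)] M.smult_closed)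
qed

lemma linear_combination:
  fixes M :: "('v,'a,'k,'m) quiver_module"
  assumes M: "left_module L M" and i: "i \<in> verts Q" and nu: "\<And>s. s < n \<Longrightarrow> \<nu> s \<in> gr M (carrier M) i"
  defines "\<theta> \<equiv> \<lambda>v. (\<Oplus>\<^bsub>M\<^esub>s\<in>{..<n}. sc (v $ s) \<odot>\<^bsub>M\<^esub> \<nu> s)"
  shows "v \<in> carrier_vec n \<Longrightarrow> \<theta> v \<in> gr M (carrier M) i"
    "v \<in> carrier_vec n \<Longrightarrow> w \<in> carrier_vec n \<Longrightarrow> \<theta> (v + w) = \<theta> v \<oplus>\<^bsub>M\<^esub> \<theta> w"
    "v \<in> carrier_vec n \<Longrightarrow> \<theta> (c \<cdot>\<^sub>v v) = sc c \<odot>\<^bsub>M\<^esub> \<theta> v"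
    "s < n \<Longrightarrow> \<theta> (unit_vec n s) = \<nu> s"
proof -
  interpret M: left_module L M by (rule M)
  have nuM: "\<nu> s \<in> carrier M" "vx i \<odot>\<^bsub>M\<^esub> \<nu> s = \<nu> s" if "s < n" for s
    using gr_eq[OF M submodule_carrier[OF M] i] nu[OF that] by auto
  have c: "(\<lambda>s. sc (v $ s) \<odot>\<^bsub>M\<^esub> \<nu> s) \<in> {..<n} \<rightarrow> carrier M" for v
    using nuM(1) by (auto intro: M.smult_closed)
  show "\<theta> v \<in> gr M (carrier M) i"
  proof -
    have e: "vx i \<odot>\<^bsub>M\<^esub> (sc c \<odot>\<^bsub>M\<^esub> \<nu> s) = sc c \<odot>\<^bsub>M\<^esub> \<nu> s" if s: "s < n" for c s
      using M.smult_assoc[of "vx i" "sc c" "\<nu> s"] M.smult_assoc[of "sc c" "vx i" "\<nu> s"] nuM[OF s] i by (simp add: sc_comm)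
    have "vx i \<odot>\<^bsub>M\<^esub> \<theta> v = \<theta> v" unfolding \<theta>_def using i
      by (subst smult_finsum_right[OF M _ _ c]) (auto intro!: M.M.finsum_cong' simp: e c M.smult_closed nuM)
    moreover have "\<theta> v \<in> carrier M" unfolding \<theta>_def by (rule M.M.finsum_closed[OF c])
    ultimately show ?thesis by (simp add: gr_eq[OF M submodule_carrier[OF M] i])
  qed
  show "\<theta> (v + w) = \<theta> v \<oplus>\<^bsub>M\<^esub> \<theta> w" if "v \<in> carrier_vec n" "w \<in> carrier_vec n"
    unfolding \<theta>_def M.M.finsum_addf[OF c c, symmetric] using that nuM(1)
    by (intro M.M.finsum_cong') (auto simp: sc_add M.smult_l_distr M.smult_closed)
  show "\<theta> (c \<cdot>\<^sub>v v) = sc c \<odot>\<^bsub>M\<^esub> \<theta> v" if "v \<in> carrier_vec n"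
    unfolding \<theta>_def smult_finsum_right[OF M gens_closed(3) finite_lessThan c] using that nuM(1)
    by (intro M.M.finsum_cong') (auto simp: sc_mult M.smult_assoc M.smult_closed)
  show "\<theta> (unit_vec n s) = \<nu> s" if s: "s < n"
  proof -
    have "\<theta> (unit_vec n s) = (\<Oplus>\<^bsub>M\<^esub>j\<in>{..<n}. if s = j then \<nu> j else \<zero>\<^bsub>M\<^esub>)"
      unfolding \<theta>_def using s nuM(1)
      by (intro M.M.finsum_cong') (auto simp: sc_one M.smult_one sc_eq[of 0] cls_null smult_zero_left[OF M])
    also have "\<dots> = \<nu> s" using s nuM(1) by (intro M.M.finsum_singleton) auto
    finally show ?thesis .
  qed
qed

end

section \<open>Projective modules with prescribed top\<close>

context rad_square_zero
begin

interpretation D: fin_digraph Q by (rule fin_digraph)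

text \<open>A basis of the radical at j of the projective module with t i generators at each vertex
  i: one element for each arrow into j applied to each generator at its tail. With t = d the same
  pairs index all columns of the matrices into j. Its size \<open>arrow_dim t j\<close> bounds the
  radical at j of any module whose top has dimension vector t.\<close>

definition arrow_index :: "('v \<Rightarrow> nat) \<Rightarrow> 'v \<Rightarrow> ('a \<times> nat) set" where
  "arrow_index t j = {(\<alpha>, s). \<alpha> \<in> arcs Q \<and> head Q \<alpha> = j \<and> s < t (tail Q \<alpha>)}"

definition arrow_dim :: "('v \<Rightarrow> nat) \<Rightarrow> 'v \<Rightarrow> nat" where
  "arrow_dim t j = card (arrow_index t j)"

definition arrow_enum :: "('v \<Rightarrow> nat) \<Rightarrow> 'v \<Rightarrow> 'a \<times> nat \<Rightarrow> nat" where
  "arrow_enum t j = (SOME f. bij_betw f (arrow_index t j) {0..<arrow_dim t j})"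

lemma arrow_enum_bij: "bij_betw (arrow_enum t j) (arrow_index t j) {0..<arrow_dim t j}"
proof -
  have "arrow_index t j \<subseteq> (SIGMA \<alpha>:arcs Q. {..<t (tail Q \<alpha>)})" by (auto simp: arrow_index_def)
  then have "finite (arrow_index t j)" by (rule finite_subset) simp
  then show ?thesis unfolding arrow_enum_def arrow_dim_def
    using ex_bij_betw_finite_nat by (intro someI_ex[of "\<lambda>f. bij_betw f _ _"]) blast
qed

lemma arrow_enum_less: "\<alpha> \<in> arcs Q \<Longrightarrow> s < t (tail Q \<alpha>) \<Longrightarrow> arrow_enum t (head Q \<alpha>) (\<alpha>, s) < arrow_dim t (head Q \<alpha>)"
  using bij_betwE[OF arrow_enum_bij[of t "head Q \<alpha>"]] by (auto simp: arrow_index_def)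

text \<open>At each vertex the t generators come first and the r radical coordinates after them. An
  arrow sends generator s to the radical coordinate numbered by its pair, or to zero if that number
  is not below r; radical coordinates go to zero. The bound r truncates the radical of the
  projective module to any smaller size.\<close>

definition gen_point :: "('v \<Rightarrow> nat) \<Rightarrow> ('v \<Rightarrow> nat) \<Rightarrow> 'a \<Rightarrow> 'k mat" where
  "gen_point t r = (\<lambda>\<alpha>\<in>arcs Q. mat (t (head Q \<alpha>) + r (head Q \<alpha>)) (t (tail Q \<alpha>) + r (tail Q \<alpha>)) (\<lambda>(a, s).
    if s < t (tail Q \<alpha>) \<and> arrow_enum t (head Q \<alpha>) (\<alpha>, s) < r (head Q \<alpha>) \<and> a = t (head Q \<alpha>) + arrow_enum t (head Q \<alpha>) (\<alpha>, s)
    then 1 else 0))"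

lemma gen_point_carrier:
  "\<alpha> \<in> arcs Q \<Longrightarrow> gen_point t r \<alpha> \<in> carrier_mat (t (head Q \<alpha>) + r (head Q \<alpha>)) (t (tail Q \<alpha>) + r (tail Q \<alpha>))"
  by (simp add: gen_point_def)

lemma gen_point_col:
  assumes "\<alpha> \<in> arcs Q" "s < t (tail Q \<alpha>) + r (tail Q \<alpha>)"
  shows "col (gen_point t r \<alpha>) s =
    (if s < t (tail Q \<alpha>) \<and> arrow_enum t (head Q \<alpha>) (\<alpha>, s) < r (head Q \<alpha>)
     then unit_vec (t (head Q \<alpha>) + r (head Q \<alpha>)) (t (head Q \<alpha>) + arrow_enum t (head Q \<alpha>) (\<alpha>, s))
     else 0\<^sub>v (t (head Q \<alpha>) + r (head Q \<alpha>)))"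
  using assms by (intro eq_vecI) (auto simp: gen_point_def)

lemma gen_point_trailing:
  assumes a: "\<alpha> \<in> arcs Q" and w: "w \<in> carrier_vec (t (tail Q \<alpha>) + r (tail Q \<alpha>))"
  shows "gen_point t r \<alpha> *\<^sub>v w \<in> trailing (t (head Q \<alpha>) + r (head Q \<alpha>)) (t (head Q \<alpha>))"
  using assms mult_mat_vec_carrier[OF gen_point_carrier[where t = t and r = r, OF a] w]
  by (auto simp: trailing_def gen_point_def scalar_prod_def intro!: sum.neutral)

lemma gen_point_variety: "gen_point t r \<in> rep_variety Q I (\<lambda>i. t i + r i)"
  unfolding rep_variety_iff
proof (intro conjI ballI impI)
  show "gen_point t r \<in> rep_ambient Q (\<lambda>i. t i + r i)"
    by (auto simp: rep_ambient_def gen_point_def)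
  fix \<alpha> \<beta> assume a: "\<alpha> \<in> arcs Q" "\<beta> \<in> arcs Q" "head Q \<alpha> = tail Q \<beta>"
  show "gen_point t r \<beta> * gen_point t r \<alpha> = 0\<^sub>m (t (head Q \<beta>) + r (head Q \<beta>)) (t (tail Q \<alpha>) + r (tail Q \<alpha>))"
    using a by (intro eq_matI) (auto simp: gen_point_def scalar_prod_def intro!: sum.neutral)
qed

text \<open>The image of every arrow is trailing by construction. Conversely,
  \<open>arrow_enum\<close> takes every value below r since r is at most \<open>arrow_dim t\<close>,
  so each trailing unit vector is an arrow applied to a generator.\<close>

lemma gen_point_rad:
  assumes r: "\<And>i. i \<in> verts Q \<Longrightarrow> r i \<le> arrow_dim t i"
  defines "e \<equiv> \<lambda>i. t i + r i"
  shows "rad L (rm e (gen_point t r)) = {m \<in> rep_space Q e. \<forall>i\<in>verts Q. m i \<in> trailing (e i) (t i)}" (is "?R = ?S")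
proof
  let ?x = "gen_point t r"
  have x: "?x \<in> rep_variety Q I e" unfolding e_def by (rule gen_point_variety)
  note lm = rm_left_module[OF x]
  have ar: "ar \<alpha> \<odot>\<^bsub>rm e ?x\<^esub> m \<in> ?S" if "\<alpha> \<in> arcs Q" "m \<in> rep_space Q e" for \<alpha> m
    unfolding rm_ar[OF x that(2,1)] using gen_point_trailing[OF that(1), of "m (tail Q \<alpha>)" t r] rep_spaceD[OF that(2), of "tail Q \<alpha>"] that(1)
    by (auto simp: e_def trailing_def intro!: rep_spaceI)
  show "?R \<subseteq> ?S"
  proof (rule rad_least[OF lm])
    show "Module.submodule ?S L (rm e ?x)"
    proof (rule submoduleI[OF lm])
      show "?S \<subseteq> carrier (rm e ?x)" by (auto simp: rm_simps)
      show "\<zero>\<^bsub>rm e ?x\<^esub> \<in> ?S" by (auto simp: rm_simps trailing_def intro!: rep_spaceI)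
      show "m \<oplus>\<^bsub>rm e ?x\<^esub> n \<in> ?S" if "m \<in> ?S" "n \<in> ?S" for m n
        using that rep_spaceD[of m e] rep_spaceD[of n e] by (auto simp: rm_simps trailing_def intro!: rep_spaceI)
      show "sc c \<odot>\<^bsub>rm e ?x\<^esub> m \<in> ?S" if "m \<in> ?S" for c m
        using that rep_spaceD[of m e] by (subst rm_sc[OF x]) (auto simp: trailing_def intro!: rep_spaceI)
      show "vx i \<odot>\<^bsub>rm e ?x\<^esub> m \<in> ?S" if "i \<in> verts Q" "m \<in> ?S" for i m
        using that rep_spaceD[of m e] by (subst rm_vx[OF x]) (auto simp: trailing_def intro!: rep_spaceI)
      show "ar \<alpha> \<odot>\<^bsub>rm e ?x\<^esub> m \<in> ?S" if "\<alpha> \<in> arcs Q" "m \<in> ?S" for \<alpha> m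
        by (rule ar[OF that(1)]) (use that(2) in simp)
    qed
  qed (use ar in \<open>auto simp: rm_simps\<close>)
  show "?S \<subseteq> ?R"
  proof
    fix m assume m: "m \<in> ?S"
    then have mc: "m \<in> rep_space Q e" by simp
    note R = rad_submodule[OF lm]
    show "m \<in> ?R"
    proof (rule mem_submodule_vertex[OF lm R])
      fix i assume i: "i \<in> verts Q"
      show "vx i \<odot>\<^bsub>rm e ?x\<^esub> m \<in> ?R" unfolding vx_rm_vsp[OF x mc i]
      proof (rule vsp_mem_submodule[OF x R i rep_spaceD[OF mc i]])
        fix s assume s: "s < e i" "m i $ s \<noteq> 0"
        then have "\<not> s < t i" using m i by (auto simp: trailing_def)
        then have ts: "t i \<le> s" "s - t i < r i" using s(1) unfolding e_def by linarith+
        then have "s - t i \<in> {0..<arrow_dim t i}" using r[OF i] by simp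
        then obtain p where p: "p \<in> arrow_index t i" "arrow_enum t i p = s - t i"
          using arrow_enum_bij[of t i] by (metis (no_types, lifting) bij_betw_imp_surj_on imageE)
        obtain \<alpha> k where ak: "p = (\<alpha>, k)" by (cases p)
        then have a: "\<alpha> \<in> arcs Q" "head Q \<alpha> = i" "k < t (tail Q \<alpha>)" using p(1) by (auto simp: arrow_index_def)
        have "?x \<alpha> *\<^sub>v unit_vec (e (tail Q \<alpha>)) k = unit_vec (e i) s"
          using gen_point_col[OF a(1), of k t r] a ts p(2) ak gen_point_carrier[OF a(1), of t r]
          by (subst mult_mat_unit_vec) (auto simp: e_def)
        then have "vsp e i (unit_vec (e i) s) = ar \<alpha> \<odot>\<^bsub>rm e ?x\<^esub> vsp e (tail Q \<alpha>) (unit_vec (e (tail Q \<alpha>)) k)"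
          using vsp_rm(5)[OF x _ unit_vec_carrier unit_vec_carrier a(1) refl] a by simp
        then show "vsp e i (unit_vec (e i) s) \<in> ?R"
          using rad_mem[OF a(1), of "vsp e (tail Q \<alpha>) (unit_vec (e (tail Q \<alpha>)) k)" "rm e ?x"]
          by (simp add: rm_simps vsp_space)
      qed
    qed (use mc in \<open>simp add: rm_simps\<close>)
  qed
qed

lemma gen_point_dv_rad:
  assumes r: "\<And>i. i \<in> verts Q \<Longrightarrow> r i \<le> arrow_dim t i" and i: "i \<in> verts Q"
  defines "e \<equiv> \<lambda>i. t i + r i"
  shows "dv (submod (rm e (gen_point t r)) (rad L (rm e (gen_point t r)))) i = r i"
proof -
  let ?x = "gen_point t r" and ?S = "{m \<in> rep_space Q e. \<forall>i\<in>verts Q. m i \<in> trailing (e i) (t i)}"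
  have x: "?x \<in> rep_variety Q I e" unfolding e_def by (rule gen_point_variety)
  have "(\<lambda>m. m i) ` ?S = (trailing (e i) (t i) :: 'k vec set)"
  proof (intro equalityI subsetI)
    fix v :: "'k vec" assume v: "v \<in> trailing (e i) (t i)"
    then have "v \<in> carrier_vec (e i)" by (simp add: trailing_def)
    then have "vsp e i v \<in> ?S" using v by (auto simp: vsp_space vsp_apply) (auto simp: trailing_def)
    moreover have "vsp e i v i = v" using i by (simp add: vsp_apply)
    ultimately show "v \<in> (\<lambda>m. m i) ` ?S" by (metis (no_types, lifting) imageI)
  qed (use i in auto)
  then show ?thesis
    using dv_rm_submod[OF x rad_submodule[OF rm_left_module[OF x]] i] dim_trailing[of "t i" "r i", where 'k = 'k] gen_point_rad[OF r]
    by (simp add: e_def)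
qed

text \<open>Nothing is truncated here: this is the projective module whose top has dimension vector
  t. Its elements have the type over which the theorem lets projective covers range.\<close>

abbreviation free :: "('v \<Rightarrow> nat) \<Rightarrow> ('v,'a,'k,'v \<Rightarrow> 'k vec) quiver_module" where
  "free t \<equiv> rm (\<lambda>i. t i + arrow_dim t i) (gen_point t (arrow_dim t))"

abbreviation gen :: "('v \<Rightarrow> nat) \<Rightarrow> 'v \<Rightarrow> nat \<Rightarrow> 'v \<Rightarrow> 'k vec" where
  "gen t i s \<equiv> vsp (\<lambda>i. t i + arrow_dim t i) i (unit_vec (t i + arrow_dim t i) s)"

lemma free_fd: "fd_module Q I (free t)" by (rule rm_fd[OF gen_point_variety])
lemmas free_left_module = fd_moduleD(1)[OF free_fd]

lemma free_dv: "i \<in> verts Q \<Longrightarrow> dv (free t) i = t i + arrow_dim t i"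
  "i \<in> verts Q \<Longrightarrow> dv (submod (free t) (rad L (free t))) i = arrow_dim t i"
  by (simp_all add: dv_rm[OF gen_point_variety] gen_point_dv_rad)

lemma gen_carrier: "gen t i s \<in> carrier (free t)"
  by (simp add: rm_simps vsp_space)

text \<open>The generators together with the trailing vectors, which form the radical, reach every
  unit vector; \<open>nakayama\<close> then removes the radical.\<close>

lemma free_generated:
  assumes N: "Module.submodule N L (free t)" and g: "\<And>i s. i \<in> verts Q \<Longrightarrow> s < t i \<Longrightarrow> gen t i s \<in> N"
  shows "N = carrier (free t)"
proof -
  let ?e = "\<lambda>i. t i + arrow_dim t i" and ?x = "gen_point t (arrow_dim t)"
  note x = gen_point_variety[of t "arrow_dim t"]
  note lm = free_left_module[of t] and R = rad_submodule[OF free_left_module[of t]] and N' = submoduleD[OF N]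
  have "rad L (free t) \<union> N \<subseteq> set_add (free t) N (rad L (free t))" using set_add_supset[OF lm N R] by blast
  note sub = this and W = set_add_submodule[OF lm N R]
  have "set_add (free t) N (rad L (free t)) = carrier (free t)"
  proof
    show "carrier (free t) \<subseteq> set_add (free t) N (rad L (free t))"
    proof
      fix m assume m: "m \<in> carrier (free t)"
      then have mc: "m \<in> rep_space Q ?e" by (simp add: rm_simps)
      show "m \<in> set_add (free t) N (rad L (free t))"
      proof (rule mem_submodule_vertex[OF lm W m])
        fix i assume i: "i \<in> verts Q"
        show "vx i \<odot>\<^bsub>free t\<^esub> m \<in> set_add (free t) N (rad L (free t))" unfolding vx_rm_vsp[OF x mc i]
        proof (rule vsp_mem_submodule[OF x W i rep_spaceD[OF mc i]])
          fix s assume s: "s < ?e i"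
          show "gen t i s \<in> set_add (free t) N (rad L (free t))"
          proof (cases "s < t i")
            case True
            then show ?thesis using g[OF i] sub by blast
          next
            case False
            have "gen t i s \<in> {m \<in> rep_space Q ?e. \<forall>i\<in>verts Q. m i \<in> trailing (?e i) (t i)}"
              using False i s by (auto simp: vsp_space vsp_apply trailing_def unit_vec_def)
            then show ?thesis using gen_point_rad[of "arrow_dim t" t] sub by blast
          qed
        qed
      qed
    qed
  qed (rule submoduleD(1)[OF W])
  then show ?thesis by (rule nakayama[OF lm N])
qed

end

section \<open>The universal property and projectivity of these modules\<close>

context rad_square_zero
begin

interpretation D: fin_digraph Q by (rule fin_digraph)

lemma gr_carrierD:
  assumes "left_module L M" "i \<in> verts Q" "y \<in> gr M (carrier M) i"
  shows "y \<in> carrier M" "vx i \<odot>\<^bsub>M\<^esub> y = y"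
  using gr_eq[OF assms(1) submodule_carrier[OF assms(1)] assms(2)] assms(3) by auto

lemma hom_gr_carrier:
  assumes M: "left_module L M" and N: "left_module L N" and h: "h \<in> module_hom L M N" and i: "i \<in> verts Q"
    and y: "y \<in> gr M (carrier M) i"
  shows "h y \<in> gr N (carrier N) i"
  using gr_carrierD[OF M i y] module_homD[OF h] i by (simp add: gr_eq[OF N submodule_carrier[OF N] i]) (metis gens_closed(1))

lemma gen_gr: "i \<in> verts Q \<Longrightarrow> gen t i s \<in> gr (free t) (carrier (free t)) i"
  using gen_carrier[of t i s] vsp_rm(4)[OF gen_point_variety, of i "unit_vec (t i + arrow_dim t i) s" t "arrow_dim t" "unit_vec (t i + arrow_dim t i) s" i]
  by (simp add: gr_eq[OF free_left_module submodule_carrier[OF free_left_module]])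

text \<open>Images of generators may be prescribed freely in the vertex spaces: the radical basis
  element belonging to an arrow and a generator is sent to that arrow applied to the image of the
  generator.\<close>

lemma free_hom:
  fixes M :: "('v,'a,'k,'m) quiver_module"
  assumes M: "left_module L M" and mu: "\<And>i s. i \<in> verts Q \<Longrightarrow> s < t i \<Longrightarrow> \<mu> i s \<in> gr M (carrier M) i"
  shows "\<exists>\<phi> \<in> module_hom L (free t) M. \<forall>i\<in>verts Q. \<forall>s<t i. \<phi> (gen t i s) = \<mu> i s"
proof -
  interpret M: left_module L M by (rule M)
  let ?e = "\<lambda>i. t i + arrow_dim t i" and ?x = "gen_point t (arrow_dim t)"
  note x = gen_point_variety[of t "arrow_dim t"] and sM = submodule_carrier[OF M]
  \<comment> \<open>Recovers the arrow and the generator behind a radical coordinate k, that is, a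
    coordinate with \<open>t i \<le> k\<close>.\<close>
  define iv where "iv i k = inv_into (arrow_index t i) (arrow_enum t i) (k - t i)" for i k
  define \<nu> where "\<nu> i k = (if k < t i then \<mu> i k else ar (fst (iv i k)) \<odot>\<^bsub>M\<^esub> \<mu> (tail Q (fst (iv i k))) (snd (iv i k)))" for i k
  have ar_gr: "ar \<alpha> \<odot>\<^bsub>M\<^esub> y \<in> gr M (carrier M) (head Q \<alpha>)" if "\<alpha> \<in> arcs Q" "y \<in> carrier M" for \<alpha> y
    using vx_ar_smult[OF M that(2,1), of "head Q \<alpha>"] that by (simp add: gr_eq[OF M sM] M.smult_closed)
  have nu: "\<nu> i k \<in> gr M (carrier M) i" if i: "i \<in> verts Q" and k: "k < ?e i" for i k
  proof (cases "k < t i")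
    case False
    then have "k - t i \<in> arrow_enum t i ` arrow_index t i"
      using k bij_betw_imp_surj_on[OF arrow_enum_bij[of t i]] by auto
    then have "iv i k \<in> arrow_index t i" unfolding iv_def by (rule inv_into_into)
    then have a: "fst (iv i k) \<in> arcs Q" "head Q (fst (iv i k)) = i" "snd (iv i k) < t (tail Q (fst (iv i k)))"
      by (auto simp: arrow_index_def)
    then have "\<mu> (tail Q (fst (iv i k))) (snd (iv i k)) \<in> carrier M"
      by (intro gr_carrierD(1)[OF M _ mu]) auto
    then show ?thesis using ar_gr[OF a(1)] a(2) False by (simp add: \<nu>_def)
  qed (simp add: \<nu>_def mu i)
  have nu_ar: "\<nu> (head Q \<alpha>) (t (head Q \<alpha>) + arrow_enum t (head Q \<alpha>) (\<alpha>, s)) = ar \<alpha> \<odot>\<^bsub>M\<^esub> \<mu> (tail Q \<alpha>) s"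
    if "\<alpha> \<in> arcs Q" "s < t (tail Q \<alpha>)" for \<alpha> s
  proof -
    have "(\<alpha>, s) \<in> arrow_index t (head Q \<alpha>)" using that by (simp add: arrow_index_def)
    then have "iv (head Q \<alpha>) (t (head Q \<alpha>) + arrow_enum t (head Q \<alpha>) (\<alpha>, s)) = (\<alpha>, s)"
      unfolding iv_def using bij_betw_imp_inj_on[OF arrow_enum_bij] by simp
    then show ?thesis by (simp add: \<nu>_def)
  qed
  define \<theta> where "\<theta> i v = (\<Oplus>\<^bsub>M\<^esub>s\<in>{..<?e i}. sc (v $ s) \<odot>\<^bsub>M\<^esub> \<nu> i s)" for i and v :: "'k vec"
  have lc1: "\<theta> i v \<in> gr M (carrier M) i" if "i \<in> verts Q" "v \<in> carrier_vec (?e i)" for i v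
    unfolding \<theta>_def by (rule linear_combination(1)[OF M that(1)]) (simp_all add: nu that)
  have lc2: "\<theta> i (v + w) = \<theta> i v \<oplus>\<^bsub>M\<^esub> \<theta> i w" if "i \<in> verts Q" "v \<in> carrier_vec (?e i)" "w \<in> carrier_vec (?e i)" for i v w
    unfolding \<theta>_def by (rule linear_combination(2)[OF M that(1)]) (simp_all add: nu that)
  have lc3: "\<theta> i (c \<cdot>\<^sub>v v) = sc c \<odot>\<^bsub>M\<^esub> \<theta> i v" if "i \<in> verts Q" "v \<in> carrier_vec (?e i)" for i c v
    unfolding \<theta>_def by (rule linear_combination(3)[OF M that(1)]) (simp_all add: nu that)
  have lc4: "\<theta> i (unit_vec (?e i) s) = \<nu> i s" if "i \<in> verts Q" "s < ?e i" for i s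
    unfolding \<theta>_def by (rule linear_combination(4)[OF M that(1)]) (simp_all add: nu that)
  have th0: "\<theta> i (0\<^sub>v (?e i)) = \<zero>\<^bsub>M\<^esub>" if i: "i \<in> verts Q" for i
    using lc3[OF i, of "0\<^sub>v (?e i)" 0] smult_zero_left[OF M gr_carrierD(1)[OF M i lc1[OF i, of "0\<^sub>v (?e i)"]]]
    by (simp add: sc_eq cls_null smult_vec_zero)
  have thx: "\<theta> (head Q \<alpha>) (?x \<alpha> *\<^sub>v v) = ar \<alpha> \<odot>\<^bsub>M\<^esub> \<theta> (tail Q \<alpha>) v"
    if a: "\<alpha> \<in> arcs Q" and v: "v \<in> carrier_vec (?e (tail Q \<alpha>))" for \<alpha> v
  proof -
    let ?h = "head Q \<alpha>" and ?t = "tail Q \<alpha>"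
    have ht: "?h \<in> verts Q" "?t \<in> verts Q" using a by auto
    note xc = gen_point_carrier[OF a, of t "arrow_dim t"]
    have tc: "\<theta> ?t v \<in> carrier M" if "v \<in> carrier_vec (?e ?t)" for v
      by (rule gr_carrierD(1)[OF M ht(2) lc1[OF ht(2) that]])
    let ?U = "{v \<in> carrier_vec (?e ?t). \<theta> ?h (?x \<alpha> *\<^sub>v v) = ar \<alpha> \<odot>\<^bsub>M\<^esub> \<theta> ?t v}"
    have u: "unit_vec (?e ?t) s \<in> ?U" if s: "s < ?e ?t" for s
    proof (cases "s < t ?t")
      case True
      note l = arrow_enum_less[where t = t, OF a True]
      have "?x \<alpha> *\<^sub>v unit_vec (?e ?t) s = unit_vec (?e ?h) (t ?h + arrow_enum t ?h (\<alpha>, s))"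
        using gen_point_col[where t = t and r = "arrow_dim t", OF a s] True l by (simp add: mult_mat_unit_vec[OF xc s])
      then have "\<theta> ?h (?x \<alpha> *\<^sub>v unit_vec (?e ?t) s) = ar \<alpha> \<odot>\<^bsub>M\<^esub> \<mu> ?t s"
        using lc4[OF ht(1), of "t ?h + arrow_enum t ?h (\<alpha>, s)"] l nu_ar[OF a True] by simp
      moreover have "\<theta> ?t (unit_vec (?e ?t) s) = \<mu> ?t s"
        using lc4[OF ht(2) s] True by (simp add: \<nu>_def)
      ultimately show ?thesis by simp
    next
      \<comment> \<open>On a radical coordinate both sides vanish: on the left the column is zero,
        on the right the image is already an arrow applied to something, so \<open>ar_ar\<close>
        applies.\<close>
      case False
      have "?x \<alpha> *\<^sub>v unit_vec (?e ?t) s = 0\<^sub>v (?e ?h)"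
        using gen_point_col[where t = t and r = "arrow_dim t", OF a s] False by (simp add: mult_mat_unit_vec[OF xc s])
      moreover have "ar \<alpha> \<odot>\<^bsub>M\<^esub> \<theta> ?t (unit_vec (?e ?t) s) = \<zero>\<^bsub>M\<^esub>"
      proof -
        have "s - t ?t \<in> arrow_enum t ?t ` arrow_index t ?t"
          using s False bij_betw_imp_surj_on[OF arrow_enum_bij[of t ?t]] by auto
        then have "iv ?t s \<in> arrow_index t ?t" unfolding iv_def by (rule inv_into_into)
        then have b: "fst (iv ?t s) \<in> arcs Q" "snd (iv ?t s) < t (tail Q (fst (iv ?t s)))"
          by (auto simp: arrow_index_def)
        then have c: "\<mu> (tail Q (fst (iv ?t s))) (snd (iv ?t s)) \<in> carrier M"
          by (intro gr_carrierD(1)[OF M _ mu]) auto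
        have "\<theta> ?t (unit_vec (?e ?t) s) = ar (fst (iv ?t s)) \<odot>\<^bsub>M\<^esub> \<mu> (tail Q (fst (iv ?t s))) (snd (iv ?t s))"
          using lc4[OF ht(2) s] False by (simp add: \<nu>_def)
        then show ?thesis using M.smult_assoc[of "ar \<alpha>" "ar (fst (iv ?t s))", OF _ _ c] a b(1)
          by (simp add: ar_ar smult_zero_left[OF M c])
      qed
      ultimately show ?thesis using th0[OF ht(1)] by simp
    qed
    have "v \<in> ?U"
    proof (rule vec_mem_of_units[OF v])
      have "ar \<alpha> \<odot>\<^bsub>M\<^esub> \<theta> ?t (0\<^sub>v (?e ?t)) = \<zero>\<^bsub>M\<^esub>" using th0[OF ht(2)] smult_zero_right[OF M] a by simp
      moreover have "?x \<alpha> *\<^sub>v 0\<^sub>v (?e ?t) = 0\<^sub>v (?e ?h)" using xc by (intro eq_vecI) auto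
      ultimately show "0\<^sub>v (?e ?t) \<in> ?U" using th0[OF ht(1)] by simp
      show "v + w \<in> ?U" if "v \<in> ?U" "w \<in> ?U" for v w
      proof -
        have vw: "v \<in> carrier_vec (?e ?t)" "w \<in> carrier_vec (?e ?t)" using that by auto
        have xv: "?x \<alpha> *\<^sub>v v \<in> carrier_vec (?e ?h)" "?x \<alpha> *\<^sub>v w \<in> carrier_vec (?e ?h)"
          using mult_mat_vec_carrier[OF xc] vw by auto
        have "\<theta> ?h (?x \<alpha> *\<^sub>v (v + w)) = \<theta> ?h (?x \<alpha> *\<^sub>v v) \<oplus>\<^bsub>M\<^esub> \<theta> ?h (?x \<alpha> *\<^sub>v w)"
          unfolding mult_add_distrib_mat_vec[OF xc vw] by (rule lc2[OF ht(1) xv])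
        also have "\<dots> = ar \<alpha> \<odot>\<^bsub>M\<^esub> \<theta> ?t (v + w)"
          using that a tc[OF vw(1)] tc[OF vw(2)] lc2[OF ht(2) vw] by (simp add: M.smult_r_distr)
        finally show ?thesis using vw by simp
      qed
      show "v $ s \<cdot>\<^sub>v unit_vec (?e ?t) s \<in> ?U" if "s < ?e ?t" "v $ s \<noteq> 0" for s
      proof -
        let ?u = "unit_vec (?e ?t) s"
        have uc: "?u \<in> carrier_vec (?e ?t)" by simp
        have xu: "?x \<alpha> *\<^sub>v ?u \<in> carrier_vec (?e ?h)" by (rule mult_mat_vec_carrier[OF xc uc])
        have "\<theta> ?h (?x \<alpha> *\<^sub>v (v $ s \<cdot>\<^sub>v ?u)) = sc (v $ s) \<odot>\<^bsub>M\<^esub> (ar \<alpha> \<odot>\<^bsub>M\<^esub> \<theta> ?t ?u)"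
          unfolding mult_mat_vec[OF xc uc] using u[OF that(1)] lc3[OF ht(1) xu, of "v $ s"] by simp
        also have "\<dots> = ar \<alpha> \<odot>\<^bsub>M\<^esub> (sc (v $ s) \<odot>\<^bsub>M\<^esub> \<theta> ?t ?u)"
          using M.smult_assoc[OF _ _ tc[OF uc], of "ar \<alpha>" "sc (v $ s)"] M.smult_assoc[OF _ _ tc[OF uc], of "sc (v $ s)" "ar \<alpha>"] a
          by (simp add: sc_comm)
        also have "\<dots> = ar \<alpha> \<odot>\<^bsub>M\<^esub> \<theta> ?t (v $ s \<cdot>\<^sub>v ?u)" using lc3[OF ht(2) uc, of "v $ s"] by simp
        finally show ?thesis by simp
      qed
    qed
    then show ?thesis by simp
  qed
  have "\<exists>\<phi> \<in> module_hom L (free t) M. \<forall>m \<in> rep_space Q ?e. \<forall>j \<in> verts Q. vx j \<odot>\<^bsub>M\<^esub> \<phi> m = \<theta> j (m j)"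
    by (rule rm_hom[OF M x]) (rule lc1 lc2 lc3 thx; assumption)+
  then obtain \<phi> where phi: "\<phi> \<in> module_hom L (free t) M"
    "\<And>m j. m \<in> rep_space Q ?e \<Longrightarrow> j \<in> verts Q \<Longrightarrow> vx j \<odot>\<^bsub>M\<^esub> \<phi> m = \<theta> j (m j)" by blast
  have "\<phi> (gen t i s) = \<mu> i s" if i: "i \<in> verts Q" and s: "s < t i" for i s
  proof -
    have g: "gen t i s \<in> gr (free t) (carrier (free t)) i" by (rule gen_gr[OF i])
    have "\<phi> (gen t i s) = vx i \<odot>\<^bsub>M\<^esub> \<phi> (gen t i s)"
      using gr_carrierD(2)[OF M i hom_gr_carrier[OF free_left_module M phi(1) i g]] by simp
    also have "\<dots> = \<theta> i (unit_vec (?e i) s)" using phi(2)[OF vsp_space i, of "unit_vec (?e i) s" i] i by (simp add: vsp_apply)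
    also have "\<dots> = \<mu> i s" using lc4[OF i, of s] s by (simp add: \<nu>_def)
    finally show ?thesis .
  qed
  then show ?thesis using phi(1) by blast
qed

lemma free_hom_eqI:
  assumes M: "left_module L M" and h: "h \<in> module_hom L (free t) M" "k \<in> module_hom L (free t) M"
    and g: "\<And>i s. i \<in> verts Q \<Longrightarrow> s < t i \<Longrightarrow> h (gen t i s) = k (gen t i s)" and x: "x \<in> carrier (free t)"
  shows "h x = k x"
proof -
  have "{x \<in> carrier (free t). h x = k x} = carrier (free t)"
    by (rule free_generated[OF equalizer_submodule[OF free_left_module M h]]) (simp add: g gen_carrier)
  then show ?thesis using x by blast
qed

lemma free_lift:
  fixes N :: "('v,'a,'k,'m) quiver_module" and N' :: "('v,'a,'k,'n) quiver_module"
  assumes N: "left_module L N" and N': "left_module L N'" and g: "g \<in> module_hom L N N'" "g ` carrier N = carrier N'"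
    and f: "f \<in> module_hom L (free t) N'"
  shows "\<exists>h \<in> module_hom L (free t) N. \<forall>x \<in> carrier (free t). g (h x) = f x"
proof -
  have "\<exists>n \<in> gr N (carrier N) i. g n = f (gen t i s)" if i: "i \<in> verts Q" for i s
  proof -
    have fg: "f (gen t i s) \<in> gr N' (carrier N') i" by (rule hom_gr_carrier[OF free_left_module N' f i gen_gr[OF i]])
    have "f (gen t i s) \<in> g ` carrier N" unfolding g(2) by (rule gr_carrierD(1)[OF N' i fg])
    then obtain n where n: "f (gen t i s) = g n" "n \<in> carrier N" by (rule imageE)
    have "vx i \<odot>\<^bsub>N\<^esub> n \<in> gr N (carrier N) i" using n(2) by (auto simp: gr_def)
    moreover have "g (vx i \<odot>\<^bsub>N\<^esub> n) = f (gen t i s)"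
      using module_homD(3)[OF g(1) _ n(2), of "vx i"] n(1) gr_carrierD(2)[OF N' i fg] i by simp
    ultimately show ?thesis by blast
  qed
  then obtain \<mu> where mu: "\<And>i s. i \<in> verts Q \<Longrightarrow> \<mu> i s \<in> gr N (carrier N) i" "\<And>i s. i \<in> verts Q \<Longrightarrow> g (\<mu> i s) = f (gen t i s)"
    by metis
  obtain h where h: "h \<in> module_hom L (free t) N" "\<forall>i\<in>verts Q. \<forall>s<t i. h (gen t i s) = \<mu> i s"
    using free_hom[OF N, of t \<mu>] mu(1) by blast
  have "g (h x) = f x" if "x \<in> carrier (free t)" for x
    using free_hom_eqI[OF N' hom_comp[OF h(1) g(1)] f _ that] h(2) mu(2) by simp
  then show ?thesis using h(1) by blast
qed

lemma free_projective: "projective_module Q I (free t)"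
  unfolding projective_module_def
proof (intro conjI allI impI ballI, goal_cases)
  case 1
  show ?case by (rule free_fd)
next
  case (2 N N' g f)
  then show ?case by (intro free_lift) (auto intro: fd_moduleD(1))
qed

end

section \<open>Projective covers, their radicals, and tops by dimension vectors\<close>

context rad_square_zero
begin

interpretation D: fin_digraph Q by (rule fin_digraph)

lemma submodule_submod:
  fixes M :: "('v,'a,'k,'m) quiver_module"
  assumes M: "left_module L M" and U: "Module.submodule U L M" and W: "Module.submodule W L M" and UW: "U \<subseteq> W"
  shows "Module.submodule U L (submod M W)"
  using submoduleD[OF U] UW by (intro submoduleI[OF submodule_left_module[OF M W]]) auto

lemma hom_preimage_submodule:
  assumes M: "left_module L M" and N: "left_module L N" and h: "h \<in> module_hom L M N" and U: "Module.submodule U L N"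
  shows "Module.submodule {x \<in> carrier M. h x \<in> U} L M"
proof -
  interpret M: left_module L M by (rule M)
  show ?thesis using submoduleD[OF U]
    by (intro submoduleI[OF M]) (auto simp: hom_zero[OF M N h] module_homD[OF h] M.smult_closed)
qed

lemma dv_submod_le: "fd_module Q I M \<Longrightarrow> Module.submodule U L M \<Longrightarrow> i \<in> verts Q \<Longrightarrow> dv (submod M U) i \<le> dv M i"
  using dv_mono[OF _ _ submodule_carrier submoduleD(1), of M U i] fd_moduleD(1)[of M] by simp

text \<open>Since both tops have dimension vector \<open>t\<close>, the map induced on tops is bijective.\<close>

lemma free_cover:
  fixes M :: "('v,'a,'k,'m) quiver_module"
  assumes fd: "fd_module Q I M" and t: "\<And>i. i \<in> verts Q \<Longrightarrow> t i = topd M i"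
  obtains \<phi> where "projective_cover Q I (free t) \<phi> M" "{w \<in> carrier (free t). \<phi> w \<in> rad L M} = rad L (free t)"
proof -
  note M = fd_moduleD(1)[OF fd] and P = free_left_module[of t] and fP = free_fd[of t]
  interpret P: left_module L "free t" by (rule P)
  interpret M: left_module L M by (rule M)
  obtain \<mu> where mu: "\<And>i s. i \<in> verts Q \<Longrightarrow> s < topd M i \<Longrightarrow> \<mu> i s \<in> gr M (carrier M) i"
    "\<And>N. Module.submodule N L M \<Longrightarrow> (\<And>i s. i \<in> verts Q \<Longrightarrow> s < topd M i \<Longrightarrow> \<mu> i s \<in> N) \<Longrightarrow> N = carrier M"
    using top_generators[OF fd] by blast
  obtain \<phi> where phi: "\<phi> \<in> module_hom L (free t) M" "\<forall>i\<in>verts Q. \<forall>s<t i. \<phi> (gen t i s) = \<mu> i s"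
    using free_hom[OF M, of t \<mu>] mu(1) t by force
  have surj: "\<phi> ` carrier (free t) = carrier M"
  proof (rule mu(2)[OF hom_image_submodule[OF P M phi(1) submodule_carrier[OF P]]])
    fix i s assume "i \<in> verts Q" "s < topd M i"
    then have "\<mu> i s = \<phi> (gen t i s)" using phi(2) t by simp
    moreover have "\<phi> (gen t i s) \<in> \<phi> ` carrier (free t)" by (intro imageI gen_carrier)
    ultimately show "\<mu> i s \<in> \<phi> ` carrier (free t)" by (simp only:)
  qed
  note R = rad_submodule[OF P] and K = hom_kernel_submodule[OF P M phi(1)]
  let ?K' = "{w \<in> carrier (free t). \<phi> w \<in> rad L M}" and ?K = "{w \<in> carrier (free t). \<phi> w = \<zero>\<^bsub>M\<^esub>}"
  have K': "Module.submodule ?K' L (free t)" by (rule hom_preimage_submodule[OF P M phi(1) rad_submodule[OF M]])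
  have RK: "rad L (free t) \<subseteq> ?K'" using hom_rad[OF P M phi(1)] submoduleD(1)[OF R] by blast
  have KK: "?K \<subseteq> ?K'" using submoduleD(2)[OF rad_submodule[OF M]] by auto
  \<comment> \<open>One inclusion is clear, so dimensions suffice. At a vertex the preimage of JM
    has the dimension of JM plus that of the kernel, and the equation
    \<open>t + dim JM = dim M\<close> turns this into \<open>arrow_dim t\<close>.\<close>
  have "rad L (free t) = carrier (submod (free t) ?K')"
  proof (rule submodule_eq_dv[OF fd_submod[OF fP K'] submodule_submod[OF P R K' RK]])
    fix i assume i: "i \<in> verts Q"
    have "\<phi> ` ?K' = rad L M"
    proof
      show "rad L M \<subseteq> \<phi> ` ?K'"
      proof
        fix y assume y: "y \<in> rad L M"
        then have "y \<in> \<phi> ` carrier (free t)" using submoduleD(1)[OF rad_submodule[OF M]] surj by blast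
        then show "y \<in> \<phi> ` ?K'" using y by blast
      qed
    qed blast
    moreover have "{w \<in> ?K'. \<phi> w = \<zero>\<^bsub>M\<^esub>} = ?K" using KK by blast
    ultimately have "dv (submod M (rad L M)) i + dv (submod (free t) ?K) i = dv (submod (free t) ?K') i"
      using dv_rank_nullity[OF fd_submod[OF fP K'] M hom_submod[OF phi(1) K'] i] by simp
    moreover have "dv M i + dv (submod (free t) ?K) i = t i + arrow_dim t i"
      using dv_rank_nullity[OF fP M phi(1) i] surj free_dv(1)[OF i] by simp
    moreover have "t i + dv (submod M (rad L M)) i = dv M i"
      using t[OF i] dv_submod_le[OF fd rad_submodule[OF M] i] by (simp add: topd_def)
    ultimately show "dv (submod (submod (free t) ?K') (rad L (free t))) i = dv (submod (free t) ?K') i"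
      using free_dv(2)[OF i, of t] by simp
  qed
  then have RK': "?K' = rad L (free t)" by simp
  \<comment> \<open>The kernel lies in the radical, so a submodule that fills the module together
    with the kernel also does so together with the radical.\<close>
  have "projective_cover Q I (free t) \<phi> M"
    unfolding projective_cover_def
  proof (intro conjI allI impI)
    fix N assume "Module.submodule N L (free t) \<and> set_add (free t) N ?K = carrier (free t)"
    then have N: "Module.submodule N L (free t)" and s: "set_add (free t) N ?K = carrier (free t)" by auto
    have "set_add (free t) N ?K \<subseteq> set_add (free t) N (rad L (free t))"
      using KK RK' by (auto simp: set_add_defs)
    then have "set_add (free t) N (rad L (free t)) = carrier (free t)"
      using s submoduleD(1)[OF set_add_submodule[OF P N R]] by blast
    then show "N = carrier (free t)" by (rule nakayama[OF P N])
  qed (use free_projective phi(1) surj in auto)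
  then show thesis using that RK' by blast
qed

text \<open>The free module with the top of M maps onto M and lifts to a map into P. Its image fills
  P together with the kernel of the cover, so by minimality the lift is onto, and the radical of P
  is an image of the radical of the free module. This controls an arbitrary cover without comparing
  covers up to isomorphism.\<close>

lemma cover_rad_bound:
  fixes P :: "('v,'a,'k,'m) quiver_module" and M :: "('v,'a,'k,'n) quiver_module"
  assumes pc: "projective_cover Q I P \<phi> M" and fd: "fd_module Q I M" and j: "j \<in> verts Q"
  shows "dv (submod P (rad L P)) j \<le> arrow_dim (topd M) j"
proof -
  let ?F = "free (topd M)"
  have fP: "fd_module Q I P" and phi: "\<phi> \<in> module_hom L P M" "\<phi> ` carrier P = carrier M"
    and sup: "\<And>N. Module.submodule N L P \<Longrightarrow> set_add P N {x \<in> carrier P. \<phi> x = \<zero>\<^bsub>M\<^esub>} = carrier P \<Longrightarrow> N = carrier P"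
    using pc by (auto simp: projective_cover_def projective_module_def)
  note P = fd_moduleD(1)[OF fP] and M = fd_moduleD(1)[OF fd] and F = free_left_module[of "topd M"]
  interpret P: left_module L P by (rule P)
  interpret M: left_module L M by (rule M)
  let ?K = "{x \<in> carrier P. \<phi> x = \<zero>\<^bsub>M\<^esub>}"
  note K = hom_kernel_submodule[OF P M phi(1)]
  obtain f where "projective_cover Q I ?F f M" using free_cover[OF fd, of "topd M"] by blast
  then have f: "f \<in> module_hom L ?F M" "f ` carrier ?F = carrier M" by (auto simp: projective_cover_def)
  obtain \<psi> where psi: "\<psi> \<in> module_hom L ?F P" "\<forall>x\<in>carrier ?F. \<phi> (\<psi> x) = f x"
    using free_lift[OF P M phi f(1)] by blast
  note N = hom_image_submodule[OF F P psi(1) submodule_carrier[OF F]]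
  have "set_add P (\<psi> ` carrier ?F) ?K = carrier P"
  proof
    show "carrier P \<subseteq> set_add P (\<psi> ` carrier ?F) ?K"
    proof
      fix y assume y: "y \<in> carrier P"
      have "\<phi> y \<in> f ` carrier ?F" unfolding f(2) by (rule module_homD(1)[OF phi(1) y])
      then obtain w where w: "\<phi> y = f w" "w \<in> carrier ?F" by (rule imageE)
      let ?n = "\<psi> w"
      have n: "?n \<in> carrier P" by (rule module_homD(1)[OF psi(1) w(2)])
      \<comment> \<open>The difference of y and its approximation from the image of the lift, with
        subtraction expressed by the scalar -1.\<close>
      let ?k = "sc (-1) \<odot>\<^bsub>P\<^esub> ?n \<oplus>\<^bsub>P\<^esub> y"
      have s: "\<ominus>\<^bsub>P\<^esub> ?n = sc (-1) \<odot>\<^bsub>P\<^esub> ?n" "\<ominus>\<^bsub>M\<^esub> \<phi> ?n = sc (-1) \<odot>\<^bsub>M\<^esub> \<phi> ?n"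
        using a_inv_smult[OF P n] a_inv_smult[OF M module_homD(1)[OF phi(1) n]] by auto
      have "\<phi> ?k = \<ominus>\<^bsub>M\<^esub> \<phi> ?n \<oplus>\<^bsub>M\<^esub> \<phi> ?n"
        using module_homD[OF phi(1)] n y w(1) psi(2) w(2) s(2) by (simp add: P.smult_closed)
      then have k: "?k \<in> ?K" using module_homD(1)[OF phi(1) n] n y by (simp add: P.smult_closed M.M.l_neg)
      have "y = ?n \<oplus>\<^bsub>P\<^esub> ?k" unfolding s(1)[symmetric] using n y by (simp add: P.M.a_assoc[symmetric] P.M.r_neg)
      then show "y \<in> set_add P (\<psi> ` carrier ?F) ?K" using k w(2) by (auto simp only: set_add_def set_mult_def) auto
    qed
  qed (rule submoduleD(1)[OF set_add_submodule[OF P N K]])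
  then have "\<psi> ` carrier ?F = carrier P" by (rule sup[OF N])
  then have "\<psi> ` rad L ?F = rad L P" by (rule hom_rad_surj[OF F P psi(1)])
  then show ?thesis
    using dv_rank_nullity[OF fd_submod[OF free_fd rad_submodule[OF F]] P hom_submod[OF psi(1) rad_submodule[OF F]] j]
      free_dv(2)[OF j, of "topd M"] by simp
qed

lemma topd_killed: "left_module L M \<Longrightarrow> killed M \<Longrightarrow> i \<in> verts Q \<Longrightarrow> topd M i = dv M i"
  using dv_zero[of M i] killed_rad_zero[of M] by (simp add: topd_def)

text \<open>When the dimensions fit, M and T are both covered by \<open>free (dv T)\<close>. The
  preimage of JM under one cover and the kernel of the other are the same radical, so the cover of T
  factors through M with kernel JM. Having top T thus becomes a numerical condition.\<close>

lemma module_top_iso_dv: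
  fixes M :: "('v,'a,'k,'m) quiver_module" and T :: "('v,'a,'k,'t) quiver_module"
  assumes fM: "fd_module Q I M" and fT: "fd_module Q I T" and ss: "semisimple_module L T"
  shows "module_iso L (module_top L M) T \<longleftrightarrow> (\<forall>i\<in>verts Q. dv (submod M (rad L M)) i + dv T i = dv M i)"
proof -
  note M = fd_moduleD(1)[OF fM] and T = fd_moduleD(1)[OF fT]
  note k = semisimple_killed[OF ss]
  show ?thesis unfolding module_top_iso[OF M T]
  proof
    assume "\<exists>g\<in>module_hom L M T. g ` carrier M = carrier T \<and> {x \<in> carrier M. g x = \<zero>\<^bsub>T\<^esub>} = rad L M"
    then obtain g where "g \<in> module_hom L M T" "g ` carrier M = carrier T" "{x \<in> carrier M. g x = \<zero>\<^bsub>T\<^esub>} = rad L M" by blast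
    then show "\<forall>i\<in>verts Q. dv (submod M (rad L M)) i + dv T i = dv M i"
      using dv_rank_nullity[OF fM T, of g] by (auto simp: add.commute)
  next
    assume d: "\<forall>i\<in>verts Q. dv (submod M (rad L M)) i + dv T i = dv M i"
    let ?F = "free (dv T)"
    note F = free_left_module[of "dv T"]
    interpret F: left_module L ?F by (rule F)
    interpret M: left_module L M by (rule M)
    obtain \<phi> where p: "projective_cover Q I ?F \<phi> M" "{w \<in> carrier ?F. \<phi> w \<in> rad L M} = rad L ?F"
    proof (rule free_cover[OF fM, of "dv T"])
      fix i assume "i \<in> verts Q"
      then have "dv (submod M (rad L M)) i + dv T i = dv M i" using d by blast
      then show "dv T i = topd M i" unfolding topd_def by linarith
    qed
    obtain \<psi> where q: "projective_cover Q I ?F \<psi> T" "{w \<in> carrier ?F. \<psi> w \<in> rad L T} = rad L ?F"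
      by (rule free_cover[OF fT, of "dv T"]) (simp add: topd_killed[OF T k])
    have phi: "\<phi> \<in> module_hom L ?F M" "\<phi> ` carrier ?F = carrier M" using p(1) by (simp_all only: projective_cover_def)
    have psi: "\<psi> \<in> module_hom L ?F T" "\<psi> ` carrier ?F = carrier T" using q(1) by (simp_all only: projective_cover_def)
    have q2: "{w \<in> carrier ?F. \<psi> w = \<zero>\<^bsub>T\<^esub>} = rad L ?F" using q(2) killed_rad_zero[OF T] k by simp
    have zR: "\<zero>\<^bsub>M\<^esub> \<in> rad L M" by (rule submoduleD(2)[OF rad_submodule[OF M]])
    \<comment> \<open>The kernel of the cover of M lies in the radical of the free module, which is
      the kernel of the cover of T.\<close>
    have ker: "\<psi> w = \<psi> w'" if w: "w \<in> carrier ?F" "w' \<in> carrier ?F" "\<phi> w = \<phi> w'" for w w'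
    proof -
      interpret T: left_module L T by (rule T)
      let ?u = "sc (-1) \<odot>\<^bsub>?F\<^esub> w \<oplus>\<^bsub>?F\<^esub> w'"
      have u: "?u \<in> carrier ?F" using w by (simp add: F.smult_closed)
      have "\<phi> ?u = \<ominus>\<^bsub>M\<^esub> \<phi> w \<oplus>\<^bsub>M\<^esub> \<phi> w"
        using module_homD[OF phi(1)] w a_inv_smult[OF M, of "\<phi> w"] by (simp add: F.smult_closed)
      then have "\<phi> ?u = \<zero>\<^bsub>M\<^esub>" using module_homD(1)[OF phi(1) w(1)] by (simp add: M.M.l_neg)
      then have "?u \<in> {w \<in> carrier ?F. \<phi> w \<in> rad L M}" using u zR by simp
      then have "?u \<in> {w \<in> carrier ?F. \<psi> w = \<zero>\<^bsub>T\<^esub>}" unfolding p(2) q2 .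
      then have "\<ominus>\<^bsub>T\<^esub> \<psi> w \<oplus>\<^bsub>T\<^esub> \<psi> w' = \<zero>\<^bsub>T\<^esub>"
        using module_homD[OF psi(1)] w a_inv_smult[OF T, of "\<psi> w"] by (simp add: F.smult_closed)
      then have "\<psi> w \<oplus>\<^bsub>T\<^esub> (\<ominus>\<^bsub>T\<^esub> \<psi> w \<oplus>\<^bsub>T\<^esub> \<psi> w') = \<psi> w" using module_homD(1)[OF psi(1)] w by simp
      then show ?thesis using module_homD(1)[OF psi(1)] w by (simp add: T.M.a_assoc[symmetric] T.M.r_neg)
    qed
    \<comment> \<open>The cover of T after a set-theoretic section of the cover of M; by
      \<open>ker\<close> the section does not matter.\<close>
    define g where "g m = \<psi> (inv_into (carrier ?F) \<phi> m)" for m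
    have g: "g (\<phi> w) = \<psi> w" if w: "w \<in> carrier ?F" for w
      unfolding g_def by (rule ker[OF inv_into_into[OF imageI[OF w]] w f_inv_into_f[OF imageI[OF w]]])
    have ex: "\<exists>w\<in>carrier ?F. m = \<phi> w" if "m \<in> carrier M" for m using that phi(2) by blast
    have "g \<in> module_hom L M T"
      unfolding module_hom_def
    proof (intro CollectI conjI allI impI Pi_I)
      fix m assume m: "m \<in> carrier M"
      obtain w where w: "w \<in> carrier ?F" "m = \<phi> w" using ex[OF m] by blast
      show "g m \<in> carrier T" unfolding w(2) g[OF w(1)] by (rule module_homD(1)[OF psi(1) w(1)])
    next
      fix m n assume mn: "m \<in> carrier M \<and> n \<in> carrier M"
      obtain w where w1: "w \<in> carrier ?F" "m = \<phi> w" using ex[OF conjunct1[OF mn]] by blast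
      obtain w' where w2: "w' \<in> carrier ?F" "n = \<phi> w'" using ex[OF conjunct2[OF mn]] by blast
      note w = w1(1) w2(1) w1(2) w2(2)
      then show "g (m \<oplus>\<^bsub>M\<^esub> n) = g m \<oplus>\<^bsub>T\<^esub> g n"
        using g[of "w \<oplus>\<^bsub>?F\<^esub> w'"] g module_homD(2)[OF phi(1) w(1,2)] module_homD(2)[OF psi(1) w(1,2)] by simp
    next
      fix X m assume Xm: "X \<in> carrier L \<and> m \<in> carrier M"
      obtain w where w1: "w \<in> carrier ?F" "m = \<phi> w" using ex[OF conjunct2[OF Xm]] by blast
      note w = conjunct1[OF Xm] w1
      then show "g (X \<odot>\<^bsub>M\<^esub> m) = X \<odot>\<^bsub>T\<^esub> g m"
        using g[of "X \<odot>\<^bsub>?F\<^esub> w"] g module_homD(3)[OF phi(1) w(1,2)] module_homD(3)[OF psi(1) w(1,2)] F.smult_closed by simp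
    qed
    moreover have "g ` carrier M = carrier T"
      unfolding phi(2)[symmetric] psi(2)[symmetric] image_image by (intro image_cong refl g)
    moreover have "{x \<in> carrier M. g x = \<zero>\<^bsub>T\<^esub>} = rad L M"
    proof (intro equalityI subsetI)
      fix m assume "m \<in> {x \<in> carrier M. g x = \<zero>\<^bsub>T\<^esub>}"
      then have m: "m \<in> carrier M" "g m = \<zero>\<^bsub>T\<^esub>" by simp_all
      obtain w where w: "w \<in> carrier ?F" "m = \<phi> w" using ex[OF m(1)] by blast
      have "\<psi> w = \<zero>\<^bsub>T\<^esub>" using m(2) unfolding w(2) g[OF w(1)] .
      with w(1) have "w \<in> {w \<in> carrier ?F. \<psi> w = \<zero>\<^bsub>T\<^esub>}" by simp
      then have "w \<in> {w \<in> carrier ?F. \<phi> w \<in> rad L M}" unfolding p(2) q2 .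
      then show "m \<in> rad L M" using w(2) by simp
    next
      fix m assume m: "m \<in> rad L M"
      then have mc: "m \<in> carrier M" using submoduleD(1)[OF rad_submodule[OF M]] by blast
      obtain w where w: "w \<in> carrier ?F" "m = \<phi> w" using ex[OF mc] by blast
      then have "w \<in> {w \<in> carrier ?F. \<phi> w \<in> rad L M}" using m by simp
      then have "w \<in> {w \<in> carrier ?F. \<psi> w = \<zero>\<^bsub>T\<^esub>}" unfolding p(2) q2 .
      then have "\<psi> w = \<zero>\<^bsub>T\<^esub>" by simp
      then show "m \<in> {x \<in> carrier M. g x = \<zero>\<^bsub>T\<^esub>}" using mc w g by simp
    qed
    ultimately show "\<exists>g\<in>module_hom L M T. g ` carrier M = carrier T \<and> {x \<in> carrier M. g x = \<zero>\<^bsub>T\<^esub>} = rad L M" by blast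
  qed
qed

end

section \<open>Polynomial conditions on ranks\<close>

text \<open>Used for two rings: the polynomials in the matrix entries of a point and the polynomial
  functions of a curve parameter. Closure under determinants and adjugates is proved once for
  both.\<close>

locale function_ring =
  fixes R :: "('x \<Rightarrow> 'k::field) set"
  assumes const: "(\<lambda>_. c) \<in> R"
    and add: "f \<in> R \<Longrightarrow> g \<in> R \<Longrightarrow> (\<lambda>x. f x + g x) \<in> R"
    and mult: "f \<in> R \<Longrightarrow> g \<in> R \<Longrightarrow> (\<lambda>x. f x * g x) \<in> R"
begin

lemma sum: "(\<And>i. i \<in> S \<Longrightarrow> f i \<in> R) \<Longrightarrow> (\<lambda>x. \<Sum>i\<in>S. f i x) \<in> R"
  by (induction S rule: infinite_finite_induct) (auto intro: const add)

lemma prod: "(\<And>i. i \<in> S \<Longrightarrow> f i \<in> R) \<Longrightarrow> (\<lambda>x. \<Prod>i\<in>S. f i x) \<in> R"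
  by (induction S rule: infinite_finite_induct) (auto intro: const mult)

lemma det:
  assumes "\<And>x. M x \<in> carrier_mat n n" "\<And>i j. i < n \<Longrightarrow> j < n \<Longrightarrow> (\<lambda>x. M x $$ (i, j)) \<in> R"
  shows "(\<lambda>x. det (M x)) \<in> R"
proof -
  have "(\<lambda>x. \<Sum>p\<in>{p. p permutes {0..<n}}. signof p * (\<Prod>i=0..<n. M x $$ (i, p i))) \<in> R"
    by (intro sum mult const prod assms(2)) (auto dest: permutes_in_image)
  then show ?thesis unfolding det_def'[OF assms(1)] .
qed

lemma adj_mat:
  assumes M: "\<And>x. M x \<in> carrier_mat n n" and e: "\<And>i j. i < n \<Longrightarrow> j < n \<Longrightarrow> (\<lambda>x. M x $$ (i, j)) \<in> R"
    and ij: "i < n" "j < n"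
  shows "(\<lambda>x. adj_mat (M x) $$ (i, j)) \<in> R"
proof -
  have "(\<lambda>x. (-1) ^ (j + i) * det (mat_delete (M x) j i)) \<in> R"
  proof (intro mult const det)
    show "mat_delete (M x) j i \<in> carrier_mat (n - 1) (n - 1)" for x by (rule mat_delete_carrier[OF M])
    show "(\<lambda>x. mat_delete (M x) j i $$ (a, b)) \<in> R" if "a < n - 1" "b < n - 1" for a b
    proof -
      \<comment> \<open>Deleting row j and column i shifts the later indices by one.\<close>
      let ?a = "if a < j then a else Suc a" and ?b = "if b < i then b else Suc b"
      have "mat_delete (M x) j i $$ (a, b) = M x $$ (?a, ?b)" for x
        using that M[of x] unfolding mat_delete_def by (subst index_mat) (auto split: if_splits)
      then show ?thesis using e[of ?a ?b] that by (auto split: if_splits)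
    qed
  qed
  moreover have "adj_mat (M x) $$ (i, j) = (-1) ^ (j + i) * det (mat_delete (M x) j i)" for x
    using M[of x] ij by (simp add: adj_mat_def cofactor_def)
  ultimately show ?thesis by simp
qed

lemma mat_mult:
  assumes "\<And>x. M x \<in> carrier_mat n m" "\<And>x. N x \<in> carrier_mat m l"
    and "\<And>i j. i < n \<Longrightarrow> j < m \<Longrightarrow> (\<lambda>x. M x $$ (i, j)) \<in> R" "\<And>i j. i < m \<Longrightarrow> j < l \<Longrightarrow> (\<lambda>x. N x $$ (i, j)) \<in> R"
    and ij: "i < n" "j < l"
  shows "(\<lambda>x. (M x * N x) $$ (i, j)) \<in> R"
proof -
  have "(\<lambda>x. \<Sum>k\<in>{0..<m}. M x $$ (i, k) * N x $$ (k, j)) \<in> R"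
    using assms by (intro sum mult) auto
  moreover have "(M x * N x) $$ (i, j) = (\<Sum>k\<in>{0..<m}. M x $$ (i, k) * N x $$ (k, j))" for x
    using assms(1)[of x] assms(2)[of x] ij by (auto simp: scalar_prod_def)
  ultimately show ?thesis by simp
qed

end

lemma inverse_mat:
  fixes A :: "'k::field mat"
  assumes A: "A \<in> carrier_mat n n" and d: "det A \<noteq> 0"
  obtains B where "B \<in> carrier_mat n n" "A * B = 1\<^sub>m n" "B * A = 1\<^sub>m n"
proof
  let ?B = "inverse (det A) \<cdot>\<^sub>m adj_mat A"
  note adj = adj_mat[OF A]
  show "?B \<in> carrier_mat n n" using adj(1) by simp
  show "A * ?B = 1\<^sub>m n" using mult_smult_distrib[OF A adj(1)] adj(2) d by (intro eq_matI) auto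
  show "?B * A = 1\<^sub>m n" using mult_smult_assoc_mat[OF adj(1) A] adj(3) d by (intro eq_matI) auto
qed

lemma inverse_mat_vec:
  fixes A :: "'k::field mat"
  assumes "A \<in> carrier_mat n n" "B \<in> carrier_mat n n" "A * B = 1\<^sub>m n" "v \<in> carrier_vec n"
  shows "A *\<^sub>v (B *\<^sub>v v) = v"
  using assms assoc_mult_mat_vec[of A n n B n v] by simp

lemma inj_on_mat:
  fixes A :: "'k::field mat"
  assumes A: "A \<in> carrier_mat n n" and d: "det A \<noteq> 0" and S: "S \<subseteq> carrier_vec n"
  shows "inj_on (\<lambda>v. A *\<^sub>v v) S"
proof -
  obtain B where "B \<in> carrier_mat n n" "B * A = 1\<^sub>m n" using inverse_mat[OF A d] by blast
  then have "B *\<^sub>v (A *\<^sub>v v) = v" if "v \<in> S" for v using inverse_mat_vec[of B n A] A S that by blast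
  then show ?thesis by (rule inj_on_inverseI)
qed

lemma dim_leading:
  assumes "r \<le> n"
  shows "vectorspace.dim class_ring ((module_vec TYPE('k::field) n)\<lparr>carrier := leading n r\<rparr>) = r"
proof -
  interpret W: vec_space "TYPE('k)" n .
  interpret V: vec_space "TYPE('k)" r .
  let ?f = "\<lambda>v :: 'k vec. v @\<^sub>v 0\<^sub>v (n - r)"
  have h: "?f \<in> LinearCombinations.module_hom class_ring (module_vec TYPE('k) r) (module_vec TYPE('k) n)"
    using assms by (auto simp: module_hom_def module_vec_simps append_vec_def Let_def intro!: eq_vecI)
  have "inj_on ?f (carrier_vec r)"
    by (intro inj_onI) (metis append_vec_eq)
  then show ?thesis
    using dim_inj_hom[OF V.vectorspace_axioms W.vectorspace_axioms h V.fin_dim] V.dim_is_n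
    by (simp add: module_vec_simps leading_eq_append[OF assms])
qed

section \<open>Images and annihilators of subspaces of a coordinate space\<close>

context vec_space
begin

lemma leading_subspace: "VectorSpace.subspace class_ring (leading n r) V"
  by (rule subspaceI) (auto simp: leading_def module_vec_simps)

lemma image_subspace:
  assumes A: "A \<in> carrier_mat n n" and W: "VectorSpace.subspace class_ring W V"
  shows "VectorSpace.subspace class_ring ((\<lambda>v. A *\<^sub>v v) ` W) V"
proof -
  note W' = subspaceD[OF W]
  have c: "w \<in> carrier_vec n" if "w \<in> W" for w using W'(1) that by (auto simp: module_vec_simps)
  have A0: "A *\<^sub>v 0\<^sub>v n = 0\<^sub>v n" using A by (intro eq_vecI) auto
  have W3: "v + w \<in> W" if "v \<in> W" "w \<in> W" for v w using W'(3)[OF that] by (simp add: module_vec_simps)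
  have W4: "k \<cdot>\<^sub>v v \<in> W" if "v \<in> W" for k v using W'(4)[OF _ that, of k] by (simp add: module_vec_simps)
  have W2: "0\<^sub>v n \<in> W" using W'(2) by (simp add: module_vec_simps)
  have i1: "(\<lambda>v. A *\<^sub>v v) ` W \<subseteq> carrier_vec n" using c A by auto
  have i2: "0\<^sub>v n \<in> (\<lambda>v. A *\<^sub>v v) ` W" using imageI[OF W2, of "\<lambda>v. A *\<^sub>v v"] A0 by simp
  have i3: "x + y \<in> (\<lambda>v. A *\<^sub>v v) ` W" if xy: "x \<in> (\<lambda>v. A *\<^sub>v v) ` W" "y \<in> (\<lambda>v. A *\<^sub>v v) ` W" for x y
  proof -
    obtain v w where vw: "v \<in> W" "w \<in> W" "x = A *\<^sub>v v" "y = A *\<^sub>v w" using xy by blast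
    show ?thesis unfolding vw(3,4) mult_add_distrib_mat_vec[OF A c[OF vw(1)] c[OF vw(2)], symmetric]
      by (rule imageI[OF W3[OF vw(1,2)]])
  qed
  have i4: "k \<cdot>\<^sub>v x \<in> (\<lambda>v. A *\<^sub>v v) ` W" if x: "x \<in> (\<lambda>v. A *\<^sub>v v) ` W" for k x
  proof -
    obtain v where v: "v \<in> W" "x = A *\<^sub>v v" using x by blast
    show ?thesis unfolding v(2) mult_mat_vec[OF A c[OF v(1)], symmetric] by (rule imageI[OF W4[OF v(1)]])
  qed
  show ?thesis by (rule subspaceI) (use i1 i2 i3 i4 in \<open>simp_all add: module_vec_simps\<close>)
qed

lemma dim_image_le:
  assumes A: "A \<in> carrier_mat n n" and W: "VectorSpace.subspace class_ring W V"
  shows "vectorspace.dim class_ring (vs ((\<lambda>v. A *\<^sub>v v) ` W)) \<le> vectorspace.dim class_ring (vs W)"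
    "det A \<noteq> 0 \<Longrightarrow> vectorspace.dim class_ring (vs ((\<lambda>v. A *\<^sub>v v) ` W)) = vectorspace.dim class_ring (vs W)"
proof -
  note W' = subspaceD[OF W]
  have h: "(\<lambda>v. A *\<^sub>v v) \<in> LinearCombinations.module_hom class_ring (vs W) V"
    using module_hom_mat[OF A] W'(1) by (auto simp: module_hom_def module_vec_simps subset_iff)
  note f = fin_dim_subspace[OF fin_dim W]
  show "vectorspace.dim class_ring (vs ((\<lambda>v. A *\<^sub>v v) ` W)) \<le> vectorspace.dim class_ring (vs W)"
    using rank_nullity_hom[OF W'(5) vectorspace_axioms h f] by simp
  show "vectorspace.dim class_ring (vs ((\<lambda>v. A *\<^sub>v v) ` W)) = vectorspace.dim class_ring (vs W)" if d: "det A \<noteq> 0"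
    using dim_inj_hom[OF W'(5) vectorspace_axioms h f] inj_on_mat[OF A d, of W] W'(1) by (simp add: module_vec_simps)
qed

lemma span_subspace_vec: "F \<subseteq> carrier_vec n \<Longrightarrow> VectorSpace.subspace class_ring (span F) V"
  by (intro span_is_subspace) (simp add: module_vec_simps)

text \<open>A maximal independent part of F, completed to a basis, gives the rows of an invertible
  matrix. This matrix carries the annihilator of F onto the vectors whose first entries
  vanish.\<close>

lemma dim_annihilator:
  assumes F: "F \<subseteq> carrier_vec n"
  shows "vectorspace.dim class_ring (vs {v \<in> carrier_vec n. \<forall>u\<in>F. u \<bullet> v = 0}) + vectorspace.dim class_ring (vs (span F)) = n"
proof -
  obtain us ws where *: "set us \<subseteq> F" "set ws \<subseteq> carrier_vec n" "length us + length ws = n"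
    "det (mat_of_cols n (us @ ws)) \<noteq> 0" "span (set us) = span F"
    "vectorspace.dim class_ring (span_vs F) = length us"
    by (rule adapted_columns[OF F])
  let ?l = "length us" and ?A = "mat_of_rows n (us @ ws)"
  let ?Z = "{v \<in> carrier_vec n. \<forall>u\<in>F. u \<bullet> v = 0}"
  have A: "?A \<in> carrier_mat n n" using *(3) by (auto simp: mat_of_rows_def)
  have "?A = transpose_mat (mat_of_cols n (us @ ws))" by (simp add: transpose_mat_of_cols)
  then have dA: "det ?A \<noteq> 0" using *(3,4) det_transpose[of "mat_of_cols n (us @ ws)" n] by (simp add: mat_of_cols_def)
  obtain B where B: "B \<in> carrier_mat n n" "?A * B = 1\<^sub>m n" "B * ?A = 1\<^sub>m n" by (rule inverse_mat[OF A dA])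
  have usc: "set us \<subseteq> carrier_vec n" using *(1) F by blast
  have Z: "v \<in> ?Z \<longleftrightarrow> (\<forall>u\<in>set us. u \<bullet> v = 0)" if v: "v \<in> carrier_vec n" for v
  proof
    assume u: "\<forall>u\<in>set us. u \<bullet> v = 0"
    have "VectorSpace.subspace class_ring {u \<in> carrier_vec n. u \<bullet> v = 0} V"
      by (rule subspaceI) (use v in \<open>auto simp: module_vec_simps add_scalar_prod_distrib\<close>)
    then have "span (set us) \<subseteq> {u \<in> carrier_vec n. u \<bullet> v = 0}"
      using u usc by (intro span_is_subset) (auto simp: VectorSpace.subspace_def)
    moreover have "F \<subseteq> span F" using F by (intro in_own_span) (simp add: module_vec_simps)
    ultimately show "v \<in> ?Z" using v *(5) by blast
  qed (use *(1) in blast)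
  have row: "(?A *\<^sub>v v) $ k = (us @ ws) ! k \<bullet> v" if "k < n" for k v
  proof -
    have "(us @ ws) ! k \<in> set (us @ ws)" using that *(3) by (intro nth_mem) simp
    then have "(us @ ws) ! k \<in> carrier_vec n" using usc *(2) by auto
    then show ?thesis using that *(3) mat_of_rows_row[of k "us @ ws" n] by (subst index_mult_mat_vec) simp_all
  qed
  have tr: "(?A *\<^sub>v v \<in> trailing n ?l) \<longleftrightarrow> v \<in> ?Z" if v: "v \<in> carrier_vec n" for v
  proof -
    have "?A *\<^sub>v v \<in> trailing n ?l \<longleftrightarrow> (\<forall>k<n. k < ?l \<longrightarrow> (us @ ws) ! k \<bullet> v = 0)"
      using mult_mat_vec_carrier[OF A v] row by (simp add: trailing_def del: index_mult_mat_vec)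
    also have "\<dots> \<longleftrightarrow> (\<forall>k<?l. us ! k \<bullet> v = 0)" unfolding *(3)[symmetric] by (auto simp: nth_append)
    finally have "?A *\<^sub>v v \<in> trailing n ?l \<longleftrightarrow> (\<forall>k<?l. us ! k \<bullet> v = 0)" .
    then show ?thesis unfolding Z[OF v] all_set_conv_all_nth .
  qed
  have im: "(\<lambda>v. ?A *\<^sub>v v) ` ?Z = trailing n ?l"
  proof (intro equalityI subsetI)
    fix y :: "'a vec" assume y: "y \<in> trailing n ?l"
    then have yc: "y \<in> carrier_vec n" by (simp add: trailing_def)
    then have By: "?A *\<^sub>v (B *\<^sub>v y) = y" "B *\<^sub>v y \<in> carrier_vec n" using inverse_mat_vec[OF A B(1,2)] B(1) by auto
    then have "B *\<^sub>v y \<in> ?Z" using iffD1[OF tr[of "B *\<^sub>v y"]] y by simp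
    then show "y \<in> (\<lambda>v. ?A *\<^sub>v v) ` ?Z" using imageI[of "B *\<^sub>v y" ?Z "\<lambda>v. ?A *\<^sub>v v"] unfolding By(1) by blast
  next
    fix y assume "y \<in> (\<lambda>v. ?A *\<^sub>v v) ` ?Z"
    then obtain v where v: "v \<in> ?Z" "y = ?A *\<^sub>v v" by blast
    have "v \<in> carrier_vec n" using v(1) by simp
    then show "y \<in> trailing n ?l" unfolding v(2) using tr v(1) by blast
  qed
  have "VectorSpace.subspace class_ring ?Z V"
    by (rule subspaceI) (use F in \<open>auto simp: module_vec_simps scalar_prod_add_distrib subset_iff\<close>)
  from dim_image_le(2)[OF A this dA] have "vectorspace.dim class_ring (vs ?Z) = n - ?l"
    unfolding im using dim_trailing[where 'k = 'a, of ?l "n - ?l"] *(3) by simp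
  then show ?thesis using *(3,6) by simp
qed

end

text \<open>Lower semicontinuity of the rank. Columns that are independent at \<open>x0\<close> are
  completed by constant vectors to an invertible matrix; its determinant is a function in R, and
  wherever it is nonzero the same columns stay independent.\<close>

lemma (in function_ring) open_rank:
  fixes u :: "'i \<Rightarrow> 'x \<Rightarrow> 'k vec"
  assumes u: "\<And>k x. u k x \<in> carrier_vec n" and e: "\<And>k a. k \<in> S \<Longrightarrow> a < n \<Longrightarrow> (\<lambda>x. u k x $ a) \<in> R"
    and r: "r \<le> vectorspace.dim class_ring ((module_vec TYPE('k) n)\<lparr>carrier := LinearCombinations.module.span class_ring (module_vec TYPE('k) n) ((\<lambda>k. u k x0) ` S)\<rparr>)"
  shows "\<exists>f\<in>R. f x0 \<noteq> 0 \<and> (\<forall>x. f x \<noteq> 0 \<longrightarrow>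
    r \<le> vectorspace.dim class_ring ((module_vec TYPE('k) n)\<lparr>carrier := LinearCombinations.module.span class_ring (module_vec TYPE('k) n) ((\<lambda>k. u k x) ` S)\<rparr>))"
proof -
  interpret V: vec_space "TYPE('k)" n .
  have c: "(\<lambda>k. u k x) ` S \<subseteq> carrier_vec n" for x using u by auto
  obtain us ws where *: "set us \<subseteq> (\<lambda>k. u k x0) ` S" "set ws \<subseteq> carrier_vec n" "length us + length ws = n"
    "det (mat_of_cols n (us @ ws)) \<noteq> 0" "V.span (set us) = V.span ((\<lambda>k. u k x0) ` S)"
    "vectorspace.dim class_ring (V.span_vs ((\<lambda>k. u k x0) ` S)) = length us"
    by (rule V.adapted_columns[OF c])
  have "us \<in> map (\<lambda>k. u k x0) ` lists S"
    unfolding lists_image[symmetric] using *(1) by (simp add: in_lists_conv_set subset_iff)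
  \<comment> \<open>The indices of the chosen columns, so that these columns can be followed when x
    varies.\<close>
  then obtain ks where ks: "us = map (\<lambda>k. u k x0) ks" "set ks \<subseteq> S" by auto
  let ?us = "\<lambda>x. map (\<lambda>k. u k x) ks"
  let ?M = "\<lambda>x. mat_of_cols n (?us x @ ws)"
  have l: "length ks + length ws = n" using *(3) ks(1) by simp
  have M: "?M x \<in> carrier_mat n n" for x using l by (auto simp: mat_of_cols_def)
  have "(\<lambda>x. ?M x $$ (a, b)) \<in> R" if ab: "a < n" "b < n" for a b
  proof (cases "b < length ks")
    case True
    then have "?M x $$ (a, b) = u (ks ! b) x $ a" for x using ab l by (simp add: mat_of_cols_index nth_append)
    moreover have "ks ! b \<in> S" using True ks(2) by auto
    ultimately show ?thesis using e ab(1) by simp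
  next
    case False
    then have "?M x $$ (a, b) = ws ! (b - length ks) $ a" for x using ab l by (simp add: mat_of_cols_index nth_append)
    then show ?thesis using const by simp
  qed
  then have "(\<lambda>x. det (?M x)) \<in> R" by (rule det[OF M])
  moreover have "det (?M x0) \<noteq> 0" using *(4) ks(1) by simp
  moreover have rk: "r \<le> vectorspace.dim class_ring (V.span_vs ((\<lambda>k. u k x) ` S))" if d: "det (?M x) \<noteq> 0" for x
  proof -
    have sc: "set (?us x) \<subseteq> carrier_vec n" using u by auto
    have "V.span (set (?us x)) = (\<lambda>v. ?M x *\<^sub>v v) ` leading n (length ks)"
      using V.span_eq_leading[OF sc *(2)] l by simp
    then have "vectorspace.dim class_ring (V.span_vs (set (?us x))) = length ks"
      using V.dim_image_le(2)[OF M V.leading_subspace d, of "length ks"] dim_leading[of "length ks" n] l by simp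
    moreover have "vectorspace.dim class_ring (V.span_vs (set (?us x))) \<le> vectorspace.dim class_ring (V.span_vs ((\<lambda>k. u k x) ` S))"
      using ks(2) by (intro V.dim_subspace_mono[OF V.fin_dim V.span_subspace_vec[OF sc] V.span_subspace_vec[OF c]] V.span_is_monotone) auto
    ultimately show ?thesis using r *(6) ks(1) by simp
  qed
  ultimately show ?thesis by (intro bexI[of _ "\<lambda>x. det (?M x)"] conjI allI impI rk)
qed

section \<open>Images and kernels of the arrows\<close>

text \<open>The shape puts the image into the leading r coordinates and the leading q coordinates
  into the kernel. When the r of one matrix is the q of the next, their product vanishes.\<close>

lemma block_mat_vec:
  fixes Y :: "'k::field mat"
  assumes Y: "Y \<in> carrier_mat n m" and b: "\<And>a b. a < n \<Longrightarrow> b < m \<Longrightarrow> Y $$ (a, b) \<noteq> 0 \<Longrightarrow> a < r \<and> q \<le> b" and w: "w \<in> carrier_vec m"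
  shows "Y *\<^sub>v w \<in> leading n r" "w \<in> leading m q \<Longrightarrow> Y *\<^sub>v w = 0\<^sub>v n"
proof -
  have z: "Y $$ (a, b) = 0" if "a < n" "b < m" "\<not> (a < r \<and> q \<le> b)" for a b using b that by blast
  have e: "(Y *\<^sub>v w) $ a = (\<Sum>k\<in>{0..<m}. Y $$ (a, k) * w $ k)" if "a < n" for a
    using Y w that by (simp add: scalar_prod_def)
  show "Y *\<^sub>v w \<in> leading n r"
    unfolding leading_def using mult_mat_vec_carrier[OF Y w] e z by (auto simp del: index_mult_mat_vec intro!: sum.neutral)
  show "Y *\<^sub>v w = 0\<^sub>v n" if l: "w \<in> leading m q"
  proof (rule eq_vecI)
    fix a assume "a < dim_vec (0\<^sub>v n :: 'k vec)"
    then have a: "a < n" by simp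
    have "Y $$ (a, k) * w $ k = 0" if "k \<in> {0..<m}" for k
      using z[OF a, of k] l that by (cases "q \<le> k") (auto simp: leading_def)
    then have "(\<Sum>k\<in>{0..<m}. Y $$ (a, k) * w $ k) = 0" by (intro sum.neutral ballI)
    then show "(Y *\<^sub>v w) $ a = 0\<^sub>v n $ a" unfolding e[OF a] using a by simp
  qed (use Y in simp)
qed

lemma mult_mat_zero_vec: "A \<in> carrier_mat n m \<Longrightarrow> A *\<^sub>v 0\<^sub>v m = (0\<^sub>v n :: 'k::field vec)"
  by (intro eq_vecI) auto

context rad_square_zero
begin

interpretation D: fin_digraph Q by (rule fin_digraph)

definition row_index :: "('v \<Rightarrow> nat) \<Rightarrow> 'v \<Rightarrow> ('a \<times> nat) set" where
  "row_index d i = {(\<alpha>, s). \<alpha> \<in> arcs Q \<and> tail Q \<alpha> = i \<and> s < d (head Q \<alpha>)}"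

abbreviation vspan :: "nat \<Rightarrow> 'k vec set \<Rightarrow> 'k vec set" where
  "vspan n F \<equiv> LinearCombinations.module.span class_ring (module_vec TYPE('k) n) F"

abbreviation vdim :: "nat \<Rightarrow> 'k vec set \<Rightarrow> nat" where
  "vdim n W \<equiv> vectorspace.dim class_ring ((module_vec TYPE('k) n)\<lparr>carrier := W\<rparr>)"

text \<open>The column space of all matrices into i taken together; by \<open>rad_colspan\<close> it
  is the radical at i.\<close>

definition colspan :: "('v \<Rightarrow> nat) \<Rightarrow> ('a \<Rightarrow> 'k mat) \<Rightarrow> 'v \<Rightarrow> 'k vec set" where
  "colspan d x i = vspan (d i) ((\<lambda>p. vec (d i) (\<lambda>a. x (fst p) $$ (a, snd p))) ` arrow_index d i)"

text \<open>The common kernel at i is the annihilator of this span. Semicontinuity is available for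
  dimensions of spans, so kernels are controlled through their complementary ranks.\<close>

definition rowspan :: "('v \<Rightarrow> nat) \<Rightarrow> ('a \<Rightarrow> 'k mat) \<Rightarrow> 'v \<Rightarrow> 'k vec set" where
  "rowspan d x i = vspan (d i) ((\<lambda>p. vec (d i) (\<lambda>b. x (fst p) $$ (snd p, b))) ` row_index d i)"

definition common_kernel :: "('v \<Rightarrow> nat) \<Rightarrow> ('a \<Rightarrow> 'k mat) \<Rightarrow> 'v \<Rightarrow> 'k vec set" where
  "common_kernel d x i = {v \<in> carrier_vec (d i). \<forall>\<alpha>\<in>arcs Q. tail Q \<alpha> = i \<longrightarrow> x \<alpha> *\<^sub>v v = 0\<^sub>v (d (head Q \<alpha>))}"

abbreviation cd :: "('v \<Rightarrow> nat) \<Rightarrow> ('a \<Rightarrow> 'k mat) \<Rightarrow> 'v \<Rightarrow> nat" where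
  "cd d x i \<equiv> dv (submod (rm d x) (rad L (rm d x))) i"

lemma colspan_subspace: "VectorSpace.subspace class_ring (colspan d x i) (module_vec TYPE('k) (d i))"
  unfolding colspan_def by (rule vec_space.span_subspace_vec) auto

lemma vec_subspaceI:
  assumes "W \<subseteq> carrier_vec n" "0\<^sub>v n \<in> W" "\<And>v w. v \<in> W \<Longrightarrow> w \<in> W \<Longrightarrow> v + w \<in> W" "\<And>c v. v \<in> W \<Longrightarrow> c \<cdot>\<^sub>v v \<in> W"
  shows "VectorSpace.subspace class_ring W (module_vec TYPE('k) n)"
proof -
  interpret vec_space "TYPE('k)" n .
  show ?thesis by (rule subspaceI) (use assms in \<open>simp_all add: module_vec_simps\<close>)
qed

lemma vec_subspaceD:
  assumes "VectorSpace.subspace class_ring W (module_vec TYPE('k) n)"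
  shows "W \<subseteq> carrier_vec n" "0\<^sub>v n \<in> W" "\<And>v w. v \<in> W \<Longrightarrow> w \<in> W \<Longrightarrow> v + w \<in> W" "\<And>c v. v \<in> W \<Longrightarrow> c \<cdot>\<^sub>v v \<in> W"
proof -
  interpret vec_space "TYPE('k)" n .
  note W = subspaceD[OF assms]
  show "W \<subseteq> carrier_vec n" "0\<^sub>v n \<in> W" using W(1,2) by (simp_all add: module_vec_simps)
  show "v + w \<in> W" if "v \<in> W" "w \<in> W" for v w using W(3)[OF that] by (simp add: module_vec_simps)
  show "c \<cdot>\<^sub>v v \<in> W" if "v \<in> W" for c v using W(4)[OF _ that, of c] by (simp add: module_vec_simps)
qed

lemma colspan_mem:
  assumes x: "x \<in> rep_ambient Q d" and a: "\<alpha> \<in> arcs Q" and w: "w \<in> carrier_vec (d (tail Q \<alpha>))"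
  shows "x \<alpha> *\<^sub>v w \<in> colspan d x (head Q \<alpha>)"
proof -
  note C = vec_subspaceD[OF colspan_subspace[of d x "head Q \<alpha>"]] and xc = rep_ambientD[OF x a]
  have "w \<in> {w \<in> carrier_vec (d (tail Q \<alpha>)). x \<alpha> *\<^sub>v w \<in> colspan d x (head Q \<alpha>)}"
  proof (rule vec_mem_of_units[OF w])
    have "x \<alpha> *\<^sub>v 0\<^sub>v (d (tail Q \<alpha>)) = 0\<^sub>v (d (head Q \<alpha>))" using xc by (intro eq_vecI) auto
    then show "0\<^sub>v (d (tail Q \<alpha>)) \<in> {w \<in> carrier_vec (d (tail Q \<alpha>)). x \<alpha> *\<^sub>v w \<in> colspan d x (head Q \<alpha>)}" using C(2) by simp
    show "v + w \<in> {w \<in> carrier_vec (d (tail Q \<alpha>)). x \<alpha> *\<^sub>v w \<in> colspan d x (head Q \<alpha>)}"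
      if "v \<in> {w \<in> carrier_vec (d (tail Q \<alpha>)). x \<alpha> *\<^sub>v w \<in> colspan d x (head Q \<alpha>)}"
        "w \<in> {w \<in> carrier_vec (d (tail Q \<alpha>)). x \<alpha> *\<^sub>v w \<in> colspan d x (head Q \<alpha>)}" for v w
      using that C(3) mult_add_distrib_mat_vec[OF xc, of v w] by simp
    fix s assume s: "s < d (tail Q \<alpha>)"
    have "vec (d (head Q \<alpha>)) (\<lambda>a. x \<alpha> $$ (a, s)) \<in> colspan d x (head Q \<alpha>)"
    proof -
      interpret vec_space "TYPE('k)" "d (head Q \<alpha>)" .
      have "(\<lambda>p. vec (d (head Q \<alpha>)) (\<lambda>a. x (fst p) $$ (a, snd p))) ` arrow_index d (head Q \<alpha>) \<subseteq> carrier_vec (d (head Q \<alpha>))" by auto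
      from in_own_span[OF this] show ?thesis using a s unfolding colspan_def by (force simp: arrow_index_def)
    qed
    moreover have "col (x \<alpha>) s = vec (d (head Q \<alpha>)) (\<lambda>a. x \<alpha> $$ (a, s))" using xc s by (intro eq_vecI) auto
    ultimately show "w $ s \<cdot>\<^sub>v unit_vec (d (tail Q \<alpha>)) s \<in> {w \<in> carrier_vec (d (tail Q \<alpha>)). x \<alpha> *\<^sub>v w \<in> colspan d x (head Q \<alpha>)}"
      using C(4) mult_smult_unit_vec[OF xc s] by simp
  qed
  then show ?thesis by simp
qed

lemma colspan_least:
  assumes x: "x \<in> rep_ambient Q d" and W: "VectorSpace.subspace class_ring W (module_vec TYPE('k) (d i))"
    and m: "\<And>\<alpha> w. \<alpha> \<in> arcs Q \<Longrightarrow> head Q \<alpha> = i \<Longrightarrow> w \<in> carrier_vec (d (tail Q \<alpha>)) \<Longrightarrow> x \<alpha> *\<^sub>v w \<in> W"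
  shows "colspan d x i \<subseteq> W"
proof -
  interpret vec_space "TYPE('k)" "d i" .
  have "vec (d i) (\<lambda>a. x \<alpha> $$ (a, s)) \<in> W" if "(\<alpha>, s) \<in> arrow_index d i" for \<alpha> s
  proof -
    have a: "\<alpha> \<in> arcs Q" "head Q \<alpha> = i" "s < d (tail Q \<alpha>)" using that by (auto simp: arrow_index_def)
    have "vec (d i) (\<lambda>a. x \<alpha> $$ (a, s)) = x \<alpha> *\<^sub>v unit_vec (d (tail Q \<alpha>)) s"
      using rep_ambientD[OF x a(1)] a by (subst mult_mat_unit_vec) (auto intro!: eq_vecI)
    then show ?thesis using m[OF a(1,2)] by simp
  qed
  then show ?thesis unfolding colspan_def using W by (intro span_is_subset) (auto simp: VectorSpace.subspace_def)
qed

lemma submodule_vertex_subspace: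
  assumes x: "x \<in> rep_variety Q I d" and U: "Module.submodule U L (rm d x)" and i: "i \<in> verts Q"
  shows "VectorSpace.subspace class_ring ((\<lambda>m. m i) ` U) (module_vec TYPE('k) (d i))"
proof (rule vec_subspaceI)
  note R' = submoduleD[OF U]
  have Rc: "m i \<in> carrier_vec (d i)" if "m \<in> U" for m
    using R'(1) that rep_spaceD[OF _ i] by (auto simp: rm_simps)
  show "(\<lambda>m. m i) ` U \<subseteq> carrier_vec (d i)" using Rc by blast
  show "0\<^sub>v (d i) \<in> (\<lambda>m. m i) ` U"
    using R'(2) i by (intro image_eqI[where x = "\<zero>\<^bsub>rm d x\<^esub>"]) (simp_all add: rm_simps)
  show "v + w \<in> (\<lambda>m. m i) ` U" if vw: "v \<in> (\<lambda>m. m i) ` U" "w \<in> (\<lambda>m. m i) ` U" for v w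
  proof -
    obtain m n where mn: "m \<in> U" "n \<in> U" "v = m i" "w = n i" using vw by blast
    show ?thesis using R'(3)[OF mn(1,2)] i mn(3,4) by (intro image_eqI[where x = "m \<oplus>\<^bsub>rm d x\<^esub> n"]) (simp_all add: rm_simps)
  qed
  show "c \<cdot>\<^sub>v v \<in> (\<lambda>m. m i) ` U" if v: "v \<in> (\<lambda>m. m i) ` U" for c v
  proof -
    obtain m where m: "m \<in> U" "v = m i" using v by blast
    have "m \<in> rep_space Q d" using R'(1) m(1) by (auto simp: rm_simps)
    then show ?thesis using R'(4)[OF gens_closed(3) m(1), of c] i m(2) rm_sc[OF x, of m c]
      by (intro image_eqI[where x = "sc c \<odot>\<^bsub>rm d x\<^esub> m"]) simp_all
  qed
qed

lemma rad_colspan: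
  assumes x: "x \<in> rep_variety Q I d" and i: "i \<in> verts Q"
  shows "(\<lambda>m. m i) ` rad L (rm d x) = colspan d x i"
proof
  note xa = rep_variety_ambient[OF x] and lm = rm_left_module[OF x]
  note R = rad_submodule[OF lm]
  have C: "0\<^sub>v (d i) \<in> colspan d x i" "v \<in> colspan d x i \<Longrightarrow> w \<in> colspan d x i \<Longrightarrow> v + w \<in> colspan d x i"
    "v \<in> colspan d x i \<Longrightarrow> c \<cdot>\<^sub>v v \<in> colspan d x i" for v w c i
    using vec_subspaceD[OF colspan_subspace[of d x i]] by auto
  let ?S = "{m \<in> rep_space Q d. m i \<in> colspan d x i}"
  have ar: "ar \<alpha> \<odot>\<^bsub>rm d x\<^esub> m \<in> ?S" if "\<alpha> \<in> arcs Q" "m \<in> rep_space Q d" for \<alpha> m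
  proof -
    have "ar \<alpha> \<odot>\<^bsub>rm d x\<^esub> m \<in> rep_space Q d"
      using submoduleD(4)[OF submodule_carrier[OF lm], of "ar \<alpha>" m] that by (simp add: rm_simps)
    then show ?thesis unfolding rm_ar[OF x that(2,1)] using i C(1) colspan_mem[OF xa that(1) rep_spaceD[OF that(2)]] that(1) by simp
  qed
  have "rad L (rm d x) \<subseteq> ?S"
  proof (rule rad_least[OF lm submoduleI[OF lm]])
    note cl = submoduleD[OF submodule_carrier[OF lm], unfolded rm_simps(1)]
    show "?S \<subseteq> carrier (rm d x)" by (auto simp: rm_simps)
    show "\<zero>\<^bsub>rm d x\<^esub> \<in> ?S" using cl(2) i C(1) by (simp add: rm_simps)
    show "m \<oplus>\<^bsub>rm d x\<^esub> n \<in> ?S" if "m \<in> ?S" "n \<in> ?S" for m n using that cl(3)[of m n] i C(2) by (simp add: rm_simps)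
    show "sc c \<odot>\<^bsub>rm d x\<^esub> m \<in> ?S" if "m \<in> ?S" for c m
      using that cl(4)[of "sc c" m] i C(3) rm_sc[OF x, of m c] by simp
    show "vx j \<odot>\<^bsub>rm d x\<^esub> m \<in> ?S" if "j \<in> verts Q" "m \<in> ?S" for j m
      using that cl(4)[of "vx j" m] i C(1) rm_vx[OF x, of m j] by auto
  qed (use ar in \<open>auto simp: rm_simps\<close>)
  then show "(\<lambda>m. m i) ` rad L (rm d x) \<subseteq> colspan d x i" by blast
  show "colspan d x i \<subseteq> (\<lambda>m. m i) ` rad L (rm d x)"
  proof (rule colspan_least[OF xa])
    show "VectorSpace.subspace class_ring ((\<lambda>m. m i) ` rad L (rm d x)) (module_vec TYPE('k) (d i))"
      by (rule submodule_vertex_subspace[OF x R i])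
    show "x \<alpha> *\<^sub>v w \<in> (\<lambda>m. m i) ` rad L (rm d x)"
      if a: "\<alpha> \<in> arcs Q" "head Q \<alpha> = i" and w: "w \<in> carrier_vec (d (tail Q \<alpha>))" for \<alpha> w
    proof (rule image_eqI)
      show "ar \<alpha> \<odot>\<^bsub>rm d x\<^esub> vsp d (tail Q \<alpha>) w \<in> rad L (rm d x)"
        by (rule rad_mem[OF a(1)]) (simp add: rm_simps vsp_space w)
      show "x \<alpha> *\<^sub>v w = (ar \<alpha> \<odot>\<^bsub>rm d x\<^esub> vsp d (tail Q \<alpha>) w) i"
        using rm_ar[OF x vsp_space[of w d "tail Q \<alpha>"] a(1)] w a i D.tail_in_verts[OF a(1)] by (simp add: vsp_apply)
    qed
  qed
qed

lemma cd_colspan: "x \<in> rep_variety Q I d \<Longrightarrow> i \<in> verts Q \<Longrightarrow> cd d x i = vdim (d i) (colspan d x i)"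
  by (simp add: dv_rm_submod rad_submodule rm_left_module rad_colspan)

lemma rep_polynomials_ring: "function_ring (rep_polynomials Q d :: (('a \<Rightarrow> 'k mat) \<Rightarrow> 'k) set)"
  by unfold_locales (auto intro: rep_polynomials.intros)

lemma cd_open:
  assumes x0: "x0 \<in> rep_variety Q I d" and i: "i \<in> verts Q"
  shows "\<exists>f\<in>rep_polynomials Q d. f x0 \<noteq> 0 \<and> (\<forall>x\<in>rep_variety Q I d. f x \<noteq> 0 \<longrightarrow> cd d x0 i \<le> cd d x i)"
proof -
  have "\<exists>f\<in>rep_polynomials Q d. f x0 \<noteq> 0 \<and> (\<forall>x. f x \<noteq> 0 \<longrightarrow> vdim (d i) (colspan d x0 i) \<le> vdim (d i) (colspan d x i))"
    unfolding colspan_def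
    by (rule function_ring.open_rank[OF rep_polynomials_ring, where u = "\<lambda>p x. vec (d i) (\<lambda>a. x (fst p) $$ (a, snd p))"])
      (auto simp: arrow_index_def intro!: rep_polynomials.coord)
  then show ?thesis using cd_colspan[OF x0 i] cd_colspan[OF _ i] by metis
qed

lemma rowspan_open:
  assumes i: "i \<in> verts Q"
  shows "\<exists>f\<in>rep_polynomials Q d. f x0 \<noteq> 0 \<and> (\<forall>x. f x \<noteq> 0 \<longrightarrow> vdim (d i) (rowspan d x0 i) \<le> vdim (d i) (rowspan d x i))"
  unfolding rowspan_def
  by (rule function_ring.open_rank[OF rep_polynomials_ring, where u = "\<lambda>p x. vec (d i) (\<lambda>b. x (fst p) $$ (snd p, b))"])
    (auto simp: row_index_def intro!: rep_polynomials.coord)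

lemma dim_common_kernel:
  assumes x: "x \<in> rep_ambient Q d"
  shows "vdim (d i) (common_kernel d x i) + vdim (d i) (rowspan d x i) = d i"
proof -
  let ?F = "(\<lambda>p. vec (d i) (\<lambda>b. x (fst p) $$ (snd p, b))) ` row_index d i"
  have F: "?F \<subseteq> carrier_vec (d i)" by auto
  have "{v \<in> carrier_vec (d i). \<forall>u\<in>?F. u \<bullet> v = 0} = common_kernel d x i"
  proof -
    have "(\<forall>u\<in>?F. u \<bullet> v = 0) \<longleftrightarrow> (\<forall>\<alpha>\<in>arcs Q. tail Q \<alpha> = i \<longrightarrow> x \<alpha> *\<^sub>v v = 0\<^sub>v (d (head Q \<alpha>)))" if v: "v \<in> carrier_vec (d i)" for v
    proof -
      have e: "(x \<alpha> *\<^sub>v v) $ s = vec (d i) (\<lambda>b. x \<alpha> $$ (s, b)) \<bullet> v" if "\<alpha> \<in> arcs Q" "tail Q \<alpha> = i" "s < d (head Q \<alpha>)" for \<alpha> s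
        using rep_ambientD[OF x that(1)] that v by (auto simp: scalar_prod_def)
      have e2: "x \<alpha> *\<^sub>v v = 0\<^sub>v (d (head Q \<alpha>)) \<longleftrightarrow> (\<forall>s<d (head Q \<alpha>). vec (d i) (\<lambda>b. x \<alpha> $$ (s, b)) \<bullet> v = 0)"
        if a: "\<alpha> \<in> arcs Q" "tail Q \<alpha> = i" for \<alpha>
      proof
        assume "x \<alpha> *\<^sub>v v = 0\<^sub>v (d (head Q \<alpha>))"
        then show "\<forall>s<d (head Q \<alpha>). vec (d i) (\<lambda>b. x \<alpha> $$ (s, b)) \<bullet> v = 0" using e[OF a] by (metis index_zero_vec(1))
      next
        assume z: "\<forall>s<d (head Q \<alpha>). vec (d i) (\<lambda>b. x \<alpha> $$ (s, b)) \<bullet> v = 0"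
        show "x \<alpha> *\<^sub>v v = 0\<^sub>v (d (head Q \<alpha>))"
        proof (rule eq_vecI)
          fix s assume "s < dim_vec (0\<^sub>v (d (head Q \<alpha>)) :: 'k vec)"
          then have s: "s < d (head Q \<alpha>)" by simp
          show "(x \<alpha> *\<^sub>v v) $ s = 0\<^sub>v (d (head Q \<alpha>)) $ s" unfolding e[OF a s] using z s by simp
        qed (use rep_ambientD[OF x a(1)] in simp)
      qed
      show ?thesis using e2 by (fastforce simp: row_index_def)
    qed
    then show ?thesis unfolding common_kernel_def by blast
  qed
  then show ?thesis using vec_space.dim_annihilator[OF F] by (simp add: rowspan_def)
qed

text \<open>The inclusion is the relation \<open>x \<beta> * x \<alpha> = 0\<close>, read as a
  statement about images and kernels.\<close>

lemma colspan_common_kernel: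
  assumes x: "x \<in> rep_variety Q I d" and i: "i \<in> verts Q"
  shows "VectorSpace.subspace class_ring (common_kernel d x i) (module_vec TYPE('k) (d i))" "colspan d x i \<subseteq> common_kernel d x i"
proof -
  interpret vec_space "TYPE('k)" "d i" .
  note xa = rep_variety_ambient[OF x]
  show s: "VectorSpace.subspace class_ring (common_kernel d x i) (module_vec TYPE('k) (d i))"
  proof (rule vec_subspaceI)
    show "common_kernel d x i \<subseteq> carrier_vec (d i)" by (auto simp: common_kernel_def)
    show "0\<^sub>v (d i) \<in> common_kernel d x i"
      using mult_mat_zero_vec[OF rep_ambientD[OF xa]] by (auto simp: common_kernel_def)
    show "v + w \<in> common_kernel d x i" if "v \<in> common_kernel d x i" "w \<in> common_kernel d x i" for v w
      using that mult_add_distrib_mat_vec[OF rep_ambientD[OF xa], of _ v w] by (auto simp: common_kernel_def)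
    show "c \<cdot>\<^sub>v v \<in> common_kernel d x i" if "v \<in> common_kernel d x i" for c v
      using that mult_mat_vec[OF rep_ambientD[OF xa], of _ v c] by (auto simp: common_kernel_def smult_vec_zero)
  qed
  show "colspan d x i \<subseteq> common_kernel d x i"
  proof (rule colspan_least[OF xa s])
    fix \<alpha> and w :: "'k vec" assume a: "\<alpha> \<in> arcs Q" "head Q \<alpha> = i" and w: "w \<in> carrier_vec (d (tail Q \<alpha>))"
    have xw: "x \<alpha> *\<^sub>v w \<in> carrier_vec (d i)" using rep_ambientD[OF xa a(1)] w a(2) by simp
    moreover have "x \<beta> *\<^sub>v (x \<alpha> *\<^sub>v w) = 0\<^sub>v (d (head Q \<beta>))" if b: "\<beta> \<in> arcs Q" "tail Q \<beta> = i" for \<beta>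
    proof -
      have "x \<beta> *\<^sub>v (x \<alpha> *\<^sub>v w) = (x \<beta> * x \<alpha>) *\<^sub>v w"
        using rep_ambientD[OF xa a(1)] rep_ambientD[OF xa b(1)] a(2) b(2) w by (intro assoc_mult_mat_vec[symmetric]) auto
      also have "x \<beta> * x \<alpha> = 0\<^sub>m (d (head Q \<beta>)) (d (tail Q \<alpha>))" using bspec[OF bspec[OF conjunct2[OF iffD1[OF rep_variety_iff x]] a(1)] b(1)] a(2) b(2) by simp
      finally show ?thesis using w by (simp add: zero_mat_mult_vec)
    qed
    ultimately show "x \<alpha> *\<^sub>v w \<in> common_kernel d x i" by (simp add: common_kernel_def)
  qed
qed

text \<open>The image lies in the common kernel. In this form the dimension of the radical is
  bounded above through a quantity that can only drop in a limit.\<close>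

lemma cd_rowspan_le:
  assumes x: "x \<in> rep_variety Q I d" and i: "i \<in> verts Q"
  shows "cd d x i + vdim (d i) (rowspan d x i) \<le> d i"
proof -
  interpret vec_space "TYPE('k)" "d i" .
  have "vdim (d i) (colspan d x i) \<le> vdim (d i) (common_kernel d x i)"
    by (rule dim_subspace_mono[OF fin_dim colspan_subspace colspan_common_kernel[OF x i]])
  then show ?thesis using dim_common_kernel[OF rep_variety_ambient[OF x], of i] cd_colspan[OF x i] by simp
qed

end

section \<open>Curves in the strata of constant radical dimension\<close>

text \<open>Over a finite field, 1 plus the product of all linear factors would be a nonconstant
  polynomial without roots.\<close>

lemma infinite_UNIV_alg_closed: "infinite (UNIV :: 'k::alg_closed_field set)"
proof
  assume f: "finite (UNIV :: 'k set)"
  let ?q = "\<Prod>a\<in>UNIV. [:- a, 1 :: 'k:]"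
  have d: "degree ?q = card (UNIV :: 'k set)" by (subst degree_prod_eq_sum_degree) auto
  have "card (UNIV :: 'k set) > 0" using f by (simp add: card_gt_0_iff)
  then have "degree (?q + 1) > 0" using d by (subst degree_add_eq_left) auto
  then obtain z where "poly (?q + 1) z = 0" using alg_closed_imp_poly_has_root by blast
  moreover have "poly ?q z = 0" using f by (auto simp: poly_prod)
  ultimately show False by simp
qed

lemma smult_mat_mult_vec:
  "A \<in> carrier_mat n m \<Longrightarrow> w \<in> carrier_vec m \<Longrightarrow> (c \<cdot>\<^sub>m A) *\<^sub>v w = c \<cdot>\<^sub>v (A *\<^sub>v (w :: 'k::field vec))"
  by (intro eq_vecI) (auto simp: scalar_prod_def sum_distrib_left mult.assoc)

definition polynomial_functions :: "('k::field \<Rightarrow> 'k) set" where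
  "polynomial_functions = range poly"

lemma polynomial_functions_ring: "function_ring (polynomial_functions :: ('k::field \<Rightarrow> 'k) set)"
proof
  show "(\<lambda>_. c) \<in> (polynomial_functions :: ('k \<Rightarrow> 'k) set)" for c
    unfolding polynomial_functions_def by (rule image_eqI[where x = "[:c:]"]) auto
  fix f g :: "'k \<Rightarrow> 'k" assume "f \<in> polynomial_functions" "g \<in> polynomial_functions"
  then obtain p q where pq: "f = poly p" "g = poly q" by (auto simp: polynomial_functions_def)
  have "(\<lambda>x. f x + g x) = poly (p + q)" "(\<lambda>x. f x * g x) = poly (p * q)" by (simp_all add: fun_eq_iff pq)
  then show "(\<lambda>x. f x + g x) \<in> polynomial_functions" "(\<lambda>x. f x * g x) \<in> polynomial_functions"
    by (simp_all add: polynomial_functions_def)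
qed

lemma polynomial_function_common_nonzero:
  fixes S :: "('k::alg_closed_field \<Rightarrow> 'k) set"
  assumes "finite S" "\<And>f. f \<in> S \<Longrightarrow> f \<in> polynomial_functions \<and> (\<exists>t. f t \<noteq> 0)"
  obtains t where "\<And>f. f \<in> S \<Longrightarrow> f t \<noteq> 0"
proof -
  have "finite {t. f t = 0}" if f: "f \<in> S" for f
  proof -
    obtain p where p: "f = poly p" using assms(2)[OF f] by (auto simp: polynomial_functions_def)
    then have "p \<noteq> 0" using assms(2)[OF f] by auto
    then show ?thesis unfolding p by (rule poly_roots_finite)
  qed
  then have "finite (\<Union>f\<in>S. {t. f t = 0})" using assms(1) by blast
  then have "\<exists>t. t \<notin> (\<Union>f\<in>S. {t. f t = 0})" using infinite_UNIV_alg_closed ex_new_if_finite by blast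
  then obtain t where "t \<notin> (\<Union>f\<in>S. {t. f t = 0})" by blast
  then have "\<And>f. f \<in> S \<Longrightarrow> f t \<noteq> 0" by simp
  then show thesis by (rule that)
qed

lemma rep_polynomials_comp:
  assumes "f \<in> rep_polynomials Q d" "function_ring R"
    and "\<And>\<alpha> r s. \<alpha> \<in> arcs Q \<Longrightarrow> r < d (head Q \<alpha>) \<Longrightarrow> s < d (tail Q \<alpha>) \<Longrightarrow> (\<lambda>t. c t \<alpha> $$ (r, s)) \<in> R"
  shows "(\<lambda>t. f (c t)) \<in> R"
  using assms(1)
proof induction
  case (const c)
  then show ?case by (rule function_ring.const[OF assms(2)])
next
  case (coord \<alpha> r s)
  then show ?case by (rule assms(3))
next
  case (add f g)
  then show ?case using function_ring.add[OF assms(2)] by blast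
next
  case (mult f g)
  then show ?case using function_ring.mult[OF assms(2)] by blast
qed

context rad_square_zero
begin

interpretation D: fin_digraph Q by (rule fin_digraph)

text \<open>In bases adapted to U the inclusions of the images in U and of U in the kernels become a
  block shape of the matrices. The subspaces U are left free between these two bounds, so that the
  radical of the point may be smaller than r.\<close>

lemma block_form:
  assumes x: "x \<in> rep_variety Q I d"
    and U: "\<And>i. i \<in> verts Q \<Longrightarrow> VectorSpace.subspace class_ring (U i) (module_vec TYPE('k) (d i))"
      "\<And>i. i \<in> verts Q \<Longrightarrow> vdim (d i) (U i) = r i"
      "\<And>i. i \<in> verts Q \<Longrightarrow> colspan d x i \<subseteq> U i" "\<And>i. i \<in> verts Q \<Longrightarrow> U i \<subseteq> common_kernel d x i"
  shows "\<exists>g y. (\<forall>i\<in>verts Q. g i \<in> carrier_mat (d i) (d i) \<and> r i \<le> d i) \<and>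
    (\<forall>\<alpha>\<in>arcs Q. y \<alpha> \<in> carrier_mat (d (head Q \<alpha>)) (d (tail Q \<alpha>)) \<and>
      (\<forall>a<d (head Q \<alpha>). \<forall>b<d (tail Q \<alpha>). y \<alpha> $$ (a, b) \<noteq> 0 \<longrightarrow> a < r (head Q \<alpha>) \<and> r (tail Q \<alpha>) \<le> b) \<and>
      x \<alpha> = g (head Q \<alpha>) * (y \<alpha> * adj_mat (g (tail Q \<alpha>))))"
proof -
  note xa = rep_variety_ambient[OF x]
  define P where "P i g h \<longleftrightarrow> g \<in> carrier_mat (d i) (d i) \<and> det g \<noteq> 0 \<and> U i = (\<lambda>v. g *\<^sub>v v) ` leading (d i) (r i) \<and> r i \<le> d i \<and>
      h \<in> carrier_mat (d i) (d i) \<and> g * h = 1\<^sub>m (d i) \<and> h * g = 1\<^sub>m (d i)" for i and g h :: "'k mat"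
  have "\<exists>g h. P i g h" if i: "i \<in> verts Q" for i
  proof -
    obtain g where g: "g \<in> carrier_mat (d i) (d i)" "det g \<noteq> 0" "U i = (\<lambda>v. g *\<^sub>v v) ` leading (d i) (r i)" "r i \<le> d i"
      using vec_space.adapted_matrix[OF U(1)[OF i]] U(2)[OF i] by metis
    obtain h where "h \<in> carrier_mat (d i) (d i)" "g * h = 1\<^sub>m (d i)" "h * g = 1\<^sub>m (d i)" by (rule inverse_mat[OF g(1,2)])
    then show ?thesis using g unfolding P_def by blast
  qed
  then obtain g h where P: "\<And>i. i \<in> verts Q \<Longrightarrow> P i (g i) (h i)" by metis
  have g: "\<And>i. i \<in> verts Q \<Longrightarrow> g i \<in> carrier_mat (d i) (d i)" "\<And>i. i \<in> verts Q \<Longrightarrow> det (g i) \<noteq> 0"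
    "\<And>i. i \<in> verts Q \<Longrightarrow> U i = (\<lambda>v. g i *\<^sub>v v) ` leading (d i) (r i)" "\<And>i. i \<in> verts Q \<Longrightarrow> r i \<le> d i"
    and h: "\<And>i. i \<in> verts Q \<Longrightarrow> h i \<in> carrier_mat (d i) (d i)" "\<And>i. i \<in> verts Q \<Longrightarrow> g i * h i = 1\<^sub>m (d i)"
    "\<And>i. i \<in> verts Q \<Longrightarrow> h i * g i = 1\<^sub>m (d i)"
    using P unfolding P_def by blast+
  \<comment> \<open>The division by the determinant compensates for writing the adjugate, and not
    the inverse, on the right of y.\<close>
  define y where "y \<alpha> = inverse (det (g (tail Q \<alpha>))) \<cdot>\<^sub>m (h (head Q \<alpha>) * (x \<alpha> * g (tail Q \<alpha>)))" for \<alpha>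
  have "y \<alpha> \<in> carrier_mat (d (head Q \<alpha>)) (d (tail Q \<alpha>)) \<and>
      (\<forall>a<d (head Q \<alpha>). \<forall>b<d (tail Q \<alpha>). y \<alpha> $$ (a, b) \<noteq> 0 \<longrightarrow> a < r (head Q \<alpha>) \<and> r (tail Q \<alpha>) \<le> b) \<and>
      x \<alpha> = g (head Q \<alpha>) * (y \<alpha> * adj_mat (g (tail Q \<alpha>)))" if a: "\<alpha> \<in> arcs Q" for \<alpha>
  proof -
    let ?h = "head Q \<alpha>" and ?t = "tail Q \<alpha>"
    let ?c = "inverse (det (g ?t))"
    have ht: "?h \<in> verts Q" "?t \<in> verts Q" using a by auto
    note xc = rep_ambientD[OF xa a] and gh = g(1)[OF ht(1)] and gt = g(1)[OF ht(2)] and hh = h(1)[OF ht(1)]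
    note adj = adj_mat[OF gt]
    have xg: "x \<alpha> * g ?t \<in> carrier_mat (d ?h) (d ?t)" using xc gt by simp
    have yc: "y \<alpha> \<in> carrier_mat (d ?h) (d ?t)" using hh xg by (simp add: y_def)
    have yv: "y \<alpha> *\<^sub>v w = ?c \<cdot>\<^sub>v (h ?h *\<^sub>v (x \<alpha> *\<^sub>v (g ?t *\<^sub>v w)))" if w: "w \<in> carrier_vec (d ?t)" for w
    proof -
      have "y \<alpha> *\<^sub>v w = ?c \<cdot>\<^sub>v ((h ?h * (x \<alpha> * g ?t)) *\<^sub>v w)"
        unfolding y_def by (rule smult_mat_mult_vec[OF mult_carrier_mat[OF hh xg] w])
      then show ?thesis using assoc_mult_mat_vec[OF hh xg w] assoc_mult_mat_vec[OF xc gt w] by simp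
    qed
    have x_eq: "x \<alpha> = g ?h * (y \<alpha> * adj_mat (g ?t))"
    proof (rule mat_eq_of_mult_vec[OF xc])
      show "g ?h * (y \<alpha> * adj_mat (g ?t)) \<in> carrier_mat (d ?h) (d ?t)" using gh yc adj(1) by simp
      fix v :: "'k vec" assume v: "v \<in> carrier_vec (d ?t)"
      have av: "adj_mat (g ?t) *\<^sub>v v \<in> carrier_vec (d ?t)" using adj(1) v by simp
      have "g ?t *\<^sub>v (adj_mat (g ?t) *\<^sub>v v) = (det (g ?t) \<cdot>\<^sub>m 1\<^sub>m (d ?t)) *\<^sub>v v"
        using assoc_mult_mat_vec[OF gt adj(1) v] adj(2) by simp
      also have "\<dots> = det (g ?t) \<cdot>\<^sub>v v"
        using v by (intro eq_vecI) (auto simp: smult_scalar_prod_distrib[of _ "d ?t"] scalar_prod_left_unit)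
      finally have "y \<alpha> *\<^sub>v (adj_mat (g ?t) *\<^sub>v v) = ?c \<cdot>\<^sub>v (h ?h *\<^sub>v (det (g ?t) \<cdot>\<^sub>v (x \<alpha> *\<^sub>v v)))"
        using yv[OF av] mult_mat_vec[OF xc v] by simp
      also have "\<dots> = h ?h *\<^sub>v (x \<alpha> *\<^sub>v v)"
        using mult_mat_vec[OF hh, of "x \<alpha> *\<^sub>v v"] xc v g(2)[OF ht(2)] by (simp add: smult_smult_assoc)
      finally have "g ?h *\<^sub>v (y \<alpha> *\<^sub>v (adj_mat (g ?t) *\<^sub>v v)) = x \<alpha> *\<^sub>v v"
        using inverse_mat_vec[OF gh hh h(2)[OF ht(1)], of "x \<alpha> *\<^sub>v v"] xc v by simp
      moreover have "(g ?h * (y \<alpha> * adj_mat (g ?t))) *\<^sub>v v = g ?h *\<^sub>v (y \<alpha> *\<^sub>v (adj_mat (g ?t) *\<^sub>v v))"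
        using assoc_mult_mat_vec[OF gh _ v, of "y \<alpha> * adj_mat (g ?t)"] assoc_mult_mat_vec[OF yc adj(1) v] yc adj(1) by simp
      ultimately show "x \<alpha> *\<^sub>v v = (g ?h * (y \<alpha> * adj_mat (g ?t))) *\<^sub>v v" by simp
    qed
    have h0: "h ?h *\<^sub>v 0\<^sub>v (d ?h) = 0\<^sub>v (d ?h)" using hh by (intro eq_vecI) auto
    \<comment> \<open>Column b of y is, up to a scalar, the adapted coordinate vector of the arrow
      applied to basis vector b. It is leading because the image lies in U, and zero for b below r
      because then the basis vector lies in U and hence in the kernel.\<close>
    have "a < r ?h \<and> r ?t \<le> b" if ab: "a < d ?h" "b < d ?t" and nz: "y \<alpha> $$ (a, b) \<noteq> 0" for a b
    proof -
      let ?u = "unit_vec (d ?t) b :: 'k vec"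
      have uc: "?u \<in> carrier_vec (d ?t)" by simp
      have yu: "y \<alpha> $$ (a, b) = (y \<alpha> *\<^sub>v ?u) $ a" unfolding mult_mat_unit_vec[OF yc ab(2)] using yc ab by simp
      have guc: "g ?t *\<^sub>v ?u \<in> carrier_vec (d ?t)" by (rule mult_mat_vec_carrier[OF gt uc])
      have "x \<alpha> *\<^sub>v (g ?t *\<^sub>v ?u) \<in> U ?h" using colspan_mem[OF xa a guc] U(3)[OF ht(1)] by blast
      then obtain l where l: "l \<in> leading (d ?h) (r ?h)" "x \<alpha> *\<^sub>v (g ?t *\<^sub>v ?u) = g ?h *\<^sub>v l" using g(3)[OF ht(1)] by auto
      have lc: "l \<in> carrier_vec (d ?h)" using l(1) by (simp add: leading_def)
      have "y \<alpha> *\<^sub>v ?u = ?c \<cdot>\<^sub>v l"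
        unfolding yv[OF uc] l(2) inverse_mat_vec[OF hh gh h(3)[OF ht(1)] lc] ..
      then have "a < r ?h" using nz ab(1) l(1) lc unfolding yu by (auto simp: leading_def not_less[symmetric] intro: ccontr)
      moreover have "r ?t \<le> b"
      proof (rule ccontr)
        assume "\<not> r ?t \<le> b"
        then have "?u \<in> leading (d ?t) (r ?t)" using ab(2) by (auto simp: leading_def)
        then have "g ?t *\<^sub>v ?u \<in> common_kernel d x ?t" using g(3)[OF ht(2)] U(4)[OF ht(2)] by blast
        then have "x \<alpha> *\<^sub>v (g ?t *\<^sub>v ?u) = 0\<^sub>v (d ?h)" using a by (simp add: common_kernel_def)
        then have "y \<alpha> *\<^sub>v ?u = 0\<^sub>v (d ?h)" unfolding yv[OF uc] by (simp add: h0 smult_vec_zero)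
        then show False using nz ab(1) unfolding yu by simp
      qed
      ultimately show ?thesis ..
    qed
    then show ?thesis using yc x_eq by blast
  qed
  then show ?thesis using g(1,4) by blast
qed

end

lemma irreducible_in_closure_of:
  assumes "irreducible_in X S"
  shows "irreducible_in X (X closure_of S)"
  unfolding irreducible_in_def
proof (intro conjI allI impI)
  have S: "S \<subseteq> topspace X" "S \<noteq> {}" "\<And>A B. closedin X A \<Longrightarrow> closedin X B \<Longrightarrow> S \<subseteq> A \<union> B \<Longrightarrow> S \<subseteq> A \<or> S \<subseteq> B"
    using assms by (auto simp: irreducible_in_def)
  note c = closure_of_subset[OF S(1)]
  show "X closure_of S \<subseteq> topspace X" by (rule closure_of_subset_topspace)
  show "X closure_of S \<noteq> {}" using c S(2) by blast
  fix A B assume "closedin X A \<and> closedin X B \<and> X closure_of S \<subseteq> A \<union> B"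
  then show "X closure_of S \<subseteq> A \<or> X closure_of S \<subseteq> B"
    using S(3)[of A B] c closure_of_minimal by (metis order_trans)
qed

text \<open>Irreducibility speaks of two closed sets; this passes to finitely many, as the finitely
  many strata require.\<close>

lemma irreducible_in_finite_cover:
  assumes Z: "irreducible_in X Z" and fin: "finite K" and cl: "\<And>k. k \<in> K \<Longrightarrow> closedin X (C k)" and cov: "Z \<subseteq> (\<Union>k\<in>K. C k)"
  shows "\<exists>k\<in>K. Z \<subseteq> C k"
  using fin cl cov
proof (induction K rule: finite_induct)
  case empty
  then show ?case using Z by (auto simp: irreducible_in_def)
next
  case (insert k K)
  have "closedin X (\<Union>k\<in>K. C k)" using insert.hyps insert.prems(1) by (intro closedin_Union) auto
  then have "Z \<subseteq> C k \<or> Z \<subseteq> (\<Union>k\<in>K. C k)"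
    using Z insert.prems unfolding irreducible_in_def by (metis UN_insert insertI1)
  then show ?case using insert by blast
qed

section \<open>Strata and semicontinuity bounds on their closures\<close>

context rad_square_zero
begin

interpretation D: fin_digraph Q by (rule fin_digraph)

definition strat :: "('v \<Rightarrow> nat) \<Rightarrow> ('v \<Rightarrow> nat) \<Rightarrow> ('a \<Rightarrow> 'k mat) set" where
  "strat d r = {x \<in> rep_variety Q I d. \<forall>i\<in>verts Q. cd d x i = r i}"

abbreviation zar :: "('v \<Rightarrow> nat) \<Rightarrow> ('a \<Rightarrow> 'k mat) topology" where
  "zar d \<equiv> rep_zariski Q I d"

lemma topspace_zar: "topspace (zar d) = rep_variety Q I d"
proof
  show "topspace (zar d) \<subseteq> rep_variety Q I d"
    unfolding topspace_def openin_rep_zariski by (auto simp: zariski_open_def)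
  have "zariski_open Q I d (rep_variety Q I d)"
    unfolding zariski_open_def by (rule exI[of _ "{\<lambda>_. 1}"]) (auto intro: rep_polynomials.const)
  then show "rep_variety Q I d \<subseteq> topspace (zar d)" by (intro openin_subset) (simp add: openin_rep_zariski)
qed

lemma zar_open_polynomial: "f \<in> rep_polynomials Q d \<Longrightarrow> openin (zar d) {x \<in> rep_variety Q I d. f x \<noteq> 0}"
  unfolding openin_rep_zariski zariski_open_def by (rule exI[of _ "{f}"]) auto

lemma zar_open_polynomial_at:
  assumes "openin (zar d) O'" "x \<in> O'"
  shows "\<exists>f\<in>rep_polynomials Q d. f x \<noteq> 0 \<and> (\<forall>y\<in>rep_variety Q I d. f y \<noteq> 0 \<longrightarrow> y \<in> O')"
  using assms unfolding openin_rep_zariski zariski_open_def by blast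

text \<open>Nonvanishing sets of single polynomials form a basis of the topology, so closure
  membership is tested on one polynomial at a time.\<close>

lemma zar_closureI:
  assumes "x \<in> rep_variety Q I d" "S \<subseteq> rep_variety Q I d"
    and "\<And>f. f \<in> rep_polynomials Q d \<Longrightarrow> f x \<noteq> 0 \<Longrightarrow> \<exists>y\<in>S. f y \<noteq> 0"
  shows "x \<in> zar d closure_of S"
  unfolding in_closure_of topspace_zar
proof (intro conjI allI impI assms(1))
  fix O' assume o: "x \<in> O' \<and> openin (zar d) O'"
  obtain f where f: "f \<in> rep_polynomials Q d" "f x \<noteq> 0" "\<And>y. y \<in> rep_variety Q I d \<Longrightarrow> f y \<noteq> 0 \<Longrightarrow> y \<in> O'"
    using zar_open_polynomial_at[OF conjunct2[OF o] conjunct1[OF o]] by blast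
  obtain y where y: "y \<in> S" "f y \<noteq> 0" using assms(3)[OF f(1,2)] by blast
  then show "\<exists>y. y \<in> S \<and> y \<in> O'" using f(3)[OF subsetD[OF assms(2) y(1)] y(2)] by (intro exI[of _ y] conjI)
qed

lemma zar_closureD:
  assumes "x \<in> zar d closure_of S" "f \<in> rep_polynomials Q d" "f x \<noteq> 0"
  obtains y where "y \<in> S" "y \<in> rep_variety Q I d" "f y \<noteq> 0"
proof -
  have "x \<in> rep_variety Q I d" using assms(1) by (simp add: in_closure_of topspace_zar)
  then have x: "x \<in> {x \<in> rep_variety Q I d. f x \<noteq> 0}" using assms(3) by simp
  have "\<forall>O'. x \<in> O' \<and> openin (zar d) O' \<longrightarrow> (\<exists>y. y \<in> S \<and> y \<in> O')" using assms(1) by (simp add: in_closure_of)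
  from this[rule_format, OF conjI[OF x zar_open_polynomial[OF assms(2)]]]
  obtain y where "y \<in> S \<and> y \<in> {x \<in> rep_variety Q I d. f x \<noteq> 0}" ..
  then show thesis by (intro that[of y]) simp_all
qed

lemma strat_variety: "x \<in> strat d r \<Longrightarrow> x \<in> rep_variety Q I d"
  by (simp add: strat_def)

text \<open>In a limit the ranks can only drop: the radical shrinks, and the common kernel, as a
  complement of a rank, grows. On the stratum itself r is at most the dimension of the common
  kernel.\<close>

lemma closure_strat_bounds:
  assumes x: "x \<in> zar d closure_of (strat d r)" and i: "i \<in> verts Q"
  shows "cd d x i \<le> r i" "r i \<le> vdim (d i) (common_kernel d x i)"
proof -
  have xv: "x \<in> rep_variety Q I d" using x by (simp add: in_closure_of topspace_zar)
  obtain f where f: "f \<in> rep_polynomials Q d" "f x \<noteq> 0" "\<forall>y\<in>rep_variety Q I d. f y \<noteq> 0 \<longrightarrow> cd d x i \<le> cd d y i"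
    using cd_open[OF xv i] by blast
  obtain y where "y \<in> strat d r" "y \<in> rep_variety Q I d" "f y \<noteq> 0" by (rule zar_closureD[OF x f(1,2)])
  then show "cd d x i \<le> r i" using f(3) i by (auto simp: strat_def)
  obtain f where f: "f \<in> rep_polynomials Q d" "f x \<noteq> 0" "\<forall>y. f y \<noteq> 0 \<longrightarrow> vdim (d i) (rowspan d x i) \<le> vdim (d i) (rowspan d y i)"
    using rowspan_open[OF i] by blast
  obtain y where y: "y \<in> strat d r" "y \<in> rep_variety Q I d" "f y \<noteq> 0" by (rule zar_closureD[OF x f(1,2)])
  have "r i + vdim (d i) (rowspan d y i) \<le> d i" using cd_rowspan_le[OF y(2) i] y(1) i by (auto simp: strat_def)
  then have "r i + vdim (d i) (rowspan d x i) \<le> d i" using f(3) y(3) by fastforce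
  then show "r i \<le> vdim (d i) (common_kernel d x i)"
    using dim_common_kernel[OF rep_variety_ambient[OF xv], of i] by linarith
qed

end

section \<open>The curve argument and irreducibility of the strata\<close>

locale rad_square_zero_alg_closed = rad_square_zero Q I
  for Q :: "('v,'a) pre_digraph" and I :: "(('v,'a) path \<Rightarrow> 'k::alg_closed_field) set"
begin

interpretation D: fin_digraph Q by (rule fin_digraph)

text \<open>In adapted bases both points are in block form; interpolating the bases and the blocks
  linearly gives a polynomial curve of representations from \<open>x\<close> to \<open>x'\<close>.\<close>

lemma strat_curve:
  assumes x: "x \<in> rep_variety Q I d"
    and U: "\<And>i. i \<in> verts Q \<Longrightarrow> VectorSpace.subspace class_ring (U i) (module_vec TYPE('k) (d i))"
      "\<And>i. i \<in> verts Q \<Longrightarrow> vdim (d i) (U i) = r i"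
      "\<And>i. i \<in> verts Q \<Longrightarrow> colspan d x i \<subseteq> U i" "\<And>i. i \<in> verts Q \<Longrightarrow> U i \<subseteq> common_kernel d x i"
    and x': "x' \<in> strat d r"
    and f: "f \<in> rep_polynomials Q d" "f x \<noteq> 0" "f' \<in> rep_polynomials Q d" "f' x' \<noteq> 0"
  shows "\<exists>z\<in>strat d r. f z \<noteq> 0 \<and> f' z \<noteq> 0"
proof -
  have xv': "x' \<in> rep_variety Q I d" and cx': "\<And>i. i \<in> verts Q \<Longrightarrow> cd d x' i = r i" using x' by (auto simp: strat_def)
  obtain g0 y0 where g0: "\<And>i. i \<in> verts Q \<Longrightarrow> g0 i \<in> carrier_mat (d i) (d i)" "\<And>i. i \<in> verts Q \<Longrightarrow> r i \<le> d i"
    and y0: "\<And>\<alpha>. \<alpha> \<in> arcs Q \<Longrightarrow> y0 \<alpha> \<in> carrier_mat (d (head Q \<alpha>)) (d (tail Q \<alpha>))"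
    "\<And>\<alpha> a b. \<alpha> \<in> arcs Q \<Longrightarrow> a < d (head Q \<alpha>) \<Longrightarrow> b < d (tail Q \<alpha>) \<Longrightarrow> y0 \<alpha> $$ (a, b) \<noteq> 0 \<Longrightarrow> a < r (head Q \<alpha>) \<and> r (tail Q \<alpha>) \<le> b"
    "\<And>\<alpha>. \<alpha> \<in> arcs Q \<Longrightarrow> x \<alpha> = g0 (head Q \<alpha>) * (y0 \<alpha> * adj_mat (g0 (tail Q \<alpha>)))"
    using block_form[OF x U] by blast
  \<comment> \<open>For the end point, which lies in the stratum, U is the image itself and has the
    right dimension.\<close>
  have "\<exists>g y. (\<forall>i\<in>verts Q. g i \<in> carrier_mat (d i) (d i) \<and> r i \<le> d i) \<and>
    (\<forall>\<alpha>\<in>arcs Q. y \<alpha> \<in> carrier_mat (d (head Q \<alpha>)) (d (tail Q \<alpha>)) \<and>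
      (\<forall>a<d (head Q \<alpha>). \<forall>b<d (tail Q \<alpha>). y \<alpha> $$ (a, b) \<noteq> 0 \<longrightarrow> a < r (head Q \<alpha>) \<and> r (tail Q \<alpha>) \<le> b) \<and>
      x' \<alpha> = g (head Q \<alpha>) * (y \<alpha> * adj_mat (g (tail Q \<alpha>))))"
    by (rule block_form[OF xv' colspan_subspace _ order_refl colspan_common_kernel(2)[OF xv']]) (use cd_colspan[OF xv'] cx' in auto)
  then obtain g1 y1 where g1: "\<And>i. i \<in> verts Q \<Longrightarrow> g1 i \<in> carrier_mat (d i) (d i)"
    and y1: "\<And>\<alpha>. \<alpha> \<in> arcs Q \<Longrightarrow> y1 \<alpha> \<in> carrier_mat (d (head Q \<alpha>)) (d (tail Q \<alpha>))"
    "\<And>\<alpha> a b. \<alpha> \<in> arcs Q \<Longrightarrow> a < d (head Q \<alpha>) \<Longrightarrow> b < d (tail Q \<alpha>) \<Longrightarrow> y1 \<alpha> $$ (a, b) \<noteq> 0 \<Longrightarrow> a < r (head Q \<alpha>) \<and> r (tail Q \<alpha>) \<le> b"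
    "\<And>\<alpha>. \<alpha> \<in> arcs Q \<Longrightarrow> x' \<alpha> = g1 (head Q \<alpha>) * (y1 \<alpha> * adj_mat (g1 (tail Q \<alpha>)))"
    by blast
  define G where "G i t = mat (d i) (d i) (\<lambda>p. (1 - t) * g0 i $$ p + t * g1 i $$ p)" for i t
  define Y where "Y \<alpha> t = mat (d (head Q \<alpha>)) (d (tail Q \<alpha>)) (\<lambda>p. (1 - t) * y0 \<alpha> $$ p + t * y1 \<alpha> $$ p)" for \<alpha> t
  \<comment> \<open>With the adjugate the entries are polynomials in t, and the formula makes sense
    also where \<open>G\<close> is singular. The factor 1/det is hidden in the blocks at both
    ends.\<close>
  define c where "c t = (\<lambda>\<alpha>\<in>arcs Q. G (head Q \<alpha>) t * (Y \<alpha> t * adj_mat (G (tail Q \<alpha>) t)))" for t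
  have Gc: "G i t \<in> carrier_mat (d i) (d i)" and Yc: "Y \<alpha> t \<in> carrier_mat (d (head Q \<alpha>)) (d (tail Q \<alpha>))" for i \<alpha> t
    by (simp_all add: G_def Y_def)
  note adj = adj_mat[OF Gc]
  have Yb: "a < r (head Q \<alpha>) \<and> r (tail Q \<alpha>) \<le> b" if "\<alpha> \<in> arcs Q" "a < d (head Q \<alpha>)" "b < d (tail Q \<alpha>)" "Y \<alpha> t $$ (a, b) \<noteq> 0" for \<alpha> t a b
  proof -
    have "y0 \<alpha> $$ (a, b) \<noteq> 0 \<or> y1 \<alpha> $$ (a, b) \<noteq> 0" using that(2-4) by (auto simp: Y_def)
    then show ?thesis using y0(2) y1(2) that(1-3) by blast
  qed
  note bl = block_mat_vec[OF Yc Yb]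
  have ca: "c t \<in> rep_ambient Q d" for t
    unfolding rep_ambient_def c_def using Gc Yc adj(1) by (intro restrict_PiE_iff[THEN iffD2] ballI) (auto intro!: mult_carrier_mat)
  have cv: "c t \<alpha> *\<^sub>v v = G (head Q \<alpha>) t *\<^sub>v (Y \<alpha> t *\<^sub>v (adj_mat (G (tail Q \<alpha>) t) *\<^sub>v v))"
    if "\<alpha> \<in> arcs Q" "v \<in> carrier_vec (d (tail Q \<alpha>))" for \<alpha> v t
    using that assoc_mult_mat_vec[OF Gc mult_carrier_mat[OF Yc adj(1)] that(2)] assoc_mult_mat_vec[OF Yc adj(1) that(2)] by (simp add: c_def)
  have cvar: "c t \<in> rep_variety Q I d" for t
    unfolding rep_variety_iff
  proof (intro conjI ballI impI ca)
    fix \<alpha> \<beta> assume ab: "\<alpha> \<in> arcs Q" "\<beta> \<in> arcs Q" "head Q \<alpha> = tail Q \<beta>"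
    note cc = rep_ambientD[OF ca ab(1), of t] rep_ambientD[OF ca ab(2), of t]
    show "c t \<beta> * c t \<alpha> = 0\<^sub>m (d (head Q \<beta>)) (d (tail Q \<alpha>))"
    proof (rule mat_eq_of_mult_vec)
      show "c t \<beta> * c t \<alpha> \<in> carrier_mat (d (head Q \<beta>)) (d (tail Q \<alpha>))" using cc ab(3) by auto
      fix v :: "'k vec" assume v: "v \<in> carrier_vec (d (tail Q \<alpha>))"
      let ?w = "adj_mat (G (tail Q \<alpha>) t) *\<^sub>v v" and ?u = "Y \<alpha> t *\<^sub>v (adj_mat (G (tail Q \<alpha>) t) *\<^sub>v v)"
      have w: "?w \<in> carrier_vec (d (tail Q \<alpha>))" by (rule mult_mat_vec_carrier[OF adj(1) v])
      have u: "?u \<in> leading (d (tail Q \<beta>)) (r (tail Q \<beta>))" using bl(1)[OF ab(1) _ _ _ w] ab(3) by simp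
      then have uc: "?u \<in> carrier_vec (d (tail Q \<beta>))" by (simp add: leading_def)
      have cu: "c t \<alpha> *\<^sub>v v \<in> carrier_vec (d (tail Q \<beta>))" using cc(1) v ab(3) by auto
      \<comment> \<open>Adjugate times matrix is the determinant times the identity, so the middle
        factors collapse to a scalar even for singular \<open>G\<close>; what remains is a product
        of two block matrices, which is zero.\<close>
      have "adj_mat (G (tail Q \<beta>) t) *\<^sub>v (G (tail Q \<beta>) t *\<^sub>v ?u) = (det (G (tail Q \<beta>) t) \<cdot>\<^sub>m 1\<^sub>m (d (tail Q \<beta>))) *\<^sub>v ?u"
        using assoc_mult_mat_vec[OF adj(1)[of "tail Q \<beta>" t] Gc[of "tail Q \<beta>" t] uc] adj(3)[of "tail Q \<beta>" t] by simp
      also have "\<dots> = det (G (tail Q \<beta>) t) \<cdot>\<^sub>v ?u" unfolding smult_mat_mult_vec[OF one_carrier_mat uc] using uc by simp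
      finally have "Y \<beta> t *\<^sub>v (adj_mat (G (tail Q \<beta>) t) *\<^sub>v (c t \<alpha> *\<^sub>v v)) = det (G (tail Q \<beta>) t) \<cdot>\<^sub>v (Y \<beta> t *\<^sub>v ?u)"
        using cv[OF ab(1) v] ab(3) mult_mat_vec[OF Yc uc] by simp
      also have "Y \<beta> t *\<^sub>v ?u = 0\<^sub>v (d (head Q \<beta>))" by (rule bl(2)[OF ab(2) _ _ _ uc u])
      finally have "c t \<beta> *\<^sub>v (c t \<alpha> *\<^sub>v v) = 0\<^sub>v (d (head Q \<beta>))"
        using cv[OF ab(2) cu] mult_mat_zero_vec[OF Gc] by (simp add: smult_vec_zero)
      then show "c t \<beta> * c t \<alpha> *\<^sub>v v = 0\<^sub>m (d (head Q \<beta>)) (d (tail Q \<alpha>)) *\<^sub>v v"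
        using assoc_mult_mat_vec[OF cc(2)[folded ab(3)] cc(1) v] v by (simp add: zero_mat_mult_vec)
    qed simp
  qed
  \<comment> \<open>All images at i lie in the image under \<open>G\<close> of the leading r
    coordinates. This bound holds for every parameter, whether or not \<open>G\<close> is
    invertible.\<close>
  have ub: "cd d (c t) i \<le> r i" if i: "i \<in> verts Q" for t i
  proof -
    interpret vec_space "TYPE('k)" "d i" .
    let ?W = "(\<lambda>v. G i t *\<^sub>v v) ` leading (d i) (r i)"
    have W: "VectorSpace.subspace class_ring ?W (module_vec TYPE('k) (d i))" by (rule image_subspace[OF Gc leading_subspace])
    have "colspan d (c t) i \<subseteq> ?W"
    proof (rule colspan_least[OF ca W])
      fix \<alpha> and w :: "'k vec" assume a: "\<alpha> \<in> arcs Q" "head Q \<alpha> = i" and w: "w \<in> carrier_vec (d (tail Q \<alpha>))"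
      have "Y \<alpha> t *\<^sub>v (adj_mat (G (tail Q \<alpha>) t) *\<^sub>v w) \<in> leading (d i) (r i)"
        using bl(1)[OF a(1) _ _ _ mult_mat_vec_carrier[OF adj(1) w]] a(2) by simp
      then show "c t \<alpha> *\<^sub>v w \<in> ?W" unfolding cv[OF a(1) w] a(2) by (rule imageI)
    qed
    then have "vdim (d i) (colspan d (c t) i) \<le> vdim (d i) ?W" by (rule dim_subspace_mono[OF fin_dim colspan_subspace[of d "c t" i] W])
    also have "\<dots> \<le> r i" using dim_image_le(1)[OF Gc leading_subspace, of t "r i"] dim_leading[where 'k = 'k, OF g0(2)[OF i]] by simp
    finally show ?thesis using cd_colspan[OF cvar i] by simp
  qed
  have G01: "G i 0 = g0 i" "G i 1 = g1 i" if "i \<in> verts Q" for i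
    using g0(1)[OF that] g1[OF that] by (auto simp: G_def intro!: eq_matI)
  have Y01: "Y \<alpha> 0 = y0 \<alpha>" "Y \<alpha> 1 = y1 \<alpha>" if "\<alpha> \<in> arcs Q" for \<alpha>
    using y0(1)[OF that] y1(1)[OF that] by (auto simp: Y_def intro!: eq_matI)
  have c0: "c 0 = x"
    by (rule PiE_ext[OF ca[unfolded rep_ambient_def] rep_variety_ambient[OF x, unfolded rep_ambient_def]])
      (simp add: c_def y0(3) G01 Y01)
  have c1: "c 1 = x'"
    by (rule PiE_ext[OF ca[unfolded rep_ambient_def] rep_variety_ambient[OF xv', unfolded rep_ambient_def]])
      (simp add: c_def y1(3) G01 Y01)
  let ?R = "polynomial_functions :: ('k \<Rightarrow> 'k) set"
  interpret R: function_ring ?R by (rule polynomial_functions_ring)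
  have id: "(\<lambda>t. t) \<in> ?R" "(\<lambda>t. 1 - t) \<in> ?R"
  proof -
    have "(\<lambda>t. t) = poly [:0, 1 :: 'k:]" "(\<lambda>t. 1 - t) = poly [:1, - 1 :: 'k:]" by (simp_all add: fun_eq_iff)
    then show "(\<lambda>t. t) \<in> ?R" "(\<lambda>t. 1 - t) \<in> ?R" by (simp_all only: polynomial_functions_def rangeI)
  qed
  have Ge: "(\<lambda>t. G i t $$ (a, b)) \<in> ?R" if "a < d i" "b < d i" for i a b
    using that by (simp add: G_def) (intro R.add R.mult R.const id)
  have Ye: "(\<lambda>t. Y \<alpha> t $$ (a, b)) \<in> ?R" if "a < d (head Q \<alpha>)" "b < d (tail Q \<alpha>)" for \<alpha> a b
    using that by (simp add: Y_def) (intro R.add R.mult R.const id)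
  have ce: "(\<lambda>t. c t \<alpha> $$ (a, b)) \<in> ?R" if "\<alpha> \<in> arcs Q" "a < d (head Q \<alpha>)" "b < d (tail Q \<alpha>)" for \<alpha> a b
  proof -
    have "(\<lambda>t. (G (head Q \<alpha>) t * (Y \<alpha> t * adj_mat (G (tail Q \<alpha>) t))) $$ (a, b)) \<in> ?R"
      by (rule R.mat_mult[OF Gc mult_carrier_mat[OF Yc adj(1)] Ge R.mat_mult[OF Yc adj(1) Ye R.adj_mat[OF Gc Ge]] that(2,3)])
    then show ?thesis using that(1) by (simp add: c_def)
  qed
  have pc: "(\<lambda>t. p (c t)) \<in> ?R" if "p \<in> rep_polynomials Q d" for p
    by (rule rep_polynomials_comp[OF that polynomial_functions_ring ce])
  \<comment> \<open>Each \<open>p i\<close> certifies that the radical at i is at least as large as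
    at the end point; combined with \<open>ub\<close> it forces equality.\<close>
  have "\<forall>i\<in>verts Q. \<exists>p. p \<in> rep_polynomials Q d \<and> p x' \<noteq> 0 \<and> (\<forall>y\<in>rep_variety Q I d. p y \<noteq> 0 \<longrightarrow> cd d x' i \<le> cd d y i)"
    using cd_open[OF xv'] by blast
  from bchoice[OF this] obtain p where
    p0: "\<forall>i\<in>verts Q. p i \<in> rep_polynomials Q d \<and> p i x' \<noteq> 0 \<and> (\<forall>y\<in>rep_variety Q I d. p i y \<noteq> 0 \<longrightarrow> cd d x' i \<le> cd d y i)" ..
  have p: "p i \<in> rep_polynomials Q d" "p i x' \<noteq> 0" if "i \<in> verts Q" for i using bspec[OF p0 that] by simp_all
  have p3: "cd d x' i \<le> cd d y i" if "i \<in> verts Q" "y \<in> rep_variety Q I d" "p i y \<noteq> 0" for i y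
    using bspec[OF p0 that(1)] that(2,3) by simp
  \<comment> \<open>The condition on f is satisfied at parameter 0, all the others at parameter 1.
    Each excludes finitely many parameters, so one parameter satisfies them all.\<close>
  let ?S = "insert (\<lambda>t. f (c t)) (insert (\<lambda>t. f' (c t)) ((\<lambda>i t. p i (c t)) ` verts Q))"
  have "finite ?S" by simp
  moreover have "q \<in> ?R \<and> (\<exists>t. q t \<noteq> 0)" if "q \<in> ?S" for q
    using that
  proof (elim insertE imageE emptyE)
    assume "q = (\<lambda>t. f (c t))"
    then show ?thesis using pc[OF f(1)] f(2) c0 by auto
  next
    assume "q = (\<lambda>t. f' (c t))"
    then show ?thesis using pc[OF f(3)] f(4) c1 by auto
  next
    fix i assume "q = (\<lambda>t. p i (c t))" "i \<in> verts Q"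
    then show ?thesis using pc[OF p(1)] p(2) c1 by auto
  qed
  ultimately obtain t where t: "\<And>q. q \<in> ?S \<Longrightarrow> q t \<noteq> 0" using polynomial_function_common_nonzero[of ?S] by blast
  have "f (c t) \<noteq> 0" "f' (c t) \<noteq> 0" using t[of "\<lambda>t. f (c t)"] t[of "\<lambda>t. f' (c t)"] by auto
  moreover have "c t \<in> strat d r"
    unfolding strat_def
  proof (intro CollectI conjI ballI cvar)
    fix i assume i: "i \<in> verts Q"
    have "p i (c t) \<noteq> 0" using t[of "\<lambda>t. p i (c t)"] i by auto
    then show "cd d (c t) i = r i" using p3[OF i cvar] ub[OF i, of t] cx'[OF i] by fastforce
  qed
  ultimately show ?thesis by blast
qed

text \<open>Points outside A and outside B are joined by a curve with a point of the stratum outside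
  both. Here the starting point lies in the stratum as well, and U is its own image space.\<close>

lemma strat_irreducible:
  assumes "strat d r \<noteq> {}"
  shows "irreducible_in (zar d) (strat d r)"
  unfolding irreducible_in_def topspace_zar
proof (intro conjI allI impI assms)
  show "strat d r \<subseteq> rep_variety Q I d" by (auto simp: strat_def)
  fix A B assume AB: "closedin (zar d) A \<and> closedin (zar d) B \<and> strat d r \<subseteq> A \<union> B"
  show "strat d r \<subseteq> A \<or> strat d r \<subseteq> B"
  proof (rule ccontr)
    assume "\<not> (strat d r \<subseteq> A \<or> strat d r \<subseteq> B)"
    then obtain x x' where x: "x \<in> strat d r" "x \<notin> A" and x': "x' \<in> strat d r" "x' \<notin> B" by blast
    have o: "openin (zar d) (rep_variety Q I d - A)" "openin (zar d) (rep_variety Q I d - B)"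
      using AB by (auto simp: closedin_def topspace_zar)
    obtain f where f: "f \<in> rep_polynomials Q d" "f x \<noteq> 0" "\<And>y. y \<in> rep_variety Q I d \<Longrightarrow> f y \<noteq> 0 \<Longrightarrow> y \<in> rep_variety Q I d - A"
      using zar_open_polynomial_at[OF o(1) DiffI[OF strat_variety[OF x(1)] x(2)]] by blast
    obtain f' where f': "f' \<in> rep_polynomials Q d" "f' x' \<noteq> 0" "\<And>y. y \<in> rep_variety Q I d \<Longrightarrow> f' y \<noteq> 0 \<Longrightarrow> y \<in> rep_variety Q I d - B"
      using zar_open_polynomial_at[OF o(2) DiffI[OF strat_variety[OF x'(1)] x'(2)]] by blast
    note xv = strat_variety[OF x(1)]
    have "\<exists>z\<in>strat d r. f z \<noteq> 0 \<and> f' z \<noteq> 0"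
    proof (rule strat_curve[OF xv colspan_subspace _ order_refl colspan_common_kernel(2)[OF xv] x'(1) f(1,2) f'(1,2)])
      show "vdim (d i) (colspan d x i) = r i" if "i \<in> verts Q" for i
        using cd_colspan[OF xv that] x(1) that by (simp add: strat_def)
    qed
    then obtain z where "z \<in> strat d r" "f z \<noteq> 0" "f' z \<noteq> 0" by blast
    then show False using f(3) f'(3) AB strat_variety by blast
  qed
qed

end

section \<open>Generic tops\<close>

context rad_square_zero
begin

interpretation D: fin_digraph Q by (rule fin_digraph)

lemma arrow_dim_mono:
  assumes "\<And>j. j \<in> verts Q \<Longrightarrow> t j \<le> t' j"
  shows "arrow_dim t i \<le> arrow_dim t' i"
  unfolding arrow_dim_def
proof (rule card_mono)
  have "arrow_index t' i \<subseteq> (SIGMA \<alpha>:arcs Q. {..<t' (tail Q \<alpha>)})" by (auto simp: arrow_index_def)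
  then show "finite (arrow_index t' i)" by (rule finite_subset) simp
  show "arrow_index t i \<subseteq> arrow_index t' i"
    using assms by (auto simp: arrow_index_def) (meson D.tail_in_verts order_less_le_trans)
qed

lemma arrow_dim_cong: "(\<And>j. j \<in> verts Q \<Longrightarrow> t j = t' j) \<Longrightarrow> arrow_dim t i = arrow_dim t' i"
  by (intro antisym arrow_dim_mono) simp_all

text \<open>M is an image of the free module with the same top, and surjections carry radicals onto
  radicals.\<close>

lemma rad_bound:
  fixes M :: "('v,'a,'k,'m) quiver_module"
  assumes fd: "fd_module Q I M" and j: "j \<in> verts Q"
  shows "dv (submod M (rad L M)) j \<le> arrow_dim (topd M) j"
proof -
  let ?F = "free (topd M)"
  note M = fd_moduleD(1)[OF fd] and F = free_left_module[of "topd M"]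
  obtain f where "projective_cover Q I ?F f M" using free_cover[OF fd, of "topd M"] by blast
  then have f: "f \<in> module_hom L ?F M" "f ` carrier ?F = carrier M" by (simp_all only: projective_cover_def)
  show ?thesis
    using dv_rank_nullity[OF fd_submod[OF free_fd rad_submodule[OF F]] M hom_submod[OF f(1) rad_submodule[OF F]] j]
      free_dv(2)[OF j, of "topd M"] hom_rad_surj[OF F M f] by simp
qed

lemma killed_direct_sum: "killed M \<Longrightarrow> killed N \<Longrightarrow> killed (direct_sum M N)"
  by (auto simp: killed_def direct_sum_simps)

text \<open>An arrow applied to u + s sees only u, because S is killed. So splitting off S leaves
  the radical unchanged.\<close>

lemma rad_summand:
  fixes M :: "('v,'a,'k,'m) quiver_module"
  assumes M: "left_module L M" and ds: "is_internal_direct_sum L M N S" and k: "killed (submod M S)"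
  shows "rad L (submod M N) = rad L M"
proof -
  interpret M: left_module L M by (rule M)
  have N: "Module.submodule N L M" and S: "Module.submodule S L M" and c: "set_add M N S = carrier M"
    using ds by (simp_all add: is_internal_direct_sum_def)
  note lA = submodule_left_module[OF M N]
  have inc: "(\<lambda>x. x) \<in> module_hom L (submod M N) M"
    using submoduleD(1)[OF N] by (auto simp: module_hom_def)
  have "Module.submodule ((\<lambda>x. x) ` rad L (submod M N)) L M"
    by (rule hom_image_submodule[OF lA M inc rad_submodule[OF lA]])
  then have R: "Module.submodule (rad L (submod M N)) L M" by simp
  have "rad L M \<subseteq> rad L (submod M N)"
  proof (rule rad_least[OF M R])
    fix \<alpha> m assume a: "\<alpha> \<in> arcs Q" and m: "m \<in> carrier M"
    then have "m \<in> set_add M N S" using c by simp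
    then obtain u s where us: "u \<in> N" "s \<in> S" "m = u \<oplus>\<^bsub>M\<^esub> s" by (auto simp: set_add_defs)
    then have uc: "u \<in> carrier M" "s \<in> carrier M" using submoduleD(1)[OF N] submoduleD(1)[OF S] by auto
    have "ar \<alpha> \<odot>\<^bsub>M\<^esub> s = \<zero>\<^bsub>M\<^esub>" using k a us(2) by (simp add: killed_def)
    then have "ar \<alpha> \<odot>\<^bsub>M\<^esub> m = ar \<alpha> \<odot>\<^bsub>M\<^esub> u" using uc a us(3) by (simp add: M.smult_r_distr M.smult_closed)
    then show "ar \<alpha> \<odot>\<^bsub>M\<^esub> m \<in> rad L (submod M N)" using rad_mem[OF a, of u "submod M N"] us(1) by simp
  qed
  moreover have "rad L (submod M N) \<subseteq> rad L M" using hom_rad[OF lA M inc] by simp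
  ultimately show ?thesis by blast
qed

text \<open>Since the radical does not change, passing to the complement N removes S from the top
  only. The last clause says that the top of N is what remains of M after JM and S: this is the top
  belonging to the enlarged radical.\<close>

lemma simple_summand:
  fixes M :: "('v,'a,'k,'m) quiver_module"
  assumes fd: "fd_module Q I M" and ds: "is_internal_direct_sum L M N S" and s: "simple_module L (submod M S)"
  shows "killed (submod M S)" "rad L M \<inter> S = {\<zero>\<^bsub>M\<^esub>}"
    "\<exists>i\<in>verts Q. \<forall>j\<in>verts Q. dv (submod M S) j = (if j = i then 1 else 0)"
    "\<And>j. j \<in> verts Q \<Longrightarrow> dv (submod M (rad L M)) j + dv (submod M S) j + topd (submod M N) j = dv M j"
proof -
  note M = fd_moduleD(1)[OF fd]
  have N: "Module.submodule N L M" and S: "Module.submodule S L M" and z: "N \<inter> S = {\<zero>\<^bsub>M\<^esub>}" and c: "set_add M N S = carrier M"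
    using ds by (simp_all add: is_internal_direct_sum_def)
  obtain i v where i: "i \<in> verts Q" and "v \<in> carrier (submod M S)" "v \<noteq> \<zero>\<^bsub>submod M S\<^esub>" "vx i \<odot>\<^bsub>submod M S\<^esub> v = v"
    and k: "killed (submod M S)" and "carrier (submod M S) = range (\<lambda>c. sc c \<odot>\<^bsub>submod M S\<^esub> v)"
    by (rule simple_moduleE[OF s])
  then have v: "v \<in> S" "v \<noteq> \<zero>\<^bsub>M\<^esub>" "vx i \<odot>\<^bsub>M\<^esub> v = v" "S = range (\<lambda>c. sc c \<odot>\<^bsub>M\<^esub> v)" by simp_all
  note dS = dv_line[OF fd S i v]
  note R = rad_summand[OF M ds k]
  note lA = submodule_left_module[OF M N]
  have "rad L M \<subseteq> N" using submoduleD(1)[OF rad_submodule[OF lA]] R by simp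
  then show "rad L M \<inter> S = {\<zero>\<^bsub>M\<^esub>}" using z submoduleD(2)[OF rad_submodule[OF M]] submoduleD(2)[OF S] by blast
  show "dv (submod M (rad L M)) j + dv (submod M S) j + topd (submod M N) j = dv M j" if j: "j \<in> verts Q" for j
  proof -
    have "dv M j = dv (submod M N) j + dv (submod M S) j"
      using direct_sum_dv(3)[OF fd N S z j] c by simp
    moreover have "dv (submod (submod M N) (rad L (submod M N))) j \<le> dv (submod M N) j"
      by (rule dv_submod_le[OF fd_submod[OF fd N] rad_submodule[OF lA] j])
    ultimately show ?thesis by (simp add: topd_def R)
  qed
  show "killed (submod M S)" by (rule k)
  show "\<exists>i\<in>verts Q. \<forall>j\<in>verts Q. dv (submod M S) j = (if j = i then 1 else 0)" using i dS by blast
qed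

end

section \<open>Components, nonempty strata, and embeddings at a generic point\<close>

context rad_square_zero_alg_closed
begin

interpretation D: fin_digraph Q by (rule fin_digraph)

lemma cd_le: "x \<in> rep_variety Q I d \<Longrightarrow> i \<in> verts Q \<Longrightarrow> cd d x i \<le> d i"
  using dv_submod_le[OF rm_fd rad_submodule[OF rm_left_module]] dv_rm by metis

lemma strat_cong: "(\<And>i. i \<in> verts Q \<Longrightarrow> r i = r' i) \<Longrightarrow> strat d r = strat d r'"
  by (simp add: strat_def)

text \<open>Finitely many strata with irreducible closures cover the variety. If every point of the
  stratum lay in the closure of another one, irreducibility would put the whole stratum into a
  single such closure, which equals its own closure by maximality; semicontinuity in both directions
  then identifies the two strata. Conversely, a larger irreducible set lies in the closure of one
  stratum, and the given point allows only the stratum itself.\<close>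

lemma strat_component_iff:
  "irreducible_component (zar d) (zar d closure_of strat d r) \<longleftrightarrow>
    (\<exists>x\<in>strat d r. \<forall>r'. (\<exists>i\<in>verts Q. r' i \<noteq> r i) \<longrightarrow> x \<notin> zar d closure_of strat d r')" (is "?C \<longleftrightarrow> ?E")
proof -
  \<comment> \<open>Radical dimensions are bounded by d, and only their values at the vertices
    matter, so there are finitely many candidates.\<close>
  let ?K = "PiE (verts Q) (\<lambda>i. {..d i})"
  have fin: "finite ?K" by (intro finite_PiE) auto
  have inK: "\<exists>k\<in>?K. x \<in> strat d k" if x: "x \<in> rep_variety Q I d" for x
    using x cd_le[OF x] by (intro bexI[of _ "restrict (cd d x) (verts Q)"]) (auto simp: strat_def)
  have sub: "strat d k \<subseteq> zar d closure_of strat d k" for k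
    by (rule closure_of_subset) (auto simp: topspace_zar strat_def)
  show ?thesis
  proof
    assume C: ?C
    then have ne: "strat d r \<noteq> {}" by (auto simp: irreducible_component_def irreducible_in_def)
    note irr = strat_irreducible[OF ne]
    show ?E
    proof (rule ccontr)
      assume nE: "\<not> ?E"
      let ?K' = "{k \<in> ?K. strat d k \<noteq> {} \<and> (\<exists>i\<in>verts Q. k i \<noteq> r i)}"
      have "strat d r \<subseteq> (\<Union>k\<in>?K'. zar d closure_of strat d k)"
      proof
        fix x assume "x \<in> strat d r"
        then obtain r' i where r': "i \<in> verts Q" "r' i \<noteq> r i" "x \<in> zar d closure_of strat d r'" using nE by blast
        then have "strat d r' \<noteq> {}" by (metis closure_of_empty empty_iff)
        then obtain y where y: "y \<in> strat d r'" by blast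
        let ?k = "restrict r' (verts Q)"
        have e: "strat d ?k = strat d r'" by (rule strat_cong) simp
        have "r' j \<le> d j" if "j \<in> verts Q" for j using cd_le[OF strat_variety[OF y] that] y that by (simp add: strat_def)
        then have "?k \<in> ?K'" using e y r'(1,2) by auto
        then show "x \<in> (\<Union>k\<in>?K'. zar d closure_of strat d k)" using r'(3) e by (intro UN_I[of ?k]) simp_all
      qed
      then have "\<exists>k\<in>?K'. strat d r \<subseteq> zar d closure_of strat d k"
        using fin by (intro irreducible_in_finite_cover[OF irr]) auto
      then obtain k where k: "k \<in> ?K'" "strat d r \<subseteq> zar d closure_of strat d k" by blast
      then have "zar d closure_of strat d r \<subseteq> zar d closure_of strat d k" by (intro closure_of_minimal) auto
      moreover have "irreducible_in (zar d) (zar d closure_of strat d k)"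
        using k(1) by (intro irreducible_in_closure_of strat_irreducible) simp
      ultimately have eq: "zar d closure_of strat d k = zar d closure_of strat d r"
        using C unfolding irreducible_component_def by blast
      obtain x where x: "x \<in> strat d r" using ne by blast
      obtain y where y: "y \<in> strat d k" using k(1) by blast
      \<comment> \<open>With equal closures, a point of either stratum bounds the radical dimensions
        of its own stratum by those of the other.\<close>
      have xk: "x \<in> zar d closure_of strat d k" and yr: "y \<in> zar d closure_of strat d r" using x y sub eq by blast+
      have "k i = r i" if i: "i \<in> verts Q" for i
        using closure_strat_bounds(1)[OF xk i] closure_strat_bounds(1)[OF yr i] x y i by (simp add: strat_def)
      then show False using k(1) by blast
    qed
  next
    assume ?E
    then obtain x where x: "x \<in> strat d r" "\<And>r'. \<exists>i\<in>verts Q. r' i \<noteq> r i \<Longrightarrow> x \<notin> zar d closure_of strat d r'" by blast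
    have irr: "irreducible_in (zar d) (zar d closure_of strat d r)"
      using x(1) by (intro irreducible_in_closure_of strat_irreducible) blast
    have "Z = zar d closure_of strat d r" if Z: "irreducible_in (zar d) Z" "zar d closure_of strat d r \<subseteq> Z" for Z
    proof -
      have "Z \<subseteq> (\<Union>k\<in>?K. zar d closure_of strat d k)"
      proof
        fix z assume "z \<in> Z"
        then have "z \<in> rep_variety Q I d" using Z(1) by (auto simp: irreducible_in_def topspace_zar)
        then obtain k where "k \<in> ?K" "z \<in> strat d k" using inK by blast
        then show "z \<in> (\<Union>k\<in>?K. zar d closure_of strat d k)" using sub by blast
      qed
      then have "\<exists>k\<in>?K. Z \<subseteq> zar d closure_of strat d k"
        using fin by (intro irreducible_in_finite_cover[OF Z(1)]) auto
      then obtain k where k: "Z \<subseteq> zar d closure_of strat d k" by blast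
      have "x \<in> zar d closure_of strat d k" using k x(1) sub Z(2) by blast
      then have "strat d k = strat d r" using x(2)[of k] by (intro strat_cong) blast
      then show ?thesis using k Z(2) by auto
    qed
    then show ?C using irr unfolding irreducible_component_def by blast
  qed
qed

text \<open>With top d - r the generators produce at most \<open>arrow_dim\<close> radical elements,
  and up to that bound \<open>gen_point\<close> realizes any number of them.\<close>

lemma strat_nonempty:
  assumes "\<And>i. i \<in> verts Q \<Longrightarrow> r i \<le> d i" "\<And>i. i \<in> verts Q \<Longrightarrow> r i \<le> arrow_dim (\<lambda>j. d j - r j) i"
  shows "strat d r \<noteq> {}"
proof -
  \<comment> \<open>The equation t + r = d is needed as an equation of functions, hence the value 0
    off the vertices, where r is unconstrained.\<close>
  define r' where "r' i = (if i \<in> verts Q then r i else 0)" for i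
  let ?t = "\<lambda>i. d i - r' i"
  have d: "(\<lambda>i. ?t i + r' i) = d" using assms(1) by (auto simp: r'_def fun_eq_iff)
  have b: "r' i \<le> arrow_dim ?t i" if "i \<in> verts Q" for i
    using assms(2)[OF that] arrow_dim_cong[of ?t "\<lambda>j. d j - r j" i] that by (simp add: r'_def)
  have "gen_point ?t r' \<in> strat d r'"
    unfolding strat_def using gen_point_variety[of ?t r'] gen_point_dv_rad[of r' ?t, OF b] d by simp
  moreover have "strat d r' = strat d r" by (rule strat_cong) (simp add: r'_def)
  ultimately show ?thesis by blast
qed

text \<open>W contains the radical and is killed by the arrows, so its vertex spaces are admissible
  subspaces U for a curve that starts at x, although x itself need not lie in the stratum. Any point
  of the stratum serves as the end point.\<close>

lemma closure_strat_enlarge: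
  assumes x: "x \<in> rep_variety Q I d" and W: "Module.submodule W L (rm d x)" "rad L (rm d x) \<subseteq> W" "killed (submod (rm d x) W)"
    and r: "\<And>j. j \<in> verts Q \<Longrightarrow> dv (submod (rm d x) W) j = r j" and ne: "strat d r \<noteq> {}"
  shows "x \<in> zar d closure_of strat d r"
proof (rule zar_closureI[OF x])
  show "strat d r \<subseteq> rep_variety Q I d" by (auto simp: strat_def)
  fix f assume f: "f \<in> rep_polynomials Q d" "f x \<noteq> 0"
  obtain x' where x': "x' \<in> strat d r" using ne by blast
  have Wc: "m \<in> rep_space Q d" if "m \<in> W" for m using submoduleD(1)[OF W(1)] that by (auto simp: rm_simps)
  \<comment> \<open>Only f has to be nonzero; the condition at the end point is filled by the
    constant 1.\<close>
  have "\<exists>z\<in>strat d r. f z \<noteq> 0 \<and> (\<lambda>_. 1 :: 'k) z \<noteq> 0"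
  proof (rule strat_curve[OF x submodule_vertex_subspace[OF x W(1)] _ _ _ x' f rep_polynomials.const one_neq_zero])
    fix j assume j: "j \<in> verts Q"
    show "vdim (d j) ((\<lambda>m. m j) ` W) = r j" using dv_rm_submod[OF x W(1) j] r[OF j] by simp
    show "colspan d x j \<subseteq> (\<lambda>m. m j) ` W" unfolding rad_colspan[OF x j, symmetric] using W(2) by blast
    show "(\<lambda>m. m j) ` W \<subseteq> common_kernel d x j"
    proof
      fix v assume "v \<in> (\<lambda>m. m j) ` W"
      then obtain m where m: "m \<in> W" "v = m j" by blast
      have "x \<alpha> *\<^sub>v v = 0\<^sub>v (d (head Q \<alpha>))" if a: "\<alpha> \<in> arcs Q" "tail Q \<alpha> = j" for \<alpha>
      proof -
        have "ar \<alpha> \<odot>\<^bsub>rm d x\<^esub> m = \<zero>\<^bsub>rm d x\<^esub>" using W(3) a(1) m(1) by (simp add: killed_def)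
        then have "(ar \<alpha> \<odot>\<^bsub>rm d x\<^esub> m) (head Q \<alpha>) = 0\<^sub>v (d (head Q \<alpha>))" using a(1) by (simp add: rm_simps)
        then show ?thesis using rm_ar[OF x Wc[OF m(1)] a(1)] a m(2) by simp
      qed
      then show "v \<in> common_kernel d x j" using rep_spaceD[OF Wc[OF m(1)] j] m(2) by (simp add: common_kernel_def)
    qed
  qed
  then show "\<exists>y\<in>strat d r. f y \<noteq> 0" by blast
qed

text \<open>An embedding bounds r' = dim JM + dim S by the radical of P, hence by
  \<open>arrow_dim\<close> of the top of the complement, which is d - r'. So the stratum of r' is
  nonempty, and enlarging the radical by S puts x into its closure, against genericity.\<close>

lemma generic_imp_no_embedding:
  assumes x: "x \<in> strat d r" and gen: "\<And>r'. \<exists>i\<in>verts Q. r' i \<noteq> r i \<Longrightarrow> x \<notin> zar d closure_of strat d r'"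
    and ds: "is_internal_direct_sum L (rm d x) N S" and s: "simple_module L (submod (rm d x) S)"
    and pc: "projective_cover Q I P \<phi> (submod (rm d x) N)"
  shows "\<not> module_embeds L (direct_sum (submod (rm d x) (rad L (rm d x))) (submod (rm d x) S)) (submod P (rad L P))"
proof
  let ?M = "rm d x"
  assume e: "module_embeds L (direct_sum (submod ?M (rad L ?M)) (submod ?M S)) (submod P (rad L P))"
  note xv = strat_variety[OF x]
  note fd = rm_fd[OF xv] and M = rm_left_module[OF xv]
  note R = rad_submodule[OF M]
  have N: "Module.submodule N L ?M" and S: "Module.submodule S L ?M" using ds by (simp_all add: is_internal_direct_sum_def)
  note sm = simple_summand[OF fd ds s]
  obtain i where i: "i \<in> verts Q" "\<And>j. j \<in> verts Q \<Longrightarrow> dv (submod ?M S) j = (if j = i then 1 else 0)"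
    using sm(3) by blast
  note dsum = direct_sum_dv[OF fd R S sm(2)]
  have fP: "fd_module Q I P" using pc by (simp add: projective_cover_def projective_module_def)
  note lP = fd_moduleD(1)[OF fP]
  define r' where "r' j = dv (submod ?M (rad L ?M)) j + dv (submod ?M S) j" for j
  have t: "topd (submod ?M N) j = d j - r' j" "r' j \<le> d j" if "j \<in> verts Q" for j
    using sm(4)[OF that] dv_rm[OF xv that] by (auto simp: r'_def)
  have "r' j \<le> arrow_dim (\<lambda>j. d j - r' j) j" if j: "j \<in> verts Q" for j
  proof -
    have "r' j \<le> dv (submod P (rad L P)) j"
      unfolding r'_def dsum(2)[OF j, symmetric] by (rule dv_embeds[OF dsum(1) fd_submod[OF fP rad_submodule[OF lP]] e j])
    also have "\<dots> \<le> arrow_dim (topd (submod ?M N)) j" by (rule cover_rad_bound[OF pc fd_submod[OF fd N] j])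
    also have "\<dots> = arrow_dim (\<lambda>j. d j - r' j) j" using t(1) by (intro arrow_dim_cong) simp
    finally show ?thesis .
  qed
  then have ne: "strat d r' \<noteq> {}" using t(2) by (intro strat_nonempty) auto
  \<comment> \<open>The sum JM + S is direct and killed by the arrows: it is the enlarged
    radical.\<close>
  let ?W = "set_add ?M (rad L ?M) S"
  have "killed (submod ?M ?W)"
  proof -
    interpret M: left_module L ?M by (rule M)
    have "ar \<alpha> \<odot>\<^bsub>?M\<^esub> m = \<zero>\<^bsub>?M\<^esub>" if a: "\<alpha> \<in> arcs Q" and mW: "m \<in> ?W" for \<alpha> m
    proof -
      obtain u s where us: "u \<in> rad L ?M" "s \<in> S" "m = u \<oplus>\<^bsub>?M\<^esub> s"
        using mW by (auto simp: set_add_defs)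
      have uc: "u \<in> carrier ?M" "s \<in> carrier ?M" using us submoduleD(1)[OF R] submoduleD(1)[OF S] by auto
      have "ar \<alpha> \<odot>\<^bsub>?M\<^esub> s = \<zero>\<^bsub>?M\<^esub>" using sm(1) a us(2) by (simp add: killed_def)
      then show ?thesis
        unfolding us(3) M.smult_r_distr[OF gens_closed(2)[OF a] uc] rad_rad[OF M us(1) a] by simp
    qed
    then show ?thesis by (simp add: killed_def)
  qed
  then have "x \<in> zar d closure_of strat d r'"
    using set_add_supset(1)[OF M R S] dsum(3) ne
    by (intro closure_strat_enlarge[OF xv set_add_submodule[OF M R S]]) (simp_all add: r'_def)
  moreover have "r' i \<noteq> r i" using x i by (simp add: r'_def strat_def)
  ultimately show False using gen i(1) by blast
qed

end

section \<open>From missing embeddings to a generic point, and the theorem\<close>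

context rad_square_zero_alg_closed
begin

interpretation D: fin_digraph Q by (rule fin_digraph)

text \<open>If x lies in the closure of the stratum of some r' \<noteq> r, then r' \<ge> r with a
  strict inequality at some vertex i, and the common kernel at i contains a vector v outside the
  image. The line through v is a simple summand S. A point of the stratum of r' shows that r' is at
  most \<open>arrow_dim\<close> of d - r', which is at most the radical of the cover of the
  complement; since dim JM + dim S is at most r', the forbidden embedding exists.\<close>

lemma no_embedding_imp_generic:
  fixes M :: "('v,'a,'k,'m) quiver_module"
  assumes fd: "fd_module Q I M" and d: "\<And>i. i \<in> verts Q \<Longrightarrow> dv M i = d i"
    and r: "\<And>i. i \<in> verts Q \<Longrightarrow> dv (submod M (rad L M)) i = r i"
    and noemb: "\<And>N S (P :: ('v,'a,'k,'v \<Rightarrow> 'k vec) quiver_module) \<phi>. is_internal_direct_sum L M N S \<Longrightarrow> simple_module L (submod M S) \<Longrightarrow>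
      projective_cover Q I P \<phi> (submod M N) \<Longrightarrow>
      \<not> module_embeds L (direct_sum (submod M (rad L M)) (submod M S)) (submod P (rad L P))"
  shows "\<exists>x\<in>strat d r. \<forall>r'. (\<exists>i\<in>verts Q. r' i \<noteq> r i) \<longrightarrow> x \<notin> zar d closure_of strat d r'"
proof -
  note M = fd_moduleD(1)[OF fd]
  interpret M: left_module L M by (rule M)
  obtain x h where x: "x \<in> rep_variety Q I d" and h: "h \<in> module_hom L (rm d x) M"
    and b: "bij_betw h (rep_space Q d) (carrier M)"
    by (rule module_coordinates[OF fd d])
  let ?X = "rm d x"
  note lm = rm_left_module[OF x] and fX = rm_fd[OF x] and xa = rep_variety_ambient[OF x]
  have hs: "h ` carrier ?X = carrier M" and hi: "inj_on h (carrier ?X)" using b by (simp_all add: bij_betw_def rm_simps)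
  note RX = rad_submodule[OF lm]
  have cd: "cd d x i = r i" if i: "i \<in> verts Q" for i
  proof -
    have "inj_on h (carrier (submod ?X (rad L ?X)))" using inj_on_subset[OF hi submoduleD(1)[OF RX]] by simp
    from dv_inj_image[OF fd_submod[OF fX RX] M hom_submod[OF h RX] i this]
    have "dv (submod M (h ` rad L ?X)) i = cd d x i" by simp
    then show ?thesis using hom_rad_surj[OF lm M h hs] r[OF i] by simp
  qed
  then have xs: "x \<in> strat d r" using x by (simp add: strat_def)
  have "False" if i: "i \<in> verts Q" and r'i: "r' i \<noteq> r i" and cl: "x \<in> zar d closure_of strat d r'" for r' i
  proof -
    have rr': "r j \<le> r' j" if "j \<in> verts Q" for j using closure_strat_bounds(1)[OF cl that] cd[OF that] by simp
    then have lt: "r i < r' i" using i r'i by (simp add: order_less_le)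
    interpret V: vec_space "TYPE('k)" "d i" .
    note ck = colspan_common_kernel[OF x i]
    have dc: "vdim (d i) (colspan d x i) = r i" using cd_colspan[OF x i] cd[OF i] by simp
    have "\<not> common_kernel d x i \<subseteq> colspan d x i"
      using V.dim_subspace_mono[OF V.fin_dim ck(1) colspan_subspace[of d x i]] dc lt closure_strat_bounds(2)[OF cl i] by linarith
    then obtain v where v: "v \<in> common_kernel d x i" "v \<notin> colspan d x i" by blast
    have vc: "v \<in> carrier_vec (d i)" using v(1) by (simp add: common_kernel_def)
    \<comment> \<open>A linear functional is wanted that vanishes on the image but not at v. In a
      basis adapted to the image, v has a nonzero coordinate k beyond the image; \<open>u\<close>
      reads off this coordinate.\<close>
    obtain g where g0: "g \<in> carrier_mat (d i) (d i)" "det g \<noteq> 0"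
      "colspan d x i = (\<lambda>v. g *\<^sub>v v) ` leading (d i) (vdim (d i) (colspan d x i))"
      by (rule V.adapted_matrix[OF colspan_subspace[of d x i]])
    note g = g0(1,2) g0(3)[unfolded dc]
    obtain g' where g': "g' \<in> carrier_mat (d i) (d i)" "g * g' = 1\<^sub>m (d i)" "g' * g = 1\<^sub>m (d i)" by (rule inverse_mat[OF g(1,2)])
    have g'v: "g' *\<^sub>v v \<in> carrier_vec (d i)" by (rule mult_mat_vec_carrier[OF g'(1) vc])
    have "g' *\<^sub>v v \<notin> leading (d i) (r i)"
    proof
      assume "g' *\<^sub>v v \<in> leading (d i) (r i)"
      then have "g *\<^sub>v (g' *\<^sub>v v) \<in> colspan d x i" unfolding g(3) by (rule imageI)
      then show False using v(2) inverse_mat_vec[OF g(1) g'(1,2) vc] by simp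
    qed
    then obtain k where k: "k < d i" "r i \<le> k" "(g' *\<^sub>v v) $ k \<noteq> 0" using g'v unfolding leading_def by blast
    define u where "u w = (g' *\<^sub>v w) $ k" for w
    have u_add: "u (w + w') = u w + u w'" if "w \<in> carrier_vec (d i)" "w' \<in> carrier_vec (d i)" for w w'
      unfolding u_def mult_add_distrib_mat_vec[OF g'(1) that] using g'(1) k(1) by simp
    have u_smult: "u (c \<cdot>\<^sub>v w) = c * u w" if "w \<in> carrier_vec (d i)" for c w
      unfolding u_def mult_mat_vec[OF g'(1) that] using g'(1) k(1) by simp
    have u_0: "u (0\<^sub>v (d i)) = 0" unfolding u_def mult_mat_zero_vec[OF g'(1)] using k(1) by simp
    have u_C: "u w = 0" if w: "w \<in> colspan d x i" for w
    proof -
      obtain l where l: "l \<in> leading (d i) (r i)" "w = g *\<^sub>v l" using w unfolding g(3) by blast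
      have "l \<in> carrier_vec (d i)" using l(1) by (simp add: leading_def)
      then have "u w = l $ k" unfolding u_def l(2) by (simp only: inverse_mat_vec[OF g'(1) g(1) g'(3)])
      then show ?thesis using l(1) k(1,2) by (simp add: leading_def)
    qed
    have uv: "u v \<noteq> 0" using k(3) by (simp add: u_def)
    let ?w = "vsp d i v"
    have wc: "?w \<in> rep_space Q d" by (rule vsp_space[where e = d and i = i, OF vc])
    have w_vx: "vx i \<odot>\<^bsub>?X\<^esub> ?w = ?w" using vsp_rm(4)[OF x i vc vc i] by simp
    have w_ar: "ar \<alpha> \<odot>\<^bsub>?X\<^esub> ?w = \<zero>\<^bsub>?X\<^esub>" if a: "\<alpha> \<in> arcs Q" for \<alpha>
    proof -
      have "x \<alpha> *\<^sub>v ?w (tail Q \<alpha>) = 0\<^sub>v (d (head Q \<alpha>))"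
      proof (cases "tail Q \<alpha> = i")
        case True
        then show ?thesis using v(1) a i by (simp add: vsp_apply common_kernel_def)
      next
        case False
        then show ?thesis using a mult_mat_zero_vec[OF rep_ambientD[OF xa a]] by (simp add: vsp_apply)
      qed
      then show ?thesis unfolding rm_ar[OF x wc a] rm_simps by (intro restrict_ext) simp
    qed
    \<comment> \<open>S is the line through v at vertex i. Its complement consists of the tuples
      whose component at i is annihilated by \<open>u\<close>; it is a submodule because
      \<open>u\<close> vanishes on the images of all arrows.\<close>
    let ?m = "h ?w" and ?SX = "range (\<lambda>c. sc c \<odot>\<^bsub>?X\<^esub> ?w)" and ?NX = "{m \<in> rep_space Q d. u (m i) = 0}"
    have wX: "?w \<in> carrier ?X" using wc by (simp add: rm_simps)
    have mM: "?m \<in> carrier M" by (rule module_homD(1)[OF h wX])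
    have m_vx: "vx i \<odot>\<^bsub>M\<^esub> ?m = ?m" using module_homD(3)[OF h _ wX, of "vx i"] w_vx i by simp
    have m_ar: "ar \<alpha> \<odot>\<^bsub>M\<^esub> ?m = \<zero>\<^bsub>M\<^esub>" if "\<alpha> \<in> arcs Q" for \<alpha>
      using module_homD(3)[OF h _ wX, of "ar \<alpha>"] w_ar[OF that] that hom_zero[OF lm M h] by simp
    have m0: "?m \<noteq> \<zero>\<^bsub>M\<^esub>"
    proof
      assume "?m = \<zero>\<^bsub>M\<^esub>"
      then have "?w = \<zero>\<^bsub>?X\<^esub>"
        using inj_onD[OF hi _ wX submoduleD(2)[OF RX, THEN subsetD[OF submoduleD(1)[OF RX]]]] hom_zero[OF lm M h] by simp
      then have "?w i = 0\<^sub>v (d i)" using i by (simp add: rm_simps)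
      then show False using uv u_0 i by (simp add: vsp_apply)
    qed
    have N0: "Module.submodule ?NX L ?X"
    proof (rule submoduleI[OF lm])
      note cl' = submoduleD[OF submodule_carrier[OF lm], unfolded rm_simps(1)]
      show "?NX \<subseteq> carrier ?X" by (auto simp: rm_simps)
      show "\<zero>\<^bsub>?X\<^esub> \<in> ?NX" using cl'(2) i u_0 by (simp add: rm_simps)
      show "m \<oplus>\<^bsub>?X\<^esub> n \<in> ?NX" if "m \<in> ?NX" "n \<in> ?NX" for m n
        using that cl'(3)[of m n] i u_add[OF rep_spaceD[where d = d and i = i, OF _ i] rep_spaceD[where d = d and i = i, OF _ i], of m n] by (simp add: rm_simps)
      show "sc c \<odot>\<^bsub>?X\<^esub> m \<in> ?NX" if "m \<in> ?NX" for c m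
        using that cl'(4)[of "sc c" m] i u_smult[OF rep_spaceD[where d = d and i = i, OF _ i], of m c] rm_sc[OF x, of m c] by simp
      show "vx j \<odot>\<^bsub>?X\<^esub> m \<in> ?NX" if "j \<in> verts Q" "m \<in> ?NX" for j m
        using that cl'(4)[of "vx j" m] i u_0 rm_vx[OF x, of m j] by auto
      show "ar \<alpha> \<odot>\<^bsub>?X\<^esub> m \<in> ?NX" if a: "\<alpha> \<in> arcs Q" and m: "m \<in> ?NX" for \<alpha> m
      proof -
        have mc: "m \<in> rep_space Q d" using m by simp
        have "u ((ar \<alpha> \<odot>\<^bsub>?X\<^esub> m) i) = 0"
          unfolding rm_ar[OF x mc a] using i u_0 u_C colspan_mem[OF xa a rep_spaceD[OF mc]] a by auto
        then show ?thesis using cl'(4)[of "ar \<alpha>" m] a mc by simp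
      qed
    qed
    have S0: "Module.submodule ?SX L ?X" by (rule line_submodule[OF lm wX i w_vx w_ar])
    let ?N = "h ` ?NX" and ?S = "h ` ?SX"
    note N = hom_image_submodule[OF lm M h N0] and S = hom_image_submodule[OF lm M h S0]
    have S_eq: "?S = range (\<lambda>c. sc c \<odot>\<^bsub>M\<^esub> ?m)"
      unfolding image_image by (intro image_cong refl) (rule module_homD(3)[OF h gens_closed(3) wX])
    have scw: "(sc c \<odot>\<^bsub>?X\<^esub> ?w) i = c \<cdot>\<^sub>v v" for c using rm_sc[OF x wc, of c] i by (simp add: vsp_apply)
    have NS: "?N \<inter> ?S = {\<zero>\<^bsub>M\<^esub>}"
    proof
      show "?N \<inter> ?S \<subseteq> {\<zero>\<^bsub>M\<^esub>}"
      proof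
        fix y assume y: "y \<in> ?N \<inter> ?S"
        obtain nn where n: "nn \<in> ?NX" "y = h nn" using IntD1[OF y] by blast
        obtain c where c: "y = h (sc c \<odot>\<^bsub>?X\<^esub> ?w)" using IntD2[OF y] by blast
        have "nn = sc c \<odot>\<^bsub>?X\<^esub> ?w"
          using inj_onD[OF hi, of nn "sc c \<odot>\<^bsub>?X\<^esub> ?w"] n c submoduleD(1)[OF N0] submoduleD(1)[OF S0] by auto
        then have "c * u v = 0" using n(1) scw[of c] u_smult[OF vc, of c] by simp
        then have "c = 0" using uv by simp
        then show "y \<in> {\<zero>\<^bsub>M\<^esub>}"
          using c smult_zero_left[OF lm wX] hom_zero[OF lm M h] by (simp add: sc_eq cls_null)
      qed
      show "{\<zero>\<^bsub>M\<^esub>} \<subseteq> ?N \<inter> ?S" using submoduleD(2)[OF N] submoduleD(2)[OF S] by simp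
    qed
    have NS_sum: "set_add M ?N ?S = carrier M"
    proof
      show "set_add M ?N ?S \<subseteq> carrier M" by (rule submoduleD(1)[OF set_add_submodule[OF M N S]])
      show "carrier M \<subseteq> set_add M ?N ?S"
      proof
        fix y assume "y \<in> carrier M"
        then obtain m where m: "m \<in> carrier ?X" "y = h m" using hs by blast
        then have mc: "m \<in> rep_space Q d" by (simp add: rm_simps)
        \<comment> \<open>The multiple of v that has to be subtracted so that \<open>u\<close>
          vanishes on what remains.\<close>
        define c where "c = u (m i) / u v"
        define n where "n = (\<lambda>j\<in>verts Q. if j = i then m i + (- c) \<cdot>\<^sub>v v else m j)"
        have nc: "n \<in> rep_space Q d" unfolding n_def using rep_spaceD[OF mc] vc by (intro rep_spaceI) auto
        have cv: "(- c) \<cdot>\<^sub>v v \<in> carrier_vec (d i)" using vc by simp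
        have nN: "n \<in> ?NX"
          using nc i u_add[OF rep_spaceD[OF mc i] cv] u_smult[OF vc, of "- c"] uv by (simp add: n_def c_def)
        have sX: "sc c \<odot>\<^bsub>?X\<^esub> ?w \<in> carrier ?X" using submoduleD(1)[OF S0] by blast
        have "n \<oplus>\<^bsub>?X\<^esub> sc c \<odot>\<^bsub>?X\<^esub> ?w = m"
        proof (rule rep_space_eqI[OF _ mc])
          show "n \<oplus>\<^bsub>?X\<^esub> sc c \<odot>\<^bsub>?X\<^esub> ?w \<in> rep_space Q d"
            using submoduleD(3)[OF submodule_carrier[OF lm], of n "sc c \<odot>\<^bsub>?X\<^esub> ?w"] nc sX by (simp add: rm_simps)
          fix j assume j: "j \<in> verts Q"
          have mj: "m j \<in> carrier_vec (d j)" by (rule rep_spaceD[OF mc j])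
          show "(n \<oplus>\<^bsub>?X\<^esub> sc c \<odot>\<^bsub>?X\<^esub> ?w) j = m j"
          proof (cases "j = i")
            case True
            then show ?thesis using j mj vc by (auto simp: rm_simps(3) rm_sc[OF x wc] n_def vsp_apply intro!: eq_vecI)
          next
            case False
            then show ?thesis using j mj by (auto simp: rm_simps(3) rm_sc[OF x wc] n_def vsp_apply smult_vec_zero intro!: eq_vecI)
          qed
        qed
        then have "y = h n \<oplus>\<^bsub>M\<^esub> h (sc c \<odot>\<^bsub>?X\<^esub> ?w)"
          using module_homD(2)[OF h _ sX, of n] nc m(2) by (simp add: rm_simps(1))
        then show "y \<in> set_add M ?N ?S" using nN unfolding set_add_def set_mult_def by auto
      qed
    qed
    have ds: "is_internal_direct_sum L M ?N ?S"
      unfolding is_internal_direct_sum_def using N S NS NS_sum by blast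
    have smp: "simple_module L (submod M ?S)"
      unfolding S_eq by (rule simple_line[OF M mM m0 i m_vx m_ar])
    note sm = simple_summand[OF fd ds smp]
    have "?m \<in> ?S" using wX sc_one lm submoduleD(1)[OF S0]
      by (intro imageI range_eqI[where x = 1]) (simp add: left_module.smult_one)
    note dS = dv_line[OF fd S i this m0 m_vx S_eq]
    let ?D = "direct_sum (submod M (rad L M)) (submod M ?S)"
    note dsum = direct_sum_dv[OF fd rad_submodule[OF M] S sm(2)]
    let ?t = "topd (submod M ?N)"
    \<comment> \<open>The free module provides a concrete cover, of the type over which
      \<open>noemb\<close> quantifies, whose radical dimensions are known exactly.\<close>
    obtain \<phi> where pc: "projective_cover Q I (free ?t) \<phi> (submod M ?N)"
      using free_cover[OF fd_submod[OF fd N], of ?t] by blast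
    note F = free_left_module[of ?t]
    obtain y where y: "y \<in> strat d r'"
      using cl by (metis closure_of_empty equals0D equals0I)
    note yv = strat_variety[OF y]
    have ty: "topd (rm d y) j = d j - r' j" if "j \<in> verts Q" for j
      using y that dv_rm[OF yv that] by (simp add: topd_def strat_def)
    \<comment> \<open>Both modules are killed by the arrows, so comparing dimension vectors
      suffices.\<close>
    have "module_embeds L ?D (submod (free ?t) (rad L (free ?t)))"
    proof (rule killed_embeds[OF dsum(1) killed_direct_sum[OF killed_rad[OF M] sm(1)] fd_submod[OF free_fd rad_submodule[OF F]] killed_rad[OF F]])
      fix j assume j: "j \<in> verts Q"
      have "dv ?D j \<le> r' j" unfolding dsum(2)[OF j] r[OF j] dS[OF j] using rr'[OF j] lt by simp
      also have "r' j = cd d y j" using y j by (simp add: strat_def)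
      also have "\<dots> \<le> arrow_dim (topd (rm d y)) j" by (rule rad_bound[OF rm_fd[OF yv] j])
      also have "\<dots> \<le> arrow_dim ?t j"
      proof (rule arrow_dim_mono)
        \<comment> \<open>The complement has top d - r - dim S, and r + dim S is at most r' because
          the inequality r \<le> r' is strict at i.\<close>
        fix l assume l: "l \<in> verts Q"
        have "r l + (if l = i then 1 else 0) + ?t l = d l" using sm(4)[OF l] unfolding r[OF l] dS[OF l] d[OF l] .
        moreover have "r l + (if l = i then 1 else 0) \<le> r' l" using rr'[OF l] lt by simp
        ultimately show "topd (rm d y) l \<le> ?t l" using ty[OF l] by linarith
      qed
      also have "\<dots> = dv (submod (free ?t) (rad L (free ?t))) j" using free_dv(2)[OF j, of ?t] by simp
      finally show "dv ?D j \<le> dv (submod (free ?t) (rad L (free ?t))) j" .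
    qed
    then show False using noemb[OF ds smp pc] by blast
  qed
  then show ?thesis using xs by blast
qed

lemma rep_top_eq:
  fixes T :: "('v,'a,'k,'t) quiver_module"
  assumes "fd_module Q I T" "semisimple_module L T"
  shows "rep_top Q I d T = {x \<in> rep_variety Q I d. \<forall>i\<in>verts Q. cd d x i + dv T i = d i}"
  unfolding rep_top_def using module_top_iso_dv[OF rm_fd assms] dv_rm by fastforce

text \<open>For fixed d, prescribing the top is the same as prescribing the radical dimensions. The
  sum form of the premise avoids truncated subtraction.\<close>

lemma rep_top_strat:
  fixes T :: "('v,'a,'k,'t) quiver_module"
  assumes T: "fd_module Q I T" "semisimple_module L T" and r: "\<And>i. i \<in> verts Q \<Longrightarrow> r i + dv T i = d i"
  shows "rep_top Q I d T = strat d r"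
proof -
  have "cd d x i + dv T i = d i \<longleftrightarrow> cd d x i = r i" if "i \<in> verts Q" for x i using r[OF that] by linarith
  then show ?thesis unfolding rep_top_eq[OF T] strat_def by blast
qed

end

theorem proposition3p9:
  fixes Q :: "('v, 'a) pre_digraph"
    and I :: "(('v, 'a) path \<Rightarrow> 'k::alg_closed_field) set"
    and d :: "'v \<Rightarrow> nat"
    and T :: "('v, 'a, 'k, 't) quiver_module"
  assumes "fin_digraph Q"
    and "admissible_ideal Q I"
    and "\<Lambda> = quiver_algebra Q I"
    and "J = jacobson_radical \<Lambda>"
    and "ideal_prod \<Lambda> J J = {\<zero>\<^bsub>\<Lambda>\<^esub>}"
    and "fd_module Q I T"
    and "semisimple_module \<Lambda> T"
  shows "generic_top Q I d T \<longleftrightarrow>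
    (\<exists>M :: ('v, 'a, 'k, 'v \<Rightarrow> 'k vec) quiver_module.
      fd_module Q I M \<and>
      module_iso \<Lambda> (module_top \<Lambda> M) T \<and>
      (\<forall>i \<in> verts Q. dimension_vector Q I M i = d i) \<and>
      (\<forall>M' S. is_internal_direct_sum \<Lambda> M M' S \<and> simple_module \<Lambda> (submod M S) \<longrightarrow>
        (\<forall>(P' :: ('v, 'a, 'k, 'v \<Rightarrow> 'k vec) quiver_module) \<phi>.
          projective_cover Q I P' \<phi> (submod M M') \<longrightarrow>
          \<not> module_embeds \<Lambda>
              (direct_sum (submod M (rad \<Lambda> M)) (submod M S))
              (submod P' (rad \<Lambda> P')))))"
    (is "_ \<longleftrightarrow> (\<exists>M. ?good M)")
proof -
  interpret rad_square_zero_alg_closed Q I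
    using assms(1,2,5) unfolding assms(3,4) by (intro rad_square_zero_alg_closed.intro rad_square_zero.intro)
  have T: "fd_module Q I T" "semisimple_module (quiver_algebra Q I) T" using assms(3,6,7) by simp_all
  show ?thesis
  proof
    assume g: "generic_top Q I d T"
    \<comment> \<open>An irreducible set is nonempty. A point with top T supplies the radical
      dimensions that complement T to d, and so identifies the set of points with top T as a
      stratum.\<close>
    then have "rep_top Q I d T \<noteq> {}"
      by (auto simp: generic_top_def irreducible_component_def irreducible_in_def)
    then obtain x0 where "\<forall>i\<in>verts Q. cd d x0 i + dimension_vector Q I T i = d i"
      unfolding rep_top_eq[OF T] by blast
    then have "rep_top Q I d T = strat d (cd d x0)" by (intro rep_top_strat[OF T]) blast
    then have "irreducible_component (zar d) (zar d closure_of strat d (cd d x0))"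
      using g by (simp add: generic_top_def)
    then obtain x where x: "x \<in> strat d (cd d x0)"
      and gen: "\<And>r'. \<exists>i\<in>verts Q. r' i \<noteq> cd d x0 i \<Longrightarrow> x \<notin> zar d closure_of strat d r'"
      unfolding strat_component_iff by blast
    have xT: "x \<in> rep_top Q I d T" using x \<open>rep_top Q I d T = strat d (cd d x0)\<close> by simp
    \<comment> \<open>The witness is the module of a point that lies in the closure of no other
      stratum.\<close>
    have "?good (rep_module Q d x)"
      unfolding assms(3)
    proof (intro conjI allI impI ballI)
      show "fd_module Q I (rep_module Q d x)" by (rule rm_fd[OF strat_variety[OF x]])
      show "module_iso (quiver_algebra Q I) (module_top (quiver_algebra Q I) (rep_module Q d x)) T"
        using xT by (simp add: rep_top_def)
      show "dimension_vector Q I (rep_module Q d x) i = d i" if "i \<in> verts Q" for i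
        by (rule dv_rm[OF strat_variety[OF x] that])
    qed (use generic_imp_no_embedding[OF x gen] in blast)
    then show "\<exists>M. ?good M" by (rule exI)
  next
    assume "\<exists>M. ?good M"
    then obtain M where M: "?good M" by blast
    let ?r = "\<lambda>i. dimension_vector Q I (submod M (rad (quiver_algebra Q I) M)) i"
    have fM: "fd_module Q I M" and d: "\<And>i. i \<in> verts Q \<Longrightarrow> dimension_vector Q I M i = d i" using M by blast+
    \<comment> \<open>The module M need not be given by a point; its dimension vectors alone
      determine the stratum.\<close>
    have "\<forall>i\<in>verts Q. ?r i + dimension_vector Q I T i = dimension_vector Q I M i"
      using M module_top_iso_dv[OF fM T] unfolding assms(3) by blast
    then have e: "rep_top Q I d T = strat d ?r" using d by (intro rep_top_strat[OF T]) simp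
    have "\<exists>x\<in>strat d ?r. \<forall>r'. (\<exists>i\<in>verts Q. r' i \<noteq> ?r i) \<longrightarrow> x \<notin> zar d closure_of strat d r'"
      by (rule no_embedding_imp_generic[OF fM d refl]) (use M[unfolded assms(3)] in blast)+
    then show "generic_top Q I d T" unfolding generic_top_def e strat_component_iff .
  qed
qed

end
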